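(* Suppose there is a polynomial $p$ and a family $\{\mathrm{Samp}_{n,w,\varepsilon}\}$ such that for all $n,w\in\mathbb{N}$ and $\varepsilon>0$, $\mathrm{Samp}_{n,w,\varepsilon}$ is a deterministic $\varepsilon$-sampler for the class of functions computed by permutation branching programs of length $n$ and width $w$, with query complexity at most $p(nw/\varepsilon)$. Then there is a polynomial $q$ and, for all $n,a\in\mathbb{N}$ and $\varepsilon>0$, a deterministic $\varepsilon$-sampler $\mathrm{Samp}'_{n,a,\varepsilon}$ for the class of functions computed by permutation branching programs of length $n$ and arbitrary (unbounded) width with $a$ accept vertices, whose query complexity is at most $q(na/\varepsilon)$. Moreover, if all the samplers $\mathrm{Samp}_{n,w,\varepsilon}$ are explicit then so is $\mathrm{Samp}'_{n,a,\varepsilon}$, and if all the samplers $\mathrm{Samp}_{n,w,\varepsilon}$ are nonadaptive then so is $\mathrm{Samp}'_{n,a,\varepsilon}$.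
   Context: An ordered branching program $B$ of length $n$ and width $w$ has layers $V_0,\dots,V_n$, each a copy of $\{1,\dots,w\}$, a start state $v_0\in V_0$, transition functions $B_r:V_{r-1}\times\{0,1\}\to V_r$ for $r=1,\dots,n$, and a set $V_{\mathit{acc}}\subseteq V_n$ of accept vertices. On input $\sigma\in\{0,1\}^n$ it sets $v_r=B_r(v_{r-1},\sigma_r)$ and $B(\sigma)=1$ iff $v_n\in V_{\mathit{acc}}$. It is a permutation branching program if for every $r$ and $b\in\{0,1\}$ the map $B_r(\cdot,b)$ is a permutation. "Unbounded width" means the width may be any natural number. For a class $\mathcal{F}$ of functions $\{0,1\}^n\to\{0,1\}$, a deterministic $\varepsilon$-sampler is a deterministic algorithm that, given oracle access to any $f\in\mathcal{F}$, makes queries to $f$ and outputs a real number $\mathrm{Samp}^f()$ with $|\mathrm{Samp}^f()-\Pr_{x\sim U_n}[f(x)=1]|\le\varepsilon$ ($U_n$ uniform on $\{0,1\}^n$). Its query complexity $S$ is the maximum over $f\in\mathcal{F}$ of the number of distinct queries made. It is explicit if, given $n$, $\varepsilon$ and the parameters defining the class, it can be computed by a uniform algorithm using space $O(\log S)$. It is nonadaptive if its queries do not depend on the answers to previous queries. *)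

theory Defs
  imports "HOL-Probability.Probability" "HOL-Computational_Algebra.Polynomial"
begin

section \<open>Permutation branching programs\<close>

text \<open>Elements of the cube $\{0,1\}^n$ are Boolean lists of length $n$. The paper's $\sigma_r$
  ($r = 1,\dots,n$) is the list entry \<open>\<sigma> ! (r - 1)\<close>.\<close>

definition cube :: "nat \<Rightarrow> bool list set" where
  "cube n = {x. length x = n}"

text \<open>All layers are copies of $\{1,\dots,w\}$; \<open>trans B r v b\<close> is $B_r(v,b)$. Length and width
  are not stored in the record but are parameters of the well-formedness predicate.\<close>

record branching_program =
  start :: nat
  trans :: "nat \<Rightarrow> nat \<Rightarrow> bool \<Rightarrow> nat"
  acc :: "nat set"

definition is_bp :: "nat \<Rightarrow> nat \<Rightarrow> branching_program \<Rightarrow> bool" where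
  "is_bp n w B \<longleftrightarrow>
     start B \<in> {1..w} \<and>
     (\<forall>r\<in>{1..n}. \<forall>v\<in>{1..w}. \<forall>b. trans B r v b \<in> {1..w}) \<and>
     acc B \<subseteq> {1..w}"

definition is_permutation_bp :: "nat \<Rightarrow> nat \<Rightarrow> branching_program \<Rightarrow> bool" where
  "is_permutation_bp n w B \<longleftrightarrow>
     is_bp n w B \<and>
     (\<forall>r\<in>{1..n}. \<forall>b. bij_betw (\<lambda>v. trans B r v b) {1..w} {1..w})"

fun bp_vertex :: "branching_program \<Rightarrow> bool list \<Rightarrow> nat \<Rightarrow> nat" where
  "bp_vertex B \<sigma> 0 = start B"
| "bp_vertex B \<sigma> (Suc r) = trans B (Suc r) (bp_vertex B \<sigma> r) (\<sigma> ! r)"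

definition bp_accepts :: "nat \<Rightarrow> branching_program \<Rightarrow> bool list \<Rightarrow> bool" where
  "bp_accepts n B \<sigma> \<longleftrightarrow> bp_vertex B \<sigma> n \<in> acc B"

text \<open>A function on $\{0,1\}^n$ is represented by any total function on lists; its values on lists
  of other lengths are irrelevant, since samplers and machines below may only query the cube.\<close>

definition perm_bp_width :: "nat \<Rightarrow> nat \<Rightarrow> (bool list \<Rightarrow> bool) set" where
  "perm_bp_width n w =
     {f. \<exists>B. is_permutation_bp n w B \<and> (\<forall>\<sigma>\<in>cube n. f \<sigma> = bp_accepts n B \<sigma>)}"

definition perm_bp_accept :: "nat \<Rightarrow> nat \<Rightarrow> (bool list \<Rightarrow> bool) set" where
  "perm_bp_accept n a =
     {f. \<exists>w B. is_permutation_bp n w B \<and> card (acc B) = a \<and>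
               (\<forall>\<sigma>\<in>cube n. f \<sigma> = bp_accepts n B \<sigma>)}"


section \<open>Deterministic samplers\<close>

text \<open>For fixed parameters, a deterministic query algorithm is a decision tree: it outputs a real
  number, or queries a point and continues in a way that depends on the answer.\<close>

datatype sampler = Output real | Query "bool list" "bool \<Rightarrow> sampler"

primrec run_sampler :: "sampler \<Rightarrow> (bool list \<Rightarrow> bool) \<Rightarrow> real" where
  "run_sampler (Output r) f = r"
| "run_sampler (Query x T) f = run_sampler (T (f x)) f"

primrec queries :: "sampler \<Rightarrow> (bool list \<Rightarrow> bool) \<Rightarrow> bool list list" where
  "queries (Output r) f = []"
| "queries (Query x T) f = x # queries (T (f x)) f"

definition is_sampler ::
  "nat \<Rightarrow> (bool list \<Rightarrow> bool) set \<Rightarrow> real \<Rightarrow> sampler \<Rightarrow> bool" where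
  "is_sampler n F \<epsilon> T \<longleftrightarrow>
     (\<forall>f\<in>F. set (queries T f) \<subseteq> cube n \<and>
        \<bar>run_sampler T f - measure_pmf.prob (pmf_of_set (cube n)) {x. f x}\<bar> \<le> \<epsilon>)"

text \<open>The number of distinct queries is bounded by the depth of the tree, so this supremum in
  \<^typ>\<open>nat\<close> is a maximum (and it is 0 if \<open>F\<close> is empty, e.g. for width 0).\<close>

definition query_complexity :: "(bool list \<Rightarrow> bool) set \<Rightarrow> sampler \<Rightarrow> nat" where
  "query_complexity F T = (SUP f\<in>F. card (set (queries T f)))"

definition nonadaptive :: "(bool list \<Rightarrow> bool) set \<Rightarrow> sampler \<Rightarrow> bool" where
  "nonadaptive F T \<longleftrightarrow> (\<exists>qs. \<forall>f\<in>F. queries T f = qs)"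


section \<open>Space-bounded oracle Turing machines\<close>

text \<open>
  Deterministic multitape oracle machines with the usual conventions for sublinear space: every
  input string is on its own two-way read-only tape, delimited by end markers that the head cannot
  pass; query and output are written to write-only tapes; only the work tapes, which are one-way
  infinite, count towards the space. Asking a query erases the query tape and makes the answer
  available to the finite control until the next query.

  Having one tape per input parameter is deliberate: on a single tape, already comparing two of the
  parameters takes space growing with their bit lengths, which would rule out the bound
  $O(\log S)$ whenever $S$ is small compared to these lengths.
\<close>

datatype move = Lft | Stay | Rgt
datatype input_symbol = LeftEnd | Bit bool | RightEnd
datatype output_symbol = Minus | Digit bool | Slash
datatype effect = Silent | Write_Query bool | Ask | Emit output_symbol

text \<open>States and work symbols are initial segments of \<^typ>\<open>nat\<close>, with initial state 0 and blank
  symbol 0. The arguments of \<open>delta\<close> are the state, the last oracle answer, and the symbols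
  scanned on the input tapes and on the work tapes; \<open>None\<close> means that the machine halts.\<close>

record machine =
  n_states :: nat
  n_symbols :: nat
  n_tapes :: nat
  delta :: "nat \<Rightarrow> bool \<Rightarrow> input_symbol list \<Rightarrow> nat list \<Rightarrow>
              (nat \<times> move list \<times> (nat \<times> move) list \<times> effect) option"

definition valid_machine :: "nat \<Rightarrow> machine \<Rightarrow> bool" where
  "valid_machine m M \<longleftrightarrow>
     n_states M > 0 \<and> n_symbols M > 0 \<and>
     (\<forall>q b xs ys q' ms ws e.
        q < n_states M \<and> length xs = m \<and> length ys = n_tapes M \<and> set ys \<subseteq> {..<n_symbols M} \<and>
        delta M q b xs ys = Some (q', ms, ws, e) \<longrightarrow>
        q' < n_states M \<and> length ms = m \<and> length ws = n_tapes M \<and>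
        fst ` set ws \<subseteq> {..<n_symbols M})"

text \<open>A work tape is a pair of its contents and its head position.\<close>

record config =
  state :: nat
  answer :: bool
  input_heads :: "nat list"
  work :: "((nat \<Rightarrow> nat) \<times> nat) list"
  query_tape :: "bool list"
  asked :: "bool list list"
  out :: "output_symbol list"

definition initial_config :: "nat \<Rightarrow> machine \<Rightarrow> config" where
  "initial_config m M =
     \<lparr>state = 0, answer = False, input_heads = replicate m 0,
      work = replicate (n_tapes M) (\<lambda>_. 0, 0), query_tape = [], asked = [], out = []\<rparr>"

definition read_input :: "bool list \<Rightarrow> nat \<Rightarrow> input_symbol" where
  "read_input x h =
     (if h = 0 then LeftEnd else if h \<le> length x then Bit (x ! (h - 1)) else RightEnd)"

fun shift :: "move \<Rightarrow> nat \<Rightarrow> nat" where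
  "shift Lft h = h - 1"
| "shift Stay h = h"
| "shift Rgt h = Suc h"

definition move_input :: "bool list \<Rightarrow> move \<Rightarrow> nat \<Rightarrow> nat" where
  "move_input x d h = min (shift d h) (Suc (length x))"

definition update_tape :: "(nat \<Rightarrow> nat) \<times> nat \<Rightarrow> nat \<times> move \<Rightarrow> (nat \<Rightarrow> nat) \<times> nat" where
  "update_tape = (\<lambda>(t, h) (s, d). (t(h := s), shift d h))"

fun perform :: "(bool list \<Rightarrow> bool) \<Rightarrow> effect \<Rightarrow> config \<Rightarrow> config" where
  "perform f Silent c = c"
| "perform f (Write_Query b) c = c\<lparr>query_tape := query_tape c @ [b]\<rparr>"
| "perform f Ask c = c\<lparr>answer := f (query_tape c), asked := asked c @ [query_tape c], query_tape := []\<rparr>"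
| "perform f (Emit s) c = c\<lparr>out := out c @ [s]\<rparr>"

definition step :: "machine \<Rightarrow> bool list list \<Rightarrow> (bool list \<Rightarrow> bool) \<Rightarrow> config \<Rightarrow> config option" where
  "step M inp f c =
     (case delta M (state c) (answer c)
             (map2 read_input inp (input_heads c)) (map (\<lambda>(t, h). t h) (work c)) of
        None \<Rightarrow> None
      | Some (q, ms, ws, e) \<Rightarrow>
          Some (perform f e
            (c\<lparr>state := q,
               input_heads := map2 (\<lambda>x (d, h). move_input x d h) inp (zip ms (input_heads c)),
               work := map2 update_tape (work c) ws\<rparr>)))"

definition config_at ::
  "machine \<Rightarrow> bool list list \<Rightarrow> (bool list \<Rightarrow> bool) \<Rightarrow> nat \<Rightarrow> config" where
  "config_at M inp f t =
     ((\<lambda>c. case step M inp f c of None \<Rightarrow> c | Some c' \<Rightarrow> c') ^^ t)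
       (initial_config (length inp) M)"

definition halts_at ::
  "machine \<Rightarrow> bool list list \<Rightarrow> (bool list \<Rightarrow> bool) \<Rightarrow> nat \<Rightarrow> bool" where
  "halts_at M inp f t \<longleftrightarrow> step M inp f (config_at M inp f t) = None"

text \<open>Every work head stays within the first \<open>s\<close> cells of its tape. Since the number of work
  tapes is a constant of the machine, this agrees with total space up to a constant factor.\<close>

definition uses_space ::
  "machine \<Rightarrow> bool list list \<Rightarrow> (bool list \<Rightarrow> bool) \<Rightarrow> real \<Rightarrow> bool" where
  "uses_space M inp f s \<longleftrightarrow>
     (\<forall>t. \<forall>(tp, h)\<in>set (work (config_at M inp f t)). real (Suc h) \<le> s)"

text \<open>Numbers are written in binary, least significant bit first.\<close>

fun binary :: "nat \<Rightarrow> bool list" where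
  "binary n = (if n = 0 then [] else odd n # binary (n div 2))"

declare binary.simps [simp del]

definition binary_value :: "bool list \<Rightarrow> nat" where
  "binary_value bs = horner_sum of_bool 2 bs"

text \<open>Machines output a rational number as an optional sign followed by a fraction, not
  necessarily in lowest terms.\<close>

definition denotes :: "output_symbol list \<Rightarrow> real \<Rightarrow> bool" where
  "denotes s r \<longleftrightarrow>
     (\<exists>neg xs ys. s = (if neg then [Minus] else []) @ map Digit xs @ [Slash] @ map Digit ys \<and>
        binary_value ys > 0 \<and>
        r = (if neg then - 1 else 1) * real (binary_value xs) / real (binary_value ys))"


section \<open>Explicit families\<close>

text \<open>
  The parameters of a family are $n$, a second number $k$ defining the class (the width or the
  number of accept vertices) and $\varepsilon$. A single machine gets $n$, $k$ and a fraction
  $u/v = \varepsilon$ as input, has oracle \<open>f\<close>, and must produce the output of the sampler and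
  ask the same set of queries; it may ask a query again, as space-bounded machines cannot store the
  answers. The space bound is uniform in all parameters; the summand 2 only makes the
  logarithm positive when $S \le 1$.
\<close>

definition explicit ::
  "(nat \<Rightarrow> nat \<Rightarrow> (bool list \<Rightarrow> bool) set) \<Rightarrow> (nat \<Rightarrow> nat \<Rightarrow> real \<Rightarrow> sampler) \<Rightarrow> bool" where
  "explicit F Samp \<longleftrightarrow>
     (\<exists>M (C::real). valid_machine 4 M \<and>
        (\<forall>n k u v. u > 0 \<longrightarrow> v > 0 \<longrightarrow>
          (let T = Samp n k (real u / real v);
               S = query_complexity (F n k) T;
               inp = [binary n, binary k, binary u, binary v]
           in \<forall>f\<in>F n k.
                uses_space M inp f (C * log 2 (real S + 2)) \<and>
                (\<exists>t. halts_at M inp f t \<and>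
                     denotes (out (config_at M inp f t)) (run_sampler T f) \<and>
                     set (asked (config_at M inp f t)) = set (queries T f)))))"

end

theory Submission
  imports Defs
begin

text \<open>
  In each layer the vertices of a program with \<open>a\<close> accept vertices have acceptance probabilities
  that sum to \<open>a\<close>, so only few of them accept with noticeable probability. Pruning the others
  changes the acceptance probability little and leaves a permutation branching program of small
  width. A sampler for small width must tell such a pruned program from the zero function, so
  the set \<open>H\<close> of its queries to the zero function meets every function of noticeable probability.

  Now let \<open>h x\<close> hold if for every \<open>r \<le> n\<close> the first \<open>r\<close> bits of \<open>x\<close>, followed by the last
  \<open>n - r\<close> bits of some \<open>y \<in> H\<close>, are accepted. This is \<open>f\<close> pruned to the vertices that accept a
  suffix of an element of \<open>H\<close>. As transitions are permutations, there are at most \<open>a * card H\<close> of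
  these in each layer, so \<open>h\<close> has small width, and by the choice of \<open>H\<close> the other vertices accept
  with small probability. The sampler for small width is run on \<open>h\<close>, each of whose values takes
  \<open>(n + 1) * card H\<close> queries to \<open>f\<close>. A machine without room for \<open>H\<close> reruns the simulation that
  produces \<open>H\<close> for every value of \<open>h\<close>.
\<close>

section \<open>Pruning permutation branching programs\<close>

text \<open>What shapes the sampler is explicitness. Space \<open>O(log S)\<close> has to suffice
  although \<open>S\<close> could be small compared to the bit lengths of the parameters, and the
  width and precision handed to the simulated machine are themselves inputs that it reads. Three
  choices deal with this. Widths and inverse precisions are powers of two, whose binary tapes can be
  laid out by counting cells. \<epsilon> is rounded to a power of two, so that with \<open>l\<close>
  the sum of the lengths of \<open>n\<close>, \<open>a\<close> and this power all exponents are
  linear in \<open>l\<close>, and \<open>l\<close> itself can be counted off with the input heads.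
  Finally \<open>2 ^ l\<close> padding queries force \<open>log S\<close> to be at least
  \<open>l\<close>. A cube with fewer than \<open>2 ^ l\<close> points cannot hold them; it is
  queried completely, and the exact probability is output. For \<open>a = 0\<close> or \<epsilon> at
  least 1 the output 0 is good enough and nothing is asked.\<close>

lemma finite_cube [simp]: "finite (cube n)"
  using finite_lists_length_eq[of "UNIV :: bool set" n] by (simp add: cube_def)

lemma card_cube: "card (cube n) = 2 ^ n"
  using card_lists_length_eq[of "UNIV :: bool set" n] by (simp add: cube_def)

lemma cube_nonempty [simp]: "cube n \<noteq> {}"
  using card_cube[of n] by (metis card.empty power_eq_0_iff zero_neq_numeral)

lemma prob_cube:
  "measure_pmf.prob (pmf_of_set (cube n)) {x. P x} = real (card {x \<in> cube n. P x}) / 2 ^ n"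
proof -
  have "cube n \<inter> {x. P x} = {x \<in> cube n. P x}" by auto
  then show ?thesis by (subst measure_pmf_of_set) (simp_all add: card_cube)
qed

text \<open>Flipping bit \<open>r\<close> exchanges the two halves of the set, because
  \<open>Q\<close> does not see that bit. This is the averaging over one input bit in the backward
  induction of \<open>card_accepted_leaving\<close>.\<close>

lemma card_cube_fixed_bit:
  assumes "r < n" and Q: "\<And>y b. y \<in> cube n \<Longrightarrow> Q (y[r := b]) = Q y"
  shows "2 * card {y \<in> cube n. y ! r = b \<and> Q y} = card {y \<in> cube n. Q y}"
proof -
  let ?S = "\<lambda>b. {y \<in> cube n. y ! r = b \<and> Q y}"
  have "bij_betw (\<lambda>y. y[r := \<not> b]) (?S b) (?S (\<not> b))"
  proof (rule bij_betwI[where g = "\<lambda>y. y[r := b]"])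
    show "(\<lambda>y. y[r := \<not> b]) \<in> ?S b \<rightarrow> ?S (\<not> b)" using assms by (auto simp: cube_def)
    show "(\<lambda>y. y[r := b]) \<in> ?S (\<not> b) \<rightarrow> ?S b" using assms by (auto simp: cube_def)
  qed (auto simp: list_update_overwrite list_update_same_conv cube_def assms)
  then have "card (?S b) = card (?S (\<not> b))" by (rule bij_betw_same_card)
  moreover have "{y \<in> cube n. Q y} = ?S b \<union> ?S (\<not> b)" by auto
  moreover have "card (?S b \<union> ?S (\<not> b)) = card (?S b) + card (?S (\<not> b))"
    by (rule card_Un_disjoint) auto
  ultimately show ?thesis by simp
qed

text \<open>A partial run starts in layer \<open>r\<close> but still reads a full input
  \<open>y\<close>, whose first \<open>r\<close> bits it ignores. All acceptance probabilities thus
  live on the one space \<open>cube n\<close>, whatever the layer.\<close>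

primrec walk :: "branching_program \<Rightarrow> bool list \<Rightarrow> nat \<Rightarrow> nat \<Rightarrow> nat \<Rightarrow> nat" where
  "walk B y r v 0 = v"
| "walk B y r v (Suc d) = trans B (Suc (r + d)) (walk B y r v d) (y ! (r + d))"

definition suffix_accepts :: "nat \<Rightarrow> branching_program \<Rightarrow> nat \<Rightarrow> nat \<Rightarrow> bool list \<Rightarrow> bool" where
  "suffix_accepts n B r v y \<longleftrightarrow> walk B y r v (n - r) \<in> acc B"

definition leaves ::
  "nat \<Rightarrow> branching_program \<Rightarrow> (nat \<Rightarrow> nat set) \<Rightarrow> nat \<Rightarrow> nat \<Rightarrow> bool list \<Rightarrow> bool" where
  "leaves n B A r v y \<longleftrightarrow> (\<exists>d\<le>n - r. walk B y r v d \<notin> A (r + d))"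

lemma walk_Suc_shift: "walk B y r v (Suc d) = walk B y (Suc r) (trans B (Suc r) v (y ! r)) d"
  by (induction d) auto

lemma walk_start: "walk B y 0 (start B) d = bp_vertex B y d"
  by (induction d) auto

lemma walk_add: "walk B y r v (d + e) = walk B y (r + d) (walk B y r v d) e"
  by (induction e) (auto simp: add.assoc)

lemma walk_cong: "(\<And>i. r \<le> i \<Longrightarrow> i < r + d \<Longrightarrow> y ! i = z ! i) \<Longrightarrow> walk B y r v d = walk B z r v d"
  by (induction d) auto

lemma walk_range:
  assumes "is_bp n w B" "r + d \<le> n" "v \<in> {1..w}"
  shows "walk B y r v d \<in> {1..w}"
  using assms(2)
proof (induction d)
  case (Suc d)
  then have "walk B y r v d \<in> {1..w}" "Suc (r + d) \<in> {1..n}" by auto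
  then show ?case using assms(1) unfolding is_bp_def walk.simps by blast
qed (use assms in auto)

lemma suffix_accepts_step:
  "r < n \<Longrightarrow> suffix_accepts n B r v y = suffix_accepts n B (Suc r) (trans B (Suc r) v (y ! r)) y"
  using walk_Suc_shift[of B y r v "n - Suc r"] by (simp add: suffix_accepts_def Suc_diff_Suc)

lemma leaves_step:
  assumes "r < n" "v \<in> A r"
  shows "leaves n B A r v y = leaves n B A (Suc r) (trans B (Suc r) v (y ! r)) y"
proof -
  have "(\<exists>d\<le>n - r. walk B y r v d \<notin> A (r + d)) \<longleftrightarrow>
        (\<exists>d\<le>n - Suc r. walk B y r v (Suc d) \<notin> A (r + Suc d))" (is "?l = ?r")
  proof
    assume ?l
    then obtain d where d: "d \<le> n - r" "walk B y r v d \<notin> A (r + d)" by blast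
    with assms(2) obtain e where "d = Suc e" by (cases d) auto
    with d assms show ?r by (intro exI[of _ e]) auto
  next
    assume ?r
    then obtain d where "d \<le> n - Suc r" "walk B y r v (Suc d) \<notin> A (r + Suc d)" by blast
    with assms show ?l by (intro exI[of _ "Suc d"]) auto
  qed
  then show ?thesis unfolding leaves_def walk_Suc_shift by simp
qed

lemma suffix_accepts_update:
  "i < r \<Longrightarrow> suffix_accepts n B r v (y[i := b]) = suffix_accepts n B r v y"
  unfolding suffix_accepts_def by (subst walk_cong[of _ _ "y[i := b]" y]) auto

lemma leaves_update: "i < r \<Longrightarrow> leaves n B A r v (y[i := b]) = leaves n B A r v y"
proof -
  assume "i < r"
  then have "walk B (y[i := b]) r v d = walk B y r v d" for d by (intro walk_cong) auto
  then show ?thesis by (simp add: leaves_def)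
qed

text \<open>Conditioned on the first vertex outside \<open>A\<close>, acceptance has small probability; no union
  bound over the layers is lost.\<close>

lemma card_accepted_leaving:
  fixes \<delta> :: real
  assumes bp: "is_bp n w B"
    and small: "\<And>r v. r \<le> n \<Longrightarrow> v \<in> {1..w} \<Longrightarrow> v \<notin> A r \<Longrightarrow>
      real (card {y \<in> cube n. suffix_accepts n B r v y}) \<le> \<delta>"
    and "\<delta> \<ge> 0" "r \<le> n" "v \<in> {1..w}"
  shows "real (card {y \<in> cube n. suffix_accepts n B r v y \<and> leaves n B A r v y}) \<le> \<delta>"
  using \<open>r \<le> n\<close> \<open>v \<in> {1..w}\<close>
proof (induction "n - r" arbitrary: r v)
  case 0
  show ?case
  proof (cases "v \<in> A r")
    case True
    with 0 have "{y \<in> cube n. suffix_accepts n B r v y \<and> leaves n B A r v y} = {}"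
      by (auto simp: leaves_def)
    then show ?thesis using \<open>\<delta> \<ge> 0\<close> by (simp only: card.empty of_nat_0)
  next
    case False
    have "card {y \<in> cube n. suffix_accepts n B r v y \<and> leaves n B A r v y}
      \<le> card {y \<in> cube n. suffix_accepts n B r v y}"
      by (intro card_mono) auto
    with small[OF 0(2,3) False] show ?thesis by linarith
  qed
next
  case (Suc k)
  show ?case
  proof (cases "v \<in> A r")
    case False
    have "card {y \<in> cube n. suffix_accepts n B r v y \<and> leaves n B A r v y}
      \<le> card {y \<in> cube n. suffix_accepts n B r v y}"
      by (intro card_mono) auto
    with small[OF Suc(3,4) False] show ?thesis by linarith
  next
    case True
    have r: "r < n" using Suc by auto
    let ?t = "\<lambda>b. trans B (Suc r) v b"
    let ?Q = "\<lambda>b y. suffix_accepts n B (Suc r) (?t b) y \<and> leaves n B A (Suc r) (?t b) y"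
    \<comment> \<open>After the bit \<open>b\<close> the walk continues from the successor, and that
      event does not depend on bit \<open>r\<close>. It therefore has exactly half of its elements
      in this half of the cube, and the two halves add up to the bound without loss.\<close>
    have half: "2 * real (card {y \<in> cube n. y ! r = b \<and> ?Q b y}) \<le> \<delta>" for b
    proof -
      have "?t b \<in> {1..w}" using bp Suc r unfolding is_bp_def by auto
      then have "real (card {y \<in> cube n. ?Q b y}) \<le> \<delta>" using Suc r by (intro Suc.hyps) auto
      moreover have "2 * card {y \<in> cube n. y ! r = b \<and> ?Q b y} = card {y \<in> cube n. ?Q b y}"
        by (rule card_cube_fixed_bit[OF r]) (simp add: suffix_accepts_update leaves_update)
      ultimately show ?thesis by linarith
    qed
    have "{y \<in> cube n. suffix_accepts n B r v y \<and> leaves n B A r v y}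
      = {y \<in> cube n. y ! r = True \<and> ?Q True y} \<union> {y \<in> cube n. y ! r = False \<and> ?Q False y}"
      using suffix_accepts_step[OF r, of B v] leaves_step[of r n v A B, OF r True]
      by (auto; metis)
    then have "card {y \<in> cube n. suffix_accepts n B r v y \<and> leaves n B A r v y}
      \<le> card {y \<in> cube n. y ! r = True \<and> ?Q True y} + card {y \<in> cube n. y ! r = False \<and> ?Q False y}"
      by (simp only: card_Un_le)
    with half[of True] half[of False] show ?thesis by linarith
  qed
qed

text \<open>Domain and image of the injection have complements of equal size, so any bijection
  between these completes it.\<close>

lemma extend_inj_to_perm:
  assumes "finite V" "D \<subseteq> V" "inj_on \<phi> D" "\<phi> ` D \<subseteq> V"
  shows "\<exists>\<pi>. bij_betw \<pi> V V \<and> (\<forall>x\<in>D. \<pi> x = \<phi> x)"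
proof -
  have "card (V - D) = card (V - \<phi> ` D)"
    using assms by (simp add: card_Diff_subset finite_subset card_image)
  then obtain g where g: "bij_betw g (V - D) (V - \<phi> ` D)"
    using assms(1) by (metis finite_Diff finite_same_card_bij)
  have "bij_betw (\<lambda>x. if x \<in> D then \<phi> x else g x) (D \<union> (V - D)) (\<phi> ` D \<union> (V - \<phi> ` D))"
  proof (rule bij_betw_combine)
    show "bij_betw (\<lambda>x. if x \<in> D then \<phi> x else g x) D (\<phi> ` D)"
      using assms(3) by (simp add: bij_betw_def inj_on_def)
    show "bij_betw (\<lambda>x. if x \<in> D then \<phi> x else g x) (V - D) (V - \<phi> ` D)"
      using g by (simp add: bij_betw_def inj_on_def)
  qed auto
  moreover have "D \<union> (V - D) = V" "\<phi> ` D \<union> (V - \<phi> ` D) = V" using assms by auto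
  ultimately show ?thesis by (intro exI[of _ "\<lambda>x. if x \<in> D then \<phi> x else g x"]) auto
qed

text \<open>The additional vertices are fixed by every transition and never reached. This permits
  rounding a width up to a power of two.\<close>

lemma perm_bp_width_mono:
  assumes "f \<in> perm_bp_width n w" "w \<le> w'"
  shows "f \<in> perm_bp_width n w'"
proof -
  obtain B where B: "is_permutation_bp n w B" and f: "\<forall>\<sigma>\<in>cube n. f \<sigma> = bp_accepts n B \<sigma>"
    using assms(1) unfolding perm_bp_width_def by auto
  define B' where "B' = B\<lparr>trans := (\<lambda>r v b. if v \<in> {1..w} then trans B r v b else v)\<rparr>"
  have bp: "is_bp n w B" using B by (simp add: is_permutation_bp_def)
  have in_w: "bp_vertex B \<sigma> r \<in> {1..w}" if "r \<le> n" for \<sigma> r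
    using walk_range[OF bp, of 0 r "start B" \<sigma>] that bp by (simp add: walk_start is_bp_def)
  have "bp_vertex B' \<sigma> r = bp_vertex B \<sigma> r" if "r \<le> n" for \<sigma> r
    using that
  proof (induction r)
    case (Suc r)
    then show ?case using in_w[of r \<sigma>] by (simp add: B'_def)
  qed (simp add: B'_def)
  then have "bp_accepts n B' \<sigma> = bp_accepts n B \<sigma>" for \<sigma>
    by (simp add: bp_accepts_def) (simp add: B'_def)
  moreover have "is_permutation_bp n w' B'"
    unfolding is_permutation_bp_def
  proof (intro conjI ballI allI)
    show "is_bp n w' B'" using bp assms(2) unfolding is_bp_def B'_def by fastforce
  next
    fix r b assume "r \<in> {1..n}"
    then have "bij_betw (\<lambda>v. trans B r v b) {1..w} {1..w}" using B by (simp add: is_permutation_bp_def)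
    then have "bij_betw (\<lambda>v. trans B' r v b) {1..w} {1..w}"
      by (subst bij_betw_cong[where g = "\<lambda>v. trans B r v b"]) (auto simp: B'_def)
    moreover have "bij_betw (\<lambda>v. trans B' r v b) {w<..w'} {w<..w'}"
      by (subst bij_betw_cong[where g = id]) (auto simp: B'_def)
    ultimately have "bij_betw (\<lambda>v. trans B' r v b) ({1..w} \<union> {w<..w'}) ({1..w} \<union> {w<..w'})"
      by (rule bij_betw_combine) auto
    moreover have "{1..w} \<union> {w<..w'} = {1..w'}" using assms(2) by auto
    ultimately show "bij_betw (\<lambda>v. trans B' r v b) {1..w'} {1..w'}" by simp
  qed
  ultimately show ?thesis using f unfolding perm_bp_width_def by auto
qed

lemma const_False_in_perm_bp_width:
  assumes "w \<ge> 1"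
  shows "(\<lambda>_. False) \<in> perm_bp_width n w"
proof -
  have "is_permutation_bp n w \<lparr>start = 1, trans = (\<lambda>r v b. v), acc = {}\<rparr>"
    using assms by (auto simp: is_permutation_bp_def is_bp_def bij_betw_def)
  then show ?thesis unfolding perm_bp_width_def by (force simp: bp_accepts_def)
qed

lemma perm_bp_width_cong:
  "f \<in> perm_bp_width n w \<Longrightarrow> (\<And>x. x \<in> cube n \<Longrightarrow> f x = g x) \<Longrightarrow> g \<in> perm_bp_width n w"
  unfolding perm_bp_width_def by auto


text \<open>Block 0 of every layer holds the kept vertices. A path that leaves them is shifted through
  the other blocks, one per layer, so it never returns to block 0 and no merging is needed.\<close>

lemma pruned_in_perm_bp_width:
  assumes B: "is_permutation_bp n w B"
    and A: "\<And>r. r \<le> n \<Longrightarrow> A r \<subseteq> {1..w} \<and> card (A r) \<le> K" and "K \<ge> 1"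
  shows "(\<lambda>x. \<forall>r\<le>n. bp_vertex B x r \<in> A r) \<in> perm_bp_width n (Suc n * K)"
proof (cases "start B \<in> A 0")
  case False
  moreover have "Suc n * K \<ge> 1" using \<open>K \<ge> 1\<close> by simp
  ultimately show ?thesis
    by (intro perm_bp_width_cong[OF const_False_in_perm_bp_width]) (auto intro!: exI[of _ 0])
next
  case True
  let ?V = "{1..Suc n * K}"
  \<comment> \<open>Slot \<open>s\<close> of block \<open>j\<close>, with \<open>Suc\<close> because
    vertices are numbered from 1. The width \<open>Suc n * K\<close> has room for the blocks 0 to
    \<open>n\<close>.\<close>
  define vx where "vx j s = Suc (j * K + s)" for j s
  have vx_div: "(vx j s - 1) div K = j" "(vx j s - 1) mod K = s" if "s < K" for j s
    using that div_mult_self3[of K j s] mod_mult_self3[of j K s] by (simp_all add: vx_def)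
  have vx_in: "vx j s \<in> ?V" if "j \<le> n" "s < K" for j s
  proof -
    have "j * K + s < Suc j * K" using that by simp
    also have "\<dots> \<le> Suc n * K" using that by (intro mult_le_mono1) auto
    finally show ?thesis by (simp add: vx_def)
  qed
  have "\<exists>e. inj_on e (A r) \<and> e ` A r \<subseteq> {..<K}" if "r \<le> n" for r
  proof -
    have "finite (A r)" "card (A r) \<le> card {..<K}" using A[OF that] finite_subset by auto
    then show ?thesis using card_le_inj[of "A r" "{..<K}"] by (metis finite_lessThan)
  qed
  then obtain e where e: "\<And>r. r \<le> n \<Longrightarrow> inj_on (e r) (A r) \<and> e r ` A r \<subseteq> {..<K}" by metis
  have eK: "e r v < K" if "r \<le> n" "v \<in> A r" for r v using e[OF that(1)] that(2) by auto
  \<comment> \<open>\<open>j\<close> and \<open>s\<close> are the block and the slot of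
    \<open>x\<close>. A kept vertex whose successor is kept stays in block 0; everything else,
    including an unoccupied slot of block 0, moves to the same slot of the next block.\<close>
  define \<phi> where "\<phi> r b x = (let j = (x - 1) div K; s = (x - 1) mod K in
      if j = 0 \<and> (\<exists>v\<in>A (r - 1). s = e (r - 1) v \<and> trans B r v b \<in> A r)
      then vx 0 (e r (trans B r (the_inv_into (A (r - 1)) (e (r - 1)) s) b))
      else vx (Suc j) s)" for r b x
  \<comment> \<open>Blocks 0 to \<open>n - 1\<close>, from which there is a next block to move to. A
    path is in block at most \<open>r\<close> after \<open>r\<close> steps, so each of its
    \<open>n\<close> transitions starts in \<open>?D\<close>.\<close>
  let ?D = "{1..n * K}"
  have \<phi>_keep: "\<phi> r b (vx 0 (e (r - 1) v)) = vx 0 (e r (trans B r v b))"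
    if "r \<in> {1..n}" "v \<in> A (r - 1)" "trans B r v b \<in> A r" for r b v
  proof -
    have "inj_on (e (r - 1)) (A (r - 1))" "e (r - 1) v < K" using e[of "r - 1"] that eK[of "r - 1" v] by auto
    then show ?thesis
      using that vx_div[of "e (r - 1) v" 0] by (auto simp: \<phi>_def Let_def the_inv_into_f_f)
  qed
  have \<phi>_drop: "\<phi> r b (vx 0 (e (r - 1) v)) = vx 1 (e (r - 1) v)"
    if "r \<in> {1..n}" "v \<in> A (r - 1)" "trans B r v b \<notin> A r" for r b v
  proof -
    have "inj_on (e (r - 1)) (A (r - 1))" "e (r - 1) v < K" using e[of "r - 1"] that eK[of "r - 1" v] by auto
    then have "\<not> (\<exists>u\<in>A (r - 1). e (r - 1) v = e (r - 1) u \<and> trans B r u b \<in> A r)"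
      using that by (metis inj_onD)
    then show ?thesis
      using that vx_div[of "e (r - 1) v" 0] \<open>e (r - 1) v < K\<close> by (auto simp: \<phi>_def Let_def)
  qed
  have \<phi>_shift: "\<phi> r b (vx j s) = vx (Suc j) s" if "j \<ge> 1" "s < K" for r b j s
    using vx_div[of s j] that by (auto simp: \<phi>_def Let_def)
  have cases_D: thesis
    if r: "r \<in> {1..n}" and x: "x \<in> ?D"
    and keep: "\<And>v. v \<in> A (r - 1) \<Longrightarrow> trans B r v b \<in> A r \<Longrightarrow> x = vx 0 (e (r - 1) v) \<Longrightarrow>
        \<phi> r b x = vx 0 (e r (trans B r v b)) \<Longrightarrow> thesis"
    and move: "\<And>j s. j < n \<Longrightarrow> s < K \<Longrightarrow> x = vx j s \<Longrightarrow> \<phi> r b x = vx (Suc j) s \<Longrightarrow> thesis"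
    for r b x thesis
  proof -
    define j s where "j = (x - 1) div K" and "s = (x - 1) mod K"
    have s: "s < K" using \<open>K \<ge> 1\<close> by (simp add: s_def)
    have xjs: "x = vx j s" using x by (simp add: vx_def j_def s_def)
    have "x - 1 < n * K" using x by auto
    then have j: "j < n" unfolding j_def by (rule less_mult_imp_div_less)
    show thesis
    proof (cases "j = 0 \<and> (\<exists>v\<in>A (r - 1). s = e (r - 1) v \<and> trans B r v b \<in> A r)")
      case True
      then obtain v where "v \<in> A (r - 1)" "s = e (r - 1) v" "trans B r v b \<in> A r" "j = 0" by auto
      with \<phi>_keep[OF r] xjs show thesis by (intro keep[of v]) auto
    next
      case False
      then have "\<phi> r b x = vx (Suc j) s" unfolding \<phi>_def Let_def j_def s_def by (rule if_not_P)
      then show thesis using move j s xjs by blast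
    qed
  qed
  \<comment> \<open>Kept images lie in block 0 and moved images in later blocks, so a collision can
    only occur within one kind. Among kept vertices it is excluded because \<open>B\<close> permutes
    the layer.\<close>
  have inj: "inj_on (\<phi> r b) ?D" if r: "r \<in> {1..n}" for r b
  proof (rule inj_onI)
    fix x x' assume x: "x \<in> ?D" and x': "x' \<in> ?D" and eq: "\<phi> r b x = \<phi> r b x'"
    have bij: "inj_on (\<lambda>v. trans B r v b) {1..w}"
      using B r by (auto simp: is_permutation_bp_def bij_betw_def)
    have "r \<le> n" "r - 1 \<le> n" using r by auto
    then have er: "inj_on (e r) (A r)" "A (r - 1) \<subseteq> {1..w}" using e A by blast+
    have vx_eq: "vx j s = vx j' s' \<longleftrightarrow> j = j' \<and> s = s'" if "s < K" "s' < K" for j s j' s'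
      using vx_div[OF that(1), of j] vx_div[OF that(2), of j'] by auto
    show "x = x'"
    proof (rule cases_D[OF r x, of b]; rule cases_D[OF r x', of b])
      fix v v' assume v: "v \<in> A (r - 1)" "trans B r v b \<in> A r" "x = vx 0 (e (r - 1) v)"
          "\<phi> r b x = vx 0 (e r (trans B r v b))"
        and v': "v' \<in> A (r - 1)" "trans B r v' b \<in> A r" "x' = vx 0 (e (r - 1) v')"
          "\<phi> r b x' = vx 0 (e r (trans B r v' b))"
      then have "e r (trans B r v b) = e r (trans B r v' b)"
        using eq by (simp add: vx_def)
      then have "trans B r v b = trans B r v' b" using er v v' by (meson inj_onD)
      then have "v = v'" using bij er v v' by (meson inj_onD subsetD)
      with v v' show "x = x'" by simp
    next
      fix v j s assume "v \<in> A (r - 1)" "trans B r v b \<in> A r"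
        "\<phi> r b x = vx 0 (e r (trans B r v b))" "\<phi> r b x' = vx (Suc j) s" "s < K"
      then show "x = x'" using eq vx_eq[of "e r (trans B r v b)" s 0 "Suc j"] eK r by auto
    next
      fix v j s assume "v \<in> A (r - 1)" "trans B r v b \<in> A r"
        "\<phi> r b x' = vx 0 (e r (trans B r v b))" "\<phi> r b x = vx (Suc j) s" "s < K"
      then show "x = x'" using eq vx_eq[of "e r (trans B r v b)" s 0 "Suc j"] eK r by auto
    next
      fix j s j' s' assume "s < K" "s' < K" "x = vx j s" "x' = vx j' s'"
        "\<phi> r b x = vx (Suc j) s" "\<phi> r b x' = vx (Suc j') s'"
      then show "x = x'" using eq vx_eq[of s s' "Suc j" "Suc j'"] by auto
    qed
  qed
  have range: "\<phi> r b ` ?D \<subseteq> ?V" if r: "r \<in> {1..n}" for r b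
  proof (rule image_subsetI)
    fix x assume x: "x \<in> ?D"
    show "\<phi> r b x \<in> ?V"
    proof (rule cases_D[OF r x, of b])
      fix v assume "trans B r v b \<in> A r" "\<phi> r b x = vx 0 (e r (trans B r v b))"
      then show ?thesis using vx_in[of 0] eK[of r] r by simp
    next
      fix j s assume "j < n" "s < K" "\<phi> r b x = vx (Suc j) s"
      then show ?thesis using vx_in[of "Suc j" s] by simp
    qed
  qed
  \<comment> \<open>On the last block the transition is whatever completes the injection to a
    permutation.\<close>
  have "\<exists>\<pi>. bij_betw \<pi> ?V ?V \<and> (\<forall>x\<in>?D. \<pi> x = \<phi> r b x)" if "r \<in> {1..n}" for r b
    by (rule extend_inj_to_perm[OF _ _ inj[OF that] range[OF that]]) auto
  then obtain \<pi> where \<pi>: "\<And>r b. r \<in> {1..n} \<Longrightarrow> bij_betw (\<pi> r b) ?V ?V"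
      "\<And>r b x. r \<in> {1..n} \<Longrightarrow> x \<in> ?D \<Longrightarrow> \<pi> r b x = \<phi> r b x" by metis
  define B' where "B' = \<lparr>start = vx 0 (e 0 (start B)), trans = (\<lambda>r v b. \<pi> r b v),
    acc = (\<lambda>v. vx 0 (e n v)) ` A n\<rparr>"
  have perm: "is_permutation_bp n (Suc n * K) B'"
    unfolding is_permutation_bp_def is_bp_def
  proof (intro conjI ballI allI)
    show "start B' \<in> ?V" using True eK[of 0] vx_in by (simp add: B'_def del: atLeastAtMost_iff)
    show "acc B' \<subseteq> ?V" using eK[of n] vx_in by (auto simp: B'_def simp del: atLeastAtMost_iff)
  next
    fix r v b assume "r \<in> {1..n}" "v \<in> ?V"
    then show "trans B' r v b \<in> ?V" using \<pi>(1)[of r b] by (auto simp: B'_def bij_betw_def simp del: atLeastAtMost_iff)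
  next
    fix r b assume "r \<in> {1..n}"
    then show "bij_betw (\<lambda>v. trans B' r v b) ?V ?V" using \<pi>(1)[of r b] by (simp add: B'_def)
  qed
  have vx_D: "vx j s \<in> ?D" if "j < n" "s < K" for j s
  proof -
    have "j * K + s < Suc j * K" using that by simp
    also have "\<dots> \<le> n * K" using that by (intro mult_le_mono1) auto
    finally show ?thesis by (simp add: vx_def)
  qed
  \<comment> \<open>The bound \<open>1 \<le> j\<close> keeps a path that has left the sets
    \<open>A\<close> out of block 0, where all accept vertices are.\<close>
  have inv: "if \<forall>i\<le>r. bp_vertex B x i \<in> A i then bp_vertex B' x r = vx 0 (e r (bp_vertex B x r))
    else \<exists>j s. 1 \<le> j \<and> j \<le> r \<and> s < K \<and> bp_vertex B' x r = vx j s" if "r \<le> n" for x r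
    using that
  proof (induction r)
    case 0
    then show ?case using True by (simp add: B'_def)
  next
    case (Suc r)
    have r: "Suc r \<in> {1..n}" using Suc by simp
    have step: "bp_vertex B' x (Suc r) = \<phi> (Suc r) (x ! r) (bp_vertex B' x r)"
      if "bp_vertex B' x r \<in> ?D" using \<pi>(2)[OF r that] by (simp add: B'_def)
    show ?case
    proof (cases "\<forall>i\<le>r. bp_vertex B x i \<in> A i")
      case True
      let ?v = "bp_vertex B x r"
      have v: "bp_vertex B' x r = vx 0 (e r ?v)" "?v \<in> A r"
        using Suc.IH[OF Suc_leD[OF Suc.prems]] True unfolding if_P[OF True] by blast+
      moreover have "e r ?v < K" using eK[of r] v r by auto
      ultimately have st: "bp_vertex B' x (Suc r) = \<phi> (Suc r) (x ! r) (vx 0 (e r ?v))"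
        using step vx_D[of 0 "e r ?v"] r by auto
      show ?thesis
      proof (cases "bp_vertex B x (Suc r) \<in> A (Suc r)")
        case in_A: True
        then have "\<forall>i\<le>Suc r. bp_vertex B x i \<in> A i" using True by (metis le_SucE)
        moreover have "bp_vertex B' x (Suc r) = vx 0 (e (Suc r) (bp_vertex B x (Suc r)))"
          using st \<phi>_keep[OF r, of ?v "x ! r"] v in_A by simp
        ultimately show ?thesis by presburger
      next
        case False
        then have "bp_vertex B' x (Suc r) = vx 1 (e r ?v)"
          using st \<phi>_drop[OF r, of ?v "x ! r"] v by simp
        moreover have "\<not> (\<forall>i\<le>Suc r. bp_vertex B x i \<in> A i)" using False by blast
        ultimately show ?thesis using \<open>e r ?v < K\<close> by (metis One_nat_def Suc_le_mono le0 le_refl)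
      qed
    next
      case False
      then obtain j s where js: "1 \<le> j" "j \<le> r" "s < K" "bp_vertex B' x r = vx j s"
        using Suc.IH[OF Suc_leD[OF Suc.prems]] unfolding if_not_P[OF False] by blast
      then have "bp_vertex B' x (Suc r) = vx (Suc j) s"
        using step vx_D[of j s] r \<phi>_shift by auto
      moreover have "\<not> (\<forall>i\<le>Suc r. bp_vertex B x i \<in> A i)" using False by (meson le_SucI)
      ultimately show ?thesis using js by (metis Suc_le_mono le_SucI)
    qed
  qed
  have "(\<forall>r\<le>n. bp_vertex B x r \<in> A r) = bp_accepts n B' x" for x
  proof (cases "\<forall>r\<le>n. bp_vertex B x r \<in> A r")
    case True
    then have "bp_vertex B' x n = vx 0 (e n (bp_vertex B x n))"
      using inv[OF order_refl, of x] unfolding if_P[OF True] by blast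
    then show ?thesis using True by (simp add: bp_accepts_def B'_def)
  next
    case False
    then obtain j s where js: "1 \<le> j" "s < K" "bp_vertex B' x n = vx j s"
      using inv[OF order_refl, of x] unfolding if_not_P[OF False] by blast
    have "vx j s \<noteq> vx 0 (e n v)" if "v \<in> A n" for v
      using vx_div(1)[of s j] vx_div(1)[of "e n v" 0] eK[of n v] that js by auto
    then have "\<not> bp_accepts n B' x" using js by (auto simp: bp_accepts_def B'_def)
    with False show ?thesis by blast
  qed
  then show ?thesis unfolding perm_bp_width_def using perm by blast
qed

section \<open>Acceptance of suffixes and splices of two inputs\<close>

lemma is_bp_perm [dest]: "is_permutation_bp n w B \<Longrightarrow> is_bp n w B"
  by (simp add: is_permutation_bp_def)

lemma bp_vertex_range:
  assumes "is_bp n w B" "r \<le> n"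
  shows "bp_vertex B x r \<in> {1..w}"
  using walk_range[OF assms(1), of 0 r "start B" x] assms by (simp add: walk_start is_bp_def)

text \<open>This is how oracle access to the whole function reveals whether the vertex that
  \<open>x\<close> reaches in layer \<open>r\<close> accepts the suffix of \<open>y\<close>.\<close>

lemma bp_accepts_splice:
  assumes "x \<in> cube n" "y \<in> cube n" "r \<le> n"
  shows "bp_accepts n B (take r x @ drop r y) = suffix_accepts n B r (bp_vertex B x r) y"
proof -
  let ?z = "take r x @ drop r y"
  have len: "length (take r x) = r" using assms by (simp add: cube_def)
  have "bp_vertex B ?z n = walk B ?z r (walk B ?z 0 (start B) r) (n - r)"
    using walk_add[of B ?z 0 "start B" r "n - r"] assms(3) walk_start[of B ?z n] by simp
  also have "walk B ?z 0 (start B) r = walk B x 0 (start B) r"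
    using len by (intro walk_cong) (auto simp: nth_append)
  also have "\<dots> = bp_vertex B x r" by (rule walk_start)
  also have "walk B ?z r (bp_vertex B x r) (n - r) = walk B y r (bp_vertex B x r) (n - r)"
    using len assms by (intro walk_cong) (simp add: nth_append cube_def)
  finally show ?thesis by (simp add: bp_accepts_def suffix_accepts_def)
qed

lemma bij_betw_walk:
  assumes "is_permutation_bp n w B" "r + d \<le> n"
  shows "bij_betw (\<lambda>v. walk B y r v d) {1..w} {1..w}"
  using assms(2)
proof (induction d)
  case (Suc d)
  then have "bij_betw (\<lambda>v. walk B y r v d) {1..w} {1..w}" "Suc (r + d) \<in> {1..n}" by auto
  then have "bij_betw ((\<lambda>v. trans B (Suc (r + d)) v (y ! (r + d))) \<circ> (\<lambda>v. walk B y r v d)) {1..w} {1..w}"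
    using assms(1) unfolding is_permutation_bp_def by (blast intro: bij_betw_trans)
  then show ?case by (simp add: comp_def)
qed (simp add: bij_betw_def)

text \<open>For fixed \<open>y\<close> the walk through the remaining layers is a composition of
  permutations, so the preimage of the accept set has the size of that set. In this way the number
  of accept vertices controls every layer, independently of the width.\<close>

lemma card_suffix_accepts:
  assumes B: "is_permutation_bp n w B" and "r \<le> n"
  shows "card {v \<in> {1..w}. suffix_accepts n B r v y} = card (acc B)"
proof -
  let ?g = "\<lambda>v. walk B y r v (n - r)"
  have bij: "bij_betw ?g {1..w} {1..w}" using bij_betw_walk[OF B, of r "n - r"] assms(2) by simp
  have "acc B \<subseteq> {1..w}" using B by (auto simp: is_permutation_bp_def is_bp_def)
  then have sub: "acc B \<subseteq> ?g ` {1..w}" using bij unfolding bij_betw_def by blast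
  have "?g ` {v \<in> {1..w}. ?g v \<in> acc B} = acc B"
  proof (intro equalityI subsetI)
    fix u assume "u \<in> acc B"
    with sub obtain v where "v \<in> {1..w}" "u = ?g v" by blast
    with \<open>u \<in> acc B\<close> show "u \<in> ?g ` {v \<in> {1..w}. ?g v \<in> acc B}" by blast
  qed blast
  then have "?g ` {v \<in> {1..w}. suffix_accepts n B r v y} = acc B"
    by (simp only: suffix_accepts_def)
  moreover have "inj_on ?g {v \<in> {1..w}. suffix_accepts n B r v y}"
    by (rule inj_on_subset[OF bij_betw_imp_inj_on[OF bij]]) blast
  ultimately show ?thesis using card_image by fastforce
qed

text \<open>Starting in \<open>v\<close> and standing still in the first \<open>r\<close> layers
  gives a program of the same class with the same accept set. A hitting property of the class
  therefore applies to every single vertex of a program.\<close>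

lemma suffix_accepts_in_perm_bp_accept:
  assumes B: "is_permutation_bp n w B" and "r \<le> n" "v \<in> {1..w}"
  shows "suffix_accepts n B r v \<in> perm_bp_accept n (card (acc B))"
proof -
  define B' where "B' = B\<lparr>start := v, trans := (\<lambda>i u b. if i \<le> r then u else trans B i u b)\<rparr>"
  have "is_permutation_bp n w B'"
    using B assms(3) by (auto simp: is_permutation_bp_def is_bp_def B'_def bij_betw_def)
  moreover have "bp_vertex B' y (r + d) = walk B y r v d" for y d
  proof (induction d)
    case 0
    have "bp_vertex B' y i = v" if "i \<le> r" for i
      using that by (induction i) (auto simp: B'_def)
    then show ?case by simp
  qed (simp add: B'_def)
  then have "bp_vertex B' y n = walk B y r v (n - r)" for y using assms(2) by (metis le_add_diff_inverse)
  then have "bp_accepts n B' y = suffix_accepts n B r v y" for y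
    by (simp add: bp_accepts_def suffix_accepts_def) (simp add: B'_def)
  moreover have "acc B' = acc B" by (simp add: B'_def)
  ultimately show ?thesis unfolding perm_bp_accept_def by (auto intro!: exI[of _ w] exI[of _ B'])
qed

section \<open>Hitting sets and hybrids\<close>

definition hybrid :: "nat \<Rightarrow> bool list set \<Rightarrow> (bool list \<Rightarrow> bool) \<Rightarrow> bool list \<Rightarrow> bool" where
  "hybrid n H f x \<longleftrightarrow> (\<forall>r\<le>n. \<exists>y\<in>H. f (take r x @ drop r y))"

text \<open>Every \<open>y\<close> is accepted from at most \<open>a\<close> vertices of each layer, so at most
  \<open>a * card H\<close> of them accept some element of \<open>H\<close>.\<close>

lemma hybrid_in_perm_bp_width:
  assumes f: "f \<in> perm_bp_accept n a" and H: "finite H" "H \<subseteq> cube n"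
    and K: "a * card H \<le> K" "1 \<le> K"
  shows "hybrid n H f \<in> perm_bp_width n (Suc n * K)"
proof -
  obtain w B where B: "is_permutation_bp n w B" "card (acc B) = a"
    and fB: "\<And>\<sigma>. \<sigma> \<in> cube n \<Longrightarrow> f \<sigma> = bp_accepts n B \<sigma>"
    using f by (auto simp: perm_bp_accept_def)
  let ?A = "\<lambda>r. {v \<in> {1..w}. \<exists>y\<in>H. suffix_accepts n B r v y}"
  have "card (?A r) \<le> K" if "r \<le> n" for r
  proof -
    have "?A r = (\<Union>y\<in>H. {v \<in> {1..w}. suffix_accepts n B r v y})" by auto
    then have "card (?A r) \<le> (\<Sum>y\<in>H. card {v \<in> {1..w}. suffix_accepts n B r v y})"
      using card_UN_le[OF H(1)] by simp
    also have "\<dots> = a * card H" using card_suffix_accepts[OF B(1) that] B(2) by simp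
    finally show ?thesis using K by simp
  qed
  then have "(\<lambda>x. \<forall>r\<le>n. bp_vertex B x r \<in> ?A r) \<in> perm_bp_width n (Suc n * K)"
    by (intro pruned_in_perm_bp_width[OF B(1) _ K(2)]) auto
  moreover have "(\<forall>r\<le>n. bp_vertex B x r \<in> ?A r) = hybrid n H f x" if x: "x \<in> cube n" for x
  proof -
    have "(bp_vertex B x r \<in> ?A r) = (\<exists>y\<in>H. f (take r x @ drop r y))" if r: "r \<le> n" for r
    proof -
      have "f (take r x @ drop r y) = suffix_accepts n B r (bp_vertex B x r) y" if "y \<in> H" for y
      proof -
        have "take r x @ drop r y \<in> cube n" using x r that H(2) by (auto simp: cube_def)
        then show ?thesis using fB bp_accepts_splice[OF x _ r] that H by auto
      qed
      then show ?thesis using bp_vertex_range[OF is_bp_perm[OF B(1)] r] by auto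
    qed
    then show ?thesis by (auto simp: hybrid_def)
  qed
  ultimately show ?thesis by (rule perm_bp_width_cong)
qed

text \<open>\<open>card_accepted_leaving\<close> for the start vertex, in terms of probabilities:
  the loss is one \<theta>, not one for each layer.\<close>

lemma pruned_loss:
  fixes \<theta> :: real
  assumes B: "is_bp n w B" and "\<theta> \<ge> 0"
    and small: "\<And>r v. r \<le> n \<Longrightarrow> v \<in> {1..w} \<Longrightarrow> v \<notin> A r \<Longrightarrow>
      measure_pmf.prob (pmf_of_set (cube n)) {y. suffix_accepts n B r v y} \<le> \<theta>"
  shows "measure_pmf.prob (pmf_of_set (cube n)) {x. bp_accepts n B x} \<le>
      measure_pmf.prob (pmf_of_set (cube n)) {x. bp_accepts n B x \<and> (\<forall>r\<le>n. bp_vertex B x r \<in> A r)} + \<theta>"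
proof -
  have "real (card {y \<in> cube n. suffix_accepts n B 0 (start B) y \<and> leaves n B A 0 (start B) y}) \<le> \<theta> * 2 ^ n"
  proof (rule card_accepted_leaving[OF B])
    show "real (card {y \<in> cube n. suffix_accepts n B r v y}) \<le> \<theta> * 2 ^ n"
      if "r \<le> n" "v \<in> {1..w}" "v \<notin> A r" for r v
      using small[OF that] by (simp add: prob_cube field_simps)
  qed (use B \<open>\<theta> \<ge> 0\<close> in \<open>auto simp: is_bp_def\<close>)
  moreover have "suffix_accepts n B 0 (start B) y = bp_accepts n B y" for y
    by (simp add: suffix_accepts_def bp_accepts_def walk_start)
  moreover have "leaves n B A 0 (start B) y = (\<not> (\<forall>r\<le>n. bp_vertex B y r \<in> A r))" for y
    by (auto simp: leaves_def walk_start)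
  ultimately have le: "real (card {y \<in> cube n. bp_accepts n B y \<and> \<not> (\<forall>r\<le>n. bp_vertex B y r \<in> A r)}) \<le> \<theta> * 2 ^ n"
    by simp
  have "{x \<in> cube n. bp_accepts n B x} =
     {x \<in> cube n. bp_accepts n B x \<and> (\<forall>r\<le>n. bp_vertex B x r \<in> A r)} \<union>
     {y \<in> cube n. bp_accepts n B y \<and> \<not> (\<forall>r\<le>n. bp_vertex B y r \<in> A r)}" by auto
  then have "card {x \<in> cube n. bp_accepts n B x} \<le>
     card {x \<in> cube n. bp_accepts n B x \<and> (\<forall>r\<le>n. bp_vertex B x r \<in> A r)} +
     card {y \<in> cube n. bp_accepts n B y \<and> \<not> (\<forall>r\<le>n. bp_vertex B y r \<in> A r)}"
    by (metis (no_types, lifting) card_Un_le)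
  with le have "real (card {x \<in> cube n. bp_accepts n B x}) \<le>
     real (card {x \<in> cube n. bp_accepts n B x \<and> (\<forall>r\<le>n. bp_vertex B x r \<in> A r)}) + \<theta> * 2 ^ n"
    by linarith
  then show ?thesis by (simp add: prob_cube field_simps)
qed

lemma prob_mono_cube:
  "(\<And>x. x \<in> cube n \<Longrightarrow> P x \<Longrightarrow> Q x) \<Longrightarrow>
   measure_pmf.prob (pmf_of_set (cube n)) {x. P x} \<le> measure_pmf.prob (pmf_of_set (cube n)) {x. Q x}"
  by (auto simp: prob_cube intro!: divide_right_mono card_mono)

lemma prob_cong_cube:
  "(\<And>x. x \<in> cube n \<Longrightarrow> P x = Q x) \<Longrightarrow>
   measure_pmf.prob (pmf_of_set (cube n)) {x. P x} = measure_pmf.prob (pmf_of_set (cube n)) {x. Q x}"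
  by (intro antisym prob_mono_cube) auto

text \<open>A vertex that accepts no suffix from \<open>H\<close> yields a member of the class that
  misses \<open>H\<close>, hence has probability at most \<theta>, and \<open>pruned_loss\<close>
  applies. The error is one-sided: the condition for \<open>r = n\<close> implies
  \<open>f x\<close>, so the hybrid never exceeds \<open>f\<close>.\<close>

lemma hybrid_prob:
  fixes \<theta> :: real
  assumes f: "f \<in> perm_bp_accept n a" and H: "H \<subseteq> cube n" and "\<theta> \<ge> 0"
    and hit: "\<And>g. g \<in> perm_bp_accept n a \<Longrightarrow> (\<forall>y\<in>H. \<not> g y) \<Longrightarrow>
      measure_pmf.prob (pmf_of_set (cube n)) {x. g x} \<le> \<theta>"
  shows "\<bar>measure_pmf.prob (pmf_of_set (cube n)) {x. hybrid n H f x} -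
      measure_pmf.prob (pmf_of_set (cube n)) {x. f x}\<bar> \<le> \<theta>"
proof -
  obtain w B where B: "is_permutation_bp n w B" "card (acc B) = a"
    and fB: "\<And>\<sigma>. \<sigma> \<in> cube n \<Longrightarrow> f \<sigma> = bp_accepts n B \<sigma>"
    using f by (auto simp: perm_bp_accept_def)
  let ?P = "measure_pmf.prob (pmf_of_set (cube n))"
  let ?A = "\<lambda>r. {v \<in> {1..w}. \<exists>y\<in>H. suffix_accepts n B r v y}"
  have loss: "?P {x. bp_accepts n B x} \<le>
     ?P {x. bp_accepts n B x \<and> (\<forall>r\<le>n. bp_vertex B x r \<in> ?A r)} + \<theta>"
  proof (rule pruned_loss[OF is_bp_perm[OF B(1)] \<open>\<theta> \<ge> 0\<close>])
    show "?P {y. suffix_accepts n B r v y} \<le> \<theta>" if "r \<le> n" "v \<in> {1..w}" "v \<notin> ?A r" for r v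
      using hit[of "suffix_accepts n B r v"] suffix_accepts_in_perm_bp_accept[OF B(1)] that B(2) by auto
  qed
  have eq: "(bp_vertex B x r \<in> ?A r) = (\<exists>y\<in>H. f (take r x @ drop r y))"
    if x: "x \<in> cube n" and r: "r \<le> n" for x r
  proof -
    have "f (take r x @ drop r y) = suffix_accepts n B r (bp_vertex B x r) y" if "y \<in> H" for y
    proof -
      have "take r x @ drop r y \<in> cube n" using x r that H by (auto simp: cube_def)
      then show ?thesis using fB bp_accepts_splice[OF x _ r] that H by auto
    qed
    then show ?thesis using bp_vertex_range[OF is_bp_perm[OF B(1)] r] by auto
  qed
  have "hybrid n H f x \<Longrightarrow> f x" if "x \<in> cube n" for x
  proof -
    assume "hybrid n H f x"
    then obtain y where "y \<in> H" "f (take n x @ drop n y)" by (auto simp: hybrid_def)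
    then show "f x" using H that by (auto simp: cube_def)
  qed
  then have "?P {x. hybrid n H f x} \<le> ?P {x. f x}" by (rule prob_mono_cube)
  moreover have "?P {x. bp_accepts n B x} = ?P {x. f x}" using fB by (intro prob_cong_cube) auto
  moreover have "?P {x. bp_accepts n B x \<and> (\<forall>r\<le>n. bp_vertex B x r \<in> ?A r)} \<le> ?P {x. hybrid n H f x}"
    using eq by (intro prob_mono_cube) (auto simp: hybrid_def)
  ultimately show ?thesis using loss by linarith
qed

lemma run_sampler_cong:
  "(\<And>y. y \<in> set (queries T f) \<Longrightarrow> f y = g y) \<Longrightarrow>
   run_sampler T g = run_sampler T f \<and> queries T g = queries T f"
  by (induction T) auto

text \<open>A sampler for small width cannot distinguish the pruned program from the zero function by
  its queries to the latter, so these queries hit every function of noticeable probability.\<close>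

lemma zero_queries_hit:
  fixes \<theta> \<eta> :: real
  assumes T: "is_sampler n (perm_bp_width n W) \<eta> T" and W: "Suc n * K \<le> W"
    and K: "K \<ge> 1" "real a \<le> K * \<theta>" and \<theta>: "\<theta> > 0"
    and f: "f \<in> perm_bp_accept n a" and miss: "\<forall>y\<in>set (queries T (\<lambda>_. False)). \<not> f y"
  shows "measure_pmf.prob (pmf_of_set (cube n)) {x. f x} \<le> \<theta> + 2 * \<eta>"
proof -
  obtain w B where B: "is_permutation_bp n w B" "card (acc B) = a"
    and fB: "\<And>\<sigma>. \<sigma> \<in> cube n \<Longrightarrow> f \<sigma> = bp_accepts n B \<sigma>"
    using f by (auto simp: perm_bp_accept_def)
  let ?P = "measure_pmf.prob (pmf_of_set (cube n))"
  let ?p = "\<lambda>r v. ?P {y. suffix_accepts n B r v y}"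
  let ?A = "\<lambda>r. {v \<in> {1..w}. \<theta> \<le> ?p r v}"
  let ?g = "\<lambda>x. \<forall>r\<le>n. bp_vertex B x r \<in> ?A r"
  \<comment> \<open>Counting the pairs of a vertex and an accepted input in two ways shows that the
    probabilities of a layer sum to \<open>a\<close>; hence at most \<open>a / \<theta>\<close> of
    them reach \<theta>.\<close>
  have cardA: "card (?A r) \<le> K" if r: "r \<le> n" for r
  proof -
    have "(\<Sum>v\<in>{1..w}. ?p r v) = real (\<Sum>v\<in>{1..w}. card {y \<in> cube n. suffix_accepts n B r v y}) / 2 ^ n"
      by (simp add: prob_cube sum_divide_distrib)
    also have "(\<Sum>v\<in>{1..w}. card {y \<in> cube n. suffix_accepts n B r v y}) =
        (\<Sum>y\<in>cube n. card {v \<in> {1..w}. suffix_accepts n B r v y})"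
      by (rule sum_multicount_gen) auto
    also have "\<dots> = a * 2 ^ n" using card_suffix_accepts[OF B(1) r] B(2) by (simp add: card_cube)
    finally have sum: "(\<Sum>v\<in>{1..w}. ?p r v) = real a" by simp
    have "real (card (?A r)) * \<theta> = (\<Sum>v\<in>?A r. \<theta>)" by simp
    also have "\<dots> \<le> (\<Sum>v\<in>?A r. ?p r v)" by (intro sum_mono) auto
    also have "\<dots> \<le> (\<Sum>v\<in>{1..w}. ?p r v)" by (intro sum_mono2) auto
    also have "\<dots> \<le> real K * \<theta>" using sum K by simp
    finally show ?thesis using \<theta> by simp
  qed
  have gW: "?g \<in> perm_bp_width n W"
    by (rule perm_bp_width_mono[OF pruned_in_perm_bp_width[OF B(1) _ K(1)] W]) (use cardA in auto)
  \<comment> \<open>In the last layer nothing remains to be read. A probability there is 0 or 1, and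
    a positive one means an accept vertex.\<close>
  have gf: "f x" if "x \<in> cube n" "?g x" for x
  proof -
    have "\<theta> \<le> ?p n (bp_vertex B x n)" using that by auto
    with \<theta> have "?p n (bp_vertex B x n) \<noteq> 0" by linarith
    then have "{y \<in> cube n. suffix_accepts n B n (bp_vertex B x n) y} \<noteq> {}"
      by (metis card.empty div_0 of_nat_0 prob_cube)
    then have "bp_accepts n B x" by (auto simp: suffix_accepts_def bp_accepts_def)
    then show ?thesis using fB that by simp
  qed
  have "W \<ge> 1" using W K(1) by (metis One_nat_def Suc_le_mono le0 le_trans mult_le_mono nat_mult_1)
  then have FW: "(\<lambda>_. False) \<in> perm_bp_width n W" by (rule const_False_in_perm_bp_width)
  then have Q: "set (queries T (\<lambda>_. False)) \<subseteq> cube n"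
    and e0: "\<bar>run_sampler T (\<lambda>_. False) - ?P {x. False}\<bar> \<le> \<eta>" using T by (auto simp: is_sampler_def)
  \<comment> \<open>On the cube \<open>?g\<close> implies \<open>f\<close>, so it vanishes at all
    queries made to the zero function. The sampler then gives one output for both functions, at the
    cost of \<eta> for each.\<close>
  have "run_sampler T ?g = run_sampler T (\<lambda>_. False)"
    using run_sampler_cong[of T "\<lambda>_. False" ?g] miss Q gf by blast
  moreover have "\<bar>run_sampler T ?g - ?P {x. ?g x}\<bar> \<le> \<eta>"
    using T gW unfolding is_sampler_def by blast
  moreover have "?P {x. False} = 0" by simp
  ultimately have g: "?P {x. ?g x} \<le> 2 * \<eta>" using e0 by linarith
  have "?P {x. bp_accepts n B x} \<le> ?P {x. bp_accepts n B x \<and> ?g x} + \<theta>"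
    by (rule pruned_loss[OF is_bp_perm[OF B(1)]]) (use \<theta> in auto)
  moreover have "?P {x. bp_accepts n B x \<and> ?g x} \<le> ?P {x. ?g x}" by (rule prob_mono_cube) auto
  moreover have "?P {x. bp_accepts n B x} = ?P {x. f x}" using fB by (intro prob_cong_cube) auto
  ultimately show ?thesis using g by linarith
qed

section \<open>Sweep programs\<close>

text \<open>The only work tape is a list of cells. An operation acts once on the input tapes, then sweeps
  right over all cells, possibly appends a cell, and sweeps back; \<open>'v\<close> is the finite control.\<close>

datatype ('v, 'c) op = Op
  (act: "'v \<Rightarrow> bool \<Rightarrow> input_symbol list \<Rightarrow> 'v \<times> move list \<times> effect")
  (fwd: "'v \<Rightarrow> 'c \<Rightarrow> 'v \<times> 'c \<times> effect")
  (grow: "'v \<Rightarrow> 'c option")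
  (bwd: "'v \<Rightarrow> 'c \<Rightarrow> 'v \<times> 'c")

datatype ('v, 'c) prog =
    Skip
  | Do "('v, 'c) op"
  | Seq "('v, 'c) prog" "('v, 'c) prog"
  | Cond "'v \<Rightarrow> bool \<Rightarrow> input_symbol list \<Rightarrow> bool" "('v, 'c) prog" "('v, 'c) prog"
  | While "'v \<Rightarrow> bool \<Rightarrow> input_symbol list \<Rightarrow> bool" "('v, 'c) prog"

type_synonym ('v, 'c) world = "'v \<times> 'c list \<times> config"

fun fpass :: "('v \<Rightarrow> 'c \<Rightarrow> 'v \<times> 'c \<times> effect) \<Rightarrow> 'v \<Rightarrow> 'c list \<Rightarrow> 'v \<times> 'c list \<times> effect list" where
  "fpass g v [] = (v, [], [])"
| "fpass g v (c # cs) =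
     (case g v c of (v1, c1, e) \<Rightarrow> case fpass g v1 cs of (v2, cs2, es) \<Rightarrow> (v2, c1 # cs2, e # es))"

fun bpass :: "('v \<Rightarrow> 'c \<Rightarrow> 'v \<times> 'c) \<Rightarrow> 'v \<Rightarrow> 'c list \<Rightarrow> 'v \<times> 'c list" where
  "bpass g v [] = (v, [])"
| "bpass g v (c # cs) =
     (case bpass g v cs of (v1, cs1) \<Rightarrow> case g v1 c of (v2, c2) \<Rightarrow> (v2, c2 # cs1))"

definition scanned :: "bool list list \<Rightarrow> config \<Rightarrow> input_symbol list" where
  "scanned inp x = map2 read_input inp (input_heads x)"

definition move_heads :: "bool list list \<Rightarrow> move list \<Rightarrow> config \<Rightarrow> config" where
  "move_heads inp ms x =
     x\<lparr>input_heads := map2 (\<lambda>x (d, h). move_input x d h) inp (zip ms (input_heads x))\<rparr>"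

fun do_op :: "bool list list \<Rightarrow> (bool list \<Rightarrow> bool) \<Rightarrow> ('v, 'c) op \<Rightarrow> ('v, 'c) world \<Rightarrow> ('v, 'c) world" where
  "do_op inp f i (v, cs, x) =
     (case act i v (answer x) (scanned inp x) of (v1, ms, e) \<Rightarrow>
      case fpass (fwd i) v1 cs of (v2, cs2, es) \<Rightarrow>
      case bpass (bwd i) v2 (cs2 @ (case grow i v2 of None \<Rightarrow> [] | Some c \<Rightarrow> [c])) of (v3, cs3) \<Rightarrow>
        (v3, cs3, fold (perform f) es (perform f e (move_heads inp ms x))))"

fun test :: "bool list list \<Rightarrow> ('v \<Rightarrow> bool \<Rightarrow> input_symbol list \<Rightarrow> bool) \<Rightarrow> ('v, 'c) world \<Rightarrow> bool" where
  "test inp b (v, cs, x) = b v (answer x) (scanned inp x)"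

text \<open>A big-step semantics: a derivation exists only for a terminating run, so a statement
  that exhibits one is a statement of total correctness.\<close>

inductive exec :: "bool list list \<Rightarrow> (bool list \<Rightarrow> bool) \<Rightarrow> ('v, 'c) prog \<Rightarrow>
    ('v, 'c) world \<Rightarrow> ('v, 'c) world \<Rightarrow> bool" for inp f where
  Skip: "exec inp f Skip w w"
| Do: "exec inp f (Do i) w (do_op inp f i w)"
| Seq: "exec inp f p w w1 \<Longrightarrow> exec inp f q w1 w2 \<Longrightarrow> exec inp f (Seq p q) w w2"
| Cond: "exec inp f (if test inp b w then p else q) w w1 \<Longrightarrow> exec inp f (Cond b p q) w w1"
| While_False: "\<not> test inp b w \<Longrightarrow> exec inp f (While b p) w w"
| While_True: "test inp b w \<Longrightarrow> exec inp f p w w1 \<Longrightarrow> exec inp f (While b p) w1 w2 \<Longrightarrow>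
    exec inp f (While b p) w w2"

section \<open>Compilation of sweep programs into machines\<close>

primrec ops :: "('v, 'c) prog \<Rightarrow> ('v, 'c) op set" where
  "ops Skip = {}"
| "ops (Do i) = {i}"
| "ops (Seq p q) = ops p \<union> ops q"
| "ops (Cond b p q) = ops p \<union> ops q"
| "ops (While b p) = ops p"

text \<open>All stacks of pending statements that can arise while \<open>p\<close> runs on top of
  \<open>k\<close>. There are finitely many, since a loop pushes itself back instead of unfolding; a
  stack can therefore be part of the finite control.\<close>

primrec conts :: "('v, 'c) prog \<Rightarrow> ('v, 'c) prog list \<Rightarrow> ('v, 'c) prog list set" where
  "conts Skip k = {Skip # k, k}"
| "conts (Do i) k = {Do i # k, k}"
| "conts (Seq p q) k = {Seq p q # k} \<union> conts p (q # k) \<union> conts q k"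
| "conts (Cond b p q) k = {Cond b p q # k} \<union> conts p k \<union> conts q k"
| "conts (While b p) k = {While b p # k, k} \<union> conts p (While b p # k)"

lemma conts_self: "p # k \<in> conts p k" and conts_rest: "k \<in> conts p k"
  by (induction p arbitrary: k) auto

lemma finite_conts: "finite (conts p k)"
  by (induction p arbitrary: k) auto

lemma finite_ops: "finite (ops p)"
  by (induction p) auto

definition wf_op :: "nat \<Rightarrow> 'v set \<Rightarrow> 'c set \<Rightarrow> ('v, 'c) op \<Rightarrow> bool" where
  "wf_op m V Cs i \<longleftrightarrow>
     (\<forall>v\<in>V. \<forall>b xs. length xs = m \<longrightarrow>
        fst (act i v b xs) \<in> V \<and> length (fst (snd (act i v b xs))) = m) \<and>
     (\<forall>v\<in>V. \<forall>c\<in>Cs. fst (fwd i v c) \<in> V \<and> fst (snd (fwd i v c)) \<in> Cs) \<and>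
     (\<forall>v\<in>V. \<forall>c. grow i v = Some c \<longrightarrow> c \<in> Cs) \<and>
     (\<forall>v\<in>V. \<forall>c\<in>Cs. fst (bwd i v c) \<in> V \<and> snd (bwd i v c) \<in> Cs)"

lemma wf_op_act:
  "wf_op m V Cs i \<Longrightarrow> v \<in> V \<Longrightarrow> length xs = m \<Longrightarrow> act i v b xs = (v1, ms, e) \<Longrightarrow> v1 \<in> V \<and> length ms = m"
  unfolding wf_op_def by (metis fst_conv snd_conv)

lemma wf_op_fwd:
  "wf_op m V Cs i \<Longrightarrow> v \<in> V \<Longrightarrow> c \<in> Cs \<Longrightarrow> fwd i v c = (v1, c1, e) \<Longrightarrow> v1 \<in> V \<and> c1 \<in> Cs"
  unfolding wf_op_def by (metis fst_conv snd_conv)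

lemma wf_op_bwd:
  "wf_op m V Cs i \<Longrightarrow> v \<in> V \<Longrightarrow> c \<in> Cs \<Longrightarrow> bwd i v c = (v1, c1) \<Longrightarrow> v1 \<in> V \<and> c1 \<in> Cs"
  unfolding wf_op_def by (metis fst_conv snd_conv)

lemma wf_op_grow: "wf_op m V Cs i \<Longrightarrow> v \<in> V \<Longrightarrow> grow i v \<in> insert None (Some ` Cs)"
  unfolding wf_op_def by (cases "grow i v") auto

datatype ('v, 'c) ctl =
    At "('v, 'c) prog list" 'v
  | Fw "('v, 'c) op" "('v, 'c) prog list" 'v
  | Bw "('v, 'c) op" "('v, 'c) prog list" 'v

text \<open>The cells occupy positions \<open>1, \<dots>, length cells\<close> of the only work tape, between two blanks
  (\<open>None\<close>); an operation starts and ends with the head on the left blank.\<close>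

fun tr :: "('v, 'c) ctl \<Rightarrow> bool \<Rightarrow> input_symbol list \<Rightarrow> 'c option \<Rightarrow>
    (('v, 'c) ctl \<times> move list \<times> 'c option \<times> move \<times> effect) option" where
  "tr (At [] v) b xs y = None"
| "tr (At (Skip # k) v) b xs y = Some (At k v, replicate (length xs) Stay, y, Stay, Silent)"
| "tr (At (Seq p q # k) v) b xs y = Some (At (p # q # k) v, replicate (length xs) Stay, y, Stay, Silent)"
| "tr (At (Cond c p q # k) v) b xs y =
     Some (At ((if c v b xs then p else q) # k) v, replicate (length xs) Stay, y, Stay, Silent)"
| "tr (At (While c p # k) v) b xs y =
     Some (At (if c v b xs then p # While c p # k else k) v, replicate (length xs) Stay, y, Stay, Silent)"
| "tr (At (Do i # k) v) b xs y =
     (case act i v b xs of (v1, ms, e) \<Rightarrow> Some (Fw i k v1, ms, y, Rgt, e))"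
| "tr (Fw i k v) b xs (Some c) =
     (case fwd i v c of (v1, c1, e) \<Rightarrow> Some (Fw i k v1, replicate (length xs) Stay, Some c1, Rgt, e))"
| "tr (Fw i k v) b xs None =
     Some (Bw i k v, replicate (length xs) Stay, grow i v, if grow i v = None then Lft else Stay, Silent)"
| "tr (Bw i k v) b xs (Some c) =
     (case bwd i v c of (v1, c1) \<Rightarrow> Some (Bw i k v1, replicate (length xs) Stay, Some c1, Lft, Silent))"
| "tr (Bw i k v) b xs None = Some (At k v, replicate (length xs) Stay, None, Stay, Silent)"

definition code_on :: "'a set \<Rightarrow> 'a \<Rightarrow> nat" where
  "code_on A = (SOME g. bij_betw g A {0..<card A})"

lemma code_on: "finite A \<Longrightarrow> bij_betw (code_on A) A {0..<card A}"
  unfolding code_on_def using someI_ex[OF ex_bij_betw_finite_nat[of A]] .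

lemma perform_update:
  "perform f e (x\<lparr>state := q, work := W\<rparr>) = (perform f e x)\<lparr>state := q, work := W\<rparr>"
  by (cases e) auto

lemma perform_input_heads [simp]: "input_heads (perform f e x) = input_heads x"
  by (cases e) auto

locale sweep_machine =
  fixes V :: "'v set" and Cs :: "'c set" and m :: nat and p0 :: "('v, 'c) prog" and v0 :: 'v
  assumes finV: "finite V" and finCs: "finite Cs" and v0: "v0 \<in> V"
    and wf: "\<And>i. i \<in> ops p0 \<Longrightarrow> wf_op m V Cs i"
begin

definition Q :: "('v, 'c) ctl set" where
  "Q = (\<lambda>(k, v). At k v) ` (conts p0 [] \<times> V) \<union>
    (\<lambda>(i, k, v). Fw i k v) ` (ops p0 \<times> conts p0 [] \<times> V) \<union>
    (\<lambda>(i, k, v). Bw i k v) ` (ops p0 \<times> conts p0 [] \<times> V)"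

lemma mem_Q [simp]:
  "At k v \<in> Q \<longleftrightarrow> k \<in> conts p0 [] \<and> v \<in> V"
  "Fw i k v \<in> Q \<longleftrightarrow> i \<in> ops p0 \<and> k \<in> conts p0 [] \<and> v \<in> V"
  "Bw i k v \<in> Q \<longleftrightarrow> i \<in> ops p0 \<and> k \<in> conts p0 [] \<and> v \<in> V"
  unfolding Q_def by (auto simp: image_iff)

lemma finite_Q: "finite Q"
  unfolding Q_def using finV by (intro finite_UnI finite_imageI finite_cartesian_product finite_conts finite_ops)

text \<open>Machines start in state 0 and on the blank 0, which the arbitrary numbering
  \<open>code_on\<close> need not respect; hence the shift by one here and in
  \<open>sym\<close>.\<close>

definition e :: "('v, 'c) ctl \<Rightarrow> nat" where
  "e s = (if s = At [p0] v0 then 0 else Suc (code_on Q s))"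

definition sym :: "'c option \<Rightarrow> nat" where
  "sym y = (case y of None \<Rightarrow> 0 | Some c \<Rightarrow> Suc (code_on Cs c))"

lemma inj_e: "inj_on e Q"
proof -
  have "inj_on (code_on Q) Q" using code_on[OF finite_Q] by (simp add: bij_betw_def)
  then show ?thesis by (auto simp: e_def inj_on_def)
qed

lemma inj_sym: "inj_on sym (insert None (Some ` Cs))"
proof -
  have "inj_on (code_on Cs) Cs" using code_on[OF finCs] by (simp add: bij_betw_def)
  then show ?thesis by (auto simp: sym_def inj_on_def)
qed

text \<open>Codes out of range, and transitions whose result would be out of range, make the machine
  halt. Its validity then follows without a look at the operations; their well-formedness only
  enters in showing that the run never gets there.\<close>

definition M :: machine where
  "M = \<lparr>n_states = Suc (card Q), n_symbols = Suc (card Cs), n_tapes = 1,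
     delta = (\<lambda>q b xs ys.
       if q \<in> e ` Q \<and> length ys = 1 \<and> hd ys \<in> sym ` insert None (Some ` Cs) then
         (case tr (inv_into Q e q) b xs (inv_into (insert None (Some ` Cs)) sym (hd ys)) of
            None \<Rightarrow> None
          | Some (s, ms, w, d, ef) \<Rightarrow>
              if s \<in> Q \<and> length ms = m \<and> w \<in> insert None (Some ` Cs)
              then Some (e s, ms, [(sym w, d)], ef) else None)
       else None)\<rparr>"

lemma valid_M: "valid_machine m M"
proof -
  have e: "e s < Suc (card Q)" if "s \<in> Q" for s
    using code_on[OF finite_Q] that by (auto simp: e_def bij_betw_def)
  have sy: "sym w < Suc (card Cs)" if "w \<in> insert None (Some ` Cs)" for w
    using code_on[OF finCs] that by (auto simp: sym_def bij_betw_def)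
  have *: "\<exists>s w d. s \<in> Q \<and> length ms = m \<and> w \<in> insert None (Some ` Cs) \<and> q' = e s \<and> ws = [(sym w, d)]"
    if "delta M q b xs ys = Some (q', ms, ws, a)" for q b xs ys q' ms ws a
    using that unfolding M_def
    by (simp del: image_insert insert_iff split: if_splits option.splits prod.splits) blast
  have "q' < n_states M \<and> length ms = m \<and> length ws = n_tapes M \<and> fst ` set ws \<subseteq> {..<n_symbols M}"
    if del: "delta M q b xs ys = Some (q', ms, ws, a)" for q b xs ys q' ms ws a
  proof -
    from *[OF del] obtain s w d where "s \<in> Q" "length ms = m" "w \<in> insert None (Some ` Cs)"
      "q' = e s" "ws = [(sym w, d)]" by blast
    then show ?thesis using e[of s] sy[of w] by (simp add: M_def)
  qed
  moreover have "n_states M > 0" "n_symbols M > 0" by (simp_all add: M_def)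
  ultimately show ?thesis unfolding valid_machine_def by blast
qed

lemma delta_M:
  assumes "s \<in> Q" "y \<in> insert None (Some ` Cs)"
  shows "delta M (e s) b xs [sym y] =
    (case tr s b xs y of None \<Rightarrow> None
     | Some (s, ms, w, d, ef) \<Rightarrow>
         if s \<in> Q \<and> length ms = m \<and> w \<in> insert None (Some ` Cs)
         then Some (e s, ms, [(sym w, d)], ef) else None)"
proof -
  have "inv_into Q e (e s) = s" "inv_into (insert None (Some ` Cs)) sym (sym y) = y"
    using assms inj_e inj_sym by (auto intro: inv_into_f_f)
  moreover have "e s \<in> e ` Q" "sym y \<in> sym ` insert None (Some ` Cs)" using assms by (auto simp only: imageI)
  ultimately show ?thesis unfolding M_def by (simp del: image_insert)
qed

definition cell_at :: "'c list \<Rightarrow> nat \<Rightarrow> 'c option" where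
  "cell_at cs h = (if h = 0 \<or> length cs < h then None else Some (cs ! (h - 1)))"

lemma cell_at_simps [simp]:
  "cell_at cs 0 = None"
  "cell_at cs (Suc (length cs)) = None"
  "cell_at (dn @ c # cs) (Suc (length dn)) = Some c"
  by (auto simp: cell_at_def nth_append)

lemma cell_at_replace:
  "cell_at (dn @ c1 # cs) i = (if i = Suc (length dn) then Some c1 else cell_at (dn @ c # cs) i)"
  by (auto simp: cell_at_def nth_append nth_Cons')

lemma cell_at_grow: "cell_at (cs @ [c]) i = (if i = Suc (length cs) then Some c else cell_at cs i)"
  by (auto simp: cell_at_def nth_append nth_Cons')

definition conc :: "('v, 'c) ctl \<Rightarrow> nat \<Rightarrow> 'c list \<Rightarrow> config \<Rightarrow> config" where
  "conc s h cs x = x\<lparr>state := e s, work := [(\<lambda>i. sym (cell_at cs i), h)]\<rparr>"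

lemma tape_update: "(\<lambda>i. sym (cell_at cs i))(h := sym y) = (\<lambda>i. sym (if i = h then y else cell_at cs i))"
  by auto

text \<open>\<open>move_input\<close> cuts off positions beyond the right end marker, so staying put
  leaves a head where it is only under this bound.\<close>

definition heads_ok :: "bool list list \<Rightarrow> config \<Rightarrow> bool" where
  "heads_ok inp x \<longleftrightarrow> length inp = m \<and> length (input_heads x) = m \<and>
     (\<forall>i<m. input_heads x ! i \<le> Suc (length (inp ! i)))"

lemma move_heads_Stay:
  assumes "heads_ok inp x" shows "move_heads inp (replicate m Stay) x = x"
proof -
  have "map2 (\<lambda>x (d, h). move_input x d h) inp (zip (replicate m Stay) (input_heads x)) = input_heads x"
    using assms by (intro nth_equalityI) (auto simp: heads_ok_def move_input_def)
  then show ?thesis by (simp add: move_heads_def)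
qed

lemma heads_ok_move:
  assumes "heads_ok inp x" "length ms = m" shows "heads_ok inp (move_heads inp ms x)"
  using assms by (auto simp: heads_ok_def move_heads_def move_input_def)

lemma heads_ok_perform: "heads_ok inp (perform f a x) = heads_ok inp x"
  by (simp add: heads_ok_def)

lemma heads_ok_fold: "heads_ok inp (fold (perform f) es x) = heads_ok inp x"
  by (induction es arbitrary: x) (auto simp: heads_ok_perform)

lemma length_scanned: "heads_ok inp x \<Longrightarrow> length (scanned inp x) = m"
  by (simp add: scanned_def heads_ok_def)

lemma step_conc:
  assumes "s \<in> Q" "set cs \<subseteq> Cs" "tr s (answer x) (scanned inp x) (cell_at cs h) = Some (s', ms, w, d, a)"
    "s' \<in> Q" "length ms = m" "w \<in> insert None (Some ` Cs)"
    "\<And>i. cell_at cs' i = (if i = h then w else cell_at cs i)"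
  shows "step M inp f (conc s h cs x) = Some (conc s' (shift d h) cs' (perform f a (move_heads inp ms x)))"
proof -
  have "cell_at cs h \<in> insert None (Some ` Cs)"
    using assms(2) by (auto simp: cell_at_def subset_iff intro!: imageI)
  note d = delta_M[OF assms(1) this]
  have swap: "x\<lparr>state := q, input_heads := H, work := W\<rparr> = x\<lparr>input_heads := H, state := q, work := W\<rparr>"
    for q H W by (cases x) simp
  have "step M inp f (conc s h cs x) =
     Some (perform f a ((move_heads inp ms x)\<lparr>state := e s', work := [(\<lambda>i. sym (cell_at cs' i), shift d h)]\<rparr>))"
    using assms(3-6) d[of "answer x" "scanned inp x"]
    by (simp add: step_def conc_def scanned_def move_heads_def update_tape_def assms(7) tape_update swap)
  then show ?thesis by (simp add: perform_update conc_def)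
qed

text \<open>A step that also bounds the work heads before it. Its reflexive transitive closure thus
  carries a space bound for all configurations passed on the way.\<close>

definition bstep :: "bool list list \<Rightarrow> (bool list \<Rightarrow> bool) \<Rightarrow> nat \<Rightarrow> config \<Rightarrow> config \<Rightarrow> bool" where
  "bstep inp f B a b \<longleftrightarrow> step M inp f a = Some b \<and> (\<forall>(t, h)\<in>set (work a). h \<le> B)"

lemma bstep_conc:
  assumes "s \<in> Q" "set cs \<subseteq> Cs" "tr s (answer x) (scanned inp x) (cell_at cs h) = Some (s', ms, w, d, a)"
    "s' \<in> Q" "length ms = m" "w \<in> insert None (Some ` Cs)"
    "\<And>i. cell_at cs' i = (if i = h then w else cell_at cs i)" "h \<le> B"
  shows "bstep inp f B (conc s h cs x) (conc s' (shift d h) cs' (perform f a (move_heads inp ms x)))"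
  unfolding bstep_def using step_conc[OF assms(1-7)] assms(8) by (simp add: conc_def)

lemma bstep_silent:
  assumes "s \<in> Q" "set cs \<subseteq> Cs" "heads_ok inp x"
    "tr s (answer x) (scanned inp x) (cell_at cs h) = Some (s', replicate (length (scanned inp x)) Stay, w, d, a)"
    "s' \<in> Q" "w \<in> insert None (Some ` Cs)"
    "\<And>i. cell_at cs' i = (if i = h then w else cell_at cs i)" "h \<le> B"
  shows "bstep inp f B (conc s h cs x) (conc s' (shift d h) cs' (perform f a x))"
  using bstep_conc[OF assms(1,2,4,5) _ assms(6-8)] assms(3)
  by (simp add: length_scanned move_heads_Stay)

lemma fwd_sweep:
  assumes "wf_op m V Cs i" "i \<in> ops p0" "k \<in> conts p0 []" "B \<ge> length dn + length cs"
    "v \<in> V" "set dn \<subseteq> Cs" "set cs \<subseteq> Cs" "heads_ok inp x" "fpass (fwd i) v cs = (v', cs', es)"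
  shows "(bstep inp f B)\<^sup>*\<^sup>* (conc (Fw i k v) (Suc (length dn)) (dn @ cs) x)
      (conc (Fw i k v') (Suc (length dn + length cs)) (dn @ cs') (fold (perform f) es x))
    \<and> v' \<in> V \<and> set cs' \<subseteq> Cs \<and> length cs' = length cs"
  using assms(4-9)
proof (induction cs arbitrary: dn v x v' cs' es)
  case (Cons c cs)
  obtain v1 c1 a where f1: "fwd i v c = (v1, c1, a)" by (cases "fwd i v c") auto
  obtain v2 cs2 es2 where f2: "fpass (fwd i) v1 cs = (v2, cs2, es2)" by (cases "fpass (fwd i) v1 cs") auto
  have v1: "v1 \<in> V" "c1 \<in> Cs" using wf_op_fwd[OF assms(1) _ _ f1] Cons.prems by auto
  have "bstep inp f B (conc (Fw i k v) (Suc (length dn)) (dn @ c # cs) x)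
      (conc (Fw i k v1) (shift Rgt (Suc (length dn))) ((dn @ [c1]) @ cs) (perform f a x))"
    by (rule bstep_silent[where w = "Some c1"])
       (use Cons.prems v1 assms(2,3) f1 cell_at_replace[of dn c1 cs _ c] in auto)
  moreover have "(bstep inp f B)\<^sup>*\<^sup>* (conc (Fw i k v1) (Suc (length (dn @ [c1]))) ((dn @ [c1]) @ cs) (perform f a x))
      (conc (Fw i k v2) (Suc (length (dn @ [c1]) + length cs)) ((dn @ [c1]) @ cs2) (fold (perform f) es2 (perform f a x)))
      \<and> v2 \<in> V \<and> set cs2 \<subseteq> Cs \<and> length cs2 = length cs"
    by (rule Cons.IH) (use Cons.prems v1 f2 in \<open>auto simp: heads_ok_perform\<close>)
  ultimately show ?case using Cons.prems f1 f2 v1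
    by (auto intro: converse_rtranclp_into_rtranclp)
qed auto

lemma bpass_snoc:
  "bpass g v (cs @ [c]) = (case g v c of (v1, c1) \<Rightarrow> case bpass g v1 cs of (v2, cs2) \<Rightarrow> (v2, cs2 @ [c1]))"
  by (induction cs) (auto split: prod.splits)

lemma bwd_sweep:
  assumes "wf_op m V Cs i" "i \<in> ops p0" "k \<in> conts p0 []" "B \<ge> length cs"
    "v \<in> V" "set cs \<subseteq> Cs" "set dn \<subseteq> Cs" "heads_ok inp x" "bpass (bwd i) v cs = (v', cs')"
  shows "(bstep inp f B)\<^sup>*\<^sup>* (conc (Bw i k v) (length cs) (cs @ dn) x) (conc (Bw i k v') 0 (cs' @ dn) x)
    \<and> v' \<in> V \<and> set cs' \<subseteq> Cs \<and> length cs' = length cs"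
  using assms(4-9)
proof (induction cs arbitrary: dn v v' cs' rule: rev_induct)
  case (snoc c cs)
  obtain v1 c1 where f1: "bwd i v c = (v1, c1)" by (cases "bwd i v c") auto
  obtain v2 cs2 where f2: "bpass (bwd i) v1 cs = (v2, cs2)" by (cases "bpass (bwd i) v1 cs") auto
  have v1: "v1 \<in> V" "c1 \<in> Cs" using wf_op_bwd[OF assms(1) _ _ f1] snoc.prems by auto
  have "bstep inp f B (conc (Bw i k v) (length (cs @ [c])) ((cs @ [c]) @ dn) x)
      (conc (Bw i k v1) (shift Lft (length (cs @ [c]))) (cs @ c1 # dn) (perform f Silent x))"
    by (rule bstep_silent[where w = "Some c1"])
       (use snoc.prems v1 assms(2,3) f1 cell_at_replace[of cs c1 dn _ c] in auto)
  moreover have "(bstep inp f B)\<^sup>*\<^sup>* (conc (Bw i k v1) (length cs) (cs @ c1 # dn) x)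
      (conc (Bw i k v2) 0 (cs2 @ c1 # dn) x) \<and> v2 \<in> V \<and> set cs2 \<subseteq> Cs \<and> length cs2 = length cs"
    by (rule snoc.IH) (use snoc.prems v1 f2 in auto)
  ultimately show ?case using snoc.prems f1 f2 v1
    by (auto simp: bpass_snoc intro: converse_rtranclp_into_rtranclp)
qed auto

definition inv_world :: "bool list list \<Rightarrow> ('v, 'c) world \<Rightarrow> bool" where
  "inv_world inp w = (case w of (v, cs, x) \<Rightarrow> v \<in> V \<and> set cs \<subseteq> Cs \<and> heads_ok inp x)"

text \<open>The blank behind the last cell is visited even when no cell is appended, which is why
  the bound exceeds the number of cells by one.\<close>

lemma do_op_correct:
  assumes w: "wf_op m V Cs i" and io: "i \<in> ops p0" and k: "k \<in> conts p0 []" "Do i # k \<in> conts p0 []"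
    and inv: "v \<in> V" "set cs \<subseteq> Cs" "heads_ok inp x"
    and d: "do_op inp f i (v, cs, x) = (v', cs', x')"
  shows "v' \<in> V \<and> set cs' \<subseteq> Cs \<and> heads_ok inp x' \<and> length cs \<le> length cs' \<and>
    (\<forall>B. Suc (length cs') \<le> B \<longrightarrow>
      (bstep inp f B)\<^sup>*\<^sup>* (conc (At (Do i # k) v) 0 cs x) (conc (At k v') 0 cs' x'))"
proof -
  obtain v1 ms a where f1: "act i v (answer x) (scanned inp x) = (v1, ms, a)"
    by (cases "act i v (answer x) (scanned inp x)") auto
  obtain v2 cs2 es where f2: "fpass (fwd i) v1 cs = (v2, cs2, es)" by (cases "fpass (fwd i) v1 cs") auto
  define cs3 where "cs3 = cs2 @ (case grow i v2 of None \<Rightarrow> [] | Some c \<Rightarrow> [c])"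
  obtain v4 cs4 where f3: "bpass (bwd i) v2 cs3 = (v4, cs4)" by (cases "bpass (bwd i) v2 cs3") auto
  let ?x1 = "perform f a (move_heads inp ms x)"
  have d': "v' = v4" "cs' = cs4" "x' = fold (perform f) es ?x1"
    using d f1 f2 f3 by (auto simp: cs3_def)
  have v1: "v1 \<in> V" "length ms = m"
    using wf_op_act[OF w inv(1) length_scanned[OF inv(3)] f1] by auto
  have x1: "heads_ok inp ?x1" using heads_ok_move[OF inv(3) v1(2)] by (simp add: heads_ok_perform)
  have s2: "(bstep inp f B)\<^sup>*\<^sup>* (conc (Fw i k v1) 1 cs ?x1) (conc (Fw i k v2) (Suc (length cs)) cs2 x')
     \<and> v2 \<in> V \<and> set cs2 \<subseteq> Cs \<and> length cs2 = length cs" if "B \<ge> length cs" for B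
    using fwd_sweep[OF w io k(1), of "[]" cs B v1 inp ?x1 v2 cs2 es f] that v1 inv x1 f2 d' by simp
  have x': "heads_ok inp x'" using x1 d' by (simp add: heads_ok_fold)
  have c3: "set cs3 \<subseteq> Cs" using s2[OF order_refl] wf_op_grow[OF w, of v2] unfolding cs3_def by (auto split: option.splits)
  have s4: "(bstep inp f B)\<^sup>*\<^sup>* (conc (Bw i k v2) (length cs3) cs3 x') (conc (Bw i k v') 0 cs' x')
     \<and> v' \<in> V \<and> set cs' \<subseteq> Cs \<and> length cs' = length cs3" if "B \<ge> length cs3" for B
    using bwd_sweep[OF w io k(1), of cs3 B v2 "[]" inp x' v4 cs4 f] that s2[OF order_refl] c3 x' f3 d' by simp
  have len: "length cs' = length cs3" "length cs \<le> length cs3"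
    using s4[OF order_refl] s2[OF order_refl] by (auto simp: cs3_def)
  have gr: "grow i v2 \<in> insert None (Some ` Cs)" "cell_at cs2 (Suc (length cs)) = None"
    using s2[OF order_refl] wf_op_grow[OF w, of v2] cell_at_simps(2)[of cs2] by auto
  have "(bstep inp f B)\<^sup>*\<^sup>* (conc (At (Do i # k) v) 0 cs x) (conc (At k v') 0 cs' x')"
    if B: "Suc (length cs') \<le> B" for B
  proof -
    have "bstep inp f B (conc (At (Do i # k) v) 0 cs x) (conc (Fw i k v1) (shift Rgt 0) cs ?x1)"
      by (rule bstep_conc[where w = None]) (use inv k v1 f1 io in auto)
    then have "(bstep inp f B)\<^sup>*\<^sup>* (conc (At (Do i # k) v) 0 cs x) (conc (Fw i k v1) 1 cs ?x1)" by simp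
    also have "(bstep inp f B)\<^sup>*\<^sup>* \<dots> (conc (Fw i k v2) (Suc (length cs)) cs2 x')"
      using s2[of B] B len by simp
    \<comment> \<open>If nothing is appended, the head steps back from the blank. An appended cell
      is written under the head, which stays there, so the backward sweep covers the new cell
      too.\<close>
    also have "(bstep inp f B) \<dots> (conc (Bw i k v2)
        (shift (if grow i v2 = None then Lft else Stay) (Suc (length cs))) cs3 (perform f Silent x'))"
      by (rule bstep_silent[where w = "grow i v2"])
         (use s2[OF order_refl] io k(1) x' B len gr in
           \<open>auto simp: cs3_def cell_at_grow split: option.splits\<close>)
    also have "shift (if grow i v2 = None then Lft else Stay) (Suc (length cs)) = length cs3"
      using s2[OF order_refl] by (auto simp: cs3_def split: option.splits)
    also have "(bstep inp f B)\<^sup>*\<^sup>* (conc (Bw i k v2) (length cs3) cs3 (perform f Silent x'))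
        (conc (Bw i k v') 0 cs' x')"
      using s4[of B] B len by simp
    also have "bstep inp f B (conc (Bw i k v') 0 cs' x') (conc (At k v') (shift Stay 0) cs' (perform f Silent x'))"
      by (rule bstep_silent[where w = None])
         (use s4[OF order_refl] io k(1) x' in auto)
    finally show ?thesis by simp
  qed
  then show ?thesis using s4[OF order_refl] x' len by auto
qed

text \<open>Cells are only ever appended, so the final number of cells bounds the space of the
  entire run, and the induction needs no bound that varies along it.\<close>

lemma exec_correct:
  assumes "exec inp f p w w'"
  shows "conts p k \<subseteq> conts p0 [] \<Longrightarrow> ops p \<subseteq> ops p0 \<Longrightarrow> w = (v, cs, x) \<Longrightarrow> w' = (v', cs', x') \<Longrightarrow>
    inv_world inp w \<Longrightarrow>
    inv_world inp w' \<and> length cs \<le> length cs' \<and>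
    (\<forall>B. Suc (length cs') \<le> B \<longrightarrow> (bstep inp f B)\<^sup>*\<^sup>* (conc (At (p # k) v) 0 cs x) (conc (At k v') 0 cs' x'))"
  using assms
proof (induction p w w' arbitrary: k v cs x v' cs' x' rule: exec.induct)
  case (Skip w)
  have "bstep inp f B (conc (At (Skip # k) v) 0 cs x) (conc (At k v) (shift Stay 0) cs (perform f Silent x))" for B
    by (rule bstep_silent[where w = None]) (use Skip in \<open>auto simp: inv_world_def\<close>)
  with Skip show ?case by auto
next
  case (Do i w)
  then show ?case using do_op_correct[of i k v cs inp x f v' cs' x'] wf
    by (auto simp: inv_world_def)
next
  case (Seq p w w1 q w2)
  obtain v1 cs1 x1 where w1: "w1 = (v1, cs1, x1)" by (cases w1)
  have 1: "inv_world inp w1 \<and> length cs \<le> length cs1 \<and>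
    (\<forall>B. Suc (length cs1) \<le> B \<longrightarrow> (bstep inp f B)\<^sup>*\<^sup>* (conc (At (p # q # k) v) 0 cs x) (conc (At (q # k) v1) 0 cs1 x1))"
    by (rule Seq.IH(1)) (use Seq.prems w1 in auto)
  have 2: "inv_world inp w2 \<and> length cs1 \<le> length cs' \<and>
    (\<forall>B. Suc (length cs') \<le> B \<longrightarrow> (bstep inp f B)\<^sup>*\<^sup>* (conc (At (q # k) v1) 0 cs1 x1) (conc (At k v') 0 cs' x'))"
    by (rule Seq.IH(2)) (use Seq.prems w1 1 in auto)
  have step: "bstep inp f B (conc (At (Seq p q # k) v) 0 cs x) (conc (At (p # q # k) v) (shift Stay 0) cs (perform f Silent x))" for B
    by (rule bstep_silent[where w = None])
       (use Seq.prems conts_self[of p "q # k"] in \<open>auto simp: inv_world_def\<close>)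
  then have "(bstep inp f B)\<^sup>*\<^sup>* (conc (At (Seq p q # k) v) 0 cs x) (conc (At k v') 0 cs' x')"
    if "Suc (length cs') \<le> B" for B
  proof -
    have "(bstep inp f B)\<^sup>*\<^sup>* (conc (At (p # q # k) v) 0 cs x) (conc (At (q # k) v1) 0 cs1 x1)"
      using 1 2 that by auto
    also have "(bstep inp f B)\<^sup>*\<^sup>* \<dots> (conc (At k v') 0 cs' x')" using 2 that by auto
    finally show ?thesis using step[of B] by (simp add: converse_rtranclp_into_rtranclp)
  qed
  then show ?case using 1 2 by simp
next
  case (Cond b w p q w1)
  let ?r = "if test inp b w then p else q"
  have 1: "inv_world inp w1 \<and> length cs \<le> length cs' \<and>
    (\<forall>B. Suc (length cs') \<le> B \<longrightarrow> (bstep inp f B)\<^sup>*\<^sup>* (conc (At (?r # k) v) 0 cs x) (conc (At k v') 0 cs' x'))"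
    by (rule Cond.IH) (use Cond.prems in auto)
  have "bstep inp f B (conc (At (Cond b p q # k) v) 0 cs x) (conc (At (?r # k) v) (shift Stay 0) cs (perform f Silent x))" for B
    by (rule bstep_silent[where w = None])
       (use Cond.prems conts_self[of ?r "k"] in \<open>auto simp: inv_world_def split: if_splits\<close>)
  then have step: "bstep inp f B (conc (At (Cond b p q # k) v) 0 cs x) (conc (At (?r # k) v) 0 cs x)" for B
    by simp
  have "(bstep inp f B)\<^sup>*\<^sup>* (conc (At (Cond b p q # k) v) 0 cs x) (conc (At k v') 0 cs' x')"
    if "Suc (length cs') \<le> B" for B
    using 1 that step[of B] by (metis converse_rtranclp_into_rtranclp)
  then show ?case using 1 by blast
next
  case (While_False b w p)
  have "bstep inp f B (conc (At (While b p # k) v) 0 cs x) (conc (At k v) (shift Stay 0) cs (perform f Silent x))" for B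
    by (rule bstep_silent[where w = None]) (use While_False in \<open>auto simp: inv_world_def\<close>)
  with While_False show ?case by auto
next
  case (While_True b w p w1 w2)
  obtain v1 cs1 x1 where w1: "w1 = (v1, cs1, x1)" by (cases w1)
  let ?k = "While b p # k"
  have 1: "inv_world inp w1 \<and> length cs \<le> length cs1 \<and>
    (\<forall>B. Suc (length cs1) \<le> B \<longrightarrow> (bstep inp f B)\<^sup>*\<^sup>* (conc (At (p # ?k) v) 0 cs x) (conc (At ?k v1) 0 cs1 x1))"
    by (rule While_True.IH(1)) (use While_True.prems w1 in auto)
  have 2: "inv_world inp w2 \<and> length cs1 \<le> length cs' \<and>
    (\<forall>B. Suc (length cs') \<le> B \<longrightarrow> (bstep inp f B)\<^sup>*\<^sup>* (conc (At ?k v1) 0 cs1 x1) (conc (At k v') 0 cs' x'))"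
    by (rule While_True.IH(2)) (use While_True.prems w1 1 in auto)
  have step: "bstep inp f B (conc (At ?k v) 0 cs x) (conc (At (p # ?k) v) (shift Stay 0) cs (perform f Silent x))" for B
    by (rule bstep_silent[where w = None])
       (use While_True conts_self[of p "?k"] in \<open>auto simp: inv_world_def\<close>)
  then have "(bstep inp f B)\<^sup>*\<^sup>* (conc (At (While b p # k) v) 0 cs x) (conc (At k v') 0 cs' x')"
    if "Suc (length cs') \<le> B" for B
  proof -
    have "(bstep inp f B)\<^sup>*\<^sup>* (conc (At (p # ?k) v) 0 cs x) (conc (At (?k) v1) 0 cs1 x1)"
      using 1 2 that by auto
    also have "(bstep inp f B)\<^sup>*\<^sup>* \<dots> (conc (At k v') 0 cs' x')" using 2 that by auto
    finally show ?thesis using step[of B] by (simp add: converse_rtranclp_into_rtranclp)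
  qed
  then show ?case using 1 2 by simp
qed

definition io0 :: config where
  "io0 = \<lparr>state = 0, answer = False, input_heads = replicate m 0, work = [], query_tape = [],
     asked = [], out = []\<rparr>"

definition next_conf :: "bool list list \<Rightarrow> (bool list \<Rightarrow> bool) \<Rightarrow> config \<Rightarrow> config" where
  "next_conf inp f c = (case step M inp f c of None \<Rightarrow> c | Some c' \<Rightarrow> c')"

text \<open>From the halting time on \<open>next_conf\<close> iterates at a fixed point, so a bound
  along the run is a bound for all times, as \<open>uses_space\<close> demands.\<close>

lemma bstep_halting:
  assumes "(bstep inp f B)\<^sup>*\<^sup>* c d" "step M inp f d = None" "\<forall>(t, h)\<in>set (work d). h \<le> B"
  shows "(\<exists>t. (next_conf inp f ^^ t) c = d) \<and> (\<forall>t. \<forall>(tp, h)\<in>set (work ((next_conf inp f ^^ t) c)). h \<le> B)"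
  using assms(1)
proof (induction rule: converse_rtranclp_induct)
  case base
  have "(next_conf inp f ^^ t) d = d" for t by (induction t) (simp_all add: next_conf_def assms(2))
  then show ?case using assms(3) by auto
next
  case (step a b)
  have ab: "next_conf inp f a = b" using step(1) by (simp add: bstep_def next_conf_def)
  have it: "(next_conf inp f ^^ Suc t) a = (next_conf inp f ^^ t) b" for t
    by (simp only: funpow_Suc_right comp_apply ab)
  from step(3) obtain t where "(next_conf inp f ^^ t) b = d" by blast
  then have "(next_conf inp f ^^ Suc t) a = d" using it by simp
  moreover have "\<forall>(tp, h)\<in>set (work ((next_conf inp f ^^ t) a)). h \<le> B" for t
  proof (cases t)
    case 0
    then show ?thesis using step(1) by (simp add: bstep_def)
  next
    case (Suc t')
    then show ?thesis using step(3) it by simp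
  qed
  ultimately show ?case by blast
qed

theorem compiled:
  assumes ex: "exec inp f p0 (v0, [], io0) (v', cs', x')" and "length inp = m"
  shows "uses_space M inp f (real (length cs' + 2)) \<and>
    (\<exists>t. halts_at M inp f t \<and> out (config_at M inp f t) = out x' \<and> asked (config_at M inp f t) = asked x')"
proof -
  let ?B = "Suc (length cs')"
  have init: "initial_config (length inp) M = conc (At [p0] v0) 0 [] io0"
    using assms(2) by (simp add: initial_config_def conc_def io0_def M_def e_def sym_def cell_at_def fun_eq_iff not_gr_zero[symmetric] del: not_gr_zero)
  have "inv_world inp (v0, [], io0)" using v0 assms(2) by (simp add: inv_world_def heads_ok_def io0_def)
  then have c: "inv_world inp (v', cs', x')"
    "(bstep inp f ?B)\<^sup>*\<^sup>* (conc (At [p0] v0) 0 [] io0) (conc (At [] v') 0 cs' x')"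
    using exec_correct[OF ex, of "[]"] by auto
  have Qf: "At [] v' \<in> Q" using c(1) conts_rest[of "[]" p0] by (auto simp: Q_def inv_world_def)
  have "cell_at cs' 0 \<in> insert None (Some ` Cs)" by (simp add: cell_at_def)
  from delta_M[OF Qf this] have halt: "step M inp f (conc (At [] v') 0 cs' x') = None"
    by (simp add: step_def conc_def)
  have at: "config_at M inp f t = (next_conf inp f ^^ t) (conc (At [p0] v0) 0 [] io0)" for t
    unfolding config_at_def init next_conf_def[abs_def] ..
  note r = bstep_halting[OF c(2) halt, folded at]
  have sp: "\<forall>t. \<forall>(tp, h)\<in>set (work (config_at M inp f t)). h \<le> ?B"
    and "\<exists>t. config_at M inp f t = conc (At [] v') 0 cs' x'"
    using r by (auto simp: conc_def)
  then obtain t where t: "config_at M inp f t = conc (At [] v') 0 cs' x'" by blast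
  \<comment> \<open>Heads reach at most \<open>Suc (length cs')\<close>, and a head in position
    \<open>h\<close> counts as \<open>Suc h\<close> cells; together this is the 2.\<close>
  have "uses_space M inp f (real (length cs' + 2))"
    unfolding uses_space_def using sp by fastforce
  moreover have "halts_at M inp f t \<and> out (config_at M inp f t) = out x' \<and> asked (config_at M inp f t) = asked x'"
    using t halt by (simp add: halts_at_def) (simp add: conc_def)
  ultimately show ?thesis by blast
qed

end

section \<open>Simulating several copies of a machine\<close>

text \<open>Bit \<open>k\<close> of the cells is a digit of binary counter \<open>k\<close>; \<open>tp c u i\<close> is the symbol on tape \<open>i\<close> of
  the simulated copy \<open>u\<close>, together with a flag for its head. Copies 0, 1, 2 run the sampler on the
  hybrid, copies 3, 4, 5 run it on the zero function. Counters 0 and 3 hold \<open>n\<close> and \<open>r\<close>,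
  counter 4 enumerates the padding points and counter 5 counts accepted ones downwards.\<close>

record cell =
  kind :: nat
  bits :: "nat \<Rightarrow> bool"
  tp :: "nat \<Rightarrow> nat \<Rightarrow> nat \<times> bool"

record vars =
  pos :: nat
  ns :: input_symbol
  flag :: bool
  short :: bool
  long :: bool
  cmp :: "bool option"
  brute :: bool
  ok :: bool
  okall :: bool
  ev :: nat
  eff :: effect
  st :: "nat \<Rightarrow> nat"
  an :: "nat \<Rightarrow> bool"
  scan :: "nat \<Rightarrow> nat"
  pend :: "nat \<Rightarrow> bool"

text \<open>With input symbols coded as numbers, the four input tapes of a simulated copy are stored
  and moved on like its work tapes.\<close>

fun ic :: "input_symbol \<Rightarrow> nat" where
  "ic LeftEnd = 0" | "ic (Bit False) = 1" | "ic (Bit True) = 2" | "ic RightEnd = 3"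

definition di :: "nat \<Rightarrow> input_symbol" where
  "di k = (if k = 0 then LeftEnd else if k = 1 then Bit False else if k = 2 then Bit True else RightEnd)"

lemma di_ic [simp]: "di (ic y) = y" by (cases y rule: ic.cases) (auto simp: di_def)
lemma ic_less: "ic y < 4" by (cases y rule: ic.cases) auto
lemma ic_eq_3 [simp]: "ic y = 3 \<longleftrightarrow> y = RightEnd" by (cases y rule: ic.cases) auto

definition stays :: "move list" where "stays = [Stay, Stay, Stay, Stay]"

definition act_op :: "(vars \<Rightarrow> bool \<Rightarrow> input_symbol list \<Rightarrow> vars \<times> move list \<times> effect) \<Rightarrow> (vars, cell) op" where
  "act_op g = Op g (\<lambda>v c. (v, c, Silent)) (\<lambda>_. None) (\<lambda>v c. (v, c))"

definition set_op :: "(vars \<Rightarrow> bool \<Rightarrow> input_symbol list \<Rightarrow> vars) \<Rightarrow> (vars, cell) op" where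
  "set_op g = act_op (\<lambda>v b xs. (g v b xs, stays, Silent))"

definition move_op :: "move list \<Rightarrow> (vars, cell) op" where
  "move_op ms = act_op (\<lambda>v b xs. (v, ms, Silent))"

definition effect_op :: "(vars \<Rightarrow> effect) \<Rightarrow> (vars, cell) op" where
  "effect_op g = act_op (\<lambda>v b xs. (v, stays, g v))"

definition active :: "nat \<Rightarrow> cell \<Rightarrow> bool" where
  "active k c \<longleftrightarrow> (if k = 4 then kind c \<ge> 2 else kind c \<noteq> 0)"

text \<open>Decrement of a binary counter: the forward pass propagates the borrow, the backward pass
  restores zero in case of underflow. The flag tells whether the counter was zero.\<close>

definition dec_op :: "nat \<Rightarrow> (vars, cell) op" where
  "dec_op k = Op (\<lambda>v b xs. (v\<lparr>flag := True\<rparr>, stays, Silent))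
     (\<lambda>v c. if active k c
       then (v\<lparr>flag := flag v \<and> \<not> bits c k\<rparr>, c\<lparr>bits := (bits c)(k := (bits c k \<noteq> flag v))\<rparr>, Silent)
       else (v, c, Silent))
     (\<lambda>_. None)
     (\<lambda>v c. if flag v \<and> active k c then (v, c\<lparr>bits := (bits c)(k := False)\<rparr>) else (v, c))"

definition copy_bits_op :: "nat \<Rightarrow> nat \<Rightarrow> (vars, cell) op" where
  "copy_bits_op k l = Op (\<lambda>v b xs. (v, stays, Silent))
     (\<lambda>v c. (v, c\<lparr>bits := (bits c)(l := bits c k)\<rparr>, Silent)) (\<lambda>_. None) (\<lambda>v c. (v, c))"

definition copy_unit_op :: "nat \<Rightarrow> nat \<Rightarrow> (vars, cell) op" where
  "copy_unit_op u w = Op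
     (\<lambda>v b xs. (v\<lparr>st := (st v)(w := st v u), an := (an v)(w := an v u)\<rparr>, stays, Silent))
     (\<lambda>v c. (v, c\<lparr>tp := (tp c)(w := tp c u)\<rparr>, Silent)) (\<lambda>_. None) (\<lambda>v c. (v, c))"

definition sweep_effect_op :: "(cell \<Rightarrow> effect) \<Rightarrow> (vars, cell) op" where
  "sweep_effect_op g = Op (\<lambda>v b xs. (v, stays, Silent)) (\<lambda>v c. (v, c, g c)) (\<lambda>_. None) (\<lambda>v c. (v, c))"

locale simulation =
  fixes M :: machine
  assumes valid: "valid_machine 4 M"
begin

definition R :: nat where "R = 4 + n_tapes M"

definition dl :: "vars \<Rightarrow> nat \<Rightarrow> (nat \<times> move list \<times> (nat \<times> move) list \<times> effect) option" where
  "dl v u = delta M (st v u) (an v u) (map (\<lambda>i. di (scan v i)) [0..<4]) (map (scan v) [4..<R])"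

text \<open>The code 3 is the right end marker, which a head must not pass, just as in
  \<open>move_input\<close>. The left boundary is taken care of by the cell of kind 0.\<close>

definition mv :: "vars \<Rightarrow> nat \<Rightarrow> nat \<Rightarrow> move" where
  "mv v u i = (case dl v u of None \<Rightarrow> Stay
     | Some (q, ms, ws, e) \<Rightarrow>
         if i < 4 then (if ms ! i = Rgt \<and> scan v i = 3 then Stay else ms ! i) else snd (ws ! (i - 4)))"

definition wr :: "vars \<Rightarrow> nat \<Rightarrow> nat \<Rightarrow> nat" where
  "wr v u i = (case dl v u of None \<Rightarrow> scan v i
     | Some (q, ms, ws, e) \<Rightarrow> if i < 4 then scan v i else fst (ws ! (i - 4)))"

text \<open>The transition depends on the symbols under all heads and is known only after the
  forward pass. Writing and left moves are therefore done in the backward pass, which travels in the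
  direction of these moves: \<open>pend\<close> hands a head over to the next cell visited. Right
  moves need a forward pass of their own.\<close>

definition gather_op :: "nat \<Rightarrow> (vars, cell) op" where
  "gather_op u = Op
     (\<lambda>v b xs. (v\<lparr>scan := (\<lambda>_. 0), pend := (\<lambda>_. False)\<rparr>, stays, Silent))
     (\<lambda>v c. (v\<lparr>scan := (\<lambda>i. if i < R \<and> snd (tp c u i) then fst (tp c u i) else scan v i)\<rparr>, c, Silent))
     (\<lambda>_. None)
     (\<lambda>v c. (v\<lparr>pend := (\<lambda>i. i < R \<and> snd (tp c u i) \<and> mv v u i = Lft \<and> kind c \<noteq> 0)\<rparr>,
        c\<lparr>tp := (tp c)(u := (\<lambda>i. if i < R
           then (if snd (tp c u i) then wr v u i else fst (tp c u i),
                 snd (tp c u i) \<and> (mv v u i \<noteq> Lft \<or> kind c = 0) \<or> pend v i)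
           else (0, False)))\<rparr>))"

text \<open>State, answer and \<open>scan\<close> are still those from before the simulated step, so
  \<open>mv\<close> yields the same directions as in \<open>gather_op\<close>.\<close>

definition right_op :: "nat \<Rightarrow> (vars, cell) op" where
  "right_op u = Op
     (\<lambda>v b xs. (v\<lparr>pend := (\<lambda>_. False)\<rparr>, stays, Silent))
     (\<lambda>v c. (v\<lparr>pend := (\<lambda>i. i < R \<and> snd (tp c u i) \<and> mv v u i = Rgt)\<rparr>,
        c\<lparr>tp := (tp c)(u := (\<lambda>i. if i < R
           then (fst (tp c u i), if mv v u i = Rgt then pend v i else snd (tp c u i))
           else (0, False)))\<rparr>, Silent))
     (\<lambda>_. None)
     (\<lambda>v c. (v, c))"

text \<open>\<open>ev\<close> is 0 while a copy runs, 1 after a query and 2 after halting. A query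
  sets the simulated answer to False. For the zero function this is correct; for a copy that runs on
  the hybrid, \<open>main_step\<close> puts in the true value.\<close>

definition finish_op :: "nat \<Rightarrow> (vars, cell) op" where
  "finish_op u = set_op (\<lambda>v b xs. case dl v u of
       None \<Rightarrow> v\<lparr>ev := 2, eff := Silent\<rparr>
     | Some (q, ms, ws, e) \<Rightarrow>
         v\<lparr>st := (st v)(u := q), an := (an v)(u := an v u \<and> e \<noteq> Ask), eff := e,
           ev := if e = Ask then 1 else ev v\<rparr>)"

definition symset :: "nat \<Rightarrow> nat set" where
  "symset i = (if i < 4 then {..<4} else {..<n_symbols M})"

text \<open>Fixed default values outside the relevant indices make the set finite although the
  fields are functions on all of \<open>nat\<close>; \<open>V\<close> below is built in the same
  way.\<close>

definition Cs :: "cell set" where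
  "Cs = {c. kind c < 4 \<and> (\<forall>k\<ge>6. \<not> bits c k) \<and>
     (\<forall>u i. if u < 6 \<and> i < R then fst (tp c u i) \<in> symset i else tp c u i = (0, False))}"

lemma CsD:
  assumes "c \<in> Cs"
  shows "u < 6 \<Longrightarrow> i < R \<Longrightarrow> fst (tp c u i) \<in> symset i" "\<not> (u < 6 \<and> i < R) \<Longrightarrow> tp c u i = (0, False)"
proof -
  have *: "if u < 6 \<and> i < R then fst (tp c u i) \<in> symset i else tp c u i = (0, False)"
    using assms unfolding Cs_def by blast
  show "u < 6 \<Longrightarrow> i < R \<Longrightarrow> fst (tp c u i) \<in> symset i" using * by simp
  show "\<not> (u < 6 \<and> i < R) \<Longrightarrow> tp c u i = (0, False)" using * by argo
qed

definition V :: "vars set" where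
  "V = {v. pos v < 4 \<and> ev v < 3 \<and> (\<forall>u. if u < 6 then st v u < n_states M else st v u = 0) \<and>
     (\<forall>u\<ge>6. \<not> an v u) \<and> (\<forall>i. if i < R then scan v i \<in> symset i else scan v i = 0) \<and>
     (\<forall>i\<ge>R. \<not> pend v i)}"

lemma finite_functions:
  assumes "finite A"
  shows "finite {f :: nat \<Rightarrow> 'a. \<forall>i. (i < N \<longrightarrow> f i \<in> A) \<and> (\<not> i < N \<longrightarrow> f i = d)}"
proof -
  have "{f. \<forall>i. (i < N \<longrightarrow> f i \<in> A) \<and> (\<not> i < N \<longrightarrow> f i = d)} =
      {f. \<forall>i. (i \<in> {..<N} \<longrightarrow> f i \<in> A) \<and> (i \<notin> {..<N} \<longrightarrow> f i = d)}" by simp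
  then show ?thesis using finite_set_of_finite_funs[of "{..<N}" A d] assms by simp
qed

lemma finite_symset: "\<exists>K. \<forall>i. symset i \<subseteq> {..<K}"
  by (intro exI[of _ "max 4 (n_symbols M)"]) (auto simp: symset_def)

lemma finite_Cs: "finite Cs"
proof -
  obtain K where K: "\<And>i. symset i \<subseteq> {..<K}" using finite_symset by blast
  let ?B = "{f :: nat \<Rightarrow> bool. \<forall>i. (i < 6 \<longrightarrow> f i \<in> UNIV) \<and> (\<not> i < 6 \<longrightarrow> f i = False)}"
  let ?T1 = "{f. \<forall>i. (i < R \<longrightarrow> f i \<in> {..<K} \<times> (UNIV :: bool set)) \<and> (\<not> i < R \<longrightarrow> f i = (0, False))}"
  let ?T = "{f. \<forall>u. (u < 6 \<longrightarrow> f u \<in> ?T1) \<and> (\<not> u < (6::nat) \<longrightarrow> f u = (\<lambda>_. (0, False)))}"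
  have "finite ?B" "finite ?T1" by (rule finite_functions; simp)+
  moreover from this(2) have "finite ?T" by (rule finite_functions)
  ultimately have "finite ((\<lambda>(k, b, t). \<lparr>kind = k, bits = b, tp = t\<rparr>) ` ({..<4} \<times> ?B \<times> ?T))" by blast
  moreover have "Cs \<subseteq> (\<lambda>(k, b, t). \<lparr>kind = k, bits = b, tp = t\<rparr>) ` ({..<4} \<times> ?B \<times> ?T)"
  proof
    fix c assume c: "c \<in> Cs"
    have "bits c \<in> ?B" "kind c \<in> {..<4}" using c by (auto simp: Cs_def)
    moreover have "tp c \<in> ?T"
    proof (intro CollectI allI conjI impI)
      fix u i assume "u < (6::nat)" "i < R"
      then have "fst (tp c u i) \<in> symset i" using CsD[OF c] by blast
      then show "tp c u i \<in> {..<K} \<times> UNIV" using K[of i] by (cases "tp c u i") auto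
    next
      fix u i assume "\<not> i < R" then show "tp c u i = (0, False)"
        using CsD[OF c] by blast
    next
      fix u assume "\<not> u < (6::nat)" then show "tp c u = (\<lambda>_. (0, False))"
        using CsD[OF c] by (intro ext) blast
    qed
    ultimately show "c \<in> (\<lambda>(k, b, t). \<lparr>kind = k, bits = b, tp = t\<rparr>) ` ({..<4} \<times> ?B \<times> ?T)"
      by (intro image_eqI[where x = "(kind c, bits c, tp c)"]) auto
  qed
  ultimately show ?thesis by (rule rev_finite_subset)
qed

lemma finite_effects: "finite (UNIV :: effect set)" and finite_inputs: "finite (UNIV :: input_symbol set)"
proof -
  have "(UNIV :: output_symbol set) \<subseteq> {Minus, Slash} \<union> range Digit"
    by (metis UNIV_I UnI1 UnI2 insertI1 insertI2 output_symbol.exhaust rangeI subsetI)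
  then have "finite (UNIV :: output_symbol set)" by (rule finite_subset) simp
  moreover have "(UNIV :: effect set) \<subseteq> {Silent, Ask} \<union> range Write_Query \<union> range Emit"
    by (metis UNIV_I UnI1 UnI2 effect.exhaust insertI1 insertI2 rangeI subsetI)
  ultimately show "finite (UNIV :: effect set)" by (auto intro: finite_subset)
  have "(UNIV :: input_symbol set) \<subseteq> {LeftEnd, RightEnd} \<union> range Bit"
    by (metis UNIV_I UnI1 UnI2 input_symbol.exhaust insertI1 insertI2 rangeI subsetI)
  then show "finite (UNIV :: input_symbol set)" by (rule finite_subset) simp
qed

lemma finite_V: "finite V"
proof -
  obtain K where K: "\<And>i. symset i \<subseteq> {..<K}" using finite_symset by blast
  let ?S = "{f. \<forall>u. (u < 6 \<longrightarrow> f u \<in> {..<n_states M}) \<and> (\<not> u < (6::nat) \<longrightarrow> f u = 0)}"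
  let ?A = "{f. \<forall>u. (u < 6 \<longrightarrow> f u \<in> UNIV) \<and> (\<not> u < (6::nat) \<longrightarrow> f u = False)}"
  let ?C = "{f. \<forall>i. (i < R \<longrightarrow> f i \<in> {..<K}) \<and> (\<not> i < R \<longrightarrow> f i = 0)}"
  let ?P = "{f. \<forall>i. (i < R \<longrightarrow> f i \<in> UNIV) \<and> (\<not> i < R \<longrightarrow> f i = False)}"
  have "finite ?S" "finite ?A" "finite ?C" "finite ?P" by (rule finite_functions; simp)+
  let ?F = "\<lambda>(a, b, c, d, e, f, g, h, i, j, k, s, t, x, y).
    \<lparr>pos = a, ns = b, flag = c, short = d, long = e, cmp = f, brute = g, ok = h, okall = i, ev = j,
     eff = k, st = s, an = t, scan = x, pend = y\<rparr>"
  let ?X = "{..<4 :: nat} \<times> (UNIV :: input_symbol set) \<times> (UNIV :: bool set) \<times> (UNIV :: bool set) \<times> (UNIV :: bool set) \<times>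
    (UNIV :: bool option set) \<times> (UNIV :: bool set) \<times> (UNIV :: bool set) \<times> (UNIV :: bool set) \<times> {..<3 :: nat} \<times>
    (UNIV :: effect set) \<times> ?S \<times> ?A \<times> ?C \<times> ?P"
  have "finite ?X"
    by (intro finite_cartesian_product \<open>finite ?S\<close> \<open>finite ?A\<close> \<open>finite ?C\<close> \<open>finite ?P\<close>
      finite_effects finite_inputs) auto
  then have "finite (?F ` ?X)" by blast
  moreover have "V \<subseteq> ?F ` ?X"
  proof
    fix v assume v: "v \<in> V"
    have "st v \<in> ?S" "an v \<in> ?A" "pend v \<in> ?P" using v by (auto simp: V_def split: if_splits)
    moreover have "scan v \<in> ?C" using v K by (auto simp: V_def split: if_splits)
    moreover have "pos v \<in> {..<4}" "ev v \<in> {..<3}" using v by (auto simp: V_def)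
    ultimately show "v \<in> ?F ` ?X"
      by (intro image_eqI[where x = "(pos v, ns v, flag v, short v, long v, cmp v, brute v, ok v, okall v,
        ev v, eff v, st v, an v, scan v, pend v)"]) (auto simp del: lessThan_iff)
  qed
  ultimately show ?thesis by (rule rev_finite_subset)
qed

lemma wf_act_op:
  "(\<And>v b xs. v \<in> V \<Longrightarrow> length xs = 4 \<Longrightarrow> fst (g v b xs) \<in> V \<and> length (fst (snd (g v b xs))) = 4) \<Longrightarrow>
   wf_op 4 V Cs (act_op g)"
  by (simp add: wf_op_def act_op_def)

lemma wf_set_op: "(\<And>v b xs. v \<in> V \<Longrightarrow> length xs = 4 \<Longrightarrow> g v b xs \<in> V) \<Longrightarrow> wf_op 4 V Cs (set_op g)"
  unfolding set_op_def by (rule wf_act_op) (simp add: stays_def)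

lemma wf_move_op: "length ms = 4 \<Longrightarrow> wf_op 4 V Cs (move_op ms)"
  unfolding move_op_def by (rule wf_act_op) simp

lemma wf_effect_op: "wf_op 4 V Cs (effect_op g)"
  unfolding effect_op_def by (rule wf_act_op) (simp add: stays_def)

lemma wf_dec_op: "k < 6 \<Longrightarrow> wf_op 4 V Cs (dec_op k)"
  by (auto simp: wf_op_def dec_op_def V_def Cs_def stays_def)

lemma wf_copy_bits_op: "k < 6 \<Longrightarrow> l < 6 \<Longrightarrow> wf_op 4 V Cs (copy_bits_op k l)"
  by (auto simp: wf_op_def copy_bits_op_def V_def Cs_def stays_def)

lemma wf_copy_unit_op: "u < 6 \<Longrightarrow> w < 6 \<Longrightarrow> wf_op 4 V Cs (copy_unit_op u w)"
  by (auto simp: wf_op_def copy_unit_op_def V_def Cs_def stays_def)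

lemma wf_sweep_effect_op: "wf_op 4 V Cs (sweep_effect_op g)"
  by (auto simp: wf_op_def sweep_effect_op_def stays_def)

lemma dl_range:
  assumes "v \<in> V" "u < 6" "dl v u = Some (q, ms, ws, e)"
  shows "q < n_states M \<and> length ms = 4 \<and> length ws = n_tapes M \<and> fst ` set ws \<subseteq> {..<n_symbols M}"
proof -
  have "st v u < n_states M" using assms(1,2) by (auto simp: V_def dest: spec[of _ u])
  moreover have "set (map (scan v) [4..<R]) \<subseteq> {..<n_symbols M}"
  proof -
    have "scan v i < n_symbols M" if "4 \<le> i" "i < R" for i
      using assms(1) that by (auto simp: V_def symset_def dest!: spec[of _ i])
    then show ?thesis by auto
  qed
  moreover have "length (map (scan v) [4..<R]) = n_tapes M" by (simp add: R_def)
  moreover have "length (map (\<lambda>i. di (scan v i)) [0..<4]) = 4" by simp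
  ultimately show ?thesis using valid assms(3) unfolding valid_machine_def dl_def by blast
qed

lemma wr_range:
  assumes "v \<in> V" "u < 6" "i < R" shows "wr v u i \<in> symset i"
proof -
  have s: "scan v i \<in> symset i" using assms by (auto simp: V_def dest!: spec[of _ i])
  show ?thesis
  proof (cases "dl v u")
    case (Some y)
    obtain q ms ws e where y: "y = (q, ms, ws, e)" by (cases y)
    note r = dl_range[OF assms(1,2) Some[unfolded y]]
    have "fst (ws ! (i - 4)) < n_symbols M" if "\<not> i < 4"
    proof -
      have "i - 4 < length ws" using that assms(3) r by (simp add: R_def)
      then show ?thesis using r by (metis image_subset_iff lessThan_iff nth_mem)
    qed
    then show ?thesis using Some y s by (auto simp: wr_def symset_def)
  qed (use s in \<open>simp add: wr_def\<close>)
qed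

lemma wf_gather_op: "u < 6 \<Longrightarrow> wf_op 4 V Cs (gather_op u)"
proof -
  assume u: "u < 6"
  have "n_symbols M > 0" using valid by (simp add: valid_machine_def)
  then have 1: "v\<lparr>scan := (\<lambda>_. 0), pend := (\<lambda>_. False)\<rparr> \<in> V" if "v \<in> V" for v
    using that by (auto simp: V_def symset_def)
  have 2: "v\<lparr>scan := (\<lambda>i. if i < R \<and> snd (tp c u i) then fst (tp c u i) else scan v i)\<rparr> \<in> V"
    if "v \<in> V" "c \<in> Cs" for v c
    using that(1) u CsD(1)[OF that(2) u] by (auto simp: V_def)
  have 3: "c\<lparr>tp := (tp c)(u := (\<lambda>i. if i < R
           then (if snd (tp c u i) then wr v u i else fst (tp c u i), B i) else (0, False)))\<rparr> \<in> Cs"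
    if "v \<in> V" "c \<in> Cs" for v c B
    using that u wr_range[OF that(1) u] by (auto simp: Cs_def)
  have 4: "v\<lparr>pend := (\<lambda>i. i < R \<and> B i)\<rparr> \<in> V" if "v \<in> V" for v B
    using that by (auto simp: V_def)
  show ?thesis unfolding wf_op_def gather_op_def using 1 2 3 4 by (simp add: stays_def)
qed

lemma wf_right_op: "u < 6 \<Longrightarrow> wf_op 4 V Cs (right_op u)"
proof -
  assume u: "u < 6"
  have 3: "c\<lparr>tp := (tp c)(u := (\<lambda>i. if i < R then (fst (tp c u i), B i) else (0, False)))\<rparr> \<in> Cs"
    if "c \<in> Cs" for c B
    using that u by (auto simp: Cs_def)
  show ?thesis unfolding wf_op_def right_op_def using 3 by (auto simp: stays_def V_def)
qed

lemma wf_finish_op: "u < 6 \<Longrightarrow> wf_op 4 V Cs (finish_op u)"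
  unfolding finish_op_def
  by (rule wf_set_op) (use dl_range in \<open>force simp: V_def split: option.splits prod.splits\<close>)

end

text \<open>\<open>S j\<close> is the control value in front of cell \<open>j\<close>. Once it is
  known in closed form, a sweep is verified by looking at a single cell.\<close>

lemma fpass_local:
  assumes "\<And>j. a \<le> j \<Longrightarrow> j < b \<Longrightarrow> g (S j) (C j) = (S (Suc j), C' j, es j)" "a \<le> b"
  shows "fpass g (S a) (map C [a..<b]) = (S b, map C' [a..<b], map es [a..<b])"
  using assms(2,1)
proof (induction "b - a" arbitrary: a)
  case (Suc n)
  then have "a < b" by simp
  moreover have "fpass g (S (Suc a)) (map C [Suc a..<b]) = (S b, map C' [Suc a..<b], map es [Suc a..<b])"
    using Suc by (intro Suc.hyps(1)) auto
  ultimately show ?case using Suc.prems(2)[of a] by (simp add: upt_conv_Cons)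
qed auto

lemma bpass_local:
  assumes "\<And>j. a \<le> j \<Longrightarrow> j < b \<Longrightarrow> g (S (Suc j)) (C j) = (S j, C' j)" "a \<le> b"
  shows "bpass g (S b) (map C [a..<b]) = (S a, map C' [a..<b])"
  using assms(2,1)
proof (induction "b - a" arbitrary: a)
  case (Suc n)
  then have "a < b" by simp
  moreover have "bpass g (S b) (map C [Suc a..<b]) = (S (Suc a), map C' [Suc a..<b])"
    using Suc by (intro Suc.hyps(1)) auto
  ultimately show ?case using Suc.prems(2)[of a] by (simp add: upt_conv_Cons)
qed auto

lemma fpass_id [simp]: "fpass (\<lambda>v c. (v, c, g c)) v cs = (v, cs, map g cs)"
  by (induction cs) auto

lemma bpass_id [simp]: "bpass (\<lambda>v c. (v, c)) v cs = (v, cs)"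
  by (induction cs) auto

lemma fold_Silent [simp]: "fold (perform f) (map (\<lambda>_. Silent) xs) x = x"
  by (induction xs) auto

definition hok :: "bool list list \<Rightarrow> config \<Rightarrow> bool" where
  "hok inp x \<longleftrightarrow> length inp = 4 \<and> length (input_heads x) = 4 \<and>
     (\<forall>i<4. input_heads x ! i \<le> Suc (length (inp ! i)))"

lemma move_heads_stays [simp]:
  assumes "hok inp x" shows "move_heads inp stays x = x"
proof -
  have "stays = replicate 4 Stay" by (simp add: stays_def numeral_eq_Suc)
  moreover have "map2 (\<lambda>x (d, h). move_input x d h) inp (zip (replicate 4 Stay) (input_heads x)) = input_heads x"
    using assms by (intro nth_equalityI) (auto simp: hok_def move_input_def)
  ultimately show ?thesis by (simp add: move_heads_def)
qed

lemma hok_perform [simp]: "hok inp (perform f e x) = hok inp x"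
  by (cases e) (auto simp: hok_def)

declare do_op.simps [simp del]

lemma do_act_op:
  "do_op inp f (act_op g) (v, cs, x) = (case g v (answer x) (scanned inp x) of (v1, ms, e) \<Rightarrow>
     (v1, cs, perform f e (move_heads inp ms x)))"
  by (simp add: act_op_def do_op.simps split: prod.split)

lemma do_set_op [simp]:
  "hok inp x \<Longrightarrow> do_op inp f (set_op g) (v, cs, x) = (g v (answer x) (scanned inp x), cs, x)"
  by (simp add: set_op_def do_act_op)

lemma do_effect_op [simp]:
  "hok inp x \<Longrightarrow> do_op inp f (effect_op g) (v, cs, x) = (v, cs, perform f (g v) x)"
  by (simp add: effect_op_def do_act_op)

lemma do_move_op [simp]: "do_op inp f (move_op ms) (v, cs, x) = (v, cs, move_heads inp ms x)"
  by (simp add: move_op_def do_act_op)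

lemma do_sweep_effect_op [simp]:
  "hok inp x \<Longrightarrow> do_op inp f (sweep_effect_op g) (v, cs, x) = (v, cs, fold (perform f) (map g cs) x)"
  by (simp add: sweep_effect_op_def do_op.simps)

text \<open>Subtracting 1 flips exactly those bits below which there are only zeros. This is the
  borrow that \<open>dec_op\<close> propagates.\<close>

lemma bit_pred:
  fixes N :: nat
  assumes "N > 0"
  shows "bit (N - 1) i \<longleftrightarrow> bit N i \<noteq> (N mod 2 ^ i = 0)"
proof -
  define q r where "q = N div 2 ^ i" and "r = N mod 2 ^ i"
  have N: "N = q * 2 ^ i + r" and r: "r < 2 ^ i"
    using div_mult_mod_eq[of N "2 ^ i"] by (simp_all add: q_def r_def)
  show ?thesis
  proof (cases "r = 0")
    case True
    then have q: "q > 0" using N assms by (cases q) auto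
    have "N - 1 = (2 ^ i - 1) + (q - 1) * 2 ^ i" using N True q by (cases q) auto
    then have "(N - 1) div 2 ^ i = q - 1 + (2 ^ i - 1) div 2 ^ i"
      using div_mult_self1[of "2 ^ i" "2 ^ i - 1" "q - 1"] by (simp add: mult.commute)
    then have "(N - 1) div 2 ^ i = q - 1" by simp
    then show ?thesis using True q by (simp add: bit_iff_odd flip: q_def r_def)
  next
    case False
    then have "N - 1 = (r - 1) + q * 2 ^ i" using N by simp
    then have "(N - 1) div 2 ^ i = q + (r - 1) div 2 ^ i"
      using div_mult_self1[of "2 ^ i" "r - 1" q] by (simp add: mult.commute)
    then have "(N - 1) div 2 ^ i = q" using r by simp
    then show ?thesis using False by (simp add: bit_iff_odd flip: q_def r_def)
  qed
qed

lemma mod_power_Suc_eq_0: "(N::nat) mod 2 ^ Suc i = 0 \<longleftrightarrow> N mod 2 ^ i = 0 \<and> \<not> bit N i"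
proof -
  define q r where "q = N div 2 ^ i" and "r = N mod 2 ^ i"
  have N: "N = 2 ^ i * q + r" and r: "r < 2 ^ i" by (simp_all add: q_def r_def)
  have "N mod 2 ^ Suc i = 2 ^ i * (q mod 2) + r"
    using mod_mult2_eq[of N "2 ^ i" 2] by (simp add: q_def r_def mult.commute)
  then show ?thesis by (auto simp: bit_iff_odd odd_iff_mod_2_eq_one even_iff_mod_2_eq_zero simp flip: q_def r_def)
qed

text \<open>Four zones: cell 0 with the left end markers, the cells below \<open>z0\<close> that
  have room for \<open>n\<close>, those below \<open>z1\<close> for the padding counter, and the
  rest of the simulated tapes.\<close>

definition kindf :: "nat \<Rightarrow> nat \<Rightarrow> nat \<Rightarrow> nat" where
  "kindf z0 z1 j = (if j = 0 then 0 else if j < z0 then 1 else if j < z1 then 2 else 3)"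

text \<open>The cell of the lowest digit. Counter 4 begins at \<open>z0\<close>, so that the cells
  of kind 2 hold its digits in the order in which they go to the query tape; cell 0 carries no
  digits at all.\<close>

definition off :: "nat \<Rightarrow> nat \<Rightarrow> nat" where
  "off z0 k = (if k = 4 then z0 else 1)"

definition cellbits :: "nat \<Rightarrow> (nat \<Rightarrow> nat) \<Rightarrow> nat \<Rightarrow> nat \<Rightarrow> bool" where
  "cellbits z0 N j k \<longleftrightarrow> k < 6 \<and> off z0 k \<le> j \<and> bit (N k) (j - off z0 k)"

context simulation
begin

definition ucell :: "(nat \<Rightarrow> nat \<Rightarrow> nat) \<Rightarrow> (nat \<Rightarrow> nat) \<Rightarrow> nat \<Rightarrow> nat \<Rightarrow> nat \<times> bool" where
  "ucell t h j = (\<lambda>i. if i < R then (t i j, j = h i) else (0, False))"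

text \<open>Tape \<open>i\<close> of a simulated configuration: the input tapes come first.\<close>

definition tpc :: "bool list list \<Rightarrow> config \<Rightarrow> nat \<Rightarrow> nat \<Rightarrow> nat" where
  "tpc mi c i = (\<lambda>j. if i < 4 then ic (read_input (mi ! i) j) else fst (work c ! (i - 4)) j)"

definition hpc :: "config \<Rightarrow> nat \<Rightarrow> nat" where
  "hpc c i = (if i < 4 then input_heads c ! i else snd (work c ! (i - 4)))"

definition CELL :: "nat \<Rightarrow> nat \<Rightarrow> (nat \<Rightarrow> nat) \<Rightarrow> (nat \<Rightarrow> bool list list) \<Rightarrow> (nat \<Rightarrow> config) \<Rightarrow> nat \<Rightarrow> cell" where
  "CELL z0 z1 N mi cf j = \<lparr>kind = kindf z0 z1 j, bits = cellbits z0 N j,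
     tp = (\<lambda>u. if u < 6 then ucell (tpc (mi u) (cf u)) (hpc (cf u)) j else (\<lambda>_. (0, False)))\<rparr>"

definition cells_of :: "nat \<Rightarrow> nat \<Rightarrow> nat \<Rightarrow> (nat \<Rightarrow> nat) \<Rightarrow> (nat \<Rightarrow> bool list list) \<Rightarrow> (nat \<Rightarrow> config) \<Rightarrow> cell list" where
  "cells_of z0 z1 s N mi cf = map (CELL z0 z1 N mi cf) [0..<s]"

definition tied :: "vars \<Rightarrow> (nat \<Rightarrow> config) \<Rightarrow> bool" where
  "tied v cf \<longleftrightarrow> (\<forall>u<6. st v u = state (cf u) \<and> an v u = answer (cf u))"

lemma active_CELL:
  "1 \<le> z0 \<Longrightarrow> active k (CELL z0 z1 N mi cf j) \<longleftrightarrow> off z0 k \<le> j"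
  by (auto simp: active_def CELL_def kindf_def off_def)

lemma do_dec_op [simp]:
  assumes "hok inp x" "k < 6" "1 \<le> z0" "N k < 2 ^ (s - off z0 k)"
  shows "do_op inp f (dec_op k) (v, cells_of z0 z1 s N mi cf, x) =
     (v\<lparr>flag := (N k = 0)\<rparr>, cells_of z0 z1 s (N(k := N k - 1)) mi cf, x)"
proof -
  let ?o = "off z0 k" and ?C = "CELL z0 z1 N mi cf"
  \<comment> \<open>In front of cell \<open>j\<close> the flag says that all digits so far are 0,
    that is, that the borrow is still running.\<close>
  let ?S = "\<lambda>j. v\<lparr>flag := (N k mod 2 ^ (j - ?o) = 0)\<rparr>"
  let ?C1 = "\<lambda>j. if ?o \<le> j then (?C j)\<lparr>bits := (cellbits z0 N j)(k := (bit (N k) (j - ?o) \<noteq> (N k mod 2 ^ (j - ?o) = 0)))\<rparr> else ?C j"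
  have 1: "fpass (fwd (dec_op k)) (?S 0) (map ?C [0..<s]) = (?S s, map ?C1 [0..<s], map (\<lambda>_. Silent) [0..<s])"
  proof (rule fpass_local)
    fix j
    show "fwd (dec_op k) (?S j) (?C j) = (?S (Suc j), ?C1 j, Silent)"
    proof (cases "?o \<le> j")
      case True
      then have "Suc j - ?o = Suc (j - ?o)" by simp
      have kk: "cellbits z0 N j k = bit (N k) (j - ?o)"
        using True assms by (simp add: cellbits_def)
      have act: "active k (?C j)" and bt: "bits (?C j) = cellbits z0 N j"
        using True assms active_CELL by (auto simp: CELL_def)
      have "fwd (dec_op k) (?S j) (?C j) =
         (v\<lparr>flag := ((N k mod 2 ^ (j - ?o) = 0) \<and> \<not> cellbits z0 N j k)\<rparr>,
          (?C j)\<lparr>bits := (cellbits z0 N j)(k := (cellbits z0 N j k \<noteq> (N k mod 2 ^ (j - ?o) = 0)))\<rparr>, Silent)"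
        by (simp add: dec_op_def act bt)
      then show ?thesis unfolding kk if_P[OF True] \<open>Suc j - ?o = Suc (j - ?o)\<close> mod_power_Suc_eq_0 .
    next
      case False
      then have "j - ?o = 0" "Suc j - ?o = 0" by auto
      with False show ?thesis using assms by (simp add: dec_op_def active_CELL)
    qed
  qed simp
  have end0: "(N k mod 2 ^ (s - ?o) = 0) = (N k = 0)" using assms(4) by simp
  let ?C' = "CELL z0 z1 (N(k := N k - 1)) mi cf"
  have act: "active k (?C1 j) = (?o \<le> j)" for j
    using active_CELL[OF assms(3), of k z1 N mi cf j] by (auto simp: active_def)
  have 2: "bpass (bwd (dec_op k)) (v\<lparr>flag := (N k = 0)\<rparr>) (map ?C1 [0..<s]) =
     (v\<lparr>flag := (N k = 0)\<rparr>, map ?C' [0..<s])"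
  proof (rule bpass_local[where S = "\<lambda>_. v\<lparr>flag := (N k = 0)\<rparr>"])
    fix j
    have other: "cellbits z0 (N(k := y)) j l = cellbits z0 N j l" if "l \<noteq> k" for l y
      using that by (simp add: cellbits_def)
    show "bwd (dec_op k) (v\<lparr>flag := (N k = 0)\<rparr>) (?C1 j) = (v\<lparr>flag := (N k = 0)\<rparr>, ?C' j)"
    proof (cases "?o \<le> j")
      case False
      then have "?C' j = ?C j" using other by (auto simp: CELL_def fun_eq_iff cellbits_def)
      then show ?thesis using False act[of j] by (simp add: dec_op_def)
    next
      case True
      have k: "cellbits z0 (N(k := N k - 1)) j k = (if N k = 0 then False else bit (N k) (j - ?o) \<noteq> (N k mod 2 ^ (j - ?o) = 0))"
        using bit_pred[of "N k" "j - ?o"] True assms(2) by (simp add: cellbits_def)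
      have "cellbits z0 (N(k := N k - 1)) j = (cellbits z0 N j)(k := (if N k = 0 then False else bit (N k) (j - ?o) \<noteq> (N k mod 2 ^ (j - ?o) = 0)))"
        using other k by (auto simp: fun_eq_iff)
      then show ?thesis using True act[of j] by (simp add: dec_op_def CELL_def)
    qed
  qed simp
  have "act (dec_op k) v (answer x) (scanned inp x) = (?S 0, stays, Silent)"
    by (simp add: dec_op_def)
  moreover have "grow (dec_op k) w = None" for w by (simp add: dec_op_def)
  ultimately show ?thesis using 1 2 end0 assms(1) by (simp add: cells_of_def do_op.simps)
qed

lemma do_copy_bits_op [simp]:
  assumes "hok inp x" "k < 6" "l < 6" "k \<noteq> 4" "l \<noteq> 4"
  shows "do_op inp f (copy_bits_op k l) (v, cells_of z0 z1 s N mi cf, x) =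
     (v, cells_of z0 z1 s (N(l := N k)) mi cf, x)"
proof -
  have "fpass (fwd (copy_bits_op k l)) v (map (CELL z0 z1 N mi cf) [0..<s]) =
     (v, map (CELL z0 z1 (N(l := N k)) mi cf) [0..<s], map (\<lambda>_. Silent) [0..<s])"
    by (rule fpass_local[where S = "\<lambda>_. v"])
       (use assms in \<open>auto simp: copy_bits_op_def CELL_def fun_eq_iff cellbits_def off_def\<close>)
  then show ?thesis using assms(1) by (simp add: cells_of_def do_op.simps) (simp add: copy_bits_op_def)
qed

lemma do_copy_unit_op [simp]:
  assumes "hok inp x" "u < 6" "w < 6" "mi w = mi u"
  shows "do_op inp f (copy_unit_op u w) (v, cells_of z0 z1 s N mi cf, x) =
     (v\<lparr>st := (st v)(w := st v u), an := (an v)(w := an v u)\<rparr>, cells_of z0 z1 s N mi (cf(w := cf u)), x)"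
proof -
  have "fpass (fwd (copy_unit_op u w)) v' (map (CELL z0 z1 N mi cf) [0..<s]) =
     (v', map (CELL z0 z1 N mi (cf(w := cf u))) [0..<s], map (\<lambda>_. Silent) [0..<s])" for v'
    by (rule fpass_local[where S = "\<lambda>_. v'"])
       (use assms in \<open>auto simp: copy_unit_op_def CELL_def fun_eq_iff\<close>)
  then show ?thesis using assms(1) by (simp add: cells_of_def do_op.simps) (simp add: copy_unit_op_def)
qed

lemma tied_copy: "tied v cf \<Longrightarrow> u < 6 \<Longrightarrow>
   tied (v\<lparr>st := (st v)(w := st v u), an := (an v)(w := an v u)\<rparr>) (cf(w := cf u))"
  by (simp add: tied_def)

text \<open>The tapes of copy \<open>u\<close> are arbitrary here: between \<open>gather_op\<close>
  and \<open>right_op\<close> they represent no configuration of the machine, because only some of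
  the heads have moved.\<close>

definition CELLu :: "nat \<Rightarrow> nat \<Rightarrow> (nat \<Rightarrow> nat) \<Rightarrow> (nat \<Rightarrow> bool list list) \<Rightarrow> (nat \<Rightarrow> config) \<Rightarrow> nat \<Rightarrow>
    (nat \<Rightarrow> nat \<Rightarrow> nat) \<Rightarrow> (nat \<Rightarrow> nat) \<Rightarrow> nat \<Rightarrow> cell" where
  "CELLu z0 z1 N mi cf u t h j =
     (CELL z0 z1 N mi cf j)\<lparr>tp := (tp (CELL z0 z1 N mi cf j))(u := ucell t h j)\<rparr>"

lemma CELLu_simps [simp]:
  "kind (CELLu z0 z1 N mi cf u t h j) = kindf z0 z1 j"
  "tp (CELLu z0 z1 N mi cf u t h j) u = ucell t h j"
  by (simp_all add: CELLu_def CELL_def)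

lemma CELLu_update:
  "(CELLu z0 z1 N mi cf u t h j)\<lparr>tp := (tp (CELLu z0 z1 N mi cf u t h j))(u := ucell t' h' j)\<rparr> =
   CELLu z0 z1 N mi cf u t' h' j"
  by (simp add: CELLu_def)

lemma mv_pend [simp]: "mv (v\<lparr>pend := p\<rparr>) u i = mv v u i"
  and wr_pend [simp]: "wr (v\<lparr>pend := p\<rparr>) u i = wr v u i"
  and dl_pend [simp]: "dl (v\<lparr>pend := p\<rparr>) u = dl v u"
proof -
  show dl: "dl (v\<lparr>pend := p\<rparr>) u = dl v u" by (simp add: dl_def)
  have sc: "scan (v\<lparr>pend := p\<rparr>) = scan v" by simp
  show "mv (v\<lparr>pend := p\<rparr>) u i = mv v u i" "wr (v\<lparr>pend := p\<rparr>) u i = wr v u i"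
    unfolding mv_def wr_def dl sc by (rule refl)+
qed

lemma do_gather_op:
  assumes "hok inp x" "\<And>i. i < R \<Longrightarrow> h i < s"
    and v1_def: "v1 = v\<lparr>scan := (\<lambda>i. if i < R then t i (h i) else 0), pend := (\<lambda>_. False)\<rparr>"
  shows "do_op inp f (gather_op u) (v, map (CELLu z0 z1 N mi cf u t h) [0..<s], x) =
    (v1, map (CELLu z0 z1 N mi cf u (\<lambda>i. (t i)(h i := wr v1 u i))
       (\<lambda>i. if mv v1 u i = Lft then h i - 1 else h i)) [0..<s], x)"
proof -
  let ?C = "CELLu z0 z1 N mi cf u t h"
  let ?t = "\<lambda>i. (t i)(h i := wr v1 u i)"
  let ?h = "\<lambda>i. if mv v1 u i = Lft then h i - 1 else h i"
  let ?S = "\<lambda>j. v\<lparr>scan := (\<lambda>i. if i < R \<and> h i < j then t i (h i) else 0), pend := (\<lambda>_. False)\<rparr>"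
  have 1: "fpass (fwd (gather_op u)) (?S 0) (map ?C [0..<s]) = (?S s, map ?C [0..<s], map (\<lambda>_. Silent) [0..<s])"
    by (rule fpass_local) (auto simp: gather_op_def ucell_def fun_eq_iff less_Suc_eq)
  have "(\<lambda>i. if i < R \<and> h i < s then t i (h i) else 0) = (\<lambda>i. if i < R then t i (h i) else 0)"
    using assms(2) by auto
  then have s: "?S s = v1" unfolding v1_def by (simp only:)
  \<comment> \<open>\<open>?P j\<close> marks the heads that move left out of cell \<open>j\<close>
    and have yet to be placed in cell \<open>j - 1\<close>.\<close>
  let ?P = "\<lambda>j. v1\<lparr>pend := (\<lambda>i. i < R \<and> h i = j \<and> mv v1 u i = Lft \<and> j \<noteq> 0)\<rparr>"
  have 2: "bpass (bwd (gather_op u)) (?P s) (map ?C [0..<s]) = (?P 0, map (CELLu z0 z1 N mi cf u ?t ?h) [0..<s])"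
  proof (rule bpass_local)
    fix j
    let ?B = "\<lambda>i. if i < R
           then (if snd (ucell t h j i) then wr v1 u i else fst (ucell t h j i),
                 snd (ucell t h j i) \<and> (mv v1 u i \<noteq> Lft \<or> kindf z0 z1 j = 0) \<or>
                 (i < R \<and> h i = Suc j \<and> mv v1 u i = Lft \<and> Suc j \<noteq> 0))
           else (0, False)"
    let ?A = "\<lambda>i. i < R \<and> snd (ucell t h j i) \<and> mv v1 u i = Lft \<and> kindf z0 z1 j \<noteq> 0"
    have "bwd (gather_op u) (?P (Suc j)) (?C j) =
        (v1\<lparr>pend := ?A\<rparr>, (?C j)\<lparr>tp := (tp (?C j))(u := ?B)\<rparr>)"
      by (simp add: gather_op_def cong: if_cong)
    also have "?A = (\<lambda>i. i < R \<and> h i = j \<and> mv v1 u i = Lft \<and> j \<noteq> 0)"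
      by (auto simp: ucell_def fun_eq_iff kindf_def)
    also have "?B = ucell ?t ?h j"
      by (auto simp: ucell_def fun_eq_iff kindf_def)
    finally show "bwd (gather_op u) (?P (Suc j)) (?C j) = (?P j, CELLu z0 z1 N mi cf u ?t ?h j)"
      unfolding CELLu_update .
  qed simp
  have "(\<lambda>i. i < R \<and> h i = s \<and> mv v1 u i = Lft \<and> s \<noteq> 0) = (\<lambda>_. False)" using assms(2) by auto
  then have "?P s = v1\<lparr>pend := (\<lambda>_. False)\<rparr>" by (simp only:)
  then have "?P s = v1" by (simp add: v1_def)
  moreover have "?P 0 = v1" by (simp add: v1_def)
  moreover have "act (gather_op u) v (answer x) (scanned inp x) = (?S 0, stays, Silent)"
    by (simp add: gather_op_def)
  moreover have "grow (gather_op u) w = None" for w by (simp add: gather_op_def)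
  ultimately show ?thesis using 1 2 s assms(1) by (simp add: do_op.simps)
qed

lemma do_right_op:
  assumes "hok inp x" "\<And>i. i < R \<Longrightarrow> mv v u i = Rgt \<Longrightarrow> Suc (h i) < s"
  shows "do_op inp f (right_op u) (v, map (CELLu z0 z1 N mi cf u t h) [0..<s], x) =
    (v\<lparr>pend := (\<lambda>_. False)\<rparr>, map (CELLu z0 z1 N mi cf u t
       (\<lambda>i. if mv v u i = Rgt then Suc (h i) else h i)) [0..<s], x)"
proof -
  let ?C = "CELLu z0 z1 N mi cf u t h"
  let ?h = "\<lambda>i. if mv v u i = Rgt then Suc (h i) else h i"
  let ?S = "\<lambda>j. v\<lparr>pend := (\<lambda>i. i < R \<and> mv v u i = Rgt \<and> Suc (h i) = j)\<rparr>"
  have 1: "fpass (fwd (right_op u)) (?S 0) (map ?C [0..<s]) =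
     (?S s, map (CELLu z0 z1 N mi cf u t ?h) [0..<s], map (\<lambda>_. Silent) [0..<s])"
  proof (rule fpass_local)
    fix j
    let ?B = "\<lambda>i. if i < R then (fst (ucell t h j i),
         if mv v u i = Rgt then i < R \<and> mv v u i = Rgt \<and> Suc (h i) = j else snd (ucell t h j i)) else (0, False)"
    let ?A = "\<lambda>i. i < R \<and> snd (ucell t h j i) \<and> mv v u i = Rgt"
    have "fwd (right_op u) (?S j) (?C j) = (v\<lparr>pend := ?A\<rparr>, (?C j)\<lparr>tp := (tp (?C j))(u := ?B)\<rparr>, Silent)"
      by (simp add: right_op_def cong: if_cong)
    also have "?A = (\<lambda>i. i < R \<and> mv v u i = Rgt \<and> Suc (h i) = Suc j)"
      by (auto simp: ucell_def fun_eq_iff)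
    also have "?B = ucell t ?h j"
      by (auto simp: ucell_def fun_eq_iff)
    finally show "fwd (right_op u) (?S j) (?C j) = (?S (Suc j), CELLu z0 z1 N mi cf u t ?h j, Silent)"
      unfolding CELLu_update .
  qed simp
  have "(\<lambda>i. i < R \<and> mv v u i = Rgt \<and> Suc (h i) = s) = (\<lambda>_. False)" using assms(2) by auto
  then have "?S s = v\<lparr>pend := (\<lambda>_. False)\<rparr>" by (simp only:)
  moreover have "act (right_op u) v (answer x) (scanned inp x) = (?S 0, stays, Silent)"
    by (simp add: right_op_def)
  moreover have "grow (right_op u) w = None" "bwd (right_op u) = (\<lambda>v c. (v, c))" for w
    by (simp_all add: right_op_def)
  ultimately show ?thesis using 1 assms(1) by (simp add: do_op.simps)
qed

text \<open>A step whose effect is returned and not performed: simulated queries and outputs are not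
  those of the simulating machine, which decides itself what to do with them.\<close>

definition mstep :: "bool list list \<Rightarrow> config \<Rightarrow> (config \<times> effect) option" where
  "mstep mi c =
     (case delta M (state c) (answer c) (map2 read_input mi (input_heads c)) (map (\<lambda>(t, h). t h) (work c)) of
        None \<Rightarrow> None
      | Some (q, ms, ws, e) \<Rightarrow> Some (c\<lparr>state := q,
               input_heads := map2 (\<lambda>x (d, h). move_input x d h) mi (zip ms (input_heads c)),
               work := map2 update_tape (work c) ws\<rparr>, e))"

lemma step_mstep: "step M mi g c = map_option (\<lambda>(c1, e). perform g e c1) (mstep mi c)"
  by (simp add: step_def mstep_def split: option.split)

lemma exec_simstep:
  "do_op inp f (gather_op u) w = w1 \<Longrightarrow> do_op inp f (right_op u) w1 = w2 \<Longrightarrow>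
   exec inp f (Seq (Do (gather_op u)) (Seq (Do (right_op u)) (Do (finish_op u)))) w (do_op inp f (finish_op u) w2)"
  using exec.Seq exec.Do by metis

text \<open>All simulated tapes share the same cells, so one \<open>s\<close> has to bound the work
  heads as well as the inputs together with both end markers.\<close>

definition fits :: "nat \<Rightarrow> bool list list \<Rightarrow> config \<Rightarrow> bool" where
  "fits s mi c \<longleftrightarrow> length mi = 4 \<and> length (input_heads c) = 4 \<and> state c < n_states M \<and>
     (\<forall>i<4. input_heads c ! i \<le> Suc (length (mi ! i)) \<and> Suc (length (mi ! i)) < s) \<and>
     length (work c) = n_tapes M \<and>
     (\<forall>(t, h)\<in>set (work c). h < s \<and> range t \<subseteq> {..<n_symbols M})"

definition simstep :: "nat \<Rightarrow> (vars, cell) prog" where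
  "simstep u = Seq (Do (gather_op u)) (Seq (Do (right_op u)) (Do (finish_op u)))"

lemma fits_perform [simp]: "fits s mi (perform g e c) = fits s mi c"
  by (cases e) (auto simp: fits_def)

lemma CELL_CELLu:
  "cf u = c \<Longrightarrow> u < 6 \<Longrightarrow> CELL z0 z1 N mi cf = CELLu z0 z1 N mi cf u (tpc (mi u) c) (hpc c)"
  by (auto simp: CELLu_def CELL_def fun_eq_iff)

lemma tpc_hpc_perform [simp]:
  "tpc mi (perform g e c) = tpc mi c" "hpc (perform g e c) = hpc c" "state (perform g e c) = state c"
proof -
  have w: "work (perform g e c) = work c" "input_heads (perform g e c) = input_heads c"
    by (cases e; simp)+
  show "state (perform g e c) = state c" by (cases e; simp)
  show "tpc mi (perform g e c) = tpc mi c" "hpc (perform g e c) = hpc c"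
    by (simp_all add: tpc_def hpc_def w fun_eq_iff)
qed

lemma hpc_less: "fits s mi c \<Longrightarrow> i < R \<Longrightarrow> hpc c i < s"
proof -
  assume f: "fits s mi c" and i: "i < R"
  show ?thesis
  proof (cases "i < 4")
    case True
    then have "input_heads c ! i \<le> Suc (length (mi ! i))" "Suc (length (mi ! i)) < s"
      using f unfolding fits_def by blast+
    then show ?thesis using True by (simp add: hpc_def)
  next
    case False
    then have "work c ! (i - 4) \<in> set (work c)" using f i unfolding fits_def R_def by auto
    then show ?thesis using f False unfolding fits_def hpc_def by auto
  qed
qed

text \<open>The configuration after the step has to fit too, since a right move out of the last cell
  would lose the head. \<open>cf\<close> records the effect with the oracle answering False, while
  the effect itself remains in \<open>eff\<close> for \<open>handle\<close>.\<close>

lemma simstep_correct: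
  assumes hok: "hok inp x" and fits: "fits s (mi u) c" and u: "u < 6" and cf: "cf u = c" and tied: "tied v cf"
    and next_fits: "\<And>c1 e. mstep (mi u) c = Some (c1, e) \<Longrightarrow> fits s (mi u) c1"
  shows "\<exists>v'. exec inp f (simstep u) (v, cells_of z0 z1 s N mi cf, x)
      (v', cells_of z0 z1 s N mi (case mstep (mi u) c of None \<Rightarrow> cf
         | Some (c1, e) \<Rightarrow> cf(u := perform (\<lambda>_. False) e c1)), x) \<and>
    ok v' = ok v \<and> okall v' = okall v \<and>
    (case mstep (mi u) c of None \<Rightarrow> tied v' cf \<and> ev v' = 2 \<and> eff v' = Silent
     | Some (c1, e) \<Rightarrow> tied v' (cf(u := perform (\<lambda>_. False) e c1)) \<and> eff v' = e \<and>
         ev v' = (if e = Ask then 1 else ev v))"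
proof -
  define v1 where "v1 = v\<lparr>scan := (\<lambda>i. if i < R then tpc (mi u) c i (hpc c i) else 0), pend := (\<lambda>_. False)\<rparr>"
  let ?t = "\<lambda>i. (tpc (mi u) c i)(hpc c i := wr v1 u i)"
  let ?hL = "\<lambda>i. if mv v1 u i = Lft then hpc c i - 1 else hpc c i"
  let ?h = "\<lambda>i. if mv v1 u i = Rgt then Suc (?hL i) else ?hL i"
  have R4: "4 \<le> R" by (simp add: R_def)
  have lens: "length (mi u) = 4" "length (input_heads c) = 4" "length (work c) = n_tapes M"
    using fits by (auto simp: fits_def)
  have in_syms: "map (\<lambda>i. di (scan v1 i)) [0..<4] = map2 read_input (mi u) (input_heads c)"
    using lens R4 by (intro nth_equalityI) (auto simp: v1_def tpc_def hpc_def)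
  have w_syms: "map (scan v1) [4..<R] = map (\<lambda>(t, h). t h) (work c)"
    using lens by (intro nth_equalityI) (auto simp: v1_def tpc_def hpc_def R_def case_prod_beta)
  have dl: "dl v1 u = delta M (state c) (answer c) (map2 read_input (mi u) (input_heads c)) (map (\<lambda>(t, h). t h) (work c))"
    unfolding dl_def in_syms w_syms using tied u cf by (simp add: v1_def tied_def)
  have CC: "CELL z0 z1 N mi cf = CELLu z0 z1 N mi cf u (tpc (mi u) c) (hpc c)"
    using cf u by (rule CELL_CELLu)
  have g: "do_op inp f (gather_op u) (v, cells_of z0 z1 s N mi cf, x) =
      (v1, map (CELLu z0 z1 N mi cf u ?t ?hL) [0..<s], x)"
    unfolding cells_of_def CC
    by (rule do_gather_op[where t = "tpc (mi u) c" and h = "hpc c"])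
      (use hok hpc_less[OF fits] v1_def in auto)
  show ?thesis
  proof (cases "mstep (mi u) c")
    case None
    then have dn: "dl v1 u = None" unfolding dl mstep_def by (auto split: option.splits)
    have mv: "mv v1 u i = Stay" "wr v1 u i = scan v1 i" for i using dn by (simp_all add: mv_def wr_def)
    have same: "map (CELLu z0 z1 N mi cf u ?t (hpc c)) [0..<s] = cells_of z0 z1 s N mi cf"
    proof -
      have "?t i = tpc (mi u) c i" if "i < R" for i
      proof -
        have "scan v1 i = tpc (mi u) c i (hpc c i)" using that by (simp add: v1_def)
        then show ?thesis using mv(2)[of i] by simp
      qed
      then have "ucell ?t (hpc c) j = ucell (tpc (mi u) c) (hpc c) j" for j
        by (simp add: ucell_def cong: if_cong)
      then have "CELLu z0 z1 N mi cf u ?t (hpc c) j = CELLu z0 z1 N mi cf u (tpc (mi u) c) (hpc c) j" for j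
        unfolding CELLu_def by (simp only:)
      then show ?thesis unfolding cells_of_def CC by (intro map_cong refl)
    qed
    have r: "do_op inp f (right_op u) (v1, map (CELLu z0 z1 N mi cf u ?t ?hL) [0..<s], x) =
        (v1\<lparr>pend := (\<lambda>_. False)\<rparr>, map (CELLu z0 z1 N mi cf u ?t ?h) [0..<s], x)"
      by (rule do_right_op[OF hok]) (simp add: mv)
    have h: "?h = hpc c" by (simp add: mv)
    have "exec inp f (simstep u) (v, cells_of z0 z1 s N mi cf, x)
       (do_op inp f (finish_op u) (v1\<lparr>pend := (\<lambda>_. False)\<rparr>, cells_of z0 z1 s N mi cf, x))"
      unfolding simstep_def by (rule exec_simstep[OF g r[unfolded h same]])
    moreover have "do_op inp f (finish_op u) (v1\<lparr>pend := (\<lambda>_. False)\<rparr>, cells_of z0 z1 s N mi cf, x) =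
       (v1\<lparr>pend := (\<lambda>_. False), ev := 2, eff := Silent\<rparr>, cells_of z0 z1 s N mi cf, x)"
      using hok dn by (simp add: finish_op_def)
    moreover have "tied (v1\<lparr>pend := (\<lambda>_. False), ev := 2, eff := Silent\<rparr>) cf"
      using tied by (simp add: tied_def v1_def)
    ultimately show ?thesis using None by (auto simp: v1_def)
  next
    case (Some ce)
    obtain c1 e where ce: "ce = (c1, e)" by (cases ce)
    obtain q ms ws where d: "dl v1 u = Some (q, ms, ws, e)"
      and c1: "c1 = c\<lparr>state := q, input_heads := map2 (\<lambda>x (d, h). move_input x d h) (mi u) (zip ms (input_heads c)),
               work := map2 update_tape (work c) ws\<rparr>"
      using Some ce unfolding mstep_def dl[symmetric] by (auto split: option.splits)
    have nf: "fits s (mi u) c1" using next_fits Some ce by simp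
    then have len2: "length ms = 4" "length ws = n_tapes M"
    proof -
      have "state c < n_states M" "set (map (\<lambda>(t, h). t h) (work c)) \<subseteq> {..<n_symbols M}"
        using fits unfolding fits_def by (auto simp: subset_iff dest!: bspec)
      moreover have "length (map2 read_input (mi u) (input_heads c)) = 4"
        "length (map (\<lambda>(t, h). t h) (work c)) = n_tapes M" using lens by auto
      ultimately show "length ms = 4" "length ws = n_tapes M"
        using valid d unfolding valid_machine_def dl by blast+
    qed
    have hd: "?h i = hpc c1 i" if "i < R" for i
    proof (cases "i < 4")
      case True
      have "hpc c1 i = move_input (mi u ! i) (ms ! i) (input_heads c ! i)"
        using True lens len2 by (simp add: c1 hpc_def)
      moreover have "input_heads c ! i \<le> Suc (length (mi u ! i))" using fits True by (simp add: fits_def)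
      moreover have "scan v1 i = 3 \<longleftrightarrow> input_heads c ! i > length (mi u ! i)"
        using True that by (auto simp: v1_def tpc_def hpc_def read_input_def)
      moreover have "mv v1 u i = (if ms ! i = Rgt \<and> scan v1 i = 3 then Stay else ms ! i)"
        using True d by (simp add: mv_def)
      ultimately show ?thesis using True
        by (cases "ms ! i") (auto simp: hpc_def move_input_def)
    next
      case False
      then have i: "i - 4 < n_tapes M" using that by (simp add: R_def)
      then have "hpc c1 i = shift (snd (ws ! (i - 4))) (snd (work c ! (i - 4)))"
        using False lens len2 by (simp add: c1 hpc_def update_tape_def case_prod_beta)
      moreover have "mv v1 u i = snd (ws ! (i - 4))" using False d by (simp add: mv_def)
      ultimately show ?thesis using False by (cases "snd (ws ! (i - 4))") (auto simp: hpc_def)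
    qed
    have td: "?t i = tpc (mi u) c1 i" if "i < R" for i
    proof (cases "i < 4")
      case True
      then show ?thesis using d that by (auto simp: wr_def v1_def tpc_def fun_eq_iff)
    next
      case False
      then have i: "i - 4 < n_tapes M" using that by (simp add: R_def)
      then show ?thesis using False lens len2 d
        by (auto simp: c1 tpc_def hpc_def update_tape_def case_prod_beta wr_def fun_eq_iff)
    qed
    have mvR: "Suc (?hL i) < s" if "i < R" "mv v1 u i = Rgt" for i
      using hpc_less[OF nf that(1)] hd[OF that(1)] that(2) by simp
    have r: "do_op inp f (right_op u) (v1, map (CELLu z0 z1 N mi cf u ?t ?hL) [0..<s], x) =
        (v1\<lparr>pend := (\<lambda>_. False)\<rparr>, map (CELLu z0 z1 N mi cf u ?t ?h) [0..<s], x)"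
      by (rule do_right_op[OF hok mvR])
    let ?c2 = "perform (\<lambda>_. False) e c1"
    have fin: "map (CELLu z0 z1 N mi cf u ?t ?h) [0..<s] = cells_of z0 z1 s N mi (cf(u := ?c2))"
    proof -
      have uc: "ucell ?t ?h j = ucell (tpc (mi u) ?c2) (hpc ?c2) j" for j
      proof (rule ext)
        fix i
        show "ucell ?t ?h j i = ucell (tpc (mi u) ?c2) (hpc ?c2) j i"
        proof (cases "i < R")
          case True
          show ?thesis unfolding ucell_def if_P[OF True] tpc_hpc_perform td[OF True] hd[OF True] ..
        qed (simp add: ucell_def)
      qed
      have "CELLu z0 z1 N mi cf u ?t ?h j = CELL z0 z1 N mi (cf(u := ?c2)) j" for j
        unfolding CELLu_def uc using u by (auto simp: CELL_def fun_eq_iff)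
      then show ?thesis unfolding cells_of_def by simp
    qed
    have "exec inp f (simstep u) (v, cells_of z0 z1 s N mi cf, x)
       (do_op inp f (finish_op u) (v1\<lparr>pend := (\<lambda>_. False)\<rparr>, cells_of z0 z1 s N mi (cf(u := ?c2)), x))"
      unfolding simstep_def by (rule exec_simstep[OF g r[unfolded fin]])
    moreover have "do_op inp f (finish_op u) (v1\<lparr>pend := (\<lambda>_. False)\<rparr>, cells_of z0 z1 s N mi (cf(u := ?c2)), x) =
       (v1\<lparr>pend := (\<lambda>_. False), st := (st v)(u := q), an := (an v)(u := an v u \<and> e \<noteq> Ask), eff := e,
           ev := if e = Ask then 1 else ev v\<rparr>, cells_of z0 z1 s N mi (cf(u := ?c2)), x)"
      using hok d by (simp add: finish_op_def v1_def)
    moreover have "answer ?c2 = (answer c \<and> e \<noteq> Ask)" by (cases e) (auto simp: c1)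
    then have "tied (v1\<lparr>pend := (\<lambda>_. False), st := (st v)(u := q), an := (an v)(u := an v u \<and> e \<noteq> Ask), eff := e,
           ev := if e = Ask then 1 else ev v\<rparr>) (cf(u := ?c2))"
      using tied u cf by (simp add: tied_def v1_def c1)
    ultimately show ?thesis using Some ce by (auto simp: v1_def)
  qed
qed

end

section \<open>Running a copy up to its next query\<close>

lemma exec_Do: "do_op inp f i w = w' \<Longrightarrow> exec inp f (Do i) w w'"
  using exec.Do by metis

text \<open>What a simulated run does to the real tapes: \<open>Emitting\<close> copies the output,
  \<open>Dry\<close> does nothing, \<open>Before\<close> writes the first \<open>r\<close> bits of
  the query that ends the run, and \<open>After\<close> writes the remaining ones. Counter 2,
  started at \<open>r\<close>, tells the two parts of the query apart.\<close>

datatype mode = Emitting | Dry | Before | After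

definition is_write :: "effect \<Rightarrow> bool" where
  "is_write e \<longleftrightarrow> (\<exists>b. e = Write_Query b)"

fun handle :: "mode \<Rightarrow> (vars, cell) prog" where
  "handle Emitting = Do (effect_op (\<lambda>v. case eff v of Emit y \<Rightarrow> Emit y | _ \<Rightarrow> Silent))"
| "handle Dry = Skip"
| "handle Before = Cond (\<lambda>v b xs. is_write (eff v))
     (Seq (Do (dec_op 2)) (Do (effect_op (\<lambda>v. if flag v then Silent else eff v)))) Skip"
| "handle After = Cond (\<lambda>v b xs. is_write (eff v))
     (Seq (Do (dec_op 2)) (Do (effect_op (\<lambda>v. if flag v then eff v else Silent)))) Skip"

text \<open>\<open>p\<close> is what stands on the real query tape when an \<open>After\<close> run
  begins. Counter 2 has been decremented once per bit written by the copy and then rests at 0, in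
  agreement with truncated subtraction.\<close>

fun mode_inv :: "mode \<Rightarrow> bool list \<Rightarrow> nat \<Rightarrow> config \<Rightarrow> (nat \<Rightarrow> nat) \<Rightarrow> config \<Rightarrow> bool" where
  "mode_inv Emitting p r c N x \<longleftrightarrow> out x = out c"
| "mode_inv Dry p r c N x \<longleftrightarrow> True"
| "mode_inv Before p r c N x \<longleftrightarrow>
     N 2 = r - length (query_tape c) \<and> query_tape x = take r (query_tape c)"
| "mode_inv After p r c N x \<longleftrightarrow>
     N 2 = r - length (query_tape c) \<and> query_tape x = p @ drop r (query_tape c)"

fun mode_result :: "mode \<Rightarrow> bool list \<Rightarrow> nat \<Rightarrow> config \<Rightarrow> config \<Rightarrow> config" where
  "mode_result Emitting p r c x = x\<lparr>out := out c\<rparr>"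
| "mode_result Dry p r c x = x"
| "mode_result Before p r c x = x\<lparr>query_tape := take r (last (asked c))\<rparr>"
| "mode_result After p r c x = x\<lparr>query_tape := p @ drop r (last (asked c))\<rparr>"

lemma hok_update [simp]:
  "hok inp (x\<lparr>out := a\<rparr>) = hok inp x" "hok inp (x\<lparr>query_tape := q\<rparr>) = hok inp x"
  "hok inp (x\<lparr>answer := b\<rparr>) = hok inp x" "hok inp (x\<lparr>asked := l\<rparr>) = hok inp x"
  by (simp_all add: hok_def)

locale sim_run = simulation +
  fixes inp :: "bool list list" and f :: "bool list \<Rightarrow> bool" and z0 z1 s n :: nat
    and A B :: "bool list list"
  assumes z0: "1 \<le> z0" and n_s: "n < 2 ^ (s - 1)"
begin

definition mi :: "nat \<Rightarrow> bool list list" where "mi u = (if u < 3 then A else B)"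

abbreviation W :: "vars \<Rightarrow> (nat \<Rightarrow> nat) \<Rightarrow> (nat \<Rightarrow> config) \<Rightarrow> config \<Rightarrow> (vars, cell) world" where
  "W v N cf x \<equiv> (v, cells_of z0 z1 s N mi cf, x)"

abbreviation "zero \<equiv> (\<lambda>_ :: bool list. False)"

definition run :: "nat \<Rightarrow> mode \<Rightarrow> (vars, cell) prog" where
  "run u md = Seq (Do (set_op (\<lambda>v b xs. v\<lparr>ev := 0\<rparr>)))
     (While (\<lambda>v b xs. ev v = 0) (Seq (simstep u) (handle md)))"

text \<open>A run up to the next query (flag True) or to halting (flag False). The query is
  provisionally answered with False; \<open>chain\<close> replaces the answer.\<close>

inductive seg :: "bool list list \<Rightarrow> config \<Rightarrow> bool \<Rightarrow> config \<Rightarrow> bool" for m where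
  halt: "fits s m c \<Longrightarrow> mstep m c = None \<Longrightarrow> seg m c False c"
| ask: "fits s m c \<Longrightarrow> mstep m c = Some (c1, Ask) \<Longrightarrow> fits s m c1 \<Longrightarrow> seg m c True (perform zero Ask c1)"
| go: "fits s m c \<Longrightarrow> mstep m c = Some (c1, e) \<Longrightarrow> e \<noteq> Ask \<Longrightarrow> fits s m c1 \<Longrightarrow>
    seg m (perform zero e c1) b c' \<Longrightarrow> seg m c b c'"

lemma mstep_io:
  "mstep m c = Some (c1, e) \<Longrightarrow> query_tape c1 = query_tape c \<and> asked c1 = asked c \<and> out c1 = out c"
  by (auto simp: mstep_def split: option.splits)

lemma seg_True: "seg m c b c' \<Longrightarrow> b \<Longrightarrow> (\<exists>y. asked c' = asked c @ [y]) \<and> query_tape c' = [] \<and> \<not> answer c'"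
proof (induction rule: seg.induct)
  case (go c c1 e b c')
  then show ?case using mstep_io[OF go(2)] by (cases e) auto
qed (auto dest: mstep_io)

lemma seg_False: "seg m c b c' \<Longrightarrow> \<not> b \<Longrightarrow> asked c' = asked c"
proof (induction rule: seg.induct)
  case (go c c1 e b c')
  then show ?case using mstep_io[OF go(2)] by (cases e) auto
qed auto

lemma seg_det: "seg m c b1 d1 \<Longrightarrow> seg m c b2 d2 \<Longrightarrow> b1 = b2 \<and> d1 = d2"
proof (induction arbitrary: b2 d2 rule: seg.induct)
  case (halt c) from halt(3,1,2) show ?case by cases auto
next
  case (ask c c1) from ask(4,1-3) show ?case by cases auto
next
  case (go c c1 e b c')
  from go(7) show ?case
  proof cases
    case (go c1' e')
    then have "c1' = c1" "e' = e" using \<open>mstep m c = Some (c1, e)\<close> by auto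
    with go show ?thesis using \<open>\<And>b2 d2. _ \<Longrightarrow> b = b2 \<and> c' = d2\<close> by blast
  qed (use go(2,3) in auto)
qed

lemma exec_handle_idle:
  assumes "hok inp x" "eff v = Silent \<or> eff v = Ask"
  shows "exec inp f (handle md) (W v N cf x) (W v N cf x)"
proof (cases md)
  case Emitting
  then show ?thesis using assms by (auto intro!: exec_Do)
next
  case Dry
  then show ?thesis by (auto intro: exec.Skip)
next
  case Before
  then show ?thesis using assms by (auto intro!: exec.Cond exec.Skip simp: is_write_def)
next
  case After
  then show ?thesis using assms by (auto intro!: exec.Cond exec.Skip simp: is_write_def)
qed

lemma exec_handle:
  assumes hok: "hok inp x" and e: "eff v = e" "e \<noteq> Ask"
    and inv: "mode_inv md p r c N x"
    and c1: "query_tape c1 = query_tape c" "out c1 = out c"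
    and N: "N 2 < 2 ^ (s - 1)"
  shows "\<exists>v' k x1. exec inp f (handle md) (W v N cf x) (W v' (N(2 := k)) cf x1) \<and> k \<le> N 2 \<and>
    mode_inv md p r (perform zero e c1) (N(2 := k)) x1 \<and> hok inp x1 \<and>
    (\<forall>c'. mode_result md p r c' x1 = mode_result md p r c' x) \<and>
    st v' = st v \<and> an v' = an v \<and> ev v' = ev v \<and> ok v' = ok v \<and> okall v' = okall v"
proof -
  have dec: "do_op inp f (dec_op 2) (W v N cf x) = W (v\<lparr>flag := (N 2 = 0)\<rparr>) (N(2 := N 2 - 1)) cf x"
    by (rule do_dec_op) (use hok z0 N in \<open>auto simp: off_def\<close>)
  have N2: "N = N(2 := N 2)" by simp
  show ?thesis
  proof (cases md)
    case Emitting
    show ?thesis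
    proof (intro exI conjI)
      show "exec inp f (handle md) (W v N cf x)
         (W v (N(2 := N 2)) cf (perform f (case e of Emit y \<Rightarrow> Emit y | _ \<Rightarrow> Silent) x))"
        using Emitting hok e by (auto intro!: exec_Do)
    qed (use Emitting inv c1 e hok in \<open>cases e; auto\<close>)+
  next
    case Dry
    show ?thesis
    proof (intro exI conjI)
      show "exec inp f (handle md) (W v N cf x) (W v (N(2 := N 2)) cf x)"
        using Dry by (auto intro!: exec.Skip)
    qed (use Dry hok in auto)
  next
    case Before
    show ?thesis
    proof (cases "is_write e")
      case False
      show ?thesis
      proof (intro exI conjI)
        show "exec inp f (handle md) (W v N cf x) (W v (N(2 := N 2)) cf x)"
          using Before False e by (auto intro!: exec.Cond exec.Skip)
      qed (use Before inv c1 e hok False in \<open>cases e; auto simp: is_write_def\<close>)+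
    next
      case True
      then obtain b where b: "e = Write_Query b" by (auto simp: is_write_def)
      show ?thesis
      proof (intro exI conjI)
        show "exec inp f (handle md) (W v N cf x)
          (W (v\<lparr>flag := (N 2 = 0)\<rparr>) (N(2 := N 2 - 1)) cf (perform f (if N 2 = 0 then Silent else e) x))"
          using Before True e hok by (auto intro!: exec.Cond exec.Seq[OF exec_Do[OF dec]] exec_Do)
      qed (use Before inv c1 b hok in auto)
    qed
  next
    case After
    show ?thesis
    proof (cases "is_write e")
      case False
      show ?thesis
      proof (intro exI conjI)
        show "exec inp f (handle md) (W v N cf x) (W v (N(2 := N 2)) cf x)"
          using After False e by (auto intro!: exec.Cond exec.Skip)
      qed (use After inv c1 e hok False in \<open>cases e; auto simp: is_write_def\<close>)+
    next
      case True
      then obtain b where b: "e = Write_Query b" by (auto simp: is_write_def)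
      show ?thesis
      proof (intro exI conjI)
        show "exec inp f (handle md) (W v N cf x)
          (W (v\<lparr>flag := (N 2 = 0)\<rparr>) (N(2 := N 2 - 1)) cf (perform f (if N 2 = 0 then e else Silent) x))"
          using After True e hok by (auto intro!: exec.Cond exec.Seq[OF exec_Do[OF dec]] exec_Do)
      qed (use After inv c1 b hok in auto)
    qed
  qed
qed

text \<open>\<open>Before\<close> and \<open>After\<close> require a segment that ends with a query,
  because \<open>mode_result\<close> refers to the query asked last.\<close>

lemma exec_run_loop:
  assumes "seg (mi u) c b c'"
  shows "hok inp x \<Longrightarrow> u < 6 \<Longrightarrow> cf u = c \<Longrightarrow> tied v cf \<Longrightarrow> ev v = 0 \<Longrightarrow> mode_inv md p r c N x \<Longrightarrow>
    N 2 < 2 ^ (s - 1) \<Longrightarrow> (md = Before \<or> md = After \<longrightarrow> b) \<Longrightarrow>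
    \<exists>v' k. exec inp f (While (\<lambda>v b xs. ev v = 0) (Seq (simstep u) (handle md))) (W v N cf x)
        (W v' (N(2 := k)) (cf(u := c')) (mode_result md p r c' x)) \<and>
      tied v' (cf(u := c')) \<and> ev v' = (if b then 1 else 2) \<and> ok v' = ok v \<and> okall v' = okall v \<and> k \<le> N 2"
  using assms
proof (induction arbitrary: v N cf x rule: seg.induct)
  case (halt c)
  from simstep_correct[of inp x s mi u c cf v f z0 z1 N] halt
  obtain v1 where v1: "exec inp f (simstep u) (W v N cf x) (W v1 N cf x)" "tied v1 cf" "ev v1 = 2"
    "eff v1 = Silent" "ok v1 = ok v" "okall v1 = okall v" by auto
  have "exec inp f (While (\<lambda>v b xs. ev v = 0) (Seq (simstep u) (handle md))) (W v N cf x) (W v1 N cf x)"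
    by (rule exec.While_True[OF _ exec.Seq[OF v1(1) exec_handle_idle]])
       (use halt v1 in \<open>auto intro: exec.While_False\<close>)
  moreover have "cf(u := c) = cf" "N(2 := N 2) = N" using halt by auto
  moreover have "mode_result md p r c x = x" using halt by (cases md) auto
  ultimately show ?case using v1 by (intro exI[of _ v1] exI[of _ "N 2"]) auto
next
  case (ask c c1)
  let ?c' = "perform zero Ask c1"
  from simstep_correct[of inp x s mi u c cf v f z0 z1 N] ask
  obtain v1 where v1: "exec inp f (simstep u) (W v N cf x) (W v1 N (cf(u := ?c')) x)" "tied v1 (cf(u := ?c'))"
    "ev v1 = 1" "eff v1 = Ask" "ok v1 = ok v" "okall v1 = okall v" by (auto simp del: perform.simps)
  have "exec inp f (While (\<lambda>v b xs. ev v = 0) (Seq (simstep u) (handle md))) (W v N cf x) (W v1 N (cf(u := ?c')) x)"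
    by (rule exec.While_True[OF _ exec.Seq[OF v1(1) exec_handle_idle]])
       (use ask v1 in \<open>auto intro: exec.While_False\<close>)
  moreover have "N(2 := N 2) = N" by auto
  moreover have "mode_result md p r ?c' x = x"
    using ask(9) mstep_io[OF ask(2)] by (cases md) auto
  ultimately show ?case using v1
    by (intro exI[of _ v1] exI[of _ "N 2"]) (auto simp del: perform.simps fun_upd_apply)
next
  case (go c c1 e b c')
  let ?c2 = "perform zero e c1"
  from simstep_correct[of inp x s mi u c cf v f z0 z1 N] go
  obtain v1 where v1: "exec inp f (simstep u) (W v N cf x) (W v1 N (cf(u := ?c2)) x)" "tied v1 (cf(u := ?c2))"
    "ev v1 = 0" "eff v1 = e" "ok v1 = ok v" "okall v1 = okall v" by (auto simp del: perform.simps)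
  from exec_handle[OF go.prems(1) v1(4) go.hyps(3) go.prems(6), of c1 "cf(u := ?c2)"] mstep_io[OF go.hyps(2)] go.prems(7)
  obtain v2 k x1 where v2: "exec inp f (handle md) (W v1 N (cf(u := ?c2)) x) (W v2 (N(2 := k)) (cf(u := ?c2)) x1)"
    "k \<le> N 2" "mode_inv md p r ?c2 (N(2 := k)) x1" "hok inp x1"
    "\<And>c'. mode_result md p r c' x1 = mode_result md p r c' x"
    "st v2 = st v1" "an v2 = an v1" "ev v2 = ev v1" "ok v2 = ok v1" "okall v2 = okall v1" by blast
  have t2: "tied v2 (cf(u := ?c2))" using v1 v2 by (simp add: tied_def)
  have "\<exists>v3 k'. exec inp f (While (\<lambda>v b xs. ev v = 0) (Seq (simstep u) (handle md)))
        (W v2 (N(2 := k)) (cf(u := ?c2)) x1)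
        (W v3 (N(2 := k, 2 := k')) (cf(u := ?c2, u := c')) (mode_result md p r c' x1)) \<and>
      tied v3 (cf(u := ?c2, u := c')) \<and> ev v3 = (if b then 1 else 2) \<and> ok v3 = ok v2 \<and>
      okall v3 = okall v2 \<and> k' \<le> (N(2 := k)) 2"
  proof (rule go.IH[where x = x1 and cf = "cf(u := ?c2)" and v = v2 and N = "N(2 := k)"])
    show "hok inp x1" "tied v2 (cf(u := ?c2))" "mode_inv md p r ?c2 (N(2 := k)) x1" by fact+
    show "u < 6" "md = Before \<or> md = After \<longrightarrow> b" by fact+
    show "ev v2 = 0" using v1 v2 by simp
    show "(N(2 := k)) 2 < 2 ^ (s - 1)" using v2(2) go.prems(7) by simp
  qed simp
  then obtain v3 k' where v3: "exec inp f (While (\<lambda>v b xs. ev v = 0) (Seq (simstep u) (handle md))) (W v2 (N(2 := k)) (cf(u := ?c2)) x1)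
        (W v3 (N(2 := k')) (cf(u := c')) (mode_result md p r c' x))"
      "tied v3 (cf(u := c'))" "ev v3 = (if b then 1 else 2)" "ok v3 = ok v2" "okall v3 = okall v2" "k' \<le> k"
    unfolding fun_upd_upd fun_upd_same v2(5) by blast
  have "exec inp f (While (\<lambda>v b xs. ev v = 0) (Seq (simstep u) (handle md))) (W v N cf x)
        (W v3 (N(2 := k')) (cf(u := c')) (mode_result md p r c' x))"
    by (rule exec.While_True[OF _ exec.Seq[OF v1(1) v2(1)] v3(1)]) (use go in simp)
  then show ?case using v1 v2 v3
    by (intro exI[of _ v3] exI[of _ k']) (auto simp del: perform.simps fun_upd_apply)
qed

lemma exec_run:
  assumes "seg (mi u) (cf u) b c'" "hok inp x" "u < 6" "tied v cf" "mode_inv md p r (cf u) N x"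
    "N 2 < 2 ^ (s - 1)" "md = Before \<or> md = After \<longrightarrow> b"
  obtains v' k where "exec inp f (run u md) (W v N cf x)
        (W v' (N(2 := k)) (cf(u := c')) (mode_result md p r c' x))"
      "tied v' (cf(u := c'))" "ev v' = (if b then 1 else 2)" "ok v' = ok v" "okall v' = okall v" "k \<le> N 2"
proof -
  have "tied (v\<lparr>ev := 0\<rparr>) cf" using assms(4) by (simp add: tied_def)
  from exec_run_loop[OF assms(1) assms(2,3) _ this _ assms(5-7)]
  obtain v' k where v': "exec inp f (While (\<lambda>v b xs. ev v = 0) (Seq (simstep u) (handle md))) (W (v\<lparr>ev := 0\<rparr>) N cf x)
        (W v' (N(2 := k)) (cf(u := c')) (mode_result md p r c' x))"
      "tied v' (cf(u := c'))" "ev v' = (if b then 1 else 2)" "ok v' = ok v" "okall v' = okall v" "k \<le> N 2"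
    by auto
  have "exec inp f (run u md) (W v N cf x) (W v' (N(2 := k)) (cf(u := c')) (mode_result md p r c' x))"
    unfolding run_def by (rule exec.Seq[OF exec_Do v'(1)]) (use assms(2) in simp)
  then show thesis using that v' by blast
qed

text \<open>A whole computation with oracle \<open>g\<close>, cut at its queries. Segments do not
  mention an oracle, which is why the copies for the hybrid and those for the zero function can run
  the same code.\<close>

inductive chain :: "bool list list \<Rightarrow> (bool list \<Rightarrow> bool) \<Rightarrow> config \<Rightarrow> config \<Rightarrow> bool" for m g where
  stop: "seg m c False c' \<Longrightarrow> chain m g c c'"
| step: "seg m c True c1 \<Longrightarrow> chain m g (c1\<lparr>answer := g (last (asked c1))\<rparr>) c' \<Longrightarrow> chain m g c c'"

lemma chain_seg: "chain m g c c' \<Longrightarrow> \<exists>b c1. seg m c b c1"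
  by (erule chain.cases; blast)

lemma chain_asked: "chain m g c c' \<Longrightarrow> \<exists>ys. asked c' = asked c @ ys"
  by (induction rule: chain.induct) (auto dest: seg_True seg_False)

text \<open>Queries of the simulated copies are not stored. Copy 1 is copy 0 before it wrote its current
  query \<open>X\<close>, copy 5 is copy 4 before it wrote \<open>Y\<close>; rerunning them regenerates the first \<open>r\<close> bits
  of \<open>X\<close> and the bits of \<open>Y\<close> from position \<open>r\<close> on.\<close>

definition loop_body :: "(vars, cell) prog" where
  "loop_body = Seq (Do (copy_unit_op 1 2)) (Seq (Do (copy_bits_op 3 2)) (Seq (run 2 Before)
     (Seq (Do (copy_bits_op 3 2)) (Seq (run 5 After) (Seq (Do (effect_op (\<lambda>_. Ask)))
     (Seq (Do (set_op (\<lambda>v b xs. v\<lparr>ok := ok v \<or> b\<rparr>))) (run 4 Dry)))))))"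

definition inner_loop :: "(vars, cell) prog" where
  "inner_loop = Seq (Do (copy_unit_op 3 4)) (Seq (Do (copy_unit_op 3 5))
     (Seq (Do (set_op (\<lambda>v b xs. v\<lparr>ok := False\<rparr>))) (Seq (run 4 Dry)
       (While (\<lambda>v b xs. ev v = 1) loop_body))))"

text \<open>Used with the copies 2, 4 and 5, which are scratch in the inner loops; copies 0, 1 and 3
  have to survive them.\<close>

definition agree_off :: "nat set \<Rightarrow> (nat \<Rightarrow> 'a) \<Rightarrow> (nat \<Rightarrow> 'a) \<Rightarrow> bool" where
  "agree_off S g h \<longleftrightarrow> (\<forall>i. i \<notin> S \<longrightarrow> g i = h i)"

lemma agree_off_refl [simp]: "agree_off S g g" by (simp add: agree_off_def)

lemma agree_off_trans: "agree_off S g h \<Longrightarrow> agree_off S h k \<Longrightarrow> agree_off S g k"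
  by (simp add: agree_off_def)

text \<open>On entry copy 5 is one query behind copy 4. Rerunning copy 5 writes the end of the query
  between them and lets it catch up; then copy 4 runs ahead to the following query, which restores
  the relation.\<close>

lemma exec_loop_body:
  assumes hok: "hok inp x" and q: "query_tape x = []" and tied: "tied v cf"
    and main: "seg A (cf 1) True cx" "query_tape (cf 1) = []"
    and h: "seg B (cf 5) True (cf 4)" "query_tape (cf 5) = []" and h1: "seg B (cf 4) b h2"
    and N: "N 3 \<le> n"
  defines "y \<equiv> take (N 3) (last (asked cx)) @ drop (N 3) (last (asked (cf 4)))"
  shows "\<exists>v' k. exec inp f loop_body (W v N cf x)
     (W v' (N(2 := k)) (cf(2 := cx, 5 := cf 4, 4 := h2)) (x\<lparr>answer := f y, asked := asked x @ [y]\<rparr>)) \<and>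
     tied v' (cf(2 := cx, 5 := cf 4, 4 := h2)) \<and> ev v' = (if b then 1 else 2) \<and>
     ok v' = (ok v \<or> f y) \<and> okall v' = okall v \<and> k \<le> n"
proof -
  have mis: "mi 2 = A" "mi 1 = A" "mi 5 = B" "mi 4 = B" by (simp_all add: mi_def)
  have r: "N 3 < 2 ^ (s - 1)" using N n_s by simp
  define r where "r = N 3"
  let ?cf1 = "cf(2 := cf 1)"
  let ?v1 = "v\<lparr>st := (st v)(2 := st v 1), an := (an v)(2 := an v 1)\<rparr>"
  have 1: "exec inp f (Do (copy_unit_op 1 2)) (W v N cf x) (W ?v1 N ?cf1 x)"
    by (rule exec_Do, rule do_copy_unit_op) (use hok mis in auto)
  have t1: "tied ?v1 ?cf1" by (rule tied_copy[OF tied]) simp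
  let ?N1 = "N(2 := r)"
  have 2: "exec inp f (Do (copy_bits_op 3 2)) (W ?v1 N ?cf1 x) (W ?v1 ?N1 ?cf1 x)"
    unfolding r_def by (rule exec_Do, rule do_copy_bits_op) (use hok in auto)
  obtain v3 k3 where 3: "exec inp f (run 2 Before) (W ?v1 ?N1 ?cf1 x)
        (W v3 (?N1(2 := k3)) (?cf1(2 := cx)) (mode_result Before [] r cx x))"
      "tied v3 (?cf1(2 := cx))" "ok v3 = ok ?v1" "okall v3 = okall ?v1" "k3 \<le> ?N1 2"
    by (rule exec_run[of 2 ?cf1 True cx x ?v1 Before "[]" r ?N1])
       (use hok t1 main q mis r in \<open>auto simp: r_def\<close>)
  let ?cf3 = "cf(2 := cx)"
  let ?x3 = "x\<lparr>query_tape := take r (last (asked cx))\<rparr>"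
  have e3: "exec inp f (run 2 Before) (W ?v1 ?N1 ?cf1 x) (W v3 (N(2 := k3)) ?cf3 ?x3)" and t3: "tied v3 ?cf3"
    using 3 by simp_all
  have 4: "exec inp f (Do (copy_bits_op 3 2)) (W v3 (N(2 := k3)) ?cf3 ?x3) (W v3 ?N1 ?cf3 ?x3)"
    using do_copy_bits_op[of inp ?x3 3 2 f v3 z0 z1 s "N(2 := k3)" mi ?cf3] hok
    by (intro exec_Do) (simp add: r_def)
  obtain v5 k5 where 5: "exec inp f (run 5 After) (W v3 ?N1 ?cf3 ?x3)
        (W v5 (?N1(2 := k5)) (?cf3(5 := cf 4)) (mode_result After (take r (last (asked cx))) r (cf 4) ?x3))"
      "tied v5 (?cf3(5 := cf 4))" "ok v5 = ok v3" "okall v5 = okall v3" "k5 \<le> ?N1 2"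
    by (rule exec_run[of 5 ?cf3 True "cf 4" ?x3 v3 After "take r (last (asked cx))" r ?N1])
       (use hok t3 h q mis r in \<open>auto simp: r_def\<close>)
  let ?cf5 = "cf(2 := cx, 5 := cf 4)"
  let ?x5 = "x\<lparr>query_tape := y\<rparr>"
  have e5: "exec inp f (run 5 After) (W v3 ?N1 ?cf3 ?x3) (W v5 (N(2 := k5)) ?cf5 ?x5)" and t5: "tied v5 ?cf5"
    using 5 by (simp_all add: y_def r_def)
  let ?x6 = "x\<lparr>answer := f y, asked := asked x @ [y]\<rparr>"
  have x6: "perform f Ask ?x5 = ?x6" using q by (cases x) simp
  have 6: "exec inp f (Do (effect_op (\<lambda>_. Ask))) (W v5 (N(2 := k5)) ?cf5 ?x5) (W v5 (N(2 := k5)) ?cf5 ?x6)"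
    unfolding x6[symmetric] by (rule exec_Do, rule do_effect_op) (use hok in simp)
  let ?v7 = "v5\<lparr>ok := ok v5 \<or> f y\<rparr>"
  have 7: "exec inp f (Do (set_op (\<lambda>v b xs. v\<lparr>ok := ok v \<or> b\<rparr>))) (W v5 (N(2 := k5)) ?cf5 ?x6) (W ?v7 (N(2 := k5)) ?cf5 ?x6)"
    by (rule exec_Do) (use hok in simp)
  have t7: "tied ?v7 ?cf5" using t5 by (simp add: tied_def)
  obtain v8 k8 where 8: "exec inp f (run 4 Dry) (W ?v7 (N(2 := k5)) ?cf5 ?x6)
        (W v8 (N(2 := k5, 2 := k8)) (?cf5(4 := h2)) (mode_result Dry [] 0 h2 ?x6))"
      "tied v8 (?cf5(4 := h2))" "ev v8 = (if b then 1 else 2)" "ok v8 = ok ?v7" "okall v8 = okall ?v7" "k8 \<le> (N(2 := k5)) 2"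
    by (rule exec_run[of 4 ?cf5 b h2 ?x6 ?v7 Dry "[]" 0 "N(2 := k5)"])
       (use hok t7 h1 mis r 5 in \<open>auto simp: r_def\<close>)
  have "exec inp f loop_body (W v N cf x) (W v8 (N(2 := k8)) (?cf5(4 := h2)) ?x6)"
    unfolding loop_body_def using 8(1)
    by (intro exec.Seq[OF 1 exec.Seq[OF 2 exec.Seq[OF e3 exec.Seq[OF 4 exec.Seq[OF e5 exec.Seq[OF 6 exec.Seq[OF 7]]]]]]])
       simp
  moreover have "k8 \<le> n" using 8(6) 5(5) N by (simp add: r_def)
  ultimately show ?thesis using 8 5 3 by (intro exI[of _ v8] exI[of _ k8]) auto
qed

lemma exec_inner_while:
  assumes "chain B zero c hend"
  shows "cf 5 = c \<Longrightarrow> seg B (cf 5) b (cf 4) \<Longrightarrow> ev v = (if b then 1 else 2) \<Longrightarrow>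
    query_tape (cf 5) = [] \<Longrightarrow> hok inp x \<Longrightarrow> query_tape x = [] \<Longrightarrow> tied v cf \<Longrightarrow>
    seg A (cf 1) True cx \<Longrightarrow> query_tape (cf 1) = [] \<Longrightarrow> N 3 \<le> n \<Longrightarrow> N 2 \<le> n \<Longrightarrow>
    asked hend = asked c @ ys \<Longrightarrow> r = N 3 \<Longrightarrow> X = last (asked cx) \<Longrightarrow>
    \<exists>v' k cf' a. exec inp f (While (\<lambda>v b xs. ev v = 1) loop_body) (W v N cf x)
       (W v' (N(2 := k)) cf' (x\<lparr>answer := a, asked := asked x @ map (\<lambda>Y. take r X @ drop r Y) ys\<rparr>)) \<and>
      tied v' cf' \<and> agree_off {2, 4, 5} cf cf' \<and> k \<le> n \<and> okall v' = okall v \<and>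
      ok v' = (ok v \<or> (\<exists>Y\<in>set ys. f (take r X @ drop r Y)))"
  using assms
proof (induction arbitrary: v N cf x b ys rule: chain.induct)
  case (stop c c')
  have det: "\<not> b" "c' = cf 4"
  proof -
    show "\<not> b" "c' = cf 4" using seg_det[of B c False c' b "cf 4"] stop by auto
  qed
  then have "ys = []" using seg_False[OF stop(1)] stop.prems by simp
  moreover have "exec inp f (While (\<lambda>v b xs. ev v = 1) loop_body) (W v N cf x) (W v N cf x)"
    by (rule exec.While_False) (use det stop in simp)
  moreover have "N(2 := N 2) = N" "x\<lparr>answer := answer x, asked := asked x\<rparr> = x" by auto
  ultimately show ?case using stop.prems
    by (intro exI[of _ v] exI[of _ "N 2"] exI[of _ cf] exI[of _ "answer x"]) auto
next
  case (step c c1 c')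
  have b: "b" "c1 = cf 4" using seg_det[of B c True c1 b "cf 4"] step by auto
  obtain y where y: "asked c1 = asked c @ [y]" "query_tape c1 = []" "\<not> answer c1" using seg_True[OF step(1)] by auto
  \<comment> \<open>For the zero function the provisional answer is already the right one, so the
    next segment starts from \<open>c1\<close> itself.\<close>
  then have c1: "c1\<lparr>answer := False\<rparr> = c1" by (cases c1) simp
  have ch: "chain B zero c1 c'" using step(2) by (simp add: c1)
  obtain b2 h2 where h2: "seg B c1 b2 h2" using chain_seg[OF ch] by blast
  obtain zs where zs: "asked c' = asked c1 @ zs" using chain_asked[OF ch] by blast
  have ys: "ys = y # zs" using zs y step.prems by simp
  let ?z = "take (N 3) (last (asked cx)) @ drop (N 3) (last (asked (cf 4)))"
  have z: "?z = take r X @ drop r y" using y b step.prems by simp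
  let ?cf = "cf(2 := cx, 5 := cf 4, 4 := h2)"
  obtain v1 k1 where 1: "exec inp f loop_body (W v N cf x)
     (W v1 (N(2 := k1)) ?cf (x\<lparr>answer := f ?z, asked := asked x @ [?z]\<rparr>))"
     "tied v1 ?cf" "ev v1 = (if b2 then 1 else 2)"
     "ok v1 = (ok v \<or> f ?z)" "okall v1 = okall v" "k1 \<le> n"
    using exec_loop_body[of x v cf cx b2 h2 N] step.prems b h2 by auto
  let ?x1 = "x\<lparr>answer := f ?z, asked := asked x @ [?z]\<rparr>"
  have "\<exists>v2 k2 cf2 a2. exec inp f (While (\<lambda>v b xs. ev v = 1) loop_body) (W v1 (N(2 := k1)) ?cf ?x1)
       (W v2 (N(2 := k1, 2 := k2)) cf2 (?x1\<lparr>answer := a2, asked := asked ?x1 @ map (\<lambda>Y. take r X @ drop r Y) zs\<rparr>)) \<and>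
      tied v2 cf2 \<and> agree_off {2, 4, 5} ?cf cf2 \<and> k2 \<le> n \<and> okall v2 = okall v1 \<and>
      ok v2 = (ok v1 \<or> (\<exists>Y\<in>set zs. f (take r X @ drop r Y)))"
  proof (rule step.IH[where b = b2 and cf = ?cf and v = v1 and N = "N(2 := k1)" and x = ?x1])
    show "?cf 5 = c1\<lparr>answer := False\<rparr>" using c1 b by simp
    show "seg B (?cf 5) b2 (?cf 4)" "query_tape (?cf 5) = []" using h2 b y by simp_all
    show "seg A (?cf 1) True cx" "query_tape (?cf 1) = []" using step.prems by simp_all
    show "(N(2 := k1)) 3 \<le> n" "(N(2 := k1)) 2 \<le> n" "r = (N(2 := k1)) 3" using step.prems 1 by simp_all
    show "asked c' = asked (c1\<lparr>answer := False\<rparr>) @ zs" using zs by simp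
    show "tied v1 ?cf" by fact
  qed (use step.prems 1 in simp_all)
  then obtain v2 k2 cf2 a2 where 2: "exec inp f (While (\<lambda>v b xs. ev v = 1) loop_body) (W v1 (N(2 := k1)) ?cf ?x1)
       (W v2 (N(2 := k2)) cf2 (?x1\<lparr>answer := a2, asked := asked ?x1 @ map (\<lambda>Y. take r X @ drop r Y) zs\<rparr>))"
      "tied v2 cf2" "agree_off {2, 4, 5} ?cf cf2" "k2 \<le> n" "okall v2 = okall v1"
      "ok v2 = (ok v1 \<or> (\<exists>Y\<in>set zs. f (take r X @ drop r Y)))"
    unfolding fun_upd_upd by blast
  have "exec inp f (While (\<lambda>v b xs. ev v = 1) loop_body) (W v N cf x)
       (W v2 (N(2 := k2)) cf2 (?x1\<lparr>answer := a2, asked := asked ?x1 @ map (\<lambda>Y. take r X @ drop r Y) zs\<rparr>))"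
    by (rule exec.While_True[OF _ 1(1) 2(1)]) (use step.prems b in simp)
  moreover have "?x1\<lparr>answer := a2, asked := asked ?x1 @ map (\<lambda>Y. take r X @ drop r Y) zs\<rparr> =
      x\<lparr>answer := a2, asked := asked x @ map (\<lambda>Y. take r X @ drop r Y) ys\<rparr>"
    by (simp add: z ys)
  ultimately have E: "exec inp f (While (\<lambda>v b xs. ev v = 1) loop_body) (W v N cf x)
      (W v2 (N(2 := k2)) cf2 (x\<lparr>answer := a2, asked := asked x @ map (\<lambda>Y. take r X @ drop r Y) ys\<rparr>))"
    by (simp only:)
  show ?case
  proof (intro exI conjI)
    show "agree_off {2, 4, 5} cf cf2" using 2(3) by (auto simp: agree_off_def)
    show "okall v2 = okall v" using 2(5) 1(5) by simp
    show "ok v2 = (ok v \<or> (\<exists>Y\<in>set ys. f (take r X @ drop r Y)))"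
      using 2(6) 1(4) unfolding z ys by auto
  qed (fact E 2)+
qed

lemma exec_inner_loop:
  assumes hok: "hok inp x" and q: "query_tape x = []" and tied: "tied v cf"
    and main: "seg A (cf 1) True cx" "query_tape (cf 1) = []"
    and H: "chain B zero (cf 3) hend" "query_tape (cf 3) = []" "asked hend = asked (cf 3) @ ys"
    and N: "N 3 \<le> n" "N 2 \<le> n"
  shows "\<exists>v' k cf' a. exec inp f inner_loop (W v N cf x)
       (W v' (N(2 := k)) cf' (x\<lparr>answer := a,
          asked := asked x @ map (\<lambda>Y. take (N 3) (last (asked cx)) @ drop (N 3) Y) ys\<rparr>)) \<and>
      tied v' cf' \<and> agree_off {2, 4, 5} cf cf' \<and> k \<le> n \<and> okall v' = okall v \<and>
      ok v' = (\<exists>Y\<in>set ys. f (take (N 3) (last (asked cx)) @ drop (N 3) Y))"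
proof -
  have mis: "mi 3 = B" "mi 4 = B" "mi 5 = B" by (simp_all add: mi_def)
  obtain b h1 where h1: "seg B (cf 3) b h1" using chain_seg[OF H(1)] by blast
  let ?cf1 = "cf(4 := cf 3)"
  let ?v1 = "v\<lparr>st := (st v)(4 := st v 3), an := (an v)(4 := an v 3)\<rparr>"
  have 1: "exec inp f (Do (copy_unit_op 3 4)) (W v N cf x) (W ?v1 N ?cf1 x)"
    by (rule exec_Do, rule do_copy_unit_op) (use hok mis in auto)
  have t1: "tied ?v1 ?cf1" by (rule tied_copy[OF tied]) simp
  let ?cf2 = "?cf1(5 := ?cf1 3)"
  let ?v2 = "?v1\<lparr>st := (st ?v1)(5 := st ?v1 3), an := (an ?v1)(5 := an ?v1 3)\<rparr>"
  have 2: "exec inp f (Do (copy_unit_op 3 5)) (W ?v1 N ?cf1 x) (W ?v2 N ?cf2 x)"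
    by (rule exec_Do, rule do_copy_unit_op) (use hok mis in auto)
  have t2: "tied ?v2 ?cf2" by (rule tied_copy[OF t1]) simp
  let ?v3 = "?v2\<lparr>ok := False\<rparr>"
  have 3: "exec inp f (Do (set_op (\<lambda>v b xs. v\<lparr>ok := False\<rparr>))) (W ?v2 N ?cf2 x) (W ?v3 N ?cf2 x)"
    by (rule exec_Do) (use hok in simp)
  have t3: "tied ?v3 ?cf2" using t2 by (simp add: tied_def)
  have s4: "seg (mi 4) (?cf2 4) b h1" using h1 mis by simp
  have N2: "N 2 < 2 ^ (s - 1)" using N n_s by simp
  obtain v4 k4 where 4: "exec inp f (run 4 Dry) (W ?v3 N ?cf2 x)
        (W v4 (N(2 := k4)) (?cf2(4 := h1)) (mode_result Dry [] 0 h1 x))"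
      "tied v4 (?cf2(4 := h1))" "ev v4 = (if b then 1 else 2)" "ok v4 = ok ?v3" "okall v4 = okall ?v3" "k4 \<le> N 2"
    by (rule exec_run[OF s4 hok _ t3, of Dry "[]" 0 N]) (use N2 in auto)
  let ?cf4 = "?cf2(4 := h1)"
  have "\<exists>v' k cf' a. exec inp f (While (\<lambda>v b xs. ev v = 1) loop_body) (W v4 (N(2 := k4)) ?cf4 x)
       (W v' (N(2 := k4, 2 := k)) cf' (x\<lparr>answer := a, asked := asked x @ map (\<lambda>Y. take (N 3) (last (asked cx)) @ drop (N 3) Y) ys\<rparr>)) \<and>
      tied v' cf' \<and> agree_off {2, 4, 5} ?cf4 cf' \<and> k \<le> n \<and> okall v' = okall v4 \<and>
      ok v' = (ok v4 \<or> (\<exists>Y\<in>set ys. f (take (N 3) (last (asked cx)) @ drop (N 3) Y)))"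
  proof (rule exec_inner_while[OF H(1), where b = b and cf = ?cf4 and v = v4 and N = "N(2 := k4)" and x = x and cx = cx])
    show "seg B (?cf4 5) b (?cf4 4)" using h1 by simp
    show "seg A (?cf4 1) True cx" using main by simp
    show "tied v4 ?cf4" by fact
    show "(N(2 := k4)) 2 \<le> n" using 4(6) N by simp
  qed (use H N 4 main hok q in simp_all)
  then obtain v5 k5 cf5 a5 where 5: "exec inp f (While (\<lambda>v b xs. ev v = 1) loop_body) (W v4 (N(2 := k4)) ?cf4 x)
       (W v5 (N(2 := k5)) cf5 (x\<lparr>answer := a5, asked := asked x @ map (\<lambda>Y. take (N 3) (last (asked cx)) @ drop (N 3) Y) ys\<rparr>))"
      "tied v5 cf5" "agree_off {2, 4, 5} ?cf4 cf5" "k5 \<le> n" "okall v5 = okall v4"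
      "ok v5 = (ok v4 \<or> (\<exists>Y\<in>set ys. f (take (N 3) (last (asked cx)) @ drop (N 3) Y)))"
    unfolding fun_upd_upd by blast
  have "exec inp f inner_loop (W v N cf x)
       (W v5 (N(2 := k5)) cf5 (x\<lparr>answer := a5, asked := asked x @ map (\<lambda>Y. take (N 3) (last (asked cx)) @ drop (N 3) Y) ys\<rparr>))"
    unfolding inner_loop_def
    by (rule exec.Seq[OF 1 exec.Seq[OF 2 exec.Seq[OF 3 exec.Seq[OF 4(1)[unfolded mode_result.simps] 5(1)]]]])
  moreover have "agree_off {2, 4, 5} cf cf5" using 5(3) by (auto simp: agree_off_def)
  ultimately show ?thesis using 4 5
    by (intro exI[of _ v5] exI[of _ k5] exI[of _ cf5] exI[of _ a5]) simp
qed

definition outer_step :: "(vars, cell) prog" where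
  "outer_step = Seq inner_loop (Seq (Do (set_op (\<lambda>v b xs. v\<lparr>okall := okall v \<and> ok v\<rparr>))) (Do (dec_op 3)))"

definition outer_loop :: "(vars, cell) prog" where
  "outer_loop = Seq (Do (copy_bits_op 0 3)) (Seq (Do (set_op (\<lambda>v b xs. v\<lparr>okall := True, flag := False\<rparr>)))
     (While (\<lambda>v b xs. \<not> flag v) outer_step))"

text \<open>\<open>r\<close> runs downwards because counters can only be decremented. The pass for
  \<open>r = 0\<close> is included: \<open>dec_op\<close> raises the flag when it finds the counter
  at 0, not when it arrives there.\<close>

lemma exec_outer_while:
  assumes "r = N 3"
  shows "\<not> flag v \<Longrightarrow> hok inp x \<Longrightarrow> query_tape x = [] \<Longrightarrow> tied v cf \<Longrightarrow>
    seg A (cf 1) True cx \<Longrightarrow> query_tape (cf 1) = [] \<Longrightarrow>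
    chain B zero (cf 3) hend \<Longrightarrow> query_tape (cf 3) = [] \<Longrightarrow> asked hend = asked (cf 3) @ ys \<Longrightarrow>
    N 3 \<le> n \<Longrightarrow> N 2 \<le> n \<Longrightarrow> X = last (asked cx) \<Longrightarrow>
    \<exists>v' k cf' a l. exec inp f (While (\<lambda>v b xs. \<not> flag v) outer_step) (W v N cf x)
       (W v' (N(2 := k, 3 := 0)) cf' (x\<lparr>answer := a, asked := asked x @ l\<rparr>)) \<and>
      tied v' cf' \<and> agree_off {2, 4, 5} cf cf' \<and> k \<le> n \<and>
      okall v' = (okall v \<and> (\<forall>r'\<le>r. \<exists>Y\<in>set ys. f (take r' X @ drop r' Y))) \<and>
      set l = {take r' X @ drop r' Y | r' Y. r' \<le> r \<and> Y \<in> set ys}"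
  using assms
proof (induction r arbitrary: v N cf x)
  case 0
  from exec_inner_loop[OF 0(2-11), folded 0(12)]
  obtain v1 k1 cf1 a1 where 1: "exec inp f inner_loop (W v N cf x)
       (W v1 (N(2 := k1)) cf1 (x\<lparr>answer := a1,
          asked := asked x @ map (\<lambda>Y. take (N 3) X @ drop (N 3) Y) ys\<rparr>))"
      "tied v1 cf1" "agree_off {2, 4, 5} cf cf1" "k1 \<le> n" "okall v1 = okall v"
      "ok v1 = (\<exists>Y\<in>set ys. f (take (N 3) X @ drop (N 3) Y))" by blast
  let ?x1 = "x\<lparr>answer := a1, asked := asked x @ map (\<lambda>Y. take (N 3) X @ drop (N 3) Y) ys\<rparr>"
  let ?v2 = "v1\<lparr>okall := okall v1 \<and> ok v1\<rparr>"
  have 2: "exec inp f (Do (set_op (\<lambda>v b xs. v\<lparr>okall := okall v \<and> ok v\<rparr>))) (W v1 (N(2 := k1)) cf1 ?x1) (W ?v2 (N(2 := k1)) cf1 ?x1)"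
    by (rule exec_Do) (use 0 in simp)
  let ?v3 = "?v2\<lparr>flag := True\<rparr>"
  have 3: "exec inp f (Do (dec_op 3)) (W ?v2 (N(2 := k1)) cf1 ?x1) (W ?v3 (N(2 := k1, 3 := 0)) cf1 ?x1)"
    using do_dec_op[of inp ?x1 3 z0 "N(2 := k1)" s f ?v2 z1 mi cf1] 0 z0
    by (intro exec_Do) (simp add: off_def)
  show ?case
  proof (intro exI conjI)
    show "exec inp f (While (\<lambda>v b xs. \<not> flag v) outer_step) (W v N cf x) (W ?v3 (N(2 := k1, 3 := 0)) cf1 ?x1)"
      by (rule exec.While_True[OF _ exec.Seq[OF 1(1) exec.Seq[OF 2 3], folded outer_step_def] exec.While_False])
         (use 0 in simp_all)
    show "tied ?v3 cf1" using 1 by (simp add: tied_def)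
    show "okall ?v3 = (okall v \<and> (\<forall>r'\<le>0. \<exists>Y\<in>set ys. f (take r' X @ drop r' Y)))" using 1 0 by simp
  qed (use 1 0 in auto)
next
  case (Suc r)
  from exec_inner_loop[OF Suc.prems(2-11), folded Suc.prems(12)]
  obtain v1 k1 cf1 a1 where 1: "exec inp f inner_loop (W v N cf x)
       (W v1 (N(2 := k1)) cf1 (x\<lparr>answer := a1,
          asked := asked x @ map (\<lambda>Y. take (N 3) X @ drop (N 3) Y) ys\<rparr>))"
      "tied v1 cf1" "agree_off {2, 4, 5} cf cf1" "k1 \<le> n" "okall v1 = okall v"
      "ok v1 = (\<exists>Y\<in>set ys. f (take (N 3) X @ drop (N 3) Y))" by blast
  let ?x1 = "x\<lparr>answer := a1, asked := asked x @ map (\<lambda>Y. take (N 3) X @ drop (N 3) Y) ys\<rparr>"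
  let ?v2 = "v1\<lparr>okall := okall v1 \<and> ok v1\<rparr>"
  have 2: "exec inp f (Do (set_op (\<lambda>v b xs. v\<lparr>okall := okall v \<and> ok v\<rparr>))) (W v1 (N(2 := k1)) cf1 ?x1) (W ?v2 (N(2 := k1)) cf1 ?x1)"
    by (rule exec_Do) (use Suc.prems in simp)
  let ?v3 = "?v2\<lparr>flag := False\<rparr>"
  let ?N3 = "N(2 := k1, 3 := r)"
  have 3: "exec inp f (Do (dec_op 3)) (W ?v2 (N(2 := k1)) cf1 ?x1) (W ?v3 ?N3 cf1 ?x1)"
  proof (rule exec_Do)
    have "N 3 - 1 = r" "N 3 \<noteq> 0" using Suc.prems(13) by simp_all
    then show "do_op inp f (dec_op 3) (W ?v2 (N(2 := k1)) cf1 ?x1) = W ?v3 ?N3 cf1 ?x1"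
      using do_dec_op[of inp ?x1 3 z0 "N(2 := k1)" s f ?v2 z1 mi cf1] Suc.prems(2,10) z0 n_s
      by (simp add: off_def)
  qed
  have t3: "tied ?v3 cf1" using 1 by (simp add: tied_def)
  have cf1: "cf1 1 = cf 1" "cf1 3 = cf 3" using 1(3) by (auto simp: agree_off_def)
  have "\<exists>v' k cf' a l. exec inp f (While (\<lambda>v b xs. \<not> flag v) outer_step) (W ?v3 ?N3 cf1 ?x1)
       (W v' (?N3(2 := k, 3 := 0)) cf' (?x1\<lparr>answer := a, asked := asked ?x1 @ l\<rparr>)) \<and>
      tied v' cf' \<and> agree_off {2, 4, 5} cf1 cf' \<and> k \<le> n \<and>
      okall v' = (okall ?v3 \<and> (\<forall>r'\<le>r. \<exists>Y\<in>set ys. f (take r' X @ drop r' Y))) \<and>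
      set l = {take r' X @ drop r' Y | r' Y. r' \<le> r \<and> Y \<in> set ys}"
  proof (rule Suc.IH[where v = ?v3 and N = ?N3 and cf = cf1 and x = ?x1])
    show "tied ?v3 cf1" by (rule t3)
    show "seg A (cf1 1) True cx" "query_tape (cf1 1) = []" "chain B zero (cf1 3) hend" "query_tape (cf1 3) = []"
      "asked hend = asked (cf1 3) @ ys" unfolding cf1 using Suc.prems by simp_all
  qed (use Suc.prems 1 in simp_all)
  then obtain v4 k4 cf4 a4 l where 4: "exec inp f (While (\<lambda>v b xs. \<not> flag v) outer_step) (W ?v3 ?N3 cf1 ?x1)
       (W v4 (?N3(2 := k4, 3 := 0)) cf4 (?x1\<lparr>answer := a4, asked := asked ?x1 @ l\<rparr>))"
      "tied v4 cf4" "agree_off {2, 4, 5} cf1 cf4" "k4 \<le> n"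
      "okall v4 = (okall ?v3 \<and> (\<forall>r'\<le>r. \<exists>Y\<in>set ys. f (take r' X @ drop r' Y)))"
      "set l = {take r' X @ drop r' Y | r' Y. r' \<le> r \<and> Y \<in> set ys}" by blast
  have N4: "?N3(2 := k4, 3 := 0) = N(2 := k4, 3 := 0)" by auto
  have "exec inp f (While (\<lambda>v b xs. \<not> flag v) outer_step) (W v N cf x)
     (W v4 (N(2 := k4, 3 := 0)) cf4 (?x1\<lparr>answer := a4, asked := asked ?x1 @ l\<rparr>))"
    by (rule exec.While_True[OF _ exec.Seq[OF 1(1) exec.Seq[OF 2 3], folded outer_step_def] 4(1)[unfolded N4]])
       (use Suc.prems in simp)
  moreover have "agree_off {2, 4, 5} cf cf4" by (rule agree_off_trans[OF 1(3) 4(3)])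
  moreover have "okall v4 = (okall v \<and> (\<forall>r'\<le>Suc r. \<exists>Y\<in>set ys. f (take r' X @ drop r' Y)))"
  proof -
    have "(\<forall>r'\<le>Suc r. P r') = (P (Suc r) \<and> (\<forall>r'\<le>r. P r'))" for P by (auto simp: le_Suc_eq)
    then show ?thesis using 4(5) 1(5,6) unfolding Suc.prems(13)[symmetric] by simp
  qed
  moreover have "set (map (\<lambda>Y. take (N 3) X @ drop (N 3) Y) ys @ l) = {take r' X @ drop r' Y | r' Y. r' \<le> Suc r \<and> Y \<in> set ys}"
    unfolding set_append 4(6) Suc.prems(13)[symmetric] by (auto simp: le_Suc_eq)
  moreover have "?x1\<lparr>answer := a4, asked := asked ?x1 @ l\<rparr> =
      x\<lparr>answer := a4, asked := asked x @ (map (\<lambda>Y. take (N 3) X @ drop (N 3) Y) ys @ l)\<rparr>" by simp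
  ultimately show ?case using 4(2,4) by (intro exI conjI) (simp only:)+
qed

text \<open>On entry copy 0 has just asked its query and copy 1 is still before it. Copy 0 receives
  the value of the hybrid as answer; copy 1 is set to this point before copy 0 proceeds, so it is
  again one segment behind.\<close>

definition main_step :: "(vars, cell) prog" where
  "main_step = Seq outer_loop (Seq (Do (set_op (\<lambda>v b xs. v\<lparr>an := (an v)(0 := okall v)\<rparr>)))
     (Seq (Do (copy_unit_op 0 1)) (run 0 Emitting)))"

definition main_loop :: "(vars, cell) prog" where
  "main_loop = Seq (run 0 Emitting) (While (\<lambda>v b xs. ev v = 1) main_step)"

definition splice :: "bool list set \<Rightarrow> (bool list \<Rightarrow> bool) \<Rightarrow> bool list \<Rightarrow> bool" where
  "splice H g X \<longleftrightarrow> (\<forall>r\<le>n. \<exists>Y\<in>H. g (take r X @ drop r Y))"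

lemma exec_main_step:
  assumes hok: "hok inp x" and q: "query_tape x = []" and tied: "tied v cf"
    and main: "seg A (cf 1) True (cf 0)" "query_tape (cf 1) = []" "out x = out (cf 0)"
    and H: "chain B zero (cf 3) hend" "query_tape (cf 3) = []" "asked hend = asked (cf 3) @ ys"
    and N: "N 0 = n" "N 3 \<le> n" "N 2 \<le> n"
  defines "c2 \<equiv> (cf 0)\<lparr>answer := splice (set ys) f (last (asked (cf 0)))\<rparr>"
  assumes c3: "seg A c2 b c3"
  shows "\<exists>v' N' cf' a l. exec inp f main_step (W v N cf x)
       (W v' N' cf' (x\<lparr>answer := a, asked := asked x @ l, out := out c3\<rparr>)) \<and>
      tied v' cf' \<and> cf' 0 = c3 \<and> cf' 1 = c2 \<and> cf' 3 = cf 3 \<and> ev v' = (if b then 1 else 2) \<and>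
      N' 0 = n \<and> N' 3 \<le> n \<and> N' 2 \<le> n \<and>
      set l = {take r (last (asked (cf 0))) @ drop r Y | r Y. r \<le> n \<and> Y \<in> set ys}"
proof -
  let ?X = "last (asked (cf 0))"
  let ?N1 = "N(3 := n)"
  have 1: "exec inp f (Do (copy_bits_op 0 3)) (W v N cf x) (W v ?N1 cf x)"
    using do_copy_bits_op[of inp x 0 3 f v z0 z1 s N mi cf] hok N by (intro exec_Do) simp
  let ?v2 = "v\<lparr>okall := True, flag := False\<rparr>"
  have 2: "exec inp f (Do (set_op (\<lambda>v b xs. v\<lparr>okall := True, flag := False\<rparr>))) (W v ?N1 cf x) (W ?v2 ?N1 cf x)"
    by (rule exec_Do) (use hok in simp)
  have t2: "tied ?v2 cf" using tied by (simp add: tied_def)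
  have "\<exists>v' k cf' a l. exec inp f (While (\<lambda>v b xs. \<not> flag v) outer_step) (W ?v2 ?N1 cf x)
       (W v' (?N1(2 := k, 3 := 0)) cf' (x\<lparr>answer := a, asked := asked x @ l\<rparr>)) \<and>
      tied v' cf' \<and> agree_off {2, 4, 5} cf cf' \<and> k \<le> n \<and>
      okall v' = (okall ?v2 \<and> (\<forall>r'\<le>n. \<exists>Y\<in>set ys. f (take r' ?X @ drop r' Y))) \<and>
      set l = {take r' ?X @ drop r' Y | r' Y. r' \<le> n \<and> Y \<in> set ys}"
    by (rule exec_outer_while[where cx = "cf 0" and hend = hend]) (use t2 hok q main H N in simp_all)
  then obtain v3 k3 cf3 a3 l where 3: "exec inp f (While (\<lambda>v b xs. \<not> flag v) outer_step) (W ?v2 ?N1 cf x)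
       (W v3 (?N1(2 := k3, 3 := 0)) cf3 (x\<lparr>answer := a3, asked := asked x @ l\<rparr>))"
      "tied v3 cf3" "agree_off {2, 4, 5} cf cf3" "k3 \<le> n"
      "okall v3 = (okall ?v2 \<and> (\<forall>r'\<le>n. \<exists>Y\<in>set ys. f (take r' ?X @ drop r' Y)))"
      "set l = {take r' ?X @ drop r' Y | r' Y. r' \<le> n \<and> Y \<in> set ys}"
    by blast
  have okall: "okall v3 = splice (set ys) f ?X" using 3(5) by (simp add: splice_def)
  let ?N3 = "?N1(2 := k3, 3 := 0)"
  let ?x3 = "x\<lparr>answer := a3, asked := asked x @ l\<rparr>"
  have cf3: "cf3 0 = cf 0" "cf3 1 = cf 1" "cf3 3 = cf 3" using 3(3) by (auto simp: agree_off_def)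
  let ?v4 = "v3\<lparr>an := (an v3)(0 := okall v3)\<rparr>"
  let ?cf4 = "cf3(0 := c2)"
  \<comment> \<open>Answers are kept in the finite control and not in the cells, so replacing one
    leaves the tape as it is.\<close>
  have cells: "cells_of z0 z1 s ?N3 mi ?cf4 = cells_of z0 z1 s ?N3 mi cf3"
  proof -
    have "tpc m c2 = tpc m (cf3 0)" "hpc c2 = hpc (cf3 0)" for m
      by (simp_all add: cf3 c2_def tpc_def hpc_def fun_eq_iff)
    then have "CELL z0 z1 ?N3 mi ?cf4 j = CELL z0 z1 ?N3 mi cf3 j" for j
      unfolding CELL_def by (auto intro!: ext)
    then show ?thesis by (simp add: cells_of_def)
  qed
  have 4: "exec inp f (Do (set_op (\<lambda>v b xs. v\<lparr>an := (an v)(0 := okall v)\<rparr>))) (W v3 ?N3 cf3 ?x3) (W ?v4 ?N3 ?cf4 ?x3)"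
    unfolding cells by (rule exec_Do) (use hok in simp)
  have t4: "tied ?v4 ?cf4" using 3(2) okall cf3 by (simp add: tied_def c2_def)
  let ?cf5 = "?cf4(1 := ?cf4 0)"
  let ?v5 = "?v4\<lparr>st := (st ?v4)(1 := st ?v4 0), an := (an ?v4)(1 := an ?v4 0)\<rparr>"
  have 5: "exec inp f (Do (copy_unit_op 0 1)) (W ?v4 ?N3 ?cf4 ?x3) (W ?v5 ?N3 ?cf5 ?x3)"
    by (rule exec_Do, rule do_copy_unit_op) (use hok in \<open>auto simp: mi_def\<close>)
  have t5: "tied ?v5 ?cf5" by (rule tied_copy[OF t4]) simp
  have s6: "seg (mi 0) (?cf5 0) b c3" using c3 by (simp add: mi_def)
  have N2: "?N3 2 < 2 ^ (s - 1)" using 3(4) n_s by simp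
  obtain v6 k6 where 6: "exec inp f (run 0 Emitting) (W ?v5 ?N3 ?cf5 ?x3)
        (W v6 (?N3(2 := k6)) (?cf5(0 := c3)) (mode_result Emitting [] 0 c3 ?x3))"
      "tied v6 (?cf5(0 := c3))" "ev v6 = (if b then 1 else 2)" "k6 \<le> ?N3 2"
    by (rule exec_run[OF s6 _ _ t5, of ?x3 Emitting "[]" 0 ?N3])
       (use N2 hok main in \<open>auto simp: c2_def\<close>)
  have "exec inp f main_step (W v N cf x) (W v6 (?N3(2 := k6)) (?cf5(0 := c3)) (?x3\<lparr>out := out c3\<rparr>))"
    unfolding main_step_def outer_loop_def
    by (rule exec.Seq[OF exec.Seq[OF 1 exec.Seq[OF 2 3(1)]] exec.Seq[OF 4 exec.Seq[OF 5 6(1)[unfolded mode_result.simps]]]])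
  moreover have "?x3\<lparr>out := out c3\<rparr> = x\<lparr>answer := a3, asked := asked x @ l, out := out c3\<rparr>" by simp
  ultimately have E: "exec inp f main_step (W v N cf x) (W v6 (?N3(2 := k6)) (?cf5(0 := c3))
      (x\<lparr>answer := a3, asked := asked x @ l, out := out c3\<rparr>))" by (simp only:)
  show ?thesis
  proof (intro exI conjI)
    show "(?N3(2 := k6)) 0 = n" "(?N3(2 := k6)) 3 \<le> n" "(?N3(2 := k6)) 2 \<le> n"
      using 6(4) 3(4) N by simp_all
    show "(?cf5(0 := c3)) 0 = c3" "(?cf5(0 := c3)) 1 = c2" "(?cf5(0 := c3)) 3 = cf 3"
      using cf3 by simp_all
  qed (fact E 3 6)+
qed

lemma exec_main_while:
  assumes "chain A (splice (set ys) f) c cend"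
  shows "cf 1 = c \<Longrightarrow> seg A (cf 1) b (cf 0) \<Longrightarrow> ev v = (if b then 1 else 2) \<Longrightarrow> query_tape (cf 1) = [] \<Longrightarrow>
    hok inp x \<Longrightarrow> query_tape x = [] \<Longrightarrow> tied v cf \<Longrightarrow> out x = out (cf 0) \<Longrightarrow>
    chain B zero (cf 3) hend \<Longrightarrow> query_tape (cf 3) = [] \<Longrightarrow> asked hend = asked (cf 3) @ ys \<Longrightarrow>
    N 0 = n \<Longrightarrow> N 3 \<le> n \<Longrightarrow> N 2 \<le> n \<Longrightarrow> asked cend = asked c @ zs \<Longrightarrow>
    \<exists>v' N' cf' x'. exec inp f (While (\<lambda>v b xs. ev v = 1) main_step) (W v N cf x) (W v' N' cf' x') \<and>
      out x' = out cend \<and>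
      set (asked x') = set (asked x) \<union> {take r X @ drop r Y | r X Y. r \<le> n \<and> X \<in> set zs \<and> Y \<in> set ys}"
  using assms
proof (induction arbitrary: v N cf x b zs rule: chain.induct)
  case (stop c c')
  have det: "\<not> b" "c' = cf 0" using seg_det[of A c False c' b "cf 0"] stop by auto
  then have "zs = []" using seg_False[OF stop(1)] stop.prems by simp
  moreover have "exec inp f (While (\<lambda>v b xs. ev v = 1) main_step) (W v N cf x) (W v N cf x)"
    by (rule exec.While_False) (use det stop in simp)
  ultimately show ?case using stop.prems det
    by (intro exI[of _ v] exI[of _ N] exI[of _ cf] exI[of _ x]) auto
next
  case (step c c1 c')
  have b: "b" "c1 = cf 0" using seg_det[of A c True c1 b "cf 0"] step by auto
  obtain y where y: "asked c1 = asked c @ [y]" "query_tape c1 = []" using seg_True[OF step(1)] by auto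
  let ?c2 = "c1\<lparr>answer := splice (set ys) f (last (asked c1))\<rparr>"
  obtain b2 c3 where c3: "seg A ?c2 b2 c3" using chain_seg[OF step(2)] by blast
  obtain zs' where zs': "asked c' = asked ?c2 @ zs'" using chain_asked[OF step(2)] by blast
  have zs: "zs = y # zs'" using zs' y step.prems by simp
  have "\<exists>v' N' cf' a l. exec inp f main_step (W v N cf x)
       (W v' N' cf' (x\<lparr>answer := a, asked := asked x @ l, out := out c3\<rparr>)) \<and>
      tied v' cf' \<and> cf' 0 = c3 \<and> cf' 1 = ?c2 \<and> cf' 3 = cf 3 \<and> ev v' = (if b2 then 1 else 2) \<and>
      N' 0 = n \<and> N' 3 \<le> n \<and> N' 2 \<le> n \<and>
      set l = {take r (last (asked c1)) @ drop r Y | r Y. r \<le> n \<and> Y \<in> set ys}"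
    unfolding b(2) by (rule exec_main_step[where hend = hend]) (use step.prems b c3 in simp_all)
  then obtain v1 N1 cf1 a1 l1 where 1: "exec inp f main_step (W v N cf x)
       (W v1 N1 cf1 (x\<lparr>answer := a1, asked := asked x @ l1, out := out c3\<rparr>))"
      "tied v1 cf1" "cf1 0 = c3" "cf1 1 = ?c2" "cf1 3 = cf 3" "ev v1 = (if b2 then 1 else 2)"
      "N1 0 = n" "N1 3 \<le> n" "N1 2 \<le> n"
      "set l1 = {take r y @ drop r Y | r Y. r \<le> n \<and> Y \<in> set ys}" using y by auto
  let ?x1 = "x\<lparr>answer := a1, asked := asked x @ l1, out := out c3\<rparr>"
  have "\<exists>v' N' cf' x'. exec inp f (While (\<lambda>v b xs. ev v = 1) main_step) (W v1 N1 cf1 ?x1) (W v' N' cf' x') \<and>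
      out x' = out c' \<and>
      set (asked x') = set (asked ?x1) \<union> {take r X @ drop r Y | r X Y. r \<le> n \<and> X \<in> set zs' \<and> Y \<in> set ys}"
    by (rule step.IH[where b = b2]) (use step.prems 1 c3 y zs' in simp_all)
  then obtain v2 N2 cf2 x2 where 2: "exec inp f (While (\<lambda>v b xs. ev v = 1) main_step) (W v1 N1 cf1 ?x1) (W v2 N2 cf2 x2)"
      "out x2 = out c'"
      "set (asked x2) = set (asked ?x1) \<union> {take r X @ drop r Y | r X Y. r \<le> n \<and> X \<in> set zs' \<and> Y \<in> set ys}" by blast
  have "exec inp f (While (\<lambda>v b xs. ev v = 1) main_step) (W v N cf x) (W v2 N2 cf2 x2)"
    by (rule exec.While_True[OF _ 1(1) 2(1)]) (use step.prems b in simp)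
  moreover have "set (asked x2) = set (asked x) \<union> {take r X @ drop r Y | r X Y. r \<le> n \<and> X \<in> set zs \<and> Y \<in> set ys}"
    unfolding 2(3) zs using 1(10) by auto
  ultimately show ?case using 2(2) by blast
qed

lemma exec_main_loop:
  assumes A: "chain A (splice (set ys) f) (cf 1) cend" "query_tape (cf 1) = []" "asked cend = asked (cf 1) @ zs"
    and B: "chain B zero (cf 3) hend" "query_tape (cf 3) = []" "asked hend = asked (cf 3) @ ys"
    and cf: "cf 0 = cf 1" "out x = out (cf 0)" "tied v cf"
    and x: "hok inp x" "query_tape x = []" and N: "N 0 = n" "N 3 \<le> n" "N 2 \<le> n"
  shows "\<exists>v' N' cf' x'. exec inp f main_loop (W v N cf x) (W v' N' cf' x') \<and> out x' = out cend \<and>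
      set (asked x') = set (asked x) \<union> {take r X @ drop r Y | r X Y. r \<le> n \<and> X \<in> set zs \<and> Y \<in> set ys}"
proof -
  obtain b c1 where c1: "seg A (cf 1) b c1" using chain_seg[OF A(1)] by blast
  then have s: "seg (mi 0) (cf 0) b c1" by (simp add: mi_def cf)
  have N2: "N 2 < 2 ^ (s - 1)" using N n_s by simp
  obtain v1 k1 where 1: "exec inp f (run 0 Emitting) (W v N cf x)
        (W v1 (N(2 := k1)) (cf(0 := c1)) (mode_result Emitting [] 0 c1 x))"
      "tied v1 (cf(0 := c1))" "ev v1 = (if b then 1 else 2)" "k1 \<le> N 2"
    by (rule exec_run[OF s x(1) _ cf(3), of Emitting "[]" 0 N]) (use N2 cf in auto)
  let ?x1 = "x\<lparr>out := out c1\<rparr>"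
  have "\<exists>v' N' cf' x'. exec inp f (While (\<lambda>v b xs. ev v = 1) main_step) (W v1 (N(2 := k1)) (cf(0 := c1)) ?x1) (W v' N' cf' x') \<and>
      out x' = out cend \<and>
      set (asked x') = set (asked ?x1) \<union> {take r X @ drop r Y | r X Y. r \<le> n \<and> X \<in> set zs \<and> Y \<in> set ys}"
    by (rule exec_main_while[OF A(1), where b = b and hend = hend]) (use c1 1 A B x N in simp_all)
  then show ?thesis unfolding main_loop_def using exec.Seq[OF 1(1)[unfolded mode_result.simps]] by fastforce
qed

end

section \<open>Binary numerals on input tapes\<close>

lemma binary_0 [simp]: "binary 0 = []" by (simp add: binary.simps)

lemma binary_nth: "i < length (binary n) \<Longrightarrow> binary n ! i = bit n i"
proof (induction n arbitrary: i rule: binary.induct)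
  case (1 n)
  have "n \<noteq> 0"
  proof
    assume "n = 0" then show False using 1(2) by simp
  qed
  then show ?case using 1 by (cases i) (auto simp: binary.simps[of n] bit_0 bit_Suc)
qed

lemma less_power_length_binary: "n < 2 ^ length (binary n)"
proof (induction n rule: binary.induct)
  case (1 n)
  show ?case
  proof (cases "n = 0")
    case False
    then have "n div 2 < 2 ^ length (binary (n div 2))" using 1 by blast
    then have "n < 2 * 2 ^ length (binary (n div 2))" by linarith
    then show ?thesis using False by (simp add: binary.simps[of n])
  qed simp
qed

lemma power_length_binary_le: "n > 0 \<Longrightarrow> 2 ^ length (binary n) \<le> 2 * n"
proof (induction n rule: binary.induct)
  case (1 n)
  show ?case
  proof (cases "n div 2 = 0")
    case True
    then have "n = 1" using 1 by auto
    then show ?thesis by (simp add: binary.simps)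
  next
    case False
    then have "2 ^ length (binary (n div 2)) \<le> 2 * (n div 2)" using 1 by auto
    then have "2 * 2 ^ length (binary (n div 2)) \<le> 2 * n" by linarith
    then show ?thesis using 1 by (simp add: binary.simps[of n])
  qed
qed

lemma length_binary_pos: "n > 0 \<Longrightarrow> length (binary n) > 0"
  by (simp add: binary.simps[of n])

lemma length_binary_power: "length (binary (2 ^ E)) = Suc E"
proof (induction E)
  case 0
  show ?case by (simp add: binary.simps)
next
  case (Suc E)
  then show ?case by (simp add: binary.simps[of "2 * 2 ^ E"])
qed

lemma not_bit_less_power:
  fixes N :: nat
  assumes "N < 2 ^ m" "m \<le> i" shows "\<not> bit N i"
proof -
  have "(2::nat) ^ m \<le> 2 ^ i" using assms(2) by (rule power_increasing) simp
  then have "N < 2 ^ i" using assms(1) by linarith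
  then show ?thesis by (simp add: bit_iff_odd)
qed

lemma read_input_binary:
  "read_input (binary n) j =
    (if j = 0 then LeftEnd else if j \<le> length (binary n) then Bit (bit n (j - 1)) else RightEnd)"
  by (auto simp: read_input_def binary_nth)

text \<open>Symbol \<open>j\<close> of a power of two depends only on how \<open>j\<close> compares
  with the exponent. The inputs of the simulated copies can therefore be laid out by counting cells,
  without computing a width or a precision.\<close>

lemma read_input_power:
  "read_input (binary (2 ^ E)) j = (if j = 0 then LeftEnd else if j \<le> E then Bit False
     else if j = Suc E then Bit True else RightEnd)"
proof -
  have "bit ((2::nat) ^ E) (j - 1) = (j - 1 = E)" by (auto simp: bit_exp_iff)
  then show ?thesis unfolding read_input_binary length_binary_power by auto
qed

lemma read_input_RightEnd [simp]: "read_input b h = RightEnd \<longleftrightarrow> length b < h"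
  by (auto simp: read_input_def)

lemma read_input_LeftEnd [simp]: "read_input b h = LeftEnd \<longleftrightarrow> h = 0"
  by (auto simp: read_input_def)

context sim_run
begin

definition nxt :: "bool list list \<Rightarrow> (bool list \<Rightarrow> bool) \<Rightarrow> config \<Rightarrow> config" where
  "nxt m g c = (case step M m g c of None \<Rightarrow> c | Some c' \<Rightarrow> c')"

lemma chain_go:
  assumes "mstep m c = Some (c1, e)" "e \<noteq> Ask" "fits s m c" "fits s m c1" "chain m g (perform zero e c1) c'"
  shows "chain m g c c'"
  using assms(5)
proof cases
  case stop
  then show ?thesis using assms by (blast intro: chain.stop seg.go)
next
  case (step c2)
  then show ?thesis using assms by (blast intro: chain.step seg.go)
qed

text \<open>Cuts an ordinary run with oracle \<open>g\<close> at its queries: a query step is the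
  step answered with False, followed by a replacement of the answer.\<close>

lemma chain_of_halting:
  assumes "\<And>t. fits s m ((nxt m g ^^ t) c)" "step M m g ((nxt m g ^^ T) c) = None"
  shows "chain m g c ((nxt m g ^^ T) c)"
  using assms
proof (induction T arbitrary: c)
  case 0
  have "mstep m c = None" using 0(2) by (simp add: step_mstep)
  moreover have "fits s m c" using 0(1)[of 0] by simp
  ultimately show ?case by (auto intro: chain.stop seg.halt)
next
  case (Suc T)
  have fc: "fits s m c" using Suc.prems(1)[of 0] by simp
  show ?case
  proof (cases "mstep m c")
    case None
    then have "nxt m g c = c" by (simp add: nxt_def step_mstep)
    then have "(nxt m g ^^ t) c = c" for t by (induction t) simp_all
    then have "(nxt m g ^^ Suc T) c = c" by blast
    then show ?thesis using None fc by (simp only:) (auto intro: chain.stop seg.halt)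
  next
    case (Some ce)
    obtain c1 e where ce: "ce = (c1, e)" by (cases ce)
    let ?c' = "perform g e c1"
    have n: "nxt m g c = ?c'" using Some ce by (simp add: nxt_def step_mstep)
    have it: "(nxt m g ^^ Suc t) c = (nxt m g ^^ t) ?c'" for t
      by (simp only: funpow_Suc_right comp_apply n)
    have IH: "chain m g ?c' ((nxt m g ^^ T) ?c')"
    proof (rule Suc.IH)
      show "fits s m ((nxt m g ^^ t) ?c')" for t using Suc.prems(1)[of "Suc t"] unfolding it .
      show "step M m g ((nxt m g ^^ T) ?c') = None" using Suc.prems(2) unfolding it .
    qed
    have f1: "fits s m c1" using Suc.prems(1)[of "Suc 0"] unfolding it by simp
    show ?thesis
    proof (cases "e = Ask")
      case True
      have sg: "seg m c True (perform zero Ask c1)" using Some ce True fc f1 by (auto intro!: seg.ask simp del: perform.simps)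
      have "(perform zero Ask c1)\<lparr>answer := g (last (asked (perform zero Ask c1)))\<rparr> = ?c'"
        using True by simp
      then have "chain m g c ((nxt m g ^^ T) ?c')" using chain.step[OF sg] IH by simp
      then show ?thesis unfolding it .
    next
      case False
      then have "?c' = perform zero e c1" by (cases e) auto
      then have "chain m g c ((nxt m g ^^ T) ?c')" using chain_go[OF _ False fc f1] Some ce IH by simp
      then show ?thesis unfolding it .
    qed
  qed
qed

end

context simulation
begin

text \<open>The part of \<open>fits\<close> that a valid machine maintains by itself; the bound on
  the work heads comes from the assumed space bound.\<close>

definition wf_config :: "bool list list \<Rightarrow> config \<Rightarrow> bool" where
  "wf_config m c \<longleftrightarrow> length (input_heads c) = 4 \<and> state c < n_states M \<and>
     (\<forall>i<4. input_heads c ! i \<le> Suc (length (m ! i))) \<and>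
     length (work c) = n_tapes M \<and> (\<forall>(t, h)\<in>set (work c). range t \<subseteq> {..<n_symbols M})"

lemma wf_config_perform: "wf_config m (perform g e c) = wf_config m c"
  by (cases e) (auto simp: wf_config_def)

lemma wf_config_mstep:
  assumes "length m = 4" "wf_config m c" "mstep m c = Some (c1, e)" shows "wf_config m c1"
proof -
  obtain q ms ws where d: "delta M (state c) (answer c) (map2 read_input m (input_heads c)) (map (\<lambda>(t, h). t h) (work c)) = Some (q, ms, ws, e)"
    and c1: "c1 = c\<lparr>state := q, input_heads := map2 (\<lambda>x (d, h). move_input x d h) m (zip ms (input_heads c)),
               work := map2 update_tape (work c) ws\<rparr>"
    using assms(3) unfolding mstep_def by (auto split: option.splits)
  have "set (map (\<lambda>(t, h). t h) (work c)) \<subseteq> {..<n_symbols M}"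
    using assms(2) unfolding wf_config_def by (auto simp: subset_iff dest!: bspec)
  moreover have "length (map2 read_input m (input_heads c)) = 4"
    "length (map (\<lambda>(t, h). t h) (work c)) = n_tapes M" "state c < n_states M"
    using assms by (auto simp: wf_config_def)
  ultimately have r: "q < n_states M" "length ms = 4" "length ws = n_tapes M" "fst ` set ws \<subseteq> {..<n_symbols M}"
    using valid d unfolding valid_machine_def by blast+
  have "range t \<subseteq> {..<n_symbols M}" if "(t, h) \<in> set (map2 update_tape (work c) ws)" for t h
  proof -
    obtain t' h' y d where 1: "((t', h'), (y, d)) \<in> set (zip (work c) ws)" "t = t'(h' := y)"
      using \<open>(t, h) \<in> set (map2 update_tape (work c) ws)\<close> by (auto simp: update_tape_def)
    then have "(t', h') \<in> set (work c)" "(y, d) \<in> set ws" by (auto dest: set_zip_leftD set_zip_rightD)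
    moreover have "\<forall>(t, h)\<in>set (work c). range t \<subseteq> {..<n_symbols M}" using assms(2) by (simp add: wf_config_def)
    ultimately have "range t' \<subseteq> {..<n_symbols M}" "y < n_symbols M" using r(4) by fastforce+
    then show ?thesis using 1 by auto
  qed
  then have "\<forall>(t, h)\<in>set (map2 update_tape (work c) ws). range t \<subseteq> {..<n_symbols M}" by blast
  then show ?thesis using r assms(1,2) unfolding c1 wf_config_def by (simp add: move_input_def)
qed

lemma wf_config_at: "length m = 4 \<Longrightarrow> wf_config m (config_at M m g t)"
proof (induction t)
  case 0
  then show ?case using valid
    by (auto simp: config_at_def initial_config_def wf_config_def valid_machine_def set_replicate_conv_if)
next
  case (Suc t)
  let ?c = "config_at M m g t"
  have n: "config_at M m g (Suc t) = (case step M m g ?c of None \<Rightarrow> ?c | Some c' \<Rightarrow> c')"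
    unfolding config_at_def by simp
  show ?case
  proof (cases "mstep m ?c")
    case None
    then show ?thesis using Suc by (simp add: n step_mstep)
  next
    case (Some ce)
    obtain c1 e where ce: "ce = (c1, e)" by (cases ce)
    have "config_at M m g (Suc t) = perform g e c1"
      unfolding n step_mstep Some ce by simp
    moreover have "wf_config m c1"
      by (rule wf_config_mstep[OF Suc.prems Suc.IH[OF Suc.prems]]) (simp add: Some ce)
    ultimately show ?thesis by (simp add: wf_config_perform)
  qed
qed

lemma fits_config_at:
  assumes m: "length m = 4" "\<And>i. i < 4 \<Longrightarrow> Suc (length (m ! i)) < s"
    and sp: "uses_space M m g sp" "sp \<le> real s"
  shows "fits s m (config_at M m g t)"
proof -
  have "h < s" if "(tp, h) \<in> set (work (config_at M m g t))" for tp h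
  proof -
    have "\<forall>(tp, h)\<in>set (work (config_at M m g t)). real (Suc h) \<le> sp"
      using sp(1) unfolding uses_space_def by blast
    then have "real (Suc h) \<le> sp" using that by (auto dest!: bspec)
    then show ?thesis using sp(2) by simp
  qed
  note hs = this
  note w = wf_config_at[OF m(1), of g t]
  have "case y of (t, h) \<Rightarrow> h < s \<and> range t \<subseteq> {..<n_symbols M}"
    if "y \<in> set (work (config_at M m g t))" for y
  proof -
    have "case y of (t, h) \<Rightarrow> range t \<subseteq> {..<n_symbols M}" using w that unfolding wf_config_def by blast
    then show ?thesis using that hs by (cases y) simp
  qed
  then show ?thesis using w m unfolding fits_def wf_config_def by simp
qed

end

lemma (in sim_run) chain_config_at:
  assumes m: "length m = 4" "\<And>i. i < 4 \<Longrightarrow> Suc (length (m ! i)) < s"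
    and sp: "uses_space M m g sp" "sp \<le> real s" and "halts_at M m g T"
  shows "chain m g (initial_config 4 M) (config_at M m g T)"
proof -
  have at: "config_at M m g t = (nxt m g ^^ t) (initial_config 4 M)" for t
    unfolding config_at_def m(1) nxt_def[abs_def] ..
  show ?thesis unfolding at
  proof (rule chain_of_halting)
    show "fits s m ((nxt m g ^^ t) (initial_config 4 M))" for t
      using fits_config_at[OF m sp] unfolding at .
    show "step M m g ((nxt m g ^^ T) (initial_config 4 M)) = None"
      using assms(5) unfolding halts_at_def at .
  qed
qed

section \<open>Input heads as counters\<close>

definition set_heads :: "config \<Rightarrow> nat list \<Rightarrow> config" where
  "set_heads x hs = x\<lparr>input_heads := hs\<rparr>"

lemma answer_set_heads [simp]: "answer (set_heads x hs) = answer x"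
  by (simp add: set_heads_def)

lemma scanned_set_heads [simp]:
  "scanned [b0, b1, b2, b3] (set_heads x [h0, h1, h2, h3]) =
     [read_input b0 h0, read_input b1 h1, read_input b2 h2, read_input b3 h3]"
  by (simp add: scanned_def set_heads_def)

lemma hok_set_heads [simp]:
  "hok [b0, b1, b2, b3] (set_heads x [h0, h1, h2, h3]) \<longleftrightarrow>
     h0 \<le> Suc (length b0) \<and> h1 \<le> Suc (length b1) \<and> h2 \<le> Suc (length b2) \<and> h3 \<le> Suc (length b3)"
  by (auto simp: hok_def set_heads_def numeral_eq_Suc less_Suc_eq)

lemma move_heads_set_heads [simp]:
  "move_heads [b0, b1, b2, b3] [m0, m1, m2, m3] (set_heads x [h0, h1, h2, h3]) =
     set_heads x [move_input b0 m0 h0, move_input b1 m1 h1, move_input b2 m2 h2, move_input b3 m3 h3]"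
  by (simp add: move_heads_def set_heads_def)

lemma move_input_simps [simp]:
  "h \<le> Suc (length b) \<Longrightarrow> move_input b Stay h = h"
  "h \<le> Suc (length b) \<Longrightarrow> move_input b Lft h = h - 1"
  "h \<le> length b \<Longrightarrow> move_input b Rgt h = Suc h"
  "move_input b Rgt (Suc (length b)) = Suc (length b)"
  by (simp_all add: move_input_def)

definition rewind :: "(vars, cell) prog" where
  "rewind = While (\<lambda>v b xs. xs \<noteq> [LeftEnd, LeftEnd, LeftEnd, LeftEnd]) (Do (move_op [Lft, Lft, Lft, Lft]))"

definition leg :: "nat \<Rightarrow> (vars, cell) prog \<Rightarrow> (vars, cell) prog" where
  "leg t p = While (\<lambda>v b xs. xs ! t \<noteq> RightEnd) (Seq p (Do (move_op (stays[t := Rgt]))))"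

text \<open>Runs \<open>p\<close> once per digit of the first two inputs, once per digit by which
  the fourth input is longer than the third, and once more if \<open>cmp\<close> says so. These are
  \<open>ell\<close> runs, counted by the input heads alone and thus without work space.\<close>

definition walk_inputs :: "(vars, cell) prog \<Rightarrow> (vars, cell) prog" where
  "walk_inputs p = Seq rewind (Seq (Do (move_op [Rgt, Stay, Stay, Stay])) (Seq (leg 0 p)
     (Seq (Do (move_op [Stay, Rgt, Stay, Stay])) (Seq (leg 1 p)
     (Seq (Do (move_op [Stay, Stay, Rgt, Rgt]))
     (Seq (While (\<lambda>v b xs. xs ! 2 \<noteq> RightEnd) (Do (move_op [Stay, Stay, Rgt, Rgt])))
     (Seq (leg 3 p) (Cond (\<lambda>v b xs. cmp v = Some True) p Skip))))))))"

primrec rep :: "nat \<Rightarrow> (vars, cell) prog \<Rightarrow> (vars, cell) prog" where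
  "rep 0 p = Skip"
| "rep (Suc k) p = Seq p (rep k p)"

locale inputs =
  fixes inp :: "bool list list" and b0 b1 b2 b3 :: "bool list" and f :: "bool list \<Rightarrow> bool"
  assumes inp: "inp = [b0, b1, b2, b3]"
begin

lemma exec_rewind:
  "h0 \<le> Suc (length b0) \<Longrightarrow> h1 \<le> Suc (length b1) \<Longrightarrow> h2 \<le> Suc (length b2) \<Longrightarrow> h3 \<le> Suc (length b3) \<Longrightarrow>
   exec inp f rewind (v, cs, set_heads x [h0, h1, h2, h3]) (v, cs, set_heads x [0, 0, 0, 0])"
proof (induction "h0 + h1 + h2 + h3" arbitrary: h0 h1 h2 h3 rule: less_induct)
  case less
  show ?case
  proof (cases "h0 + h1 + h2 + h3 = 0")
    case True
    then show ?thesis unfolding rewind_def inp by (auto intro!: exec.While_False)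
  next
    case False
    have IH: "exec inp f rewind (v, cs, set_heads x [h0 - 1, h1 - 1, h2 - 1, h3 - 1]) (v, cs, set_heads x [0, 0, 0, 0])"
      by (rule less.hyps) (use less.prems False in auto)
    have mv: "exec inp f (Do (move_op [Lft, Lft, Lft, Lft])) (v, cs, set_heads x [h0, h1, h2, h3])
       (v, cs, set_heads x [h0 - 1, h1 - 1, h2 - 1, h3 - 1])"
      unfolding inp by (rule exec_Do) (use less.prems in simp)
    show ?thesis unfolding rewind_def
      by (rule exec.While_True[OF _ mv IH[unfolded rewind_def]]) (use False in \<open>auto simp: inp\<close>)
  qed
qed

text \<open>\<open>p\<close> may change the control and the cells but has to give back the input
  heads, which do the counting; \<open>I i\<close> describes the situation after \<open>i\<close>
  runs.\<close>

definition tickable :: "(nat \<Rightarrow> vars \<Rightarrow> cell list \<Rightarrow> bool) \<Rightarrow> nat \<Rightarrow> (vars, cell) prog \<Rightarrow> config \<Rightarrow> bool" where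
  "tickable I k p x \<longleftrightarrow> (\<forall>i<k. \<forall>v cs hs. I i v cs \<longrightarrow> length hs = 4 \<longrightarrow> hok inp (set_heads x hs) \<longrightarrow>
     (\<exists>v' cs'. exec inp f p (v, cs, set_heads x hs) (v', cs', set_heads x hs) \<and> I (Suc i) v' cs'))"

lemma exec_leg:
  assumes t: "t < 4" and tick: "tickable I k p x"
    and hs: "length hs = 4" "hok inp (set_heads x hs)" and "hs ! t + r = Suc (length (inp ! t))" "i + r \<le> k"
    and I: "I i v cs"
  shows "\<exists>v' cs'. exec inp f (leg t p) (v, cs, set_heads x hs)
     (v', cs', set_heads x (hs[t := Suc (length (inp ! t))])) \<and> I (i + r) v' cs'"
  using assms(3-)
proof (induction r arbitrary: hs i v cs)
  case 0
  have "scanned inp (set_heads x hs) ! t = RightEnd"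
    using 0 t by (simp add: scanned_def set_heads_def inp)
  then have "exec inp f (leg t p) (v, cs, set_heads x hs) (v, cs, set_heads x hs)"
    unfolding leg_def by (auto intro: exec.While_False)
  moreover have "hs[t := Suc (length (inp ! t))] = hs"
    using 0 by (simp flip: 0(3))
  ultimately show ?case using 0 by auto
next
  case (Suc r)
  have ne: "scanned inp (set_heads x hs) ! t \<noteq> RightEnd"
    using Suc.prems t by (simp add: scanned_def set_heads_def inp)
  have "i < k" using Suc.prems(4) by simp
  then obtain v1 cs1 where 1: "exec inp f p (v, cs, set_heads x hs) (v1, cs1, set_heads x hs)" "I (Suc i) v1 cs1"
    using tick[unfolded tickable_def, rule_format, of i v cs hs] Suc.prems(1,2,5) by blast
  let ?hs = "hs[t := Suc (hs ! t)]"
  have mv: "exec inp f (Do (move_op (stays[t := Rgt]))) (v1, cs1, set_heads x hs) (v1, cs1, set_heads x ?hs)"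
  proof (rule exec_Do)
    obtain h0 h1 h2 h3 where h: "hs = [h0, h1, h2, h3]"
      using Suc.prems(1) by (auto simp: numeral_eq_Suc length_Suc_conv)
    have "t = 0 \<or> t = 1 \<or> t = 2 \<or> t = 3" using t by auto
    then show "do_op inp f (move_op (stays[t := Rgt])) (v1, cs1, set_heads x hs) = (v1, cs1, set_heads x ?hs)"
      using Suc.prems by (elim disjE) (simp_all add: stays_def inp h numeral_eq_Suc)
  qed
  have "\<exists>v' cs'. exec inp f (leg t p) (v1, cs1, set_heads x ?hs)
     (v', cs', set_heads x (?hs[t := Suc (length (inp ! t))])) \<and> I (Suc i + r) v' cs'"
  proof (rule Suc.IH)
    show "hok inp (set_heads x ?hs)"
      using Suc.prems t by (auto simp: hok_def set_heads_def nth_list_update)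
  qed (use Suc.prems 1 t in auto)
  then obtain v2 cs2 where 2: "exec inp f (leg t p) (v1, cs1, set_heads x ?hs)
     (v2, cs2, set_heads x (hs[t := Suc (length (inp ! t))]))" "I (i + Suc r) v2 cs2" by auto
  have "exec inp f (leg t p) (v, cs, set_heads x hs) (v2, cs2, set_heads x (hs[t := Suc (length (inp ! t))]))"
    unfolding leg_def by (rule exec.While_True[OF _ exec.Seq[OF 1(1) mv] 2(1)[unfolded leg_def]]) (use ne in simp)
  then show ?case using 2 by blast
qed

lemma exec_skip_common:
  "h \<le> Suc (length b2) \<Longrightarrow> length b2 \<le> length b3 \<Longrightarrow> h0 \<le> Suc (length b0) \<Longrightarrow> h1 \<le> Suc (length b1) \<Longrightarrow>
   exec inp f (While (\<lambda>v b xs. xs ! 2 \<noteq> RightEnd) (Do (move_op [Stay, Stay, Rgt, Rgt])))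
     (v, cs, set_heads x [h0, h1, h, h]) (v, cs, set_heads x [h0, h1, Suc (length b2), Suc (length b2)])"
proof (induction "Suc (length b2) - h" arbitrary: h)
  case 0
  then have h: "h = Suc (length b2)" by simp
  show ?case unfolding h by (rule exec.While_False) (simp add: inp)
next
  case (Suc k)
  have IH: "exec inp f (While (\<lambda>v b xs. xs ! 2 \<noteq> RightEnd) (Do (move_op [Stay, Stay, Rgt, Rgt])))
     (v, cs, set_heads x [h0, h1, Suc h, Suc h]) (v, cs, set_heads x [h0, h1, Suc (length b2), Suc (length b2)])"
    by (rule Suc.hyps(1)) (use Suc in auto)
  have mv: "exec inp f (Do (move_op [Stay, Stay, Rgt, Rgt])) (v, cs, set_heads x [h0, h1, h, h])
     (v, cs, set_heads x [h0, h1, Suc h, Suc h])"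
    unfolding inp by (rule exec_Do) (use Suc in simp)
  show ?case by (rule exec.While_True[OF _ mv IH]) (use Suc in \<open>simp add: inp\<close>)
qed

lemma exec_walk_inputs:
  assumes len: "length b2 \<le> length b3"
    and k: "k = length b0 + length b1 + (length b3 - length b2) + (if gt then 1 else 0)"
    and gt: "\<And>i v cs. I i v cs \<Longrightarrow> (cmp v = Some True) = gt"
    and tick: "tickable I k p x"
    and h: "h0 \<le> Suc (length b0)" "h1 \<le> Suc (length b1)" "h2 \<le> Suc (length b2)" "h3 \<le> Suc (length b3)"
    and I: "I 0 v cs"
  shows "\<exists>v' cs'. exec inp f (walk_inputs p) (v, cs, set_heads x [h0, h1, h2, h3])
     (v', cs', set_heads x [Suc (length b0), Suc (length b1), Suc (length b2), Suc (length b3)]) \<and> I k v' cs'"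
proof -
  note r = exec_rewind[OF h, of v cs x]
  have m1: "exec inp f (Do (move_op [Rgt, Stay, Stay, Stay])) (v, cs, set_heads x [0, 0, 0, 0]) (v, cs, set_heads x [1, 0, 0, 0])"
    unfolding inp by (rule exec_Do) simp
  obtain v1 cs1 where 1: "exec inp f (leg 0 p) (v, cs, set_heads x [1, 0, 0, 0]) (v1, cs1, set_heads x [Suc (length b0), 0, 0, 0])"
      "I (length b0) v1 cs1"
    using exec_leg[OF _ tick, of 0 "[1, 0, 0, 0]" "length b0" 0 v cs] I k by (auto simp: inp)
  have m2: "exec inp f (Do (move_op [Stay, Rgt, Stay, Stay])) (v1, cs1, set_heads x [Suc (length b0), 0, 0, 0])
      (v1, cs1, set_heads x [Suc (length b0), 1, 0, 0])"
    unfolding inp by (rule exec_Do) simp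
  obtain v2 cs2 where 2: "exec inp f (leg 1 p) (v1, cs1, set_heads x [Suc (length b0), 1, 0, 0])
      (v2, cs2, set_heads x [Suc (length b0), Suc (length b1), 0, 0])"
      "I (length b0 + length b1) v2 cs2"
    using exec_leg[OF _ tick, of 1 "[Suc (length b0), 1, 0, 0]" "length b1" "length b0" v1 cs1] 1 k by (auto simp: inp)
  have m3: "exec inp f (Do (move_op [Stay, Stay, Rgt, Rgt])) (v2, cs2, set_heads x [Suc (length b0), Suc (length b1), 0, 0])
      (v2, cs2, set_heads x [Suc (length b0), Suc (length b1), 1, 1])"
    unfolding inp by (rule exec_Do) simp
  have m4: "exec inp f (While (\<lambda>v b xs. xs ! 2 \<noteq> RightEnd) (Do (move_op [Stay, Stay, Rgt, Rgt])))
     (v2, cs2, set_heads x [Suc (length b0), Suc (length b1), 1, 1])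
     (v2, cs2, set_heads x [Suc (length b0), Suc (length b1), Suc (length b2), Suc (length b2)])"
    by (rule exec_skip_common[OF _ len]) auto
  define D where "D = length b3 - length b2"
  have b3: "length b3 = length b2 + D" and le: "length b0 + length b1 + D \<le> k"
    using len k by (simp_all add: D_def)
  obtain v3 cs3 where 3: "exec inp f (leg 3 p) (v2, cs2, set_heads x [Suc (length b0), Suc (length b1), Suc (length b2), Suc (length b2)])
      (v3, cs3, set_heads x [Suc (length b0), Suc (length b1), Suc (length b2), Suc (length b3)])"
      "I (length b0 + length b1 + D) v3 cs3"
    using exec_leg[OF _ tick _ _ _ le 2(2), of 3 "[Suc (length b0), Suc (length b1), Suc (length b2), Suc (length b2)]"] b3
    by (auto simp: inp eval_nat_numeral)
  let ?x = "set_heads x [Suc (length b0), Suc (length b1), Suc (length b2), Suc (length b3)]"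
  have "\<exists>v4 cs4. exec inp f (Cond (\<lambda>v b xs. cmp v = Some True) p Skip) (v3, cs3, ?x) (v4, cs4, ?x) \<and> I k v4 cs4"
  proof (cases gt)
    case True
    then have lt: "length b0 + length b1 + D < k" and k1: "Suc (length b0 + length b1 + D) = k" using k by (simp_all add: D_def)
    have hx: "hok inp ?x" and l4: "length [Suc (length b0), Suc (length b1), Suc (length b2), Suc (length b3)] = 4"
      by (simp_all add: inp)
    obtain v4 cs4 where "exec inp f p (v3, cs3, ?x) (v4, cs4, ?x)" "I k v4 cs4"
      using tick[unfolded tickable_def, rule_format, OF lt 3(2) l4 hx] unfolding k1 by blast
    then show ?thesis using gt[OF 3(2)] True by (intro exI conjI exec.Cond) auto
  next
    case False
    then show ?thesis using gt[OF 3(2)] 3(2) k by (intro exI conjI exec.Cond) (auto simp: D_def intro: exec.Skip)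
  qed
  then obtain v4 cs4 where 4: "exec inp f (Cond (\<lambda>v b xs. cmp v = Some True) p Skip) (v3, cs3, ?x) (v4, cs4, ?x)" "I k v4 cs4"
    by blast
  show ?thesis unfolding walk_inputs_def
    using exec.Seq[OF r exec.Seq[OF m1 exec.Seq[OF 1(1) exec.Seq[OF m2 exec.Seq[OF 2(1)
      exec.Seq[OF m3 exec.Seq[OF m4 exec.Seq[OF 3(1) 4(1)]]]]]]]] 4(2) by blast
qed

end

lemma bij_betw_bits_cube: "bij_betw (\<lambda>z. map (bit z) [0..<m]) {..<(2::nat) ^ m} (cube m)"
proof -
  have inj: "inj_on (\<lambda>z :: nat. map (bit z) [0..<m]) {..<2 ^ m}"
  proof (rule inj_onI)
    fix y z :: nat assume yz: "y \<in> {..<2 ^ m}" "z \<in> {..<2 ^ m}" "map (bit y) [0..<m] = map (bit z) [0..<m]"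
    have "horner_sum of_bool (2::nat) (map (bit y) [0..<m]) = horner_sum of_bool 2 (map (bit z) [0..<m])"
      by (simp only: yz(3))
    then have "take_bit m y = take_bit m z" by (simp only: horner_sum_bit_eq_take_bit)
    then show "y = z" using yz by (simp add: take_bit_nat_eq_self_iff[THEN iffD2])
  qed
  have "(\<lambda>z. map (bit z) [0..<m]) ` {..<(2::nat) ^ m} \<subseteq> cube m" by (auto simp: cube_def)
  moreover have "finite (cube m)" "card (cube m) = 2 ^ m"
    using finite_lists_length_eq[of "UNIV :: bool set" m] card_lists_length_eq[of "UNIV :: bool set" m]
    by (simp_all add: cube_def)
  ultimately have "(\<lambda>z. map (bit z) [0..<m]) ` {..<(2::nat) ^ m} = cube m"
    using inj by (intro card_subset_eq) (simp_all add: card_image)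
  with inj show ?thesis by (simp add: bij_betw_def)
qed

lemma horner_sum_complement:
  "Suc (horner_sum of_bool (2::nat) bs + horner_sum of_bool 2 (map Not bs)) = 2 ^ length bs"
proof (induction bs)
  case (Cons b bs)
  show ?case using arg_cong[OF Cons, of "\<lambda>x. 2 * x"] by (cases b) (simp_all add: algebra_simps)
qed simp

lemma fold_write:
  "fold (perform f) (map (\<lambda>j. if P j then Write_Query (b j) else Silent) js) x =
     x\<lparr>query_tape := query_tape x @ map b (filter P js)\<rparr>"
  by (induction js arbitrary: x) auto

lemma fold_emit:
  "fold (perform f) (map (\<lambda>j. if P j then Emit (b j) else Silent) js) x =
     x\<lparr>out := out x @ map b (filter P js)\<rparr>"
  by (induction js arbitrary: x) auto

section \<open>Laying out the work tape\<close>

text \<open>Expects counter 2 to have been decremented once, with the flag telling whether it was 0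
  before, so that a count of 0 writes nothing.\<close>

definition zeros :: "(vars, cell) prog" where
  "zeros = While (\<lambda>v b xs. \<not> flag v) (Seq (Do (effect_op (\<lambda>_. Write_Query False))) (Do (dec_op 2)))"

text \<open>The query consists of the digits of counter 4, followed by as many zeros as counter 1
  says; the layout has left it at the number of missing bits.\<close>

definition pad_body :: "(vars, cell) prog" where
  "pad_body = Seq (Do (sweep_effect_op (\<lambda>c. if kind c = 2 then Write_Query (bits c 4) else Silent)))
     (Seq (Do (copy_bits_op 1 2)) (Seq (Do (dec_op 2)) (Seq zeros (Seq (Do (effect_op (\<lambda>_. Ask)))
     (Seq (Cond (\<lambda>v b xs. b) (Do (dec_op 5)) Skip) (Do (dec_op 4)))))))"

definition pad :: "(vars, cell) prog" where
  "pad = Seq (Do (set_op (\<lambda>v b xs. v\<lparr>flag := False\<rparr>))) (While (\<lambda>v b xs. \<not> flag v) pad_body)"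

text \<open>Counter 5 starts with all ones, so its complement is the number of decrements.\<close>

definition emit_count :: "(vars, cell) prog" where
  "emit_count = Seq (Do (sweep_effect_op (\<lambda>c. if kind c \<noteq> 0 then Emit (Digit (\<not> bits c 5)) else Silent)))
     (Seq (Do (effect_op (\<lambda>_. Emit Slash)))
     (Seq (Do (sweep_effect_op (\<lambda>c. if kind c = 2 then Emit (Digit False) else Silent)))
       (Do (effect_op (\<lambda>_. Emit (Digit True))))))"

definition emit_zero :: "(vars, cell) prog" where
  "emit_zero = Seq (Do (effect_op (\<lambda>_. Emit Slash))) (Do (effect_op (\<lambda>_. Emit (Digit True))))"

text \<open>\<open>cmp\<close> records the comparison of the numerator, shifted to the length of the denominator,
  with the denominator, from the most significant bit down.\<close>

definition cmp_nat :: "nat \<Rightarrow> nat \<Rightarrow> bool option" where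
  "cmp_nat x y = (if x = y then None else Some (x < y))"

definition compare_step :: "vars \<Rightarrow> input_symbol list \<Rightarrow> vars" where
  "compare_step v xs = (let b = (xs ! 2 = Bit True); c = (xs ! 3 = Bit True) in
     if cmp v = None \<and> b \<noteq> c then v\<lparr>cmp := Some c\<rparr> else v)"

definition scan_lengths :: "(vars, cell) prog" where
  "scan_lengths = While (\<lambda>v b xs. \<not> (xs ! 2 = RightEnd \<and> xs ! 3 = RightEnd))
     (Do (act_op (\<lambda>v b xs. (v\<lparr>short := (short v \<or> xs ! 3 = RightEnd), long := (long v \<or> xs ! 2 = RightEnd)\<rparr>,
        [Stay, Stay, Rgt, Rgt], Silent))))"

definition scan_bits :: "(vars, cell) prog" where
  "scan_bits = While (\<lambda>v b xs. xs ! 3 \<noteq> LeftEnd)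
     (Do (act_op (\<lambda>v b xs. (compare_step v xs, [Stay, Stay, Lft, Lft], Silent))))"

definition base :: "vars \<Rightarrow> bool" where
  "base v \<longleftrightarrow> st v = (\<lambda>_. 0) \<and> an v = (\<lambda>_. False)"

context simulation
begin

text \<open>A cell receives all its initial values when it is made: the tapes of the six copies in
  their initial configuration, \<open>n\<close> in counters 0 and 1, and ones in counters 4 and 5
  over their zones. \<open>pos\<close> needs to tell apart only positions 0, 1 and later ones, since
  the third simulated input is the numeral 1.\<close>

definition new_cell :: "nat \<Rightarrow> input_symbol \<Rightarrow> input_symbol \<Rightarrow> vars \<Rightarrow> cell" where
  "new_cell kd e0 e1 v = (let first = (pos v = 1) in
     \<lparr>kind = (if first then 0 else kd),
      bits = (\<lambda>k. k < 6 \<and> \<not> first \<and>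
        (if k < 2 then ns v = Bit True else if k = 4 then kd = 2 else k = 5 \<and> kd < 3)),
      tp = (\<lambda>u i. if u < 6 \<and> i < R then
         (if i = 0 then ic (ns v) else if 4 \<le> i \<or> first then 0
          else if i = 1 then ic (if u < 3 then e1 else e0)
          else if i = 2 then ic (if pos v = 2 then Bit True else RightEnd) else ic e0, first)
         else (0, False))\<rparr>)"

definition new_op :: "nat \<Rightarrow> input_symbol \<Rightarrow> input_symbol \<Rightarrow> bool \<Rightarrow> (vars, cell) op" where
  "new_op kd e0 e1 useN = Op
     (\<lambda>v b xs. (v\<lparr>ns := (if useN then xs ! 0 else RightEnd), pos := min 3 (Suc (pos v))\<rparr>, stays, Silent))
     (\<lambda>v c. (v, c, Silent)) (\<lambda>v. Some (new_cell kd e0 e1 v)) (\<lambda>v c. (v, c))"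

lemma wf_new_op: "kd < 4 \<Longrightarrow> wf_op 4 V Cs (new_op kd e0 e1 useN)"
proof -
  assume "kd < 4"
  moreover have "n_symbols M > 0" using valid by (simp add: valid_machine_def)
  ultimately have "new_cell kd e0 e1 v \<in> Cs" for v
    using ic_less by (auto simp: new_cell_def Cs_def symset_def Let_def)
  then show ?thesis by (auto simp: wf_op_def new_op_def stays_def V_def)
qed

lemma do_new_op:
  assumes "hok inp x" "y = (if useN then scanned inp x ! 0 else RightEnd)"
    and "new_cell kd e0 e1 (v\<lparr>ns := y, pos := min 3 (Suc (pos v))\<rparr>) = CELL z0 z1 N mi cf j"
  shows "do_op inp f (new_op kd e0 e1 useN) (v, cells_of z0 z1 j N mi cf, x) =
     (v\<lparr>ns := y, pos := min 3 (Suc (pos v))\<rparr>, cells_of z0 z1 (Suc j) N mi cf, x)"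
  using assms by (simp add: do_op.simps new_op_def cells_of_def)

definition lay0 :: "(vars, cell) prog" where
  "lay0 = Seq (While (\<lambda>v b xs. xs ! 0 \<noteq> RightEnd)
      (Seq (Do (new_op 1 (Bit False) (Bit False) True)) (Do (move_op [Rgt, Stay, Stay, Stay]))))
     (Do (new_op 1 (Bit False) (Bit False) True))"

text \<open>Counter 1 starts at \<open>n\<close>, so \<open>ell\<close> runs append
  \<open>min n ell\<close> cells and raise \<open>brute\<close> exactly if \<open>n < ell\<close>.
  What is left in the counter is \<open>n - ell\<close>, the number of zeros that complete a padding
  query.\<close>

definition tick :: "(vars, cell) prog" where
  "tick = Seq (Do (dec_op 1)) (Cond (\<lambda>v b xs. flag v) (Do (set_op (\<lambda>v b xs. v\<lparr>brute := True\<rparr>)))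
     (Do (new_op 2 (Bit False) (Bit False) False)))"

text \<open>The first cell made here has the top digit of \<open>2 ^ E0\<close>, and
  \<open>c * ell + 1\<close> cells later comes the top digit of \<open>2 ^ E1\<close>. The final
  \<open>d * ell\<close> cells are room for the work tapes of the simulated machine.\<close>

definition lay2 :: "nat \<Rightarrow> nat \<Rightarrow> (vars, cell) prog" where
  "lay2 c d = Seq (Do (new_op 3 (Bit True) (Bit False) False))
     (Seq (rep c (walk_inputs (Do (new_op 3 RightEnd (Bit False) False))))
     (Seq (Do (new_op 3 RightEnd (Bit True) False))
       (rep d (walk_inputs (Do (new_op 3 RightEnd RightEnd False))))))"

end

locale layout = simulation +
  fixes n a nu nv c d :: nat and f :: "bool list \<Rightarrow> bool"
begin

definition "lu = length (binary nu)"
definition "lv = length (binary nv)"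
definition "gt = (nu * 2 ^ (lv - lu) < nv)"
definition "ell = length (binary n) + length (binary a) + (lv - lu) + (if gt then 1 else 0)"
text \<open>The 2 accounts for the end markers of the tape of \<open>n\<close>.\<close>

definition "z0 = length (binary n) + 2"
definition "zl = min n ell"
definition "z1 = z0 + zl"
definition "E0 = z1 - 1"
definition "E1 = z1 + c * ell"
definition "sz = E1 + 2 + d * ell"
definition "inp = [binary n, binary a, binary nu, binary nv]"
definition "inA = [binary n, binary (2 ^ E1), binary 1, binary (2 ^ E0)]"
definition "inB = [binary n, binary (2 ^ E0), binary 1, binary (2 ^ E0)]"
definition "mi u = (if u < (3::nat) then inA else inB)"
definition "cf0 = (\<lambda>_::nat. initial_config 4 M)"
text \<open>Counters 4 and 5 are given the values for completed zones from the first cell on: the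
  cells present at any time show just their low digits.\<close>

definition "N00 = (\<lambda>k::nat. if k < 2 then n else if k = 4 then 2 ^ zl - 1 else if k = 5 then 2 ^ (z1 - 1) - 1 else 0)"

sublocale inputs inp "binary n" "binary a" "binary nu" "binary nv" f
  by unfold_locales (rule inp_def)

abbreviation "CS j N \<equiv> cells_of z0 z1 j N mi cf0"

lemma z_pos: "2 \<le> z0" "z0 \<le> z1" "n < 2 ^ (z0 - 2)"
  using less_power_length_binary[of n] by (simp_all add: z0_def z1_def)

lemma tpc_initial:
  "i < 4 \<Longrightarrow> tpc m (initial_config 4 M) i j = ic (read_input (m ! i) j)"
  "4 \<le> i \<Longrightarrow> i < R \<Longrightarrow> tpc m (initial_config 4 M) i j = 0"
  "i < R \<Longrightarrow> hpc (initial_config 4 M) i = 0"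
  by (auto simp: tpc_def hpc_def initial_config_def R_def)

lemma new_cell_eq:
  assumes p: "pos v = min 3 j" and y: "y = read_input (binary n) j"
    and kd: "0 < j \<Longrightarrow> kd = kindf z0 z1 j"
    and e0: "0 < j \<Longrightarrow> e0 = read_input (binary (2 ^ E0)) j"
    and e1: "0 < j \<Longrightarrow> e1 = read_input (binary (2 ^ E1)) j"
    and N: "N 0 = n" "N 2 = 0" "N 3 = 0"
    and N1: "0 < j \<Longrightarrow> bit (N 1) (j - 1) \<longleftrightarrow> y = Bit True"
    and N4: "0 < j \<Longrightarrow> z0 \<le> j \<and> bit (N 4) (j - z0) \<longleftrightarrow> kd = 2"
    and N5: "0 < j \<Longrightarrow> bit (N 5) (j - 1) \<longleftrightarrow> kd < 3"
  shows "new_cell kd e0 e1 (v\<lparr>ns := y, pos := min 3 (Suc (pos v))\<rparr>) = CELL z0 z1 N mi cf0 j"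
proof -
  have first: "min 3 (Suc (pos v)) = 1 \<longleftrightarrow> j = 0" and second: "min 3 (Suc (pos v)) = 2 \<longleftrightarrow> j = 1"
    using p by auto
  have N0: "bit (N 0) (j - 1) \<longleftrightarrow> y = Bit True" if "0 < j"
    using that not_bit_less_power[OF less_power_length_binary[of n]] by (auto simp: y read_input_binary N)
  have b: "(k < 6 \<and> j \<noteq> 0 \<and> (if k < 2 then y = Bit True else if k = 4 then kd = 2 else k = 5 \<and> kd < 3))
      = cellbits z0 N j k" for k
  proof (cases "j = 0")
    case True
    then show ?thesis using z_pos by (simp add: cellbits_def off_def)
  next
    case False
    consider "k = 0" | "k = 1" | "k = 2" | "k = 3" | "k = 4" | "k = 5" | "6 \<le> k" by linarith
    then show ?thesis
      by cases (use False N N0 N1 N4 N5 in \<open>auto simp: cellbits_def off_def\<close>)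
  qed
  have one: "read_input (binary (Suc 0)) j = (if j = 0 then LeftEnd else if j = 1 then Bit True else RightEnd)" for j
    using read_input_power[of 0 j] by auto
  have length1: "length (binary (Suc 0)) = 1" using length_binary_power[of 0] by simp
  have t: "(if i = 0 then ic y else if 4 \<le> i \<or> j = 0 then 0
          else if i = 1 then ic (if u < 3 then e1 else e0)
          else if i = 2 then ic (if j = 1 then Bit True else RightEnd) else ic e0)
      = tpc (mi u) (cf0 u) i j" if "i < R" for i u
  proof -
    consider "i = 0" | "i = 1" | "i = 2" | "i = 3" | "4 \<le> i" by linarith
    then show ?thesis
    proof cases
      case 3
      then show ?thesis
        by (auto simp: cf0_def tpc_initial mi_def inA_def inB_def one length1)
    qed (use e0 e1 y that in \<open>auto simp: cf0_def tpc_initial mi_def inA_def inB_def read_input_def\<close>)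
  qed
  have h: "(j = 0) = (j = hpc (cf0 u) i)" if "i < R" for i u
    using that by (simp add: cf0_def tpc_initial)
  have "(\<lambda>u i. if u < 6 \<and> i < R then
         (if i = 0 then ic y else if 4 \<le> i \<or> j = 0 then 0
          else if i = 1 then ic (if u < 3 then e1 else e0)
          else if i = 2 then ic (if j = 1 then Bit True else RightEnd) else ic e0, j = 0)
         else (0, False)) =
      (\<lambda>u. if u < 6 then ucell (tpc (mi u) (cf0 u)) (hpc (cf0 u)) j else (\<lambda>_. (0, False)))"
  proof (intro ext)
    fix u i
    show "(if u < 6 \<and> i < R then
         (if i = 0 then ic y else if 4 \<le> i \<or> j = 0 then 0
          else if i = 1 then ic (if u < 3 then e1 else e0)
          else if i = 2 then ic (if j = 1 then Bit True else RightEnd) else ic e0, j = 0)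
         else (0, False)) =
      (if u < 6 then ucell (tpc (mi u) (cf0 u)) (hpc (cf0 u)) j else (\<lambda>_. (0, False))) i"
    proof (cases "u < 6 \<and> i < R")
      case True
      then show ?thesis unfolding if_P[OF True] t[OF conjunct2[OF True]] using h by (simp add: ucell_def)
    qed (auto simp: ucell_def)
  qed
  moreover have "(if j = 0 then 0 else kd) = kindf z0 z1 j" using kd by (auto simp: kindf_def)
  ultimately show ?thesis
    unfolding new_cell_def CELL_def Let_def using b first second by (simp cong: if_cong)
qed

lemma E0_E1: "z1 = Suc E0" "E0 < E1" using z_pos by (auto simp: E0_def E1_def)

lemma N00_bits:
  "0 < j \<Longrightarrow> bit (N00 1) (j - 1) \<longleftrightarrow> read_input (binary n) j = Bit True"
  "j < z1 \<Longrightarrow> z0 \<le> j \<Longrightarrow> bit (N00 4) (j - z0)"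
  "0 < j \<Longrightarrow> j < z1 \<Longrightarrow> bit (N00 5) (j - 1)"
proof -
  show "0 < j \<Longrightarrow> bit (N00 1) (j - 1) \<longleftrightarrow> read_input (binary n) j = Bit True"
    using not_bit_less_power[OF less_power_length_binary[of n]] by (auto simp: read_input_binary N00_def)
  have m: "bit ((2::nat) ^ k - 1) i \<longleftrightarrow> i < k" for k i
    using bit_mask_iff[where 'a = nat, of k i] by (simp add: mask_eq_exp_minus_1)
  then have m: "bit ((2::nat) ^ k - Suc 0) i \<longleftrightarrow> i < k" for k i by simp
  show "j < z1 \<Longrightarrow> z0 \<le> j \<Longrightarrow> bit (N00 4) (j - z0)" by (auto simp: N00_def m z1_def)
  show "0 < j \<Longrightarrow> j < z1 \<Longrightarrow> bit (N00 5) (j - 1)" by (auto simp: N00_def m)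
qed

lemma exec_lay0:
  assumes "h1 \<le> Suc (length (binary a))" "h2 \<le> Suc (length (binary nu))" "h3 \<le> Suc (length (binary nv))"
  shows "pos v = 0 \<Longrightarrow> \<exists>v'. exec inp f lay0 (v, [], set_heads x [0, h1, h2, h3])
     (v', CS z0 N00, set_heads x [Suc (length (binary n)), h1, h2, h3]) \<and>
     pos v' = min 3 z0 \<and> st v' = st v \<and> an v' = an v \<and> cmp v' = cmp v \<and> brute v' = brute v"
proof -
  let ?new = "new_op 1 (Bit False) (Bit False) True"
  let ?x = "\<lambda>j. set_heads x [j, h1, h2, h3]"
  have new: "exec inp f (Do ?new) (v, CS j N00, ?x j)
      (v\<lparr>ns := read_input (binary n) j, pos := min 3 (Suc (pos v))\<rparr>, CS (Suc j) N00, ?x j)"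
    if "j \<le> Suc (length (binary n))" "pos v = min 3 j" for v j
  proof (rule exec_Do, rule do_new_op)
    have j: "j < z0" using that by (simp add: z0_def)
    show "new_cell 1 (Bit False) (Bit False) (v\<lparr>ns := read_input (binary n) j, pos := min 3 (Suc (pos v))\<rparr>) =
        CELL z0 z1 N00 mi cf0 j"
    proof (rule new_cell_eq[OF that(2) refl])
      show "0 < j \<Longrightarrow> bit (N00 1) (j - 1) \<longleftrightarrow> read_input (binary n) j = Bit True" by (rule N00_bits)
      show "0 < j \<Longrightarrow> bit (N00 5) (j - 1) \<longleftrightarrow> (1::nat) < 3" using N00_bits(3)[of j] j z_pos by simp
      show "0 < j \<Longrightarrow> z0 \<le> j \<and> bit (N00 4) (j - z0) \<longleftrightarrow> (1::nat) = 2" using j by simp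
    qed (use j z_pos E0_E1 in \<open>auto simp: kindf_def read_input_power N00_def\<close>)
  qed (use that assms in \<open>auto simp: inp_def\<close>)
  have loop: "\<exists>v'. exec inp f (While (\<lambda>v b xs. xs ! 0 \<noteq> RightEnd) (Seq (Do ?new) (Do (move_op [Rgt, Stay, Stay, Stay]))))
      (v, CS j N00, ?x j) (v', CS (Suc (length (binary n))) N00, ?x (Suc (length (binary n)))) \<and>
     pos v' = min 3 (Suc (length (binary n))) \<and> st v' = st v \<and> an v' = an v \<and> cmp v' = cmp v \<and> brute v' = brute v"
    if "j \<le> Suc (length (binary n))" "pos v = min 3 j" for v j
    using that
  proof (induction "Suc (length (binary n)) - j" arbitrary: j v)
    case 0
    then have "j = Suc (length (binary n))" by simp
    then show ?case using 0 by (auto intro!: exI[of _ v] exec.While_False simp: inp_def)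
  next
    case (Suc k)
    let ?v1 = "v\<lparr>ns := read_input (binary n) j, pos := min 3 (Suc (pos v))\<rparr>"
    have j: "j \<le> length (binary n)" using Suc by simp
    have mv: "exec inp f (Do (move_op [Rgt, Stay, Stay, Stay])) (?v1, CS (Suc j) N00, ?x j) (?v1, CS (Suc j) N00, ?x (Suc j))"
      by (rule exec_Do) (use j assms in \<open>simp add: inp_def\<close>)
    have k: "k = Suc (length (binary n)) - Suc j" and p1: "pos ?v1 = min 3 (Suc j)" using Suc by simp_all
    from Suc.hyps(1)[OF k _ p1] j obtain v' where v': "exec inp f (While (\<lambda>v b xs. xs ! 0 \<noteq> RightEnd) (Seq (Do ?new) (Do (move_op [Rgt, Stay, Stay, Stay]))))
      (?v1, CS (Suc j) N00, ?x (Suc j)) (v', CS (Suc (length (binary n))) N00, ?x (Suc (length (binary n))))"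
      "pos v' = min 3 (Suc (length (binary n)))" "st v' = st ?v1" "an v' = an ?v1" "cmp v' = cmp ?v1" "brute v' = brute ?v1"
      by blast
    have "exec inp f (While (\<lambda>v b xs. xs ! 0 \<noteq> RightEnd) (Seq (Do ?new) (Do (move_op [Rgt, Stay, Stay, Stay]))))
      (v, CS j N00, ?x j) (v', CS (Suc (length (binary n))) N00, ?x (Suc (length (binary n))))"
      by (rule exec.While_True[OF _ exec.Seq[OF new mv] v'(1)]) (use Suc j in \<open>auto simp: inp_def\<close>)
    then show ?case using v' by (intro exI[of _ v'] conjI) simp_all
  qed
  assume p: "pos v = 0"
  have e: "CS 0 N00 = []" by (simp add: cells_of_def)
  from loop[of 0 v] p obtain v1 where v1: "exec inp f (While (\<lambda>v b xs. xs ! 0 \<noteq> RightEnd) (Seq (Do ?new) (Do (move_op [Rgt, Stay, Stay, Stay]))))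
      (v, [], ?x 0) (v1, CS (Suc (length (binary n))) N00, ?x (Suc (length (binary n))))"
     "pos v1 = min 3 (Suc (length (binary n)))" "st v1 = st v" "an v1 = an v" "cmp v1 = cmp v" "brute v1 = brute v"
    unfolding e by auto
  have z: "z0 = Suc (Suc (length (binary n)))" by (simp add: z0_def)
  let ?v2 = "v1\<lparr>ns := read_input (binary n) (Suc (length (binary n))), pos := min 3 (Suc (pos v1))\<rparr>"
  have "exec inp f lay0 (v, [], ?x 0) (?v2, CS z0 N00, ?x (Suc (length (binary n))))"
    unfolding lay0_def
    by (rule exec.Seq[OF v1(1) new[of "Suc (length (binary n))" v1, folded z]]) (use v1 in auto)
  then show ?thesis using v1 z by (intro exI[of _ ?v2]) auto
qed

definition tick_inv :: "bool option \<Rightarrow> nat \<Rightarrow> vars \<Rightarrow> cell list \<Rightarrow> bool" where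
  "tick_inv q i v cs \<longleftrightarrow> cs = CS (z0 + min n i) (N00(1 := n - i)) \<and> pos v = min 3 (z0 + min n i) \<and>
     brute v = (n < i) \<and> cmp v = q \<and> base v"

lemma tickable_tick: "tickable (tick_inv q) ell tick x"
  unfolding tickable_def
proof (intro allI impI)
  fix i v cs hs
  assume i: "i < ell" and I: "tick_inv q i v cs" and hs: "length hs = 4" and hok: "hok inp (set_heads x hs)"
  let ?x = "set_heads x hs" and ?N = "N00(1 := n - i)" and ?N' = "N00(1 := n - Suc i)"
  let ?j = "z0 + min n i"
  let ?v1 = "v\<lparr>flag := (n - i = 0)\<rparr>"
  have cs: "cs = CS ?j ?N" using I by (simp add: tick_inv_def)
  have lt: "n - i < 2 ^ (?j - 1)"
  proof -
    have "(2::nat) ^ (z0 - 2) \<le> 2 ^ (?j - 1)" by (rule power_increasing) auto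
    then show ?thesis using z_pos by linarith
  qed
  have N': "?N(1 := ?N 1 - 1) = ?N'" by auto
  have 1: "exec inp f (Do (dec_op 1)) (v, CS ?j ?N, ?x) (?v1, CS ?j ?N', ?x)"
    using do_dec_op[of inp ?x 1 z0 ?N ?j f v z1 mi cf0] hok z_pos lt unfolding N'
    by (intro exec_Do) (simp add: off_def)
  show "\<exists>v' cs'. exec inp f tick (v, cs, ?x) (v', cs', ?x) \<and> tick_inv q (Suc i) v' cs'"
  proof (cases "n \<le> i")
    case True
    let ?v2 = "?v1\<lparr>brute := True\<rparr>"
    have 2: "exec inp f (Do (set_op (\<lambda>v b xs. v\<lparr>brute := True\<rparr>))) (?v1, CS ?j ?N', ?x) (?v2, CS ?j ?N', ?x)"
      by (rule exec_Do) (use hok in simp)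
    have "exec inp f tick (v, CS ?j ?N, ?x) (?v2, CS ?j ?N', ?x)"
      unfolding tick_def by (rule exec.Seq[OF 1 exec.Cond]) (use 2 True in simp)
    moreover have "tick_inv q (Suc i) ?v2 (CS ?j ?N')"
      using I True by (simp add: tick_inv_def base_def)
    ultimately show ?thesis unfolding cs by blast
  next
    case False
    then have j: "?j = z0 + i" and jz: "z0 + i < z1" using i by (auto simp: z1_def zl_def)
    let ?v2 = "?v1\<lparr>ns := RightEnd, pos := min 3 (Suc (pos ?v1))\<rparr>"
    have RE: "RightEnd = read_input (binary n) ?j" by (rule sym) (simp add: z0_def)
    have 2: "exec inp f (Do (new_op 2 (Bit False) (Bit False) False)) (?v1, CS ?j ?N', ?x) (?v2, CS (Suc ?j) ?N', ?x)"
    proof (rule exec_Do, rule do_new_op[OF hok])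
      show "new_cell 2 (Bit False) (Bit False) ?v2 = CELL z0 z1 ?N' mi cf0 ?j"
      proof (rule new_cell_eq)
        show "pos ?v1 = min 3 ?j" using I by (simp add: tick_inv_def)
        show "RightEnd = read_input (binary n) ?j" by (rule RE)
        have "n - Suc i < 2 ^ (z0 - 2)" using z_pos by linarith
        then have "\<not> bit (n - Suc i) (?j - 1)" by (rule not_bit_less_power) auto
        then show "bit (?N' 1) (?j - 1) \<longleftrightarrow> RightEnd = Bit True" by simp
        show "z0 \<le> ?j \<and> bit (?N' 4) (?j - z0) \<longleftrightarrow> (2::nat) = 2" using N00_bits(2)[of ?j] jz j by simp
        show "0 < ?j \<Longrightarrow> bit (?N' 5) (?j - 1) \<longleftrightarrow> (2::nat) < 3" using N00_bits(3)[of ?j] jz j by simp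
      qed (use jz j z_pos E0_E1 in \<open>auto simp: kindf_def read_input_power N00_def\<close>)
    qed simp
    have "exec inp f tick (v, CS ?j ?N, ?x) (?v2, CS (Suc ?j) ?N', ?x)"
      unfolding tick_def by (rule exec.Seq[OF 1 exec.Cond]) (use 2 False in simp)
    moreover have "tick_inv q (Suc i) ?v2 (CS (Suc ?j) ?N')"
    proof -
      have "min n i = i" "min n (Suc i) = Suc i" using False by auto
      then show ?thesis using I False by (simp add: tick_inv_def base_def del: fun_upd_apply)
    qed
    ultimately show ?thesis unfolding cs by blast
  qed
qed

definition grow_inv :: "bool option \<Rightarrow> (nat \<Rightarrow> nat) \<Rightarrow> nat \<Rightarrow> nat \<Rightarrow> vars \<Rightarrow> cell list \<Rightarrow> bool" where
  "grow_inv q N j i v cs \<longleftrightarrow> cs = CS (j + i) N \<and> pos v = 3 \<and> cmp v = q \<and> base v"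

text \<open>Cells appended from here on have only digits 0, so every counter value has to fit into
  the cells already present.\<close>

definition late :: "(nat \<Rightarrow> nat) \<Rightarrow> bool" where
  "late N \<longleftrightarrow> N 0 = n \<and> N 1 \<le> n \<and> N 2 = 0 \<and> N 3 = 0 \<and> N 4 = 0 \<and> N 5 < 2 ^ (z1 - 1)"

lemma exec_new_late:
  assumes "late N" "z1 \<le> j" "e0 = read_input (binary (2 ^ E0)) j" "e1 = read_input (binary (2 ^ E1)) j"
    and hok: "hok inp x" and I: "grow_inv q N j0 i v cs" and j: "j0 + i = j"
  shows "\<exists>v' cs'. exec inp f (Do (new_op 3 e0 e1 False)) (v, cs, x) (v', cs', x) \<and> grow_inv q N j0 (Suc i) v' cs'"
proof -
  let ?v' = "v\<lparr>ns := RightEnd, pos := min 3 (Suc (pos v))\<rparr>"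
  have zj: "z0 \<le> j" "3 \<le> j \<or> pos v \<noteq> 3 \<or> z1 = 2" using z_pos assms by auto
  have jl: "length (binary n) + 2 \<le> j" using z_pos assms(2) by (simp add: z0_def)
  have "exec inp f (Do (new_op 3 e0 e1 False)) (v, CS j N, x) (?v', CS (Suc j) N, x)"
  proof (rule exec_Do, rule do_new_op[OF hok])
    have p3: "min 3 (Suc (pos v)) = 3" using I by (simp add: grow_inv_def)
    have "new_cell 3 e0 e1 ((v\<lparr>pos := min 3 (j + 1)\<rparr>)\<lparr>ns := RightEnd, pos := min 3 (Suc (pos (v\<lparr>pos := min 3 (j + 1)\<rparr>)))\<rparr>) =
       new_cell 3 e0 e1 ?v'"
      using jl p3 by (simp add: min_def)
    show "new_cell 3 e0 e1 ?v' = CELL z0 z1 N mi cf0 j"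
    proof -
      have eq: "new_cell 3 e0 e1 ?v' = new_cell 3 e0 e1 ((v\<lparr>pos := min 3 j\<rparr>)\<lparr>ns := RightEnd, pos := min 3 (Suc (pos (v\<lparr>pos := min 3 j\<rparr>)))\<rparr>)"
        using jl p3 by (simp add: min_def)
      show ?thesis unfolding eq
      proof (rule new_cell_eq)
        show "pos (v\<lparr>pos := min 3 j\<rparr>) = min 3 j" by simp
        show "RightEnd = read_input (binary n) j" by (rule sym) (use jl in simp)
        have "N 1 < 2 ^ (z0 - 2)" using assms(1) z_pos by (simp add: late_def)
        then have "\<not> bit (N 1) (j - 1)" by (rule not_bit_less_power) (use zj in auto)
        then show "bit (N 1) (j - 1) \<longleftrightarrow> RightEnd = Bit True" by simp
        have "\<not> bit (N 5) (j - 1)" using assms(1,2) unfolding late_def by (intro not_bit_less_power[of _ "z1 - 1"]) auto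
        then show "bit (N 5) (j - 1) \<longleftrightarrow> (3::nat) < 3" by simp
        show "z0 \<le> j \<and> bit (N 4) (j - z0) \<longleftrightarrow> (3::nat) = 2" using assms(1) by (simp add: late_def)
        show "e0 = read_input (binary (2 ^ E0)) j" "e1 = read_input (binary (2 ^ E1)) j" by fact+
      qed (use assms(1,2) z_pos in \<open>auto simp: kindf_def late_def\<close>)
    qed
  qed simp
  moreover have "grow_inv q N j0 (Suc i) ?v' (CS (Suc j) N)" using I j by (auto simp: grow_inv_def base_def)
  ultimately show ?thesis using I j by (auto simp: grow_inv_def)
qed

lemma grow_inv_shift: "grow_inv q N j i v cs = grow_inv q N (j + i) 0 v cs"
  by (simp add: grow_inv_def)

lemma length_4_cases: "length hs = 4 \<Longrightarrow> \<exists>h0 h1 h2 h3. hs = [h0, h1, h2, h3]"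
  by (auto simp: numeral_eq_Suc length_Suc_conv)

lemma exec_rep_walk:
  assumes N: "late N" and len: "lu \<le> lv" and q: "(q = Some True) = gt"
  shows "z1 \<le> J \<Longrightarrow> (\<And>j. J \<le> j \<Longrightarrow> j < J + k * ell \<Longrightarrow>
      e0 = read_input (binary (2 ^ E0)) j \<and> e1 = read_input (binary (2 ^ E1)) j) \<Longrightarrow>
     grow_inv q N J 0 v cs \<Longrightarrow> length hs = 4 \<Longrightarrow> hok inp (set_heads x hs) \<Longrightarrow>
     \<exists>v' cs' hs'. exec inp f (rep k (walk_inputs (Do (new_op 3 e0 e1 False)))) (v, cs, set_heads x hs)
       (v', cs', set_heads x hs') \<and> grow_inv q N (J + k * ell) 0 v' cs' \<and>
       length hs' = 4 \<and> hok inp (set_heads x hs')"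
proof (induction k arbitrary: J v cs hs)
  case 0
  then show ?case by (intro exI[of _ v] exI[of _ cs] exI[of _ hs]) (auto intro: exec.Skip)
next
  case (Suc k)
  obtain h0 h1 h2 h3 where hs: "hs = [h0, h1, h2, h3]" using length_4_cases Suc.prems(4) by blast
  have t: "tickable (grow_inv q N J) ell (Do (new_op 3 e0 e1 False)) x"
    unfolding tickable_def
  proof (intro allI impI)
    fix i v cs hs assume i: "i < ell" "grow_inv q N J i v cs" "hok inp (set_heads x hs)"
    have "e0 = read_input (binary (2 ^ E0)) (J + i)" "e1 = read_input (binary (2 ^ E1)) (J + i)"
      using Suc.prems(2)[of "J + i"] i by auto
    then show "\<exists>v' cs'. exec inp f (Do (new_op 3 e0 e1 False)) (v, cs, set_heads x hs) (v', cs', set_heads x hs) \<and>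
        grow_inv q N J (Suc i) v' cs'"
      using Suc.prems(1) i by (intro exec_new_late[OF N _ _ _ i(3) i(2), of "J + i"]) auto
  qed
  let ?hs = "[Suc (length (binary n)), Suc (length (binary a)), Suc (length (binary nu)), Suc (length (binary nv))]"
  have "\<exists>v' cs'. exec inp f (walk_inputs (Do (new_op 3 e0 e1 False))) (v, cs, set_heads x [h0, h1, h2, h3])
     (v', cs', set_heads x ?hs) \<and> grow_inv q N J ell v' cs'"
  proof (rule exec_walk_inputs[OF _ _ _ t])
    show "length (binary nu) \<le> length (binary nv)" using len by (simp add: lu_def lv_def)
    show "ell = length (binary n) + length (binary a) + (length (binary nv) - length (binary nu)) + (if gt then 1 else 0)"
      by (simp add: ell_def lu_def lv_def)
    show "(cmp v = Some True) = gt" if "grow_inv q N J i v cs" for i v cs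
      using that q by (simp add: grow_inv_def)
  qed (use Suc.prems hs in \<open>auto simp: inp_def\<close>)
  then obtain v1 cs1 where 1: "exec inp f (walk_inputs (Do (new_op 3 e0 e1 False))) (v, cs, set_heads x hs)
     (v1, cs1, set_heads x ?hs)" "grow_inv q N (J + ell) 0 v1 cs1" unfolding hs by (metis grow_inv_shift)
  have "\<exists>v' cs' hs'. exec inp f (rep k (walk_inputs (Do (new_op 3 e0 e1 False)))) (v1, cs1, set_heads x ?hs)
       (v', cs', set_heads x hs') \<and> grow_inv q N (J + ell + k * ell) 0 v' cs' \<and>
       length hs' = 4 \<and> hok inp (set_heads x hs')"
    by (rule Suc.IH[OF _ _ 1(2)]) (use Suc.prems in \<open>auto simp: inp_def add.assoc\<close>)
  then obtain v2 cs2 hs2 where 2: "exec inp f (rep k (walk_inputs (Do (new_op 3 e0 e1 False)))) (v1, cs1, set_heads x ?hs)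
       (v2, cs2, set_heads x hs2)" "grow_inv q N (J + Suc k * ell) 0 v2 cs2"
       "length hs2 = 4" "hok inp (set_heads x hs2)" by (auto simp: add.assoc)
  show ?case using exec.Seq[OF 1(1) 2(1)] 2 by auto
qed

lemma exec_lay2:
  assumes N: "late N" and len: "lu \<le> lv" and q: "(q = Some True) = gt"
    and I: "grow_inv q N z1 0 v cs" and hs: "length hs = 4" "hok inp (set_heads x hs)"
  shows "\<exists>v' cs' hs'. exec inp f (lay2 c d) (v, cs, set_heads x hs) (v', cs', set_heads x hs') \<and>
     grow_inv q N sz 0 v' cs' \<and> length hs' = 4 \<and> hok inp (set_heads x hs')"
proof -
  have z: "2 \<le> z1" using z_pos by simp
  obtain v1 cs1 where 1: "exec inp f (Do (new_op 3 (Bit True) (Bit False) False)) (v, cs, set_heads x hs) (v1, cs1, set_heads x hs)"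
    "grow_inv q N (Suc z1) 0 v1 cs1"
  proof -
    have "Bit True = read_input (binary (2 ^ E0)) z1" "Bit False = read_input (binary (2 ^ E1)) z1"
      using E0_E1 by (simp_all add: read_input_power)
    from exec_new_late[OF N order_refl this hs(2) I] show thesis
      using that by (auto simp: grow_inv_def)
  qed
  have "\<exists>v' cs' hs'. exec inp f (rep c (walk_inputs (Do (new_op 3 RightEnd (Bit False) False)))) (v1, cs1, set_heads x hs)
       (v', cs', set_heads x hs') \<and> grow_inv q N (Suc z1 + c * ell) 0 v' cs' \<and>
       length hs' = 4 \<and> hok inp (set_heads x hs')"
  proof (rule exec_rep_walk[OF N len q _ _ 1(2) hs])
    fix j assume j: "Suc z1 \<le> j" "j < Suc z1 + c * ell"
    then have "j \<le> E1" by (simp add: E1_def)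
    then show "RightEnd = read_input (binary (2 ^ E0)) j \<and> Bit False = read_input (binary (2 ^ E1)) j"
      using E0_E1 j by (simp add: read_input_power)
  qed simp
  then obtain v2 cs2 hs2 where 2: "exec inp f (rep c (walk_inputs (Do (new_op 3 RightEnd (Bit False) False)))) (v1, cs1, set_heads x hs)
       (v2, cs2, set_heads x hs2)" "grow_inv q N (Suc E1) 0 v2 cs2" "length hs2 = 4" "hok inp (set_heads x hs2)"
    by (auto simp: E1_def)
  obtain v3 cs3 where 3: "exec inp f (Do (new_op 3 RightEnd (Bit True) False)) (v2, cs2, set_heads x hs2) (v3, cs3, set_heads x hs2)"
    "grow_inv q N (Suc (Suc E1)) 0 v3 cs3"
    using exec_new_late[OF N _ _ _ 2(4,2), of "Suc E1" RightEnd "Bit True"] E0_E1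
    by (auto simp: read_input_power grow_inv_shift[of _ _ "Suc E1" "Suc 0"])
  have "\<exists>v' cs' hs'. exec inp f (rep d (walk_inputs (Do (new_op 3 RightEnd RightEnd False)))) (v3, cs3, set_heads x hs2)
       (v', cs', set_heads x hs') \<and> grow_inv q N (Suc (Suc E1) + d * ell) 0 v' cs' \<and>
       length hs' = 4 \<and> hok inp (set_heads x hs')"
    by (rule exec_rep_walk[OF N len q _ _ 3(2) 2(3,4)]) (use E0_E1 in \<open>auto simp: read_input_power\<close>)
  then obtain v4 cs4 hs4 where 4: "exec inp f (rep d (walk_inputs (Do (new_op 3 RightEnd RightEnd False)))) (v3, cs3, set_heads x hs2)
       (v4, cs4, set_heads x hs4)" "grow_inv q N sz 0 v4 cs4" "length hs4 = 4" "hok inp (set_heads x hs4)"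
    by (auto simp: sz_def)
  show ?thesis unfolding lay2_def
    using exec.Seq[OF 1(1) exec.Seq[OF 2(1) exec.Seq[OF 3(1) 4(1)]]] 4 by blast
qed

section \<open>The padding queries and the number of accepted ones\<close>

definition zpoint :: "nat \<Rightarrow> bool list" where
  "zpoint z = map (bit z) [0..<zl] @ replicate (n - zl) False"

lemma exec_zeros:
  assumes "hok inp x" "m \<le> n"
  shows "N 2 = m - 1 \<Longrightarrow> exec inp f zeros (v\<lparr>flag := (m = 0)\<rparr>, CS z1 N, x)
     (v\<lparr>flag := True\<rparr>, CS z1 (N(2 := 0)), x\<lparr>query_tape := query_tape x @ replicate m False\<rparr>)"
  using assms
proof (induction m arbitrary: N v x)
  case 0
  have "N(2 := 0) = N" using 0 by auto
  then show ?case unfolding zeros_def by (auto intro!: exec.While_False)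
next
  case (Suc m)
  let ?v = "v\<lparr>flag := False\<rparr>" and ?x = "x\<lparr>query_tape := query_tape x @ [False]\<rparr>"
  have w: "exec inp f (Do (effect_op (\<lambda>_. Write_Query False))) (?v, CS z1 N, x) (?v, CS z1 N, ?x)"
    by (rule exec_Do) (use Suc in simp)
  have "m < 2 ^ (z1 - 1)"
  proof -
    have "(2::nat) ^ (z0 - 2) \<le> 2 ^ (z1 - 1)" using z_pos by (intro power_increasing) auto
    then show ?thesis using z_pos(3) Suc.prems(3) by linarith
  qed
  then have d: "exec inp f (Do (dec_op 2)) (?v, CS z1 N, ?x) (v\<lparr>flag := (m = 0)\<rparr>, CS z1 (N(2 := m - 1)), ?x)"
    using do_dec_op[of inp ?x 2 z0 N z1 f ?v z1 mi cf0] Suc z_pos by (intro exec_Do) (simp add: off_def)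
  have "exec inp f zeros (v\<lparr>flag := (m = 0)\<rparr>, CS z1 (N(2 := m - 1)), ?x)
     (v\<lparr>flag := True\<rparr>, CS z1 (N(2 := m - 1, 2 := 0)), ?x\<lparr>query_tape := query_tape ?x @ replicate m False\<rparr>)"
    by (rule Suc.IH) (use Suc.prems in auto)
  moreover have "?x\<lparr>query_tape := query_tape ?x @ replicate m False\<rparr> =
      x\<lparr>query_tape := query_tape x @ replicate (Suc m) False\<rparr>" by simp
  ultimately have r: "exec inp f zeros (v\<lparr>flag := (m = 0)\<rparr>, CS z1 (N(2 := m - 1)), ?x)
     (v\<lparr>flag := True\<rparr>, CS z1 (N(2 := 0)), x\<lparr>query_tape := query_tape x @ replicate (Suc m) False\<rparr>)"
    by (simp only: fun_upd_upd)
  have "exec inp f zeros (?v, CS z1 N, x)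
     (v\<lparr>flag := True\<rparr>, CS z1 (N(2 := 0)), x\<lparr>query_tape := query_tape x @ replicate (Suc m) False\<rparr>)"
    unfolding zeros_def by (rule exec.While_True[OF _ exec.Seq[OF w d] r[unfolded zeros_def]]) simp
  then show ?case by (simp del: fun_upd_apply)
qed

lemma kind_bits_CELL:
  "kind (CELL z0 z1 N mi cf0 j) = kindf z0 z1 j" "bits (CELL z0 z1 N mi cf0 j) = cellbits z0 N j"
  by (simp_all add: CELL_def)

lemma exec_pad_body:
  assumes hok: "hok inp x" and q: "query_tape x = []" and N: "N 1 = n - zl" "N 4 < 2 ^ zl" "N 5 < 2 ^ (z1 - 1)"
  defines "p \<equiv> zpoint (N 4)"
  shows "exec inp f pad_body (v, CS z1 N, x)
     (v\<lparr>flag := (N 4 = 0)\<rparr>, CS z1 (N(2 := 0, 5 := N 5 - (if f p then 1 else 0), 4 := N 4 - 1)),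
      x\<lparr>answer := f p, asked := asked x @ [p]\<rparr>)"
proof -
  let ?x1 = "x\<lparr>query_tape := map (bit (N 4)) [0..<zl]\<rparr>"
  have "filter (\<lambda>j. kindf z0 z1 j = 2) [0..<z1] = [z0..<z1]"
  proof -
    have "[0..<z1] = [0..<z0] @ [z0..<z1]" using z_pos upt_add_eq_append[of 0 z0 zl] by (simp add: z1_def)
    then show ?thesis using z_pos by (auto simp: kindf_def filter_empty_conv intro!: filter_True)
  qed
  moreover have "map (\<lambda>j. cellbits z0 N j 4) [z0..<z1] = map (bit (N 4)) [0..<zl]"
    by (rule nth_equalityI) (auto simp: cellbits_def off_def z1_def)
  ultimately have "fold (perform f) (map ((\<lambda>c. if kind c = 2 then Write_Query (bits c 4) else Silent) \<circ> CELL z0 z1 N mi cf0) [0..<z1]) x = ?x1"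
    using fold_write[of f "\<lambda>j. kindf z0 z1 j = 2" "\<lambda>j. cellbits z0 N j 4" "[0..<z1]" x] q
    by (simp add: comp_def kind_bits_CELL cong: if_cong)
  then have 1: "exec inp f (Do (sweep_effect_op (\<lambda>c. if kind c = 2 then Write_Query (bits c 4) else Silent)))
      (v, CS z1 N, x) (v, CS z1 N, ?x1)"
    using hok by (intro exec_Do) (simp add: cells_of_def)
  have 2: "exec inp f (Do (copy_bits_op 1 2)) (v, CS z1 N, ?x1) (v, CS z1 (N(2 := n - zl)), ?x1)"
    using do_copy_bits_op[of inp ?x1 1 2 f v z0 z1 z1 N mi cf0] hok N by (intro exec_Do) simp
  have lt: "n - zl < 2 ^ (z1 - 1)"
  proof -
    have "(2::nat) ^ (z0 - 2) \<le> 2 ^ (z1 - 1)" using z_pos by (intro power_increasing) auto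
    then show ?thesis using z_pos(3) by linarith
  qed
  have 3: "exec inp f (Do (dec_op 2)) (v, CS z1 (N(2 := n - zl)), ?x1)
      (v\<lparr>flag := (n - zl = 0)\<rparr>, CS z1 (N(2 := n - zl - 1)), ?x1)"
    using do_dec_op[of inp ?x1 2 z0 "N(2 := n - zl)" z1 f v z1 mi cf0] hok lt z_pos
    by (intro exec_Do) (simp add: off_def)
  let ?x4 = "x\<lparr>query_tape := p\<rparr>"
  have 4: "exec inp f zeros (v\<lparr>flag := (n - zl = 0)\<rparr>, CS z1 (N(2 := n - zl - 1)), ?x1)
      (v\<lparr>flag := True\<rparr>, CS z1 (N(2 := 0)), ?x4)"
    using exec_zeros[of ?x1 "n - zl" "N(2 := n - zl - 1)" v] hok by (simp add: p_def zpoint_def)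
  let ?v4 = "v\<lparr>flag := True\<rparr>" and ?x5 = "x\<lparr>answer := f p, asked := asked x @ [p]\<rparr>"
  have x5: "perform f Ask ?x4 = ?x5" using q by (cases x) simp
  have 5: "exec inp f (Do (effect_op (\<lambda>_. Ask))) (?v4, CS z1 (N(2 := 0)), ?x4) (?v4, CS z1 (N(2 := 0)), ?x5)"
    unfolding x5[symmetric] by (rule exec_Do, rule do_effect_op) (use hok in simp)
  let ?N6 = "N(2 := 0, 5 := N 5 - (if f p then 1 else 0))"
  have "\<exists>b. exec inp f (Cond (\<lambda>v b xs. b) (Do (dec_op 5)) Skip) (?v4, CS z1 (N(2 := 0)), ?x5) (v\<lparr>flag := b\<rparr>, CS z1 ?N6, ?x5)"
  proof (cases "f p")
    case True
    have "exec inp f (Do (dec_op 5)) (?v4, CS z1 (N(2 := 0)), ?x5) (v\<lparr>flag := (N 5 = 0)\<rparr>, CS z1 ?N6, ?x5)"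
      using do_dec_op[of inp ?x5 5 z0 "N(2 := 0)" z1 f ?v4 z1 mi cf0] hok N z_pos True
      by (intro exec_Do) (simp add: off_def)
    then show ?thesis using True by (auto intro!: exec.Cond)
  next
    case False
    moreover have "?N6 = N(2 := 0)" using False by auto
    ultimately show ?thesis by (auto intro!: exec.Cond exec.Skip exI[of _ True])
  qed
  then obtain b where 6: "exec inp f (Cond (\<lambda>v b xs. b) (Do (dec_op 5)) Skip) (?v4, CS z1 (N(2 := 0)), ?x5) (v\<lparr>flag := b\<rparr>, CS z1 ?N6, ?x5)"
    by blast
  have 7: "exec inp f (Do (dec_op 4)) (v\<lparr>flag := b\<rparr>, CS z1 ?N6, ?x5) (v\<lparr>flag := (N 4 = 0)\<rparr>, CS z1 (?N6(4 := N 4 - 1)), ?x5)"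
    using do_dec_op[of inp ?x5 4 z0 ?N6 z1 f "v\<lparr>flag := b\<rparr>" z1 mi cf0] hok N(2) z_pos
    by (intro exec_Do) (simp add: off_def z1_def)
  show ?thesis unfolding pad_body_def
    by (rule exec.Seq[OF 1 exec.Seq[OF 2 exec.Seq[OF 3 exec.Seq[OF 4 exec.Seq[OF 5 exec.Seq[OF 6 7]]]]]])
qed

text \<open>Started at \<open>2 ^ zl - 1\<close>, the countdown passes through all strings of
  \<open>zl\<close> bits. If \<open>zl = n\<close> these are all inputs, and the decrements of
  counter 5 give the exact probability.\<close>

lemma exec_pad_while:
  assumes "Z = N 4"
  shows "hok inp x \<Longrightarrow> query_tape x = [] \<Longrightarrow> N 1 = n - zl \<Longrightarrow> N 4 < 2 ^ zl \<Longrightarrow> N 5 < 2 ^ (z1 - 1) \<Longrightarrow>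
    \<exists>b l. exec inp f (While (\<lambda>v b xs. \<not> flag v) pad_body) (v\<lparr>flag := False\<rparr>, CS z1 N, x)
      (v\<lparr>flag := True\<rparr>, CS z1 (N(2 := 0, 5 := N 5 - card {z. z \<le> Z \<and> f (zpoint z)}, 4 := 0)),
       x\<lparr>answer := b, asked := asked x @ l\<rparr>) \<and> set l = zpoint ` {..Z}"
  using assms
proof (induction Z arbitrary: N x)
  case 0
  note b = exec_pad_body[of x N "v\<lparr>flag := False\<rparr>", OF 0(1-5)]
  have "card {z. z \<le> (0::nat) \<and> f (zpoint z)} = (if f (zpoint 0) then 1 else 0)"
  proof -
    have "{z. z \<le> (0::nat) \<and> f (zpoint z)} = (if f (zpoint 0) then {0} else {})" by auto
    then show ?thesis by simp
  qed
  moreover have N4: "N 4 = 0" using 0(6) by simp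
  ultimately have b: "exec inp f pad_body (v\<lparr>flag := False\<rparr>, CS z1 N, x)
      (v\<lparr>flag := True\<rparr>, CS z1 (N(2 := 0, 5 := N 5 - card {z. z \<le> (0::nat) \<and> f (zpoint z)}, 4 := 0)),
       x\<lparr>answer := f (zpoint 0), asked := asked x @ [zpoint 0]\<rparr>)"
    using b by simp
  have "exec inp f (While (\<lambda>v b xs. \<not> flag v) pad_body) (v\<lparr>flag := False\<rparr>, CS z1 N, x)
      (v\<lparr>flag := True\<rparr>, CS z1 (N(2 := 0, 5 := N 5 - card {z. z \<le> (0::nat) \<and> f (zpoint z)}, 4 := 0)),
       x\<lparr>answer := f (zpoint 0), asked := asked x @ [zpoint 0]\<rparr>)"
    by (rule exec.While_True[OF _ b exec.While_False]) simp_all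
  moreover have "set [zpoint 0] = zpoint ` {..0}" by simp
  ultimately show ?case by blast
next
  case (Suc Z)
  let ?p = "zpoint (Suc Z)"
  let ?N1 = "N(2 := 0, 5 := N 5 - (if f ?p then 1 else 0), 4 := Z)"
  let ?x1 = "x\<lparr>answer := f ?p, asked := asked x @ [?p]\<rparr>"
  have Z: "N 4 = Suc Z" using Suc.prems by simp
  have b: "exec inp f pad_body (v\<lparr>flag := False\<rparr>, CS z1 N, x) (v\<lparr>flag := False\<rparr>, CS z1 ?N1, ?x1)"
    using exec_pad_body[of x N "v\<lparr>flag := False\<rparr>", OF Suc.prems(1-5)] by (simp add: Z)
  have "\<exists>b l. exec inp f (While (\<lambda>v b xs. \<not> flag v) pad_body) (v\<lparr>flag := False\<rparr>, CS z1 ?N1, ?x1)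
      (v\<lparr>flag := True\<rparr>, CS z1 (?N1(2 := 0, 5 := ?N1 5 - card {z. z \<le> Z \<and> f (zpoint z)}, 4 := 0)),
       ?x1\<lparr>answer := b, asked := asked ?x1 @ l\<rparr>) \<and> set l = zpoint ` {..Z}"
  proof (rule Suc.IH[where N = ?N1 and x = ?x1])
    show "?N1 4 < 2 ^ zl" "?N1 5 < 2 ^ (z1 - 1)" "Z = ?N1 4" "?N1 1 = n - zl"
      using Suc.prems(3-5) Z by simp_all
  qed (use Suc.prems in simp_all)
  then obtain b' l where r: "exec inp f (While (\<lambda>v b xs. \<not> flag v) pad_body) (v\<lparr>flag := False\<rparr>, CS z1 ?N1, ?x1)
      (v\<lparr>flag := True\<rparr>, CS z1 (?N1(2 := 0, 5 := ?N1 5 - card {z. z \<le> Z \<and> f (zpoint z)}, 4 := 0)),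
       ?x1\<lparr>answer := b', asked := asked ?x1 @ l\<rparr>)" "set l = zpoint ` {..Z}" by blast
  have card: "card {z. z \<le> Suc Z \<and> f (zpoint z)} = (if f ?p then 1 else 0) + card {z. z \<le> Z \<and> f (zpoint z)}"
  proof -
    have "{z. z \<le> Suc Z \<and> f (zpoint z)} = (if f ?p then insert (Suc Z) {z. z \<le> Z \<and> f (zpoint z)} else {z. z \<le> Z \<and> f (zpoint z)})"
      by (auto simp: le_Suc_eq)
    then show ?thesis by simp
  qed
  have N: "?N1(2 := 0, 5 := ?N1 5 - card {z. z \<le> Z \<and> f (zpoint z)}, 4 := 0) =
      N(2 := 0, 5 := N 5 - card {z. z \<le> Suc Z \<and> f (zpoint z)}, 4 := 0)"
    unfolding card by (auto simp: fun_eq_iff)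
  have x: "?x1\<lparr>answer := b', asked := asked ?x1 @ l\<rparr> = x\<lparr>answer := b', asked := asked x @ (?p # l)\<rparr>" by simp
  have "exec inp f (While (\<lambda>v b xs. \<not> flag v) pad_body) (v\<lparr>flag := False\<rparr>, CS z1 N, x)
      (v\<lparr>flag := True\<rparr>, CS z1 (N(2 := 0, 5 := N 5 - card {z. z \<le> Suc Z \<and> f (zpoint z)}, 4 := 0)),
       x\<lparr>answer := b', asked := asked x @ (?p # l)\<rparr>)"
    by (rule exec.While_True[OF _ b r(1)[unfolded N x]]) simp
  moreover have "set (?p # l) = zpoint ` {..Suc Z}" using r(2) by (auto simp: atMost_Suc)
  ultimately show ?case by blast
qed

lemma zpoint_image: "zpoint ` {..2 ^ zl - 1} = (\<lambda>z. z @ replicate (n - zl) False) ` cube zl"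
proof -
  have "(y \<le> 2 ^ zl - 1) = (y < 2 ^ zl)" for y :: nat
    by (metis Suc_diff_1 less_Suc_eq_le pos2 zero_less_power)
  then have "{..2 ^ zl - 1} = {..<2 ^ zl :: nat}" by auto
  moreover have "zpoint = (\<lambda>z. z @ replicate (n - zl) False) \<circ> (\<lambda>z. map (bit z) [0..<zl])"
    by (simp add: fun_eq_iff zpoint_def)
  ultimately show ?thesis
    using bij_betw_imp_surj_on[OF bij_betw_bits_cube[of zl]] by (simp only: image_comp[symmetric])
qed

end

text \<open>Once two prefixes differ, further digits cannot reverse their order; this is why one
  value \<open>cmp\<close> is enough memory for the comparison.\<close>

lemma cmp_nat_step: "cmp_nat (2 * x + of_bool b) (2 * y + of_bool c) =
   (if cmp_nat x y = None \<and> b \<noteq> c then Some c else cmp_nat x y)"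
  by (cases b; cases c) (auto simp: cmp_nat_def; presburger)+

lemma div_power_bit: "(N::nat) div 2 ^ h = 2 * (N div 2 ^ Suc h) + of_bool (bit N h)"
proof -
  have "N div 2 ^ Suc h = N div 2 ^ h div 2" by (simp add: div_mult2_eq power_Suc2 del: power_Suc)
  then show ?thesis by (simp add: bit_iff_odd of_bool_odd_eq_mod_2 del: power_Suc)
qed

lemma binary_value_power: "binary_value (replicate k False @ [True]) = 2 ^ k"
  by (induction k) (simp_all add: binary_value_def)

definition v_init :: vars where
  "v_init = \<lparr>pos = 0, ns = LeftEnd, flag = False, short = False, long = False, cmp = None, brute = False,
     ok = False, okall = False, ev = 0, eff = Silent, st = (\<lambda>_. 0), an = (\<lambda>_. False),
     scan = (\<lambda>_. 0), pend = (\<lambda>_. False)\<rparr>"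

context simulation
begin

definition whole :: "nat \<Rightarrow> nat \<Rightarrow> (vars, cell) prog" where
  "whole c d = Seq (Do (move_op [Stay, Rgt, Rgt, Rgt])) (Cond (\<lambda>v b xs. xs ! 1 = RightEnd) emit_zero
     (Seq scan_lengths (Seq (Do (move_op [Stay, Stay, Lft, Lft])) (Seq scan_bits
     (Cond (\<lambda>v b xs. short v \<or> \<not> long v \<and> cmp v \<noteq> Some True) emit_zero
     (Seq lay0 (Seq (walk_inputs tick) (Seq pad
     (Cond (\<lambda>v b xs. brute v) emit_count (Seq (lay2 c d) (sim_run.main_loop M)))))))))))"

lemma v_init_V: "v_init \<in> V"
  using valid by (auto simp: v_init_def V_def symset_def valid_machine_def)

lemma ops_rep: "ops (rep k p) \<subseteq> ops p"
  by (induction k) auto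

lemma V_updates [simp]:
  "v\<lparr>flag := b\<rparr> \<in> V \<longleftrightarrow> v \<in> V" "v\<lparr>ok := b\<rparr> \<in> V \<longleftrightarrow> v \<in> V" "v\<lparr>okall := b\<rparr> \<in> V \<longleftrightarrow> v \<in> V"
  "v\<lparr>brute := b\<rparr> \<in> V \<longleftrightarrow> v \<in> V" "v\<lparr>short := b\<rparr> \<in> V \<longleftrightarrow> v \<in> V" "v\<lparr>long := b\<rparr> \<in> V \<longleftrightarrow> v \<in> V"
  "v\<lparr>cmp := q\<rparr> \<in> V \<longleftrightarrow> v \<in> V"
  "v \<in> V \<Longrightarrow> v\<lparr>ev := 0\<rparr> \<in> V" "v \<in> V \<Longrightarrow> v\<lparr>an := (an v)(0 := b)\<rparr> \<in> V"
  by (simp_all add: V_def)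

lemma wf_main_loop: "i \<in> ops (sim_run.main_loop M) \<Longrightarrow> wf_op 4 V Cs i"
proof -
  interpret r: sim_run M "[]" "\<lambda>_. False" 1 1 1 0 "[]" "[]" by unfold_locales auto
  have h: "i \<in> ops (handle md) \<Longrightarrow> wf_op 4 V Cs i" for md
    by (cases md) (auto simp: wf_effect_op wf_dec_op)
  have run: "i \<in> ops (r.run u md) \<Longrightarrow> u < 6 \<Longrightarrow> wf_op 4 V Cs i" for u md
    using h by (auto simp: r.run_def simstep_def wf_gather_op wf_right_op wf_finish_op intro!: wf_set_op)
  show "i \<in> ops r.main_loop \<Longrightarrow> wf_op 4 V Cs i"
    unfolding r.main_loop_def r.main_step_def r.outer_loop_def r.outer_step_def r.inner_loop_def r.loop_body_def
    by (auto simp: wf_copy_unit_op wf_copy_bits_op wf_dec_op wf_effect_op dest!: run intro!: wf_set_op)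
qed

lemma wf_whole: "i \<in> ops (whole c d) \<Longrightarrow> wf_op 4 V Cs i"
proof -
  have w: "i \<in> ops (walk_inputs p) \<Longrightarrow> (i \<in> ops p \<Longrightarrow> wf_op 4 V Cs i) \<Longrightarrow> wf_op 4 V Cs i" for p
    by (auto simp: walk_inputs_def rewind_def leg_def wf_move_op stays_def)
  have t: "i \<in> ops tick \<Longrightarrow> wf_op 4 V Cs i"
    by (auto simp: tick_def wf_dec_op wf_new_op intro!: wf_set_op)
  have l0: "i \<in> ops lay0 \<Longrightarrow> wf_op 4 V Cs i" by (auto simp: lay0_def wf_new_op wf_move_op)
  have l2: "i \<in> ops (lay2 c d) \<Longrightarrow> wf_op 4 V Cs i"
    by (auto simp: lay2_def wf_new_op dest!: subsetD[OF ops_rep] elim!: w)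
  have p: "i \<in> ops pad \<Longrightarrow> wf_op 4 V Cs i"
    by (auto simp: pad_def pad_body_def zeros_def wf_sweep_effect_op wf_copy_bits_op wf_dec_op wf_effect_op
        intro!: wf_set_op)
  have s: "i \<in> ops scan_lengths \<Longrightarrow> wf_op 4 V Cs i" "i \<in> ops scan_bits \<Longrightarrow> wf_op 4 V Cs i"
    by (auto simp: scan_lengths_def scan_bits_def compare_step_def Let_def intro!: wf_act_op)
  have e: "i \<in> ops emit_zero \<Longrightarrow> wf_op 4 V Cs i" "i \<in> ops emit_count \<Longrightarrow> wf_op 4 V Cs i"
    by (auto simp: emit_zero_def emit_count_def wf_sweep_effect_op wf_effect_op)
  show "i \<in> ops (whole c d) \<Longrightarrow> wf_op 4 V Cs i"
    using w[OF _ t] l0 l2 p s e wf_main_loop by (auto simp: whole_def wf_move_op)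
qed

end

context layout
begin

text \<open>\<open>t\<close> is where both heads would be without end markers. A head that waits at
  its marker while the other one still moves belongs to the shorter numeral.\<close>

lemma exec_scan_lengths:
  "1 \<le> t \<Longrightarrow> t \<le> Suc (max lu lv) \<Longrightarrow> short v = (lv < t - 1) \<Longrightarrow> long v = (lu < t - 1) \<Longrightarrow>
   h0 \<le> Suc (length (binary n)) \<Longrightarrow> h1 \<le> Suc (length (binary a)) \<Longrightarrow>
   exec inp f scan_lengths (v, cs, set_heads x [h0, h1, min t (Suc lu), min t (Suc lv)])
     (v\<lparr>short := (lv < lu), long := (lu < lv)\<rparr>, cs, set_heads x [h0, h1, Suc lu, Suc lv])"
proof (induction "Suc (max lu lv) - t" arbitrary: t v)
  case 0
  then have "t = Suc (max lu lv)" by simp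
  then have "min t (Suc lu) = Suc lu" "min t (Suc lv) = Suc lv" "v\<lparr>short := (lv < lu), long := (lu < lv)\<rparr> = v"
    using 0 by (auto simp: max_def split: if_splits)
  then show ?case unfolding scan_lengths_def
    by (simp only:) (rule exec.While_False, simp add: inp_def lu_def lv_def)
next
  case (Suc k)
  then have t: "t \<le> max lu lv" by simp
  let ?v = "v\<lparr>short := (lv < t), long := (lu < t)\<rparr>"
  have s: "(short v \<or> lv < t) = (lv < t)" "(long v \<or> lu < t) = (lu < t)" using Suc.prems by auto
  have lens: "length (binary nu) = lu" "length (binary nv) = lv" by (simp_all add: lu_def lv_def)
  have mv: "move_input (binary nu) Rgt (min t (Suc lu)) = min (Suc t) (Suc lu)"
    "move_input (binary nv) Rgt (min t (Suc lv)) = min (Suc t) (Suc lv)"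
    by (auto simp: move_input_def lens)
  have 1: "exec inp f (Do (act_op (\<lambda>v b xs. (v\<lparr>short := (short v \<or> xs ! 3 = RightEnd), long := (long v \<or> xs ! 2 = RightEnd)\<rparr>,
        [Stay, Stay, Rgt, Rgt], Silent)))) (v, cs, set_heads x [h0, h1, min t (Suc lu), min t (Suc lv)])
     (?v, cs, set_heads x [h0, h1, min (Suc t) (Suc lu), min (Suc t) (Suc lv)])"
    by (rule exec_Do) (use Suc.prems s in \<open>simp add: do_act_op inp_def mv lens\<close>)
  have 2: "exec inp f scan_lengths (?v, cs, set_heads x [h0, h1, min (Suc t) (Suc lu), min (Suc t) (Suc lv)])
     (?v\<lparr>short := (lv < lu), long := (lu < lv)\<rparr>, cs, set_heads x [h0, h1, Suc lu, Suc lv])"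
    by (rule Suc.hyps(1)) (use Suc t in auto)
  have "exec inp f scan_lengths (v, cs, set_heads x [h0, h1, min t (Suc lu), min t (Suc lv)])
     (?v\<lparr>short := (lv < lu), long := (lu < lv)\<rparr>, cs, set_heads x [h0, h1, Suc lu, Suc lv])"
    unfolding scan_lengths_def
    by (rule exec.While_True[OF _ 1 2[unfolded scan_lengths_def]]) (use t in \<open>auto simp: inp_def lens\<close>)
  then show ?case by simp
qed

text \<open>Both heads start at the top digits and move left together. For
  \<open>lu \<le> lv\<close> the head on the numerator may reach the left marker early and rest
  there; the marker counts as digit 0, and these zeros are the shift by \<open>lv - lu\<close>
  digits.\<close>

lemma exec_scan_bits:
  "h \<le> lv \<Longrightarrow> (lu \<le> lv \<Longrightarrow> cmp v = cmp_nat (nu * 2 ^ (lv - lu) div 2 ^ h) (nv div 2 ^ h)) \<Longrightarrow>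
   h0 \<le> Suc (length (binary n)) \<Longrightarrow> h1 \<le> Suc (length (binary a)) \<Longrightarrow>
   \<exists>q. exec inp f scan_bits (v, cs, set_heads x [h0, h1, lu - (lv - h), h])
     (v\<lparr>cmp := q\<rparr>, cs, set_heads x [h0, h1, lu - lv, 0]) \<and>
     (lu \<le> lv \<longrightarrow> q = cmp_nat (nu * 2 ^ (lv - lu)) nv)"
proof (induction h arbitrary: v)
  case 0
  have "exec inp f scan_bits (v, cs, set_heads x [h0, h1, lu - lv, 0]) (v, cs, set_heads x [h0, h1, lu - lv, 0])"
    unfolding scan_bits_def by (rule exec.While_False) (simp add: inp_def)
  moreover have "v\<lparr>cmp := cmp v\<rparr> = v" by simp
  ultimately show ?case using 0 by (intro exI[of _ "cmp v"]) simp
next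
  case (Suc h)
  let ?hu = "lu - (lv - Suc h)"
  let ?U = "nu * 2 ^ (lv - lu)"
  have lens: "length (binary nu) = lu" "length (binary nv) = lv" by (simp_all add: lu_def lv_def)
  let ?b = "read_input (binary nu) ?hu = Bit True" and ?c = "read_input (binary nv) (Suc h) = Bit True"
  let ?v = "v\<lparr>cmp := (if cmp v = None \<and> ?b \<noteq> ?c then Some ?c else cmp v)\<rparr>"
  have hu: "?hu - 1 = lu - (lv - h)" using Suc.prems(1) by simp
  have step: "exec inp f (Do (act_op (\<lambda>v b xs. (compare_step v xs, [Stay, Stay, Lft, Lft], Silent))))
     (v, cs, set_heads x [h0, h1, k, Suc h])
     (v\<lparr>cmp := (if cmp v = None \<and> (read_input (binary nu) k = Bit True) \<noteq> ?c then Some ?c else cmp v)\<rparr>, cs,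
      set_heads x [h0, h1, k - 1, h])" if "k \<le> Suc lu" for k
    by (rule exec_Do) (use Suc.prems that in \<open>simp add: do_act_op inp_def lens compare_step_def Let_def\<close>)
  have 1: "exec inp f (Do (act_op (\<lambda>v b xs. (compare_step v xs, [Stay, Stay, Lft, Lft], Silent))))
     (v, cs, set_heads x [h0, h1, ?hu, Suc h]) (?v, cs, set_heads x [h0, h1, lu - (lv - h), h])"
    using step[of ?hu] unfolding hu by simp
  have "cmp ?v = cmp_nat (?U div 2 ^ h) (nv div 2 ^ h)" if len: "lu \<le> lv"
  proof -
    have c: "?c = bit nv h" using Suc.prems(1) by (simp add: read_input_binary lens)
    have "bit ?U h = (lv - lu \<le> h \<and> bit nu (h - (lv - lu)))"
      using bit_push_bit_iff[of "lv - lu" nu h] by (simp add: push_bit_eq_mult)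
    then have b: "?b = bit ?U h" using Suc.prems(1) len by (auto simp: read_input_binary lens add.commute)
    show ?thesis
      unfolding div_power_bit[of ?U h] div_power_bit[of nv h] cmp_nat_step
      using Suc.prems(2)[OF len] by (simp add: b c)
  qed
  then have "\<exists>q. exec inp f scan_bits (?v, cs, set_heads x [h0, h1, lu - (lv - h), h])
     (?v\<lparr>cmp := q\<rparr>, cs, set_heads x [h0, h1, lu - lv, 0]) \<and>
     (lu \<le> lv \<longrightarrow> q = cmp_nat (nu * 2 ^ (lv - lu)) nv)"
    by (intro Suc.IH) (use Suc.prems in simp_all)
  then obtain q where 2: "exec inp f scan_bits (?v, cs, set_heads x [h0, h1, lu - (lv - h), h])
     (v\<lparr>cmp := q\<rparr>, cs, set_heads x [h0, h1, lu - lv, 0])" "lu \<le> lv \<longrightarrow> q = cmp_nat (nu * 2 ^ (lv - lu)) nv"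
    by auto
  have "exec inp f scan_bits (v, cs, set_heads x [h0, h1, ?hu, Suc h]) (v\<lparr>cmp := q\<rparr>, cs, set_heads x [h0, h1, lu - lv, 0])"
    unfolding scan_bits_def by (rule exec.While_True[OF _ 1 2(1)[unfolded scan_bits_def]]) (simp add: inp_def)
  then show ?case using 2(2) by blast
qed

lemma exec_emit_zero:
  "hok inp x \<Longrightarrow> exec inp f emit_zero (v, cs, x) (v, cs, x\<lparr>out := out x @ [Slash, Digit True]\<rparr>)"
  unfolding emit_zero_def by (rule exec.Seq[OF exec_Do[OF do_effect_op] exec_Do]) simp_all

text \<open>The continuation \<open>p\<close> is arbitrary, because the trivial case and the main
  case share this start of the program.\<close>

lemma exec_prelude:
  assumes "a > 0"
  shows "\<exists>q. (lu \<le> lv \<longrightarrow> q = cmp_nat (nu * 2 ^ (lv - lu)) nv) \<and> (\<forall>p w.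
      exec inp f (Cond (\<lambda>v b xs. short v \<or> \<not> long v \<and> cmp v \<noteq> Some True) emit_zero p)
        (v_init\<lparr>short := (lv < lu), long := (lu < lv), cmp := q\<rparr>, [], set_heads x [0, 1, lu - lv, 0]) w \<longrightarrow>
      exec inp f (Seq (Do (move_op [Stay, Rgt, Rgt, Rgt])) (Cond (\<lambda>v b xs. xs ! 1 = RightEnd) emit_zero
     (Seq scan_lengths (Seq (Do (move_op [Stay, Stay, Lft, Lft])) (Seq scan_bits
     (Cond (\<lambda>v b xs. short v \<or> \<not> long v \<and> cmp v \<noteq> Some True) emit_zero p))))))
     (v_init, [], set_heads x [0, 0, 0, 0]) w)"
proof -
  have lens: "length (binary nu) = lu" "length (binary nv) = lv" by (simp_all add: lu_def lv_def)
  have la: "length (binary a) > 0" using length_binary_pos assms(1) by simp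
  have 1: "exec inp f (Do (move_op [Stay, Rgt, Rgt, Rgt])) (v_init, [], set_heads x [0, 0, 0, 0])
     (v_init, [], set_heads x [0, 1, 1, 1])"
    by (rule exec_Do) (simp add: inp_def)
  have 2: "exec inp f scan_lengths (v_init, [], set_heads x [0, 1, 1, 1])
     (v_init\<lparr>short := (lv < lu), long := (lu < lv)\<rparr>, [], set_heads x [0, 1, Suc lu, Suc lv])"
    using exec_scan_lengths[of 1 v_init 0 1 "[]" x] by (simp add: v_init_def)
  let ?v2 = "v_init\<lparr>short := (lv < lu), long := (lu < lv)\<rparr>"
  have 3: "exec inp f (Do (move_op [Stay, Stay, Lft, Lft])) (?v2, [], set_heads x [0, 1, Suc lu, Suc lv])
     (?v2, [], set_heads x [0, 1, lu, lv])"
    by (rule exec_Do) (simp add: inp_def lens)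
  have "nu * 2 ^ (lv - lu) div 2 ^ lv = 0" if "lu \<le> lv"
  proof -
    have "nu * 2 ^ (lv - lu) < 2 ^ lu * 2 ^ (lv - lu)" using less_power_length_binary[of nu] by (simp add: lens)
    then show ?thesis using that by (simp flip: power_add)
  qed
  moreover have "nv div 2 ^ lv = 0" using less_power_length_binary[of nv] by (simp add: lens)
  ultimately obtain q where 4: "exec inp f scan_bits (?v2, [], set_heads x [0, 1, lu, lv])
     (?v2\<lparr>cmp := q\<rparr>, [], set_heads x [0, 1, lu - lv, 0])" "lu \<le> lv \<longrightarrow> q = cmp_nat (nu * 2 ^ (lv - lu)) nv"
    using exec_scan_bits[of lv ?v2 0 1 "[]" x] by (auto simp: v_init_def cmp_nat_def)
  have "\<not> test inp (\<lambda>v b xs. xs ! 1 = RightEnd) (v_init, [] :: cell list, set_heads x [0, 1, 1, 1])"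
    using la by (simp add: inp_def)
  then have "exec inp f (Seq (Do (move_op [Stay, Rgt, Rgt, Rgt])) (Cond (\<lambda>v b xs. xs ! 1 = RightEnd) emit_zero
     (Seq scan_lengths (Seq (Do (move_op [Stay, Stay, Lft, Lft])) (Seq scan_bits r)))))
     (v_init, [], set_heads x [0, 0, 0, 0]) w"
    if "exec inp f r (v_init\<lparr>short := (lv < lu), long := (lu < lv), cmp := q\<rparr>, [], set_heads x [0, 1, lu - lv, 0]) w" for r w
    by (intro exec.Seq[OF 1] exec.Cond) (use exec.Seq[OF 2 exec.Seq[OF 3 exec.Seq[OF 4(1) that]]] in simp)
  with 4(2) show ?thesis by blast
qed

text \<open>No cell is appended, so the space is constant, as it has to be for a sampler without
  queries. The output is a fraction with empty numerator, which denotes 0.\<close>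

lemma exec_trivial:
  assumes "a = 0 \<or> lv < lu \<or> lv = lu \<and> \<not> gt"
  shows "\<exists>v' x'. exec inp f (whole c d) (v_init, [], set_heads x [0, 0, 0, 0]) (v', [], x') \<and>
     out x' = out x @ [Slash, Digit True] \<and> asked x' = asked x"
proof (cases "a = 0")
  case True
  have 1: "exec inp f (Do (move_op [Stay, Rgt, Rgt, Rgt])) (v_init, [], set_heads x [0, 0, 0, 0])
     (v_init, [], set_heads x [0, 1, 1, 1])"
    by (rule exec_Do) (simp add: inp_def)
  let ?x = "set_heads x [0, 1, 1, 1]"
  have "hok inp ?x" by (simp add: inp_def)
  note e = exec_emit_zero[OF this, of v_init "[]"]
  have "exec inp f (whole c d) (v_init, [], set_heads x [0, 0, 0, 0]) (v_init, [], ?x\<lparr>out := out ?x @ [Slash, Digit True]\<rparr>)"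
  proof -
    have "binary a = []" using True by simp
    then have "test inp (\<lambda>v b xs. xs ! 1 = RightEnd) (v_init, [] :: cell list, ?x)" by (simp add: inp_def)
    then show ?thesis unfolding whole_def by (intro exec.Seq[OF 1] exec.Cond) (simp only: if_True e)
  qed
  then show ?thesis by (intro exI conjI, assumption) (simp_all add: set_heads_def)
next
  case False
  let ?x = "set_heads x [0, 1, lu - lv, 0]"
  have hx: "hok inp ?x" by (simp add: inp_def lu_def)
  obtain q where q: "lu \<le> lv \<longrightarrow> q = cmp_nat (nu * 2 ^ (lv - lu)) nv"
    and pre: "\<And>p w. exec inp f (Cond (\<lambda>v b xs. short v \<or> \<not> long v \<and> cmp v \<noteq> Some True) emit_zero p)
        (v_init\<lparr>short := (lv < lu), long := (lu < lv), cmp := q\<rparr>, [], ?x) w \<Longrightarrow>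
      exec inp f (Seq (Do (move_op [Stay, Rgt, Rgt, Rgt])) (Cond (\<lambda>v b xs. xs ! 1 = RightEnd) emit_zero
     (Seq scan_lengths (Seq (Do (move_op [Stay, Stay, Lft, Lft])) (Seq scan_bits
     (Cond (\<lambda>v b xs. short v \<or> \<not> long v \<and> cmp v \<noteq> Some True) emit_zero p))))))
     (v_init, [], set_heads x [0, 0, 0, 0]) w"
    using exec_prelude[of x] False by auto
  let ?v = "v_init\<lparr>short := (lv < lu), long := (lu < lv), cmp := q\<rparr>"
  have "test inp (\<lambda>v b xs. short v \<or> \<not> long v \<and> cmp v \<noteq> Some True) (?v, [] :: cell list, ?x)"
    using assms False q by (auto simp: cmp_nat_def gt_def split: if_splits)
  then have "exec inp f (whole c d) (v_init, [], set_heads x [0, 0, 0, 0]) (?v, [], ?x\<lparr>out := out ?x @ [Slash, Digit True]\<rparr>)"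
    unfolding whole_def using exec_emit_zero[OF hx, of ?v "[]"] by (intro pre exec.Cond) simp
  then show ?thesis by (intro exI conjI, assumption) (simp_all add: set_heads_def)
qed

definition "accepted = card {z. z \<le> 2 ^ zl - 1 \<and> f (zpoint z)}"

definition "Npad = N00(1 := n - ell, 2 := 0, 5 := 2 ^ (z1 - 1) - 1 - accepted, 4 := 0)"

lemma late_Npad: "late Npad"
  by (auto simp: late_def Npad_def N00_def)

lemma exec_to_pad:
  assumes "0 < a" "lu \<le> lv" "lu < lv \<or> gt" "query_tape x = []"
  obtains v b l where "\<And>w. exec inp f (Cond (\<lambda>v b xs. brute v) emit_count (Seq (lay2 c d) (sim_run.main_loop M)))
      (v, CS z1 Npad, (set_heads x [Suc (length (binary n)), Suc (length (binary a)), Suc lu, Suc lv])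
         \<lparr>answer := b, asked := asked x @ l\<rparr>) w \<Longrightarrow>
      exec inp f (whole c d) (v_init, [], set_heads x [0, 0, 0, 0]) w"
    "set l = zpoint ` {..2 ^ zl - 1}" "brute v = (n < ell)" "base v" "(cmp v = Some True) = gt" "pos v = min 3 z1"
proof -
  have lens: "length (binary nu) = lu" "length (binary nv) = lv" by (simp_all add: lu_def lv_def)
  let ?x0 = "set_heads x [0, 1, lu - lv, 0]"
  obtain q where q: "lu \<le> lv \<longrightarrow> q = cmp_nat (nu * 2 ^ (lv - lu)) nv"
    and pre: "\<And>p w. exec inp f (Cond (\<lambda>v b xs. short v \<or> \<not> long v \<and> cmp v \<noteq> Some True) emit_zero p)
        (v_init\<lparr>short := (lv < lu), long := (lu < lv), cmp := q\<rparr>, [], ?x0) w \<Longrightarrow>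
      exec inp f (Seq (Do (move_op [Stay, Rgt, Rgt, Rgt])) (Cond (\<lambda>v b xs. xs ! 1 = RightEnd) emit_zero
     (Seq scan_lengths (Seq (Do (move_op [Stay, Stay, Lft, Lft])) (Seq scan_bits
     (Cond (\<lambda>v b xs. short v \<or> \<not> long v \<and> cmp v \<noteq> Some True) emit_zero p))))))
     (v_init, [], set_heads x [0, 0, 0, 0]) w"
    using exec_prelude[of x] assms(1) by auto
  have qgt: "(q = Some True) = gt" using q assms(2) by (auto simp: cmp_nat_def gt_def)
  let ?v = "v_init\<lparr>short := (lv < lu), long := (lu < lv), cmp := q\<rparr>"
  have nt: "\<not> test inp (\<lambda>v b xs. short v \<or> \<not> long v \<and> cmp v \<noteq> Some True) (?v, [] :: cell list, ?x0)"
    using assms(2,3) qgt by auto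
  have "pos ?v = 0" by (simp add: v_init_def)
  then obtain v1 where 1: "exec inp f lay0 (?v, [], set_heads x [0, 1, lu - lv, 0])
     (v1, CS z0 N00, set_heads x [Suc (length (binary n)), 1, lu - lv, 0])"
     "pos v1 = min 3 z0" "st v1 = st ?v" "an v1 = an ?v" "cmp v1 = cmp ?v" "brute v1 = brute ?v"
    using exec_lay0[of 1 "lu - lv" 0 ?v x] le_SucI[OF diff_le_self[of lu lv]] by (auto simp: lens)
  have N00: "N00(1 := n) = N00" by (auto simp: N00_def)
  have I0: "tick_inv q 0 v1 (CS z0 N00)" using 1 by (simp add: tick_inv_def base_def v_init_def N00[simplified])
  have "\<exists>v' cs'. exec inp f (walk_inputs tick) (v1, CS z0 N00, set_heads x [Suc (length (binary n)), 1, lu - lv, 0])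
     (v', cs', set_heads x [Suc (length (binary n)), Suc (length (binary a)), Suc (length (binary nu)), Suc (length (binary nv))]) \<and>
     tick_inv q ell v' cs'"
  proof (rule exec_walk_inputs[OF _ _ _ tickable_tick _ _ _ _ I0])
    show "length (binary nu) \<le> length (binary nv)" using assms(2) by (simp add: lens)
    show "ell = length (binary n) + length (binary a) + (length (binary nv) - length (binary nu)) + (if gt then 1 else 0)"
      by (simp add: ell_def lens)
    show "(cmp v = Some True) = gt" if "tick_inv q i v cs" for i v cs
      using that qgt by (simp add: tick_inv_def)
  qed (simp_all add: lens)
  then obtain v2 cs2 where 2: "exec inp f (walk_inputs tick) (v1, CS z0 N00, set_heads x [Suc (length (binary n)), 1, lu - lv, 0])
     (v2, cs2, set_heads x [Suc (length (binary n)), Suc (length (binary a)), Suc lu, Suc lv])" "tick_inv q ell v2 cs2"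
    unfolding lens by blast
  let ?x2 = "set_heads x [Suc (length (binary n)), Suc (length (binary a)), Suc lu, Suc lv]"
  have hx2: "hok inp ?x2" by (simp add: inp_def lens)
  let ?N2 = "N00(1 := n - ell)"
  have cs2: "cs2 = CS z1 ?N2" using 2(2) by (simp add: tick_inv_def z1_def zl_def)
  let ?v3 = "v2\<lparr>flag := False\<rparr>"
  have 3: "exec inp f (Do (set_op (\<lambda>v b xs. v\<lparr>flag := False\<rparr>))) (v2, CS z1 ?N2, ?x2) (?v3, CS z1 ?N2, ?x2)"
    by (rule exec_Do) (use hx2 in simp)
  have "\<exists>b l. exec inp f (While (\<lambda>v b xs. \<not> flag v) pad_body) (v2\<lparr>flag := False\<rparr>, CS z1 ?N2, ?x2)
      (v2\<lparr>flag := True\<rparr>, CS z1 (?N2(2 := 0, 5 := ?N2 5 - card {z. z \<le> 2 ^ zl - 1 \<and> f (zpoint z)}, 4 := 0)),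
       ?x2\<lparr>answer := b, asked := asked ?x2 @ l\<rparr>) \<and> set l = zpoint ` {..2 ^ zl - 1}"
  proof (rule exec_pad_while)
    show "2 ^ zl - 1 = ?N2 4" "?N2 5 < 2 ^ (z1 - 1)" "?N2 4 < 2 ^ zl" by (simp_all add: N00_def)
    show "?N2 1 = n - zl" by (simp add: zl_def min_def)
    show "query_tape ?x2 = []" using assms(4) by (simp add: set_heads_def)
  qed (rule hx2)
  then obtain b l where 4: "exec inp f (While (\<lambda>v b xs. \<not> flag v) pad_body) (?v3, CS z1 ?N2, ?x2)
      (v2\<lparr>flag := True\<rparr>, CS z1 (?N2(2 := 0, 5 := ?N2 5 - card {z. z \<le> 2 ^ zl - 1 \<and> f (zpoint z)}, 4 := 0)),
       ?x2\<lparr>answer := b, asked := asked ?x2 @ l\<rparr>)" "set l = zpoint ` {..2 ^ zl - 1}" by blast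
  have N: "?N2(2 := 0, 5 := ?N2 5 - card {z. z \<le> 2 ^ zl - 1 \<and> f (zpoint z)}, 4 := 0) = Npad"
    by (simp add: Npad_def accepted_def N00_def fun_eq_iff)
  have x: "asked ?x2 = asked x" by (simp add: set_heads_def)
  let ?x4 = "?x2\<lparr>answer := b, asked := asked x @ l\<rparr>"
  have 5: "exec inp f pad (v2, CS z1 ?N2, ?x2) (v2\<lparr>flag := True\<rparr>, CS z1 Npad, ?x4)"
    unfolding pad_def by (rule exec.Seq[OF 3 4(1)[unfolded N x]])
  have "exec inp f (whole c d) (v_init, [], set_heads x [0, 0, 0, 0]) w"
    if "exec inp f (Cond (\<lambda>v b xs. brute v) emit_count (Seq (lay2 c d) (sim_run.main_loop M)))
      (v2\<lparr>flag := True\<rparr>, CS z1 Npad, ?x4) w" for w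
    unfolding whole_def
    by (intro pre exec.Cond)
       (simp only: nt if_False, rule exec.Seq[OF 1(1) exec.Seq[OF 2(1)[unfolded cs2] exec.Seq[OF 5 that]]])
  moreover have "pos v2 = min 3 z1" "brute v2 = (n < ell)" "cmp v2 = q" "base v2"
    using 2(2) by (simp_all add: tick_inv_def z1_def zl_def)
  ultimately show thesis using that[where v = "v2\<lparr>flag := True\<rparr>" and b = b and l = l] 4(2) qgt by (simp add: base_def)
qed

lemma accepted_le: "accepted \<le> 2 ^ zl"
proof -
  have "{z. z \<le> 2 ^ zl - 1 \<and> f (zpoint z)} \<subseteq> {..<2 ^ zl}"
    by (auto simp: le_diff_conv2 Suc_le_eq)
  then show ?thesis unfolding accepted_def using card_mono[of "{..<2 ^ zl :: nat}"] by fastforce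
qed

lemma exec_brute:
  assumes "0 < a" "lu \<le> lv" "lu < lv \<or> gt" "n < ell" and x: "query_tape x = []" "asked x = []" "out x = []"
  shows "\<exists>v' cs' x'. exec inp f (whole c d) (v_init, [], set_heads x [0, 0, 0, 0]) (v', cs', x') \<and>
     length cs' = length (binary n) + 2 + n \<and> set (asked x') = cube n \<and>
     denotes (out x') (real (card {y \<in> cube n. f y}) / 2 ^ n)"
proof -
  have zl: "zl = n" using assms(4) by (simp add: zl_def)
  obtain v b l where pre: "\<And>w. exec inp f (Cond (\<lambda>v b xs. brute v) emit_count (Seq (lay2 c d) (sim_run.main_loop M)))
      (v, CS z1 Npad, (set_heads x [Suc (length (binary n)), Suc (length (binary a)), Suc lu, Suc lv])
         \<lparr>answer := b, asked := asked x @ l\<rparr>) w \<Longrightarrow>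
      exec inp f (whole c d) (v_init, [], set_heads x [0, 0, 0, 0]) w"
    and v: "set l = zpoint ` {..2 ^ zl - 1}" "brute v = (n < ell)" "base v" "(cmp v = Some True) = gt"
    by (rule exec_to_pad[OF assms(1-3) x(1)]) blast
  let ?x = "(set_heads x [Suc (length (binary n)), Suc (length (binary a)), Suc lu, Suc lv])\<lparr>answer := b, asked := asked x @ l\<rparr>"
  have hx: "hok inp ?x" by (simp add: inp_def lu_def lv_def)
  let ?D = "map (\<lambda>j. Digit (\<not> cellbits z0 Npad j 5)) (filter (\<lambda>j. kindf z0 z1 j \<noteq> 0) [0..<z1])"
  let ?Z = "map (\<lambda>j. Digit False) (filter (\<lambda>j. kindf z0 z1 j = 2) [0..<z1])"
  have 1: "exec inp f (Do (sweep_effect_op (\<lambda>c. if kind c \<noteq> 0 then Emit (Digit (\<not> bits c 5)) else Silent)))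
     (v, CS z1 Npad, ?x) (v, CS z1 Npad, ?x\<lparr>out := ?D\<rparr>)"
  proof (rule exec_Do)
    show "do_op inp f (sweep_effect_op (\<lambda>c. if kind c \<noteq> 0 then Emit (Digit (\<not> bits c 5)) else Silent)) (v, CS z1 Npad, ?x) =
       (v, CS z1 Npad, ?x\<lparr>out := ?D\<rparr>)"
      using fold_emit[of f "\<lambda>j. kindf z0 z1 j \<noteq> 0" "\<lambda>j. Digit (\<not> cellbits z0 Npad j 5)" "[0..<z1]" ?x] hx x(3)
      by (simp add: cells_of_def comp_def kind_bits_CELL set_heads_def cong: if_cong)
  qed
  have 2: "exec inp f (Do (effect_op (\<lambda>_. Emit Slash))) (v, CS z1 Npad, ?x\<lparr>out := ?D\<rparr>) (v, CS z1 Npad, ?x\<lparr>out := ?D @ [Slash]\<rparr>)"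
    by (rule exec_Do) (use hx in simp)
  have 3: "exec inp f (Do (sweep_effect_op (\<lambda>c. if kind c = 2 then Emit (Digit False) else Silent)))
     (v, CS z1 Npad, ?x\<lparr>out := ?D @ [Slash]\<rparr>) (v, CS z1 Npad, ?x\<lparr>out := ?D @ [Slash] @ ?Z\<rparr>)"
  proof (rule exec_Do)
    show "do_op inp f (sweep_effect_op (\<lambda>c. if kind c = 2 then Emit (Digit False) else Silent)) (v, CS z1 Npad, ?x\<lparr>out := ?D @ [Slash]\<rparr>) =
       (v, CS z1 Npad, ?x\<lparr>out := ?D @ [Slash] @ ?Z\<rparr>)"
      using fold_emit[of f "\<lambda>j. kindf z0 z1 j = 2" "\<lambda>j. Digit False" "[0..<z1]" "?x\<lparr>out := ?D @ [Slash]\<rparr>"] hx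
      by (simp add: cells_of_def comp_def kind_bits_CELL cong: if_cong)
  qed
  have 4: "exec inp f (Do (effect_op (\<lambda>_. Emit (Digit True)))) (v, CS z1 Npad, ?x\<lparr>out := ?D @ [Slash] @ ?Z\<rparr>)
     (v, CS z1 Npad, ?x\<lparr>out := ?D @ [Slash] @ ?Z @ [Digit True]\<rparr>)"
    by (rule exec_Do) (use hx in simp)
  have E: "exec inp f emit_count (v, CS z1 Npad, ?x) (v, CS z1 Npad, ?x\<lparr>out := ?D @ [Slash] @ ?Z @ [Digit True]\<rparr>)"
    unfolding emit_count_def by (rule exec.Seq[OF 1 exec.Seq[OF 2 exec.Seq[OF 3 4]]])
  have ex: "exec inp f (whole c d) (v_init, [], set_heads x [0, 0, 0, 0])
     (v, CS z1 Npad, ?x\<lparr>out := ?D @ [Slash] @ ?Z @ [Digit True]\<rparr>)"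
    by (intro pre exec.Cond) (use E v(2) assms(4) in simp)
  have z1: "z1 = Suc (z1 - 1)" using z_pos by simp
  have f1: "filter (\<lambda>j. kindf z0 z1 j \<noteq> 0) [0..<z1] = map Suc [0..<z1 - 1]"
  proof -
    have "(\<lambda>j. kindf z0 z1 j \<noteq> 0) = (\<lambda>j. j \<noteq> 0)" by (auto simp: kindf_def)
    moreover have "filter (\<lambda>j. j \<noteq> 0) [0..<Suc m] = map Suc [0..<m]" for m
      by (induction m) auto
    ultimately show ?thesis using z1 by metis
  qed
  have f2: "filter (\<lambda>j. kindf z0 z1 j = 2) [0..<z1] = [z0..<z1]"
  proof -
    have "[0..<z1] = [0..<z0] @ [z0..<z1]" using z_pos upt_add_eq_append[of 0 z0 zl] by (simp add: z1_def)
    then show ?thesis using z_pos by (auto simp: kindf_def filter_empty_conv intro!: filter_True)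
  qed
  let ?N = "Npad 5" and ?m = "z1 - 1"
  let ?bs = "map (bit ?N) [0..<?m]"
  have D: "?D = map Digit (map Not ?bs)" unfolding f1 by (simp add: cellbits_def off_def)
  \<comment> \<open>One zero per cell of kind 2, that is \<open>n\<close> of them, and a final one:
    the numeral of \<open>2 ^ n\<close>.\<close>
  have Z: "?Z @ [Digit True] = map Digit (replicate n False @ [True])"
    unfolding f2 using zl by (simp add: z1_def map_replicate_const)
  have Nlt: "?N < 2 ^ ?m" using late_Npad by (simp add: late_def)
  have "binary_value ?bs = ?N"
    unfolding binary_value_def horner_sum_bit_eq_take_bit using Nlt by (simp add: take_bit_nat_eq_self_iff)
  then have bv: "Suc (?N + binary_value (map Not ?bs)) = 2 ^ ?m"
    using horner_sum_complement[of ?bs] by (simp add: binary_value_def)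
  \<comment> \<open>As many as \<open>2 ^ zl\<close> inputs may be accepted, one more than
    \<open>zl\<close> digits can count. Counter 5 has the additional digit because it extends over
    the cells below \<open>z0\<close> as well.\<close>
  have "(2::nat) ^ Suc zl \<le> 2 ^ ?m" using z_pos by (intro power_increasing) (auto simp: z1_def)
  then have "accepted \<le> 2 ^ ?m - 1" using accepted_le one_le_power[of "2::nat" zl] by (simp del: one_le_power)
  moreover have "?N = 2 ^ ?m - 1 - accepted" by (simp add: Npad_def)
  ultimately have "?N + accepted + 1 = 2 ^ ?m" using one_le_power[of "2::nat" ?m] by linarith
  then have acc: "binary_value (map Not ?bs) = accepted" using bv by linarith
  have "accepted = card {y \<in> cube n. f y}"
  proof -
    have "bij_betw (\<lambda>z. map (bit z) [0..<n]) {z \<in> {..<2 ^ n :: nat}. f (map (bit z) [0..<n])} {y \<in> cube n. f y}"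
      using bij_betw_bits_cube[of n] unfolding bij_betw_def by (auto intro: inj_on_subset)
    then have "card {z \<in> {..<2 ^ n :: nat}. f (map (bit z) [0..<n])} = card {y \<in> cube n. f y}"
      by (rule bij_betw_same_card)
    moreover have "(z \<le> 2 ^ n - 1) = (z < 2 ^ n)" for z :: nat
      by (metis Suc_diff_1 less_Suc_eq_le pos2 zero_less_power)
    ultimately show ?thesis by (simp add: accepted_def zpoint_def zl)
  qed
  then have "denotes (?D @ [Slash] @ ?Z @ [Digit True]) (real (card {y \<in> cube n. f y}) / 2 ^ n)"
    unfolding denotes_def
    by (intro exI[of _ False] exI[of _ "map Not ?bs"] exI[of _ "replicate n False @ [True]"])
       (use D Z acc in \<open>auto simp: binary_value_power\<close>)
  moreover have "set l = cube n" using v(1) zpoint_image zl by simp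
  moreover have "length (CS z1 Npad) = length (binary n) + 2 + n"
    using zl by (simp add: cells_of_def z1_def z0_def)
  ultimately show ?thesis using ex x(2) by (intro exI conjI) (assumption | simp)+
qed

lemma exec_main:
  assumes "0 < a" "lu \<le> lv" "lu < lv \<or> gt" "ell \<le> n" and x: "query_tape x = []" "asked x = []" "out x = []"
    and A: "sim_run.chain M sz inA (sim_run.splice n (set ys) f) (initial_config 4 M) cA" "asked cA = zs"
    and B: "sim_run.chain M sz inB (\<lambda>_. False) (initial_config 4 M) cB" "asked cB = ys"
  shows "\<exists>v' cs' x'. exec inp f (whole c d) (v_init, [], set_heads x [0, 0, 0, 0]) (v', cs', x') \<and>
     length cs' = sz \<and> out x' = out cA \<and>
     set (asked x') = (\<lambda>z. z @ replicate (n - ell) False) ` cube ell \<union>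
        {take r X @ drop r Y | r X Y. r \<le> n \<and> X \<in> set zs \<and> Y \<in> set ys}"
proof -
  have zl: "zl = ell" using assms(4) by (simp add: zl_def)
  have "length (binary a) > 0" using assms(1) length_binary_pos by simp
  then have "ell \<ge> 1" unfolding ell_def by linarith
  \<comment> \<open>With at least three cells \<open>pos\<close> has reached its final value 3, as
    \<open>grow_inv\<close> demands.\<close>
  then have z13: "3 \<le> z1" using z_pos zl by (simp add: z1_def)
  obtain v b l where pre: "\<And>w. exec inp f (Cond (\<lambda>v b xs. brute v) emit_count (Seq (lay2 c d) (sim_run.main_loop M)))
      (v, CS z1 Npad, (set_heads x [Suc (length (binary n)), Suc (length (binary a)), Suc lu, Suc lv])
         \<lparr>answer := b, asked := asked x @ l\<rparr>) w \<Longrightarrow>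
      exec inp f (whole c d) (v_init, [], set_heads x [0, 0, 0, 0]) w"
    and v: "set l = zpoint ` {..2 ^ zl - 1}" "brute v = (n < ell)" "base v" "(cmp v = Some True) = gt" "pos v = min 3 z1"
    by (rule exec_to_pad[OF assms(1-3) x(1)]) blast
  define x1 where "x1 = x\<lparr>answer := b, asked := asked x @ l\<rparr>"
  let ?hs = "[Suc (length (binary n)), Suc (length (binary a)), Suc lu, Suc lv]"
  have sx: "(set_heads x ?hs)\<lparr>answer := b, asked := asked x @ l\<rparr> = set_heads x1 ?hs"
    by (simp add: set_heads_def x1_def)
  have hx: "hok inp (set_heads x1 ?hs)" by (simp add: inp_def lu_def lv_def)
  have "grow_inv (cmp v) Npad z1 0 v (CS z1 Npad)" using v z13 by (simp add: grow_inv_def)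
  from exec_lay2[OF late_Npad assms(2) v(4) this _ hx]
  obtain v2 cs2 hs2 where 2: "exec inp f (lay2 c d) (v, CS z1 Npad, set_heads x1 ?hs) (v2, cs2, set_heads x1 hs2)"
    "grow_inv (cmp v) Npad sz 0 v2 cs2" "hok inp (set_heads x1 hs2)" by auto
  have nsz: "n < 2 ^ (sz - 1)"
  proof -
    have "z0 - 2 \<le> sz - 1" by (simp add: sz_def E1_def z1_def)
    then have "(2::nat) ^ (z0 - 2) \<le> 2 ^ (sz - 1)" by (rule power_increasing) simp
    then show ?thesis using z_pos(3) by linarith
  qed
  interpret r: sim_run M inp f z0 z1 sz n inA inB
    by unfold_locales (use z_pos nsz in auto)
  have mi: "r.mi = mi" by (simp add: fun_eq_iff r.mi_def mi_def)
  have i0: "query_tape (initial_config 4 M) = []" "asked (initial_config 4 M) = []" "out (initial_config 4 M) = []"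
    "state (initial_config 4 M) = 0" "answer (initial_config 4 M) = False"
    by (simp_all add: initial_config_def)
  have "\<exists>v' N' cf' x'. exec inp f r.main_loop (v2, cells_of z0 z1 sz Npad r.mi cf0, set_heads x1 hs2)
      (v', cells_of z0 z1 sz N' r.mi cf', x') \<and> out x' = out cA \<and>
      set (asked x') = set (asked (set_heads x1 hs2)) \<union> {take r X @ drop r Y | r X Y. r \<le> n \<and> X \<in> set zs \<and> Y \<in> set ys}"
  proof (rule r.exec_main_loop)
    show "r.chain inA (r.splice (set ys) f) (cf0 1) cA" "r.chain inB (\<lambda>_. False) (cf0 3) cB"
      using A(1) B(1) by (simp_all add: cf0_def)
    show "tied v2 cf0" using 2(2) by (simp add: tied_def grow_inv_def base_def cf0_def i0)
    show "out (set_heads x1 hs2) = out (cf0 0)" "query_tape (set_heads x1 hs2) = []"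
      using x by (simp_all add: cf0_def i0 x1_def set_heads_def)
    show "Npad 0 = n" "Npad 3 \<le> n" "Npad 2 \<le> n" using late_Npad by (simp_all add: late_def)
  qed (use A(2) B(2) 2(3) in \<open>simp_all add: cf0_def i0\<close>)
  then obtain v3 N3 cf3 x3 where 3: "exec inp f (sim_run.main_loop M) (v2, CS sz Npad, set_heads x1 hs2)
      (v3, cells_of z0 z1 sz N3 mi cf3, x3)" "out x3 = out cA"
      "set (asked x3) = set (asked (set_heads x1 hs2)) \<union> {take r X @ drop r Y | r X Y. r \<le> n \<and> X \<in> set zs \<and> Y \<in> set ys}"
    unfolding mi by blast
  have cs2: "cs2 = CS sz Npad" using 2(2) by (simp add: grow_inv_def)
  have "exec inp f (whole c d) (v_init, [], set_heads x [0, 0, 0, 0]) (v3, cells_of z0 z1 sz N3 mi cf3, x3)"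
    by (intro pre exec.Cond) (use exec.Seq[OF 2(1)[unfolded cs2] 3(1)] v(2) assms(4) sx in simp)
  moreover have "asked (set_heads x1 hs2) = l" using x by (simp add: set_heads_def x1_def)
  moreover have "set l = (\<lambda>z. z @ replicate (n - ell) False) ` cube ell" using v(1) zpoint_image zl by simp
  ultimately show ?thesis using 3(2,3)
    by (intro exI[of _ v3] exI[of _ "cells_of z0 z1 sz N3 mi cf3"] exI[of _ x3]) (simp add: cells_of_def)
qed

end

context simulation
begin

theorem machine_of_whole:
  "\<exists>M'. valid_machine 4 M' \<and> (\<forall>inp f v' cs' x'. length inp = 4 \<longrightarrow>
     exec inp f (whole c d) (v_init, [], set_heads \<lparr>state = 0, answer = False, input_heads = [], work = [],
       query_tape = [], asked = [], out = []\<rparr> [0, 0, 0, 0]) (v', cs', x') \<longrightarrow>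
     uses_space M' inp f (real (length cs' + 2)) \<and>
     (\<exists>t. halts_at M' inp f t \<and> out (config_at M' inp f t) = out x' \<and> asked (config_at M' inp f t) = asked x'))"
proof -
  interpret m: sweep_machine V Cs 4 "whole c d" v_init
    by unfold_locales (use finite_V finite_Cs v_init_V wf_whole in auto)
  have "set_heads \<lparr>state = 0, answer = False, input_heads = [], work = [],
       query_tape = [], asked = [], out = []\<rparr> [0, 0, 0, 0] = m.io0"
  proof -
    have "replicate 4 (0::nat) = [0, 0, 0, 0]" by (simp add: numeral_eq_Suc)
    then show ?thesis by (simp add: set_heads_def m.io0_def)
  qed
  then show ?thesis using m.valid_M m.compiled by auto
qed

end

section \<open>The reduced sampler\<close>

primrec ask_list :: "bool list list \<Rightarrow> (bool list \<Rightarrow> sampler) \<Rightarrow> sampler" where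
  "ask_list [] k = k []"
| "ask_list (x # xs) k = Query x (\<lambda>b. ask_list xs (\<lambda>bs. k (b # bs)))"

lemma run_ask_list: "run_sampler (ask_list xs k) f = run_sampler (k (map f xs)) f"
  by (induction xs arbitrary: k) auto

lemma queries_ask_list: "queries (ask_list xs k) f = xs @ queries (k (map f xs)) f"
  by (induction xs arbitrary: k) auto

definition table :: "bool list list \<Rightarrow> bool list \<Rightarrow> bool list \<Rightarrow> bool" where
  "table xs bs z \<longleftrightarrow> map_of (zip xs bs) z = Some True"

lemma table_map: "table xs (map f xs) z \<longleftrightarrow> z \<in> set xs \<and> f z"
  by (simp add: table_def map_of_zip_map)

definition cross :: "nat \<Rightarrow> bool list list \<Rightarrow> bool list \<Rightarrow> bool list list" where
  "cross n H x = [take r x @ drop r y. r \<leftarrow> [0..<Suc n], y \<leftarrow> H]"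

lemma set_cross: "set (cross n H x) = {take r x @ drop r y | r y. r \<le> n \<and> y \<in> set H}"
  by (auto simp: cross_def less_Suc_eq_le simp del: upt_Suc) force

text \<open>All of \<open>cross n H x\<close> is asked, even where the quantifiers of the hybrid
  could be decided early. The queries then depend on \<open>f\<close> only through values of the
  hybrid, which preserves nonadaptivity, and a machine can ask the same set without remembering
  answers.\<close>

primrec sim_tree :: "nat \<Rightarrow> bool list list \<Rightarrow> sampler \<Rightarrow> sampler" where
  "sim_tree n H (Output r) = Output r"
| "sim_tree n H (Query x T) = ask_list (cross n H x)
     (\<lambda>bs. sim_tree n H (T (hybrid n (set H) (table (cross n H x) bs) x)))"

lemma hybrid_table: "hybrid n (set H) (table (cross n H x) (map f (cross n H x))) x = hybrid n (set H) f x"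
  unfolding hybrid_def table_map set_cross by blast

lemma run_sim_tree: "run_sampler (sim_tree n H T) f = run_sampler T (hybrid n (set H) f)"
  by (induction T) (simp_all add: run_ask_list hybrid_table)

lemma queries_sim_tree:
  "queries (sim_tree n H T) f = concat (map (cross n H) (queries T (hybrid n (set H) f)))"
  by (induction T) (simp_all add: queries_ask_list hybrid_table)

definition cube_list :: "nat \<Rightarrow> bool list list" where
  "cube_list n = List.n_lists n [False, True]"

lemma set_cube_list [simp]: "set (cube_list n) = cube n"
  by (auto simp: cube_list_def set_n_lists cube_def)

text \<open>Needed to use the supremum in \<open>query_complexity\<close> as an upper bound.\<close>

lemma queries_bounded: "\<exists>N. \<forall>f. card (set (queries T f)) \<le> N"
proof (induction T)
  case (Query x T)
  obtain N0 N1 where "\<forall>f. card (set (queries (T False) f)) \<le> N0" "\<forall>f. card (set (queries (T True) f)) \<le> N1"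
    using Query[of "T False"] Query[of "T True"] by auto
  then have "card (set (queries (T b) f)) \<le> N0 + N1" for b f by (cases b) (simp_all add: trans_le_add1 trans_le_add2)
  then have "card (insert x (set (queries (T b) f))) \<le> Suc (N0 + N1)" for b f
    by (simp add: card_insert_if le_SucI)
  then show ?case by auto
qed auto

lemma card_queries_le: "f \<in> F \<Longrightarrow> card (set (queries T f)) \<le> query_complexity F T"
proof -
  assume "f \<in> F"
  moreover obtain N where "\<forall>f. card (set (queries T f)) \<le> N" using queries_bounded by blast
  then have "bdd_above ((\<lambda>f. card (set (queries T f))) ` F)" by (auto intro!: bdd_aboveI)
  ultimately show ?thesis unfolding query_complexity_def by (rule cSUP_upper)
qed

lemma query_complexity_le: "(\<And>f. f \<in> F \<Longrightarrow> card (set (queries T f)) \<le> N) \<Longrightarrow> query_complexity F T \<le> N"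
  unfolding query_complexity_def by (cases "F = {}") (simp add: Sup_nat_def, rule cSUP_least)

text \<open>\<open>2 ^ - kappa \<epsilon>\<close> is \<open>min 1 \<epsilon>\<close> rounded down to a power of two.\<close>

definition kappa :: "real \<Rightarrow> nat" where
  "kappa \<epsilon> = (LEAST k. 1 \<le> \<epsilon> * 2 ^ k)"

lemma kappa_ge: assumes "\<epsilon> > 0" shows "1 \<le> \<epsilon> * 2 ^ kappa \<epsilon>"
proof -
  obtain k where "1 / \<epsilon> < 2 ^ k" using real_arch_pow[of 2 "1 / \<epsilon>"] by auto
  then have "1 \<le> \<epsilon> * 2 ^ k" using assms by (simp add: field_simps)
  then show ?thesis unfolding kappa_def by (rule LeastI)
qed

lemma kappa_less: assumes "kappa \<epsilon> > 0" shows "\<epsilon> * 2 ^ kappa \<epsilon> < 2"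
proof -
  have "\<not> 1 \<le> \<epsilon> * 2 ^ (kappa \<epsilon> - 1)"
    using assms unfolding kappa_def by (intro not_less_Least) simp
  moreover have "(2::real) ^ kappa \<epsilon> = 2 * 2 ^ (kappa \<epsilon> - 1)" using assms by (simp flip: power_Suc)
  ultimately show ?thesis by simp
qed

text \<open>A positive number with \<open>m\<close> digits lies between \<open>2 ^ (m - 1)\<close>
  and \<open>2 ^ m\<close>. For \<open>lu \<le> lv\<close>, shifting \<open>u\<close> to the length
  of \<open>v\<close> thus leaves at most one more doubling to reach \<open>v\<close>, and
  \<open>gt\<close> says whether it is necessary. So \<open>kappa\<close> is found by comparing
  digits, without arithmetic.\<close>

lemma kappa_fraction:
  fixes u v :: nat
  defines "lu \<equiv> length (binary u)" and "lv \<equiv> length (binary v)"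
  defines "gt \<equiv> u * 2 ^ (lv - lu) < v"
  assumes uv: "u > 0" "v > 0"
  shows "kappa (real u / real v) = (if lv < lu \<or> lv = lu \<and> \<not> gt then 0 else lv - lu + of_bool gt)"
proof -
  have P: "1 \<le> real u / real v * 2 ^ k \<longleftrightarrow> v \<le> u * 2 ^ k" for k
  proof -
    have "1 \<le> real u / real v * 2 ^ k \<longleftrightarrow> real v \<le> real (u * 2 ^ k)" using uv by (simp add: field_simps)
    then show ?thesis by (simp only: of_nat_le_iff)
  qed
  have b: "u < 2 ^ lu" "2 ^ lu \<le> 2 * u" "v < 2 ^ lv" "2 ^ lv \<le> 2 * v"
    using uv less_power_length_binary power_length_binary_le by (simp_all add: lu_def lv_def)
  show ?thesis
  proof (cases "lv < lu \<or> lv = lu \<and> \<not> gt")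
    case True
    have "v \<le> u"
    proof (cases "lv < lu")
      case True
      then have "(2::nat) ^ Suc lv \<le> 2 ^ lu" by (intro power_increasing) auto
      then show ?thesis using b by simp
    qed (use True in \<open>auto simp: gt_def\<close>)
    then have "(LEAST k. v \<le> u * 2 ^ k) = 0" by (intro Least_eq_0) simp
    then show ?thesis using True by (simp only: kappa_def P if_True)
  next
    case False
    then have le: "lu \<le> lv" by simp
    have "(LEAST k. v \<le> u * 2 ^ k) = lv - lu + of_bool gt"
    proof (rule Least_equality)
      show "v \<le> u * 2 ^ (lv - lu + of_bool gt)"
      proof (cases gt)
        case True
        have "v < 2 ^ lu * 2 ^ (lv - lu)" using b(3) le by (simp flip: power_add)
        also have "\<dots> \<le> 2 * u * 2 ^ (lv - lu)" using b(2) by (intro mult_right_mono) auto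
        finally show ?thesis using True by (simp add: algebra_simps)
      qed (simp add: gt_def)
    next
      fix y assume y: "v \<le> u * 2 ^ y"
      show "lv - lu + of_bool gt \<le> y"
      proof (rule ccontr)
        assume *: "\<not> ?thesis"
        show False
        proof (cases gt)
          case True
          then have "(2::nat) ^ y \<le> 2 ^ (lv - lu)" using * by (intro power_increasing) auto
          then have "u * 2 ^ y \<le> u * 2 ^ (lv - lu)" by simp
          then show False using True y unfolding gt_def by linarith
        next
          case False
          then have "Suc y \<le> lv - lu" using * by simp
          then have "(2::nat) ^ Suc y \<le> 2 ^ (lv - lu)" by (intro power_increasing) auto
          then have "u * 2 ^ Suc y \<le> u * 2 ^ (lv - lu)" by (rule mult_left_mono) simp
          also have "\<dots> < 2 ^ lu * 2 ^ (lv - lu)" using b(1) by simp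
          also have "\<dots> = 2 ^ lv" using le by (simp flip: power_add)
          finally show False using b(4) y by simp
        qed
      qed
    qed
    then show ?thesis using False by (simp only: kappa_def P if_False)
  qed
qed

text \<open>One exponent serves for both factors, so that an argument of at most
  \<open>2 ^ m\<close> gives the bound \<open>2 ^ (D * (1 + m))\<close>: only exponents remain, and
  these are what the layout can count.\<close>

lemma poly_bound: "\<exists>D. \<forall>x\<ge>1. poly p x \<le> 2 ^ D * x ^ D" for p :: "real poly"
proof (induction p)
  case 0
  show ?case by auto
next
  case (pCons a p)
  then obtain D where D: "\<And>x. x \<ge> 1 \<Longrightarrow> poly p x \<le> 2 ^ D * x ^ D" by blast
  obtain m where m: "\<bar>a\<bar> < 2 ^ m" using real_arch_pow[of 2] by auto
  have "poly (pCons a p) x \<le> 2 ^ (Suc D + m) * x ^ (Suc D + m)" if x: "x \<ge> 1" for x :: real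
  proof -
    have "x * poly p x \<le> x * (2 ^ D * x ^ D)" using D[OF x] x by (intro mult_left_mono) auto
    then have 1: "x * poly p x \<le> 2 ^ D * x ^ Suc D" by (simp add: algebra_simps)
    have 2: "x ^ Suc D \<le> x ^ (Suc D + m)" using x by (intro power_increasing) auto
    have "1 \<le> x ^ (Suc D + m)" using x by (rule one_le_power)
    then have "2 ^ m * 1 \<le> 2 ^ m * x ^ (Suc D + m)" by (intro mult_left_mono) auto
    moreover have "2 ^ D * x ^ Suc D \<le> 2 ^ D * x ^ (Suc D + m)" using 2 by (intro mult_left_mono) auto
    ultimately have "poly (pCons a p) x \<le> (2 ^ m + 2 ^ D) * x ^ (Suc D + m)"
      using 1 m unfolding distrib_right poly_pCons by linarith
    also have "(2::real) ^ m + 2 ^ D \<le> 2 ^ (Suc D + m)"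
    proof -
      have "(2::real) ^ m \<le> 2 ^ (D + m)" "(2::real) ^ D \<le> 2 ^ (D + m)" by (intro power_increasing; simp)+
      moreover have "(2::real) ^ (Suc D + m) = 2 ^ (D + m) + 2 ^ (D + m)" by simp
      ultimately show ?thesis by linarith
    qed
    finally show ?thesis using x by (simp add: mult_right_mono)
  qed
  then show ?case by blast
qed


locale sampler_family =
  fixes p :: "real poly" and Samp :: "nat \<Rightarrow> nat \<Rightarrow> real \<Rightarrow> sampler" and D :: nat
  assumes samp: "\<epsilon> > 0 \<Longrightarrow> is_sampler n (perm_bp_width n w) \<epsilon> (Samp n w \<epsilon>)"
    and complexity: "\<epsilon> > 0 \<Longrightarrow>
      real (query_complexity (perm_bp_width n w) (Samp n w \<epsilon>)) \<le> poly p (real n * real w / \<epsilon>)"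
    and D: "x \<ge> 1 \<Longrightarrow> poly p x \<le> 2 ^ D * x ^ D"
begin

text \<open>Exponent of the width for the hitting argument, where at most
  \<open>a * 2 ^ (kappa \<epsilon> + 2)\<close> vertices of each layer are kept, and of the
  precision of both runs. It is the index of the last cell of kind 2.\<close>

definition "E0 n l = length (binary n) + 1 + l"
text \<open>Exponent of the width of the hybrid, with \<open>5 * D * l\<close> for the size of the
  hitting set. The summand 1 is due to \<open>lay2\<close>, which spends a cell of its own on the
  top digit of the shorter numeral.\<close>

definition "E1 n l = E0 n l + 1 + 5 * D * l"
definition "coarse n l = Samp n (2 ^ E0 n l) (real 1 / real (2 ^ E0 n l :: nat))"
definition "precise n l = Samp n (2 ^ E1 n l) (real 1 / real (2 ^ E0 n l :: nat))"
definition "hits n l = queries (coarse n l) (\<lambda>_. False)"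
definition "padding n l = map (\<lambda>z. z @ replicate (n - l) False) (cube_list l)"
definition "len n a \<epsilon> = length (binary n) + length (binary a) + kappa \<epsilon>"
text \<open>The precise run makes at most \<open>2 ^ (e * l)\<close> queries: its length, width and
  precision amount to \<open>(5 * D + 5) * l\<close> bits, and the polynomial contributes the factor
  \<open>D\<close>.\<close>

definition "e = D * (5 * D + 5)"

text \<open>The answers to the queries in \<open>padding\<close> are ignored. They make the query complexity so
  large that \<open>O(log S)\<close> space suffices to store \<open>n\<close>, \<open>a\<close> and \<open>\<epsilon>\<close>.\<close>

definition reduced :: "nat \<Rightarrow> nat \<Rightarrow> real \<Rightarrow> sampler" where
  "reduced n a \<epsilon> = (let l = len n a \<epsilon> in
     if a = 0 \<or> kappa \<epsilon> = 0 then Output 0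
     else if n < l then ask_list (cube_list n)
       (\<lambda>bs. Output (real (card {x \<in> cube n. table (cube_list n) bs x}) / 2 ^ n))
     else ask_list (padding n l) (\<lambda>_. sim_tree n (hits n l) (precise n l)))"

lemma complexity_power:
  assumes "n > 0"
  shows "query_complexity (perm_bp_width n (2 ^ W)) (Samp n (2 ^ W) (real 1 / real (2 ^ E :: nat)))
    \<le> 2 ^ (D * (1 + length (binary n) + W + E))" (is "?S \<le> _")
proof -
  let ?x = "real n * real (2 ^ W) / (real 1 / real (2 ^ E :: nat))"
  have x: "?x = real (n * 2 ^ (W + E))" by (simp add: power_add)
  have "1 \<le> n * 2 ^ (W + E)" using assms by simp
  then have x1: "?x \<ge> 1" unfolding x by linarith
  have "n * 2 ^ (W + E) \<le> 2 ^ (length (binary n) + W + E)"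
    using less_power_length_binary[of n] by (simp add: power_add)
  then have x2: "?x \<le> 2 ^ (length (binary n) + W + E)" unfolding x by (metis of_nat_le_iff of_nat_numeral of_nat_power)
  have "real ?S \<le> poly p ?x" by (rule complexity) simp
  also have "\<dots> \<le> 2 ^ D * ?x ^ D" by (rule D[OF x1])
  also have "\<dots> = (2 * ?x) ^ D" by (simp only: power_mult_distrib)
  also have "\<dots> \<le> (2 * 2 ^ (length (binary n) + W + E)) ^ D" using x1 x2 by (intro power_mono) auto
  also have "\<dots> = 2 ^ (D * (1 + length (binary n) + W + E))"
    by (simp only: power_mult power_Suc[symmetric] mult.commute[of D]) simp
  also have "\<dots> = real (2 ^ (D * (1 + length (binary n) + W + E)))" by simp
  finally show ?thesis by (simp only: of_nat_le_iff)
qed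

lemma FW: "(\<lambda>_. False) \<in> perm_bp_width n (2 ^ E)"
  by (rule const_False_in_perm_bp_width) simp

lemma hits_cube: "set (hits n l) \<subseteq> cube n"
  using samp[of "real 1 / real (2 ^ E0 n l :: nat)" n "2 ^ E0 n l"] FW[of n "E0 n l"]
  by (auto simp: is_sampler_def hits_def coarse_def)

context
  fixes n a :: nat and \<epsilon> :: real and l
  assumes \<epsilon>: "\<epsilon> > 0" and a: "a > 0" and k: "kappa \<epsilon> > 0" and n: "l \<le> n" and l: "l = len n a \<epsilon>"
begin

lemma sizes: "length (binary n) \<ge> 1" "length (binary a) \<ge> 1" "l \<ge> 3"
  "length (binary n) + 2 \<le> l" "kappa \<epsilon> + 2 \<le> l" "n > 0"
proof -
  have "l > 0" using k l by (simp add: len_def)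
  then show 0: "n > 0" using n by simp
  then show 1: "length (binary n) \<ge> 1" "length (binary a) \<ge> 1"
    using length_binary_pos[of n] length_binary_pos[of a] a by linarith+
  show "l \<ge> 3" "length (binary n) + 2 \<le> l" "kappa \<epsilon> + 2 \<le> l" using 1 k unfolding l len_def by linarith+
qed

lemma coarse_complexity: "query_complexity (perm_bp_width n (2 ^ E0 n l)) (coarse n l) \<le> 2 ^ (5 * D * l)"
proof -
  \<comment> \<open>Each \<open>E0\<close> contains one \<open>l\<close>; the other three absorb the
    remaining \<open>3 * length (binary n) + 3\<close>.\<close>
  have "1 + length (binary n) + E0 n l + E0 n l \<le> 5 * l" using sizes by (simp add: E0_def)
  then have "D * (1 + length (binary n) + E0 n l + E0 n l) \<le> D * (5 * l)" by (rule mult_left_mono) simp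
  then have "(2::nat) ^ (D * (1 + length (binary n) + E0 n l + E0 n l)) \<le> 2 ^ (5 * D * l)"
    by (intro power_increasing) (simp_all add: algebra_simps)
  with complexity_power[OF sizes(6), of "E0 n l" "E0 n l"] show ?thesis unfolding coarse_def by linarith
qed

lemma precise_complexity: "query_complexity (perm_bp_width n (2 ^ E1 n l)) (precise n l) \<le> 2 ^ (e * l)"
proof -
  have "1 + length (binary n) + E1 n l + E0 n l \<le> (5 * D + 5) * l"
    using sizes by (simp add: E0_def E1_def algebra_simps)
  then have "D * (1 + length (binary n) + E1 n l + E0 n l) \<le> D * ((5 * D + 5) * l)" by (rule mult_left_mono) simp
  then have "(2::nat) ^ (D * (1 + length (binary n) + E1 n l + E0 n l)) \<le> 2 ^ (e * l)"
    by (intro power_increasing) (simp_all add: e_def mult.assoc)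
  with complexity_power[OF sizes(6), of "E1 n l" "E0 n l"] show ?thesis unfolding precise_def by linarith
qed

lemma card_hits: "card (set (hits n l)) \<le> 2 ^ (5 * D * l)"
  using card_queries_le[where T = "coarse n l", OF FW[of n "E0 n l"]] coarse_complexity unfolding hits_def by linarith

lemma hybrid_hits: "f \<in> perm_bp_accept n a \<Longrightarrow> hybrid n (set (hits n l)) f \<in> perm_bp_width n (2 ^ E1 n l)"
proof (rule perm_bp_width_mono)
  let ?K = "2 ^ (length (binary a) + 5 * D * l)"
  assume f: "f \<in> perm_bp_accept n a"
  have "a * card (set (hits n l)) \<le> ?K"
    unfolding power_add using less_power_length_binary[of a] card_hits by (intro mult_mono) auto
  then show "hybrid n (set (hits n l)) f \<in> perm_bp_width n (Suc n * ?K)"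
    by (intro hybrid_in_perm_bp_width[OF f] hits_cube) auto
  have "Suc n * ?K \<le> 2 ^ length (binary n) * ?K"
    using less_power_length_binary[of n] by (intro mult_right_mono) auto
  also have "\<dots> = 2 ^ (length (binary n) + (length (binary a) + 5 * D * l))" by (simp only: power_add)
  also have "\<dots> \<le> 2 ^ E1 n l" by (intro power_increasing) (auto simp: E0_def E1_def l len_def)
  finally show "Suc n * ?K \<le> 2 ^ E1 n l" .
qed

text \<open>\<theta> is a quarter of the admissible error \<open>2 ^ - kappa \<epsilon>\<close>, and
  the two evaluations of the coarse sampler cost at most another quarter. The remaining half is left
  to the sampler that runs on the hybrid.\<close>

lemma hits_hit:
  assumes f: "f \<in> perm_bp_accept n a" and miss: "\<forall>y\<in>set (hits n l). \<not> f y"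
  shows "measure_pmf.prob (pmf_of_set (cube n)) {x. f x} \<le> 1 / 2 ^ (kappa \<epsilon> + 1)"
proof -
  let ?\<theta> = "1 / 2 ^ (kappa \<epsilon> + 2) :: real" and ?\<eta> = "real 1 / real (2 ^ E0 n l :: nat)"
  let ?K = "a * 2 ^ (kappa \<epsilon> + 2)"
  have "measure_pmf.prob (pmf_of_set (cube n)) {x. f x} \<le> ?\<theta> + 2 * ?\<eta>"
  proof (rule zero_queries_hit[OF _ _ _ _ _ f, where W = "2 ^ E0 n l" and K = ?K and T = "coarse n l"])
    show "is_sampler n (perm_bp_width n (2 ^ E0 n l)) ?\<eta> (coarse n l)"
      unfolding coarse_def by (rule samp) simp
    have "Suc n * ?K \<le> 2 ^ length (binary n) * (2 ^ length (binary a) * 2 ^ (kappa \<epsilon> + 2))"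
      using less_power_length_binary[of n] less_power_length_binary[of a] by (intro mult_mono) auto
    also have "\<dots> = 2 ^ (length (binary n) + (length (binary a) + (kappa \<epsilon> + 2)))" by (simp only: power_add)
    also have "\<dots> \<le> 2 ^ E0 n l" using sizes(1) by (intro power_increasing) (auto simp: E0_def l len_def)
    finally show "Suc n * ?K \<le> 2 ^ E0 n l" .
  qed (use a miss in \<open>simp_all add: hits_def\<close>)
  moreover have "2 * ?\<eta> \<le> ?\<theta>"
  proof -
    have "(2::real) ^ (kappa \<epsilon> + 3) \<le> 2 ^ E0 n l" using sizes(5) by (intro power_increasing) (auto simp: E0_def)
    then show ?thesis by (simp add: field_simps power_add)
  qed
  moreover have "2 * ?\<theta> = 1 / 2 ^ (kappa \<epsilon> + 1)" by simp
  ultimately show ?thesis by linarith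
qed

lemma reduced_main: "reduced n a \<epsilon> = ask_list (padding n l) (\<lambda>_. sim_tree n (hits n l) (precise n l))"
  using a k n by (simp add: reduced_def l[symmetric] Let_def)

lemma set_padding: "set (padding n l) = (\<lambda>z. z @ replicate (n - l) False) ` cube l"
  by (simp add: padding_def)

lemma card_padding: "card (set (padding n l)) = 2 ^ l"
  unfolding set_padding by (subst card_image) (auto simp: inj_on_def card_cube)

lemma set_queries_main:
  "set (queries (reduced n a \<epsilon>) f) = (\<lambda>z. z @ replicate (n - l) False) ` cube l \<union>
     {take r X @ drop r Y | r X Y. r \<le> n \<and>
        X \<in> set (queries (precise n l) (hybrid n (set (hits n l)) f)) \<and> Y \<in> set (hits n l)}"
  unfolding reduced_main queries_ask_list queries_sim_tree by (auto simp: set_padding set_cross)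

lemma run_main: "run_sampler (reduced n a \<epsilon>) f = run_sampler (precise n l) (hybrid n (set (hits n l)) f)"
  by (simp add: reduced_main run_ask_list run_sim_tree)

lemma precise_sampler: "is_sampler n (perm_bp_width n (2 ^ E1 n l)) (real 1 / real (2 ^ E0 n l :: nat)) (precise n l)"
  unfolding precise_def by (rule samp) simp

text \<open>The lower bound on the number of queries is what pays for the space of the machine. The
  padding alone provides it, whatever \<open>f\<close> is.\<close>

lemma main_correct:
  assumes f: "f \<in> perm_bp_accept n a"
  shows "set (queries (reduced n a \<epsilon>) f) \<subseteq> cube n"
    "\<bar>run_sampler (reduced n a \<epsilon>) f - measure_pmf.prob (pmf_of_set (cube n)) {x. f x}\<bar> \<le> \<epsilon>"
    "card (set (queries (reduced n a \<epsilon>) f)) \<le> 2 ^ ((2 * e + 2) * l)"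
    "2 ^ l \<le> card (set (queries (reduced n a \<epsilon>) f))"
proof -
  let ?h = "hybrid n (set (hits n l)) f" and ?P = "measure_pmf.prob (pmf_of_set (cube n))"
  have Q: "set (queries (precise n l) ?h) \<subseteq> cube n"
    and r: "\<bar>run_sampler (precise n l) ?h - ?P {x. ?h x}\<bar> \<le> real 1 / real (2 ^ E0 n l :: nat)"
    using precise_sampler hybrid_hits[OF f] unfolding is_sampler_def by blast+
  show "set (queries (reduced n a \<epsilon>) f) \<subseteq> cube n"
  proof
    fix z assume "z \<in> set (queries (reduced n a \<epsilon>) f)"
    then consider x where "x \<in> cube l" "z = x @ replicate (n - l) False"
      | r X Y where "z = take r X @ drop r Y" "r \<le> n" "X \<in> cube n" "Y \<in> cube n"
      unfolding set_queries_main using Q hits_cube[of n l] by blast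
    then show "z \<in> cube n" using n by cases (simp_all add: cube_def)
  qed
  have "\<bar>?P {x. ?h x} - ?P {x. f x}\<bar> \<le> 1 / 2 ^ (kappa \<epsilon> + 1)"
    by (rule hybrid_prob[OF f hits_cube]) (use hits_hit in auto)
  moreover have "(2::real) ^ (kappa \<epsilon> + 1) \<le> 2 ^ E0 n l" using sizes(5) by (intro power_increasing) (auto simp: E0_def)
  then have "real 1 / real (2 ^ E0 n l :: nat) \<le> 1 / 2 ^ (kappa \<epsilon> + 1)" by (simp add: field_simps)
  moreover have "1 / 2 ^ (kappa \<epsilon> + 1) + 1 / 2 ^ (kappa \<epsilon> + 1) = 1 / (2 ^ kappa \<epsilon> :: real)" by simp
  moreover have "1 / 2 ^ kappa \<epsilon> \<le> \<epsilon>" using kappa_ge[OF \<epsilon>] by (simp add: field_simps)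
  ultimately show "\<bar>run_sampler (reduced n a \<epsilon>) f - ?P {x. f x}\<bar> \<le> \<epsilon>" using r unfolding run_main by linarith
  let ?X = "set (queries (precise n l) ?h)" and ?Y = "set (hits n l)"
  have fin: "finite (set (queries (reduced n a \<epsilon>) f))" by simp
  show "2 ^ l \<le> card (set (queries (reduced n a \<epsilon>) f))"
    unfolding card_padding[symmetric] by (rule card_mono[OF fin]) (simp add: set_queries_main set_padding)
  have "card {take r X @ drop r Y | r X Y. r \<le> n \<and> X \<in> ?X \<and> Y \<in> ?Y} \<le> card ({..n} \<times> ?X \<times> ?Y)"
    (is "card ?Z \<le> card ?W")
  proof (rule surj_card_le)
    show "?Z \<subseteq> (\<lambda>(r, X, Y). take r X @ drop r Y) ` ?W"
    proof
      fix z assume "z \<in> ?Z"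
      then obtain r X Y where "z = take r X @ drop r Y" "r \<le> n" "X \<in> ?X" "Y \<in> ?Y" by blast
      then show "z \<in> (\<lambda>(r, X, Y). take r X @ drop r Y) ` ?W" by (intro image_eqI[of _ _ "(r, X, Y)"]) simp_all
    qed
  qed simp
  also have "\<dots> = Suc n * (card ?X * card ?Y)" by (simp add: card_cartesian_product)
  also have "\<dots> \<le> 2 ^ l * (2 ^ (e * l) * 2 ^ (e * l))"
  proof (intro mult_mono)
    have "(2::nat) ^ length (binary n) \<le> 2 ^ l" using sizes(4) by (intro power_increasing) auto
    then show "Suc n \<le> 2 ^ l" using less_power_length_binary[of n] by linarith
    show "card ?X \<le> 2 ^ (e * l)" using card_queries_le[OF hybrid_hits[OF f], of "precise n l"] precise_complexity by linarith
    have "5 * D \<le> e" by (simp add: e_def distrib_left)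
    then have "(2::nat) ^ (5 * D * l) \<le> 2 ^ (e * l)" by (intro power_increasing mult_right_mono) simp_all
    then show "card ?Y \<le> 2 ^ (e * l)" using card_hits by linarith
  qed auto
  also have "\<dots> = 2 ^ (l + (e * l + e * l))" by (simp only: power_add)
  also have "l + (e * l + e * l) = (2 * e + 1) * l" by (simp add: algebra_simps)
  finally have Z: "card ?Z \<le> 2 ^ ((2 * e + 1) * l)" .
  have "card (set (queries (reduced n a \<epsilon>) f)) \<le> card (set (padding n l)) + card ?Z"
    unfolding set_queries_main set_padding by (rule card_Un_le)
  also have "\<dots> \<le> 2 ^ l + 2 ^ ((2 * e + 1) * l)" unfolding card_padding using Z by simp
  also have "(2::nat) ^ l \<le> 2 ^ ((2 * e + 1) * l)" by (intro power_increasing) simp_all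
  also have "(2::nat) ^ ((2 * e + 1) * l) + 2 ^ ((2 * e + 1) * l) = 2 ^ Suc ((2 * e + 1) * l)"
    by (simp only: power_Suc mult_2)
  also have "\<dots> \<le> 2 ^ ((2 * e + 2) * l)"
    using sizes(3) by (intro power_increasing) (simp_all add: distrib_right)
  finally show "card (set (queries (reduced n a \<epsilon>) f)) \<le> 2 ^ ((2 * e + 2) * l)" by simp
qed

end

end

lemma perm_bp_accept_0: "f \<in> perm_bp_accept n 0 \<Longrightarrow> x \<in> cube n \<Longrightarrow> \<not> f x"
proof -
  assume "f \<in> perm_bp_accept n 0" and x: "x \<in> cube n"
  then obtain w B where B: "acc B \<subseteq> {1..w}" "card (acc B) = 0" and f: "f x = bp_accepts n B x"
    by (auto simp: perm_bp_accept_def is_permutation_bp_def is_bp_def)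
  have "acc B = {}" using B finite_subset[OF B(1)] by simp
  then show ?thesis using f by (simp add: bp_accepts_def)
qed

section \<open>Explicitness and the main theorem\<close>

lemma log_ge: "2 ^ m \<le> S \<Longrightarrow> real m \<le> log 2 (real S + 2)"
proof -
  assume "2 ^ m \<le> S"
  then have "real (2 ^ m) \<le> real S" by (simp only: of_nat_le_iff)
  then have "(2::real) ^ m \<le> real S + 2" unfolding of_nat_power of_nat_numeral by linarith
  then show ?thesis by (subst le_log_iff) (simp_all add: powr_realpow)
qed

lemma log_le: "S \<le> 2 ^ m \<Longrightarrow> log 2 (real S + 2) \<le> real (m + 2)"
proof -
  assume "S \<le> 2 ^ m"
  then have "S + 2 \<le> 2 ^ (m + 2)" using one_le_power[of "2::nat" m, OF one_le_numeral]
    unfolding power_add power2_eq_square by linarith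
  then have "real (S + 2) \<le> real (2 ^ (m + 2))" by (simp only: of_nat_le_iff)
  then have "real S + 2 \<le> 2 ^ (m + 2)" by simp
  then show ?thesis using powr_realpow[of 2 "m + 2"] by (subst log_le_iff) simp_all
qed

lemma uses_space_mono: "uses_space M inp f s \<Longrightarrow> s \<le> s' \<Longrightarrow> uses_space M inp f s'"
  unfolding uses_space_def by fastforce

lemma length_binary_le: "length (binary n) \<le> n"
proof (cases "n = 0")
  case False
  have "2 ^ length (binary n) \<le> 2 * n" using False by (simp add: power_length_binary_le)
  moreover have "2 * n < 2 ^ Suc n" using less_exp[of n] by simp
  ultimately have "(2::nat) ^ length (binary n) < 2 ^ Suc n" by (rule le_less_trans)
  then have "length (binary n) < Suc n" by (rule power_less_imp_less_exp[rotated]) simp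
  then show ?thesis by simp
qed (simp add: binary.simps)

context sampler_family
begin

lemma reduced_trivial: "a = 0 \<or> kappa \<epsilon> = 0 \<Longrightarrow> reduced n a \<epsilon> = Output 0"
  by (simp add: reduced_def Let_def)

lemma brute:
  assumes "a > 0" "kappa \<epsilon> > 0" "n < len n a \<epsilon>"
  shows "run_sampler (reduced n a \<epsilon>) f = real (card {x \<in> cube n. f x}) / 2 ^ n"
    "queries (reduced n a \<epsilon>) f = cube_list n"
proof -
  have "{x \<in> cube n. table (cube_list n) (map f (cube_list n)) x} = {x \<in> cube n. f x}"
    by (auto simp: table_map)
  then show "run_sampler (reduced n a \<epsilon>) f = real (card {x \<in> cube n. f x}) / 2 ^ n"
    "queries (reduced n a \<epsilon>) f = cube_list n"
    using assms by (simp_all add: reduced_def Let_def run_ask_list queries_ask_list)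
qed

text \<open>Each of the three lengths overestimates its parameter by a factor of at most 2, which
  makes 8. With the summand 1 the right-hand side is a base of at least 1 for every \<open>n\<close>
  and \<open>a\<close>, so that it can be raised to higher powers.\<close>

lemma power_len_le:
  assumes "\<epsilon> > 0" "n > 0" "a > 0" "kappa \<epsilon> > 0"
  shows "2 ^ len n a \<epsilon> \<le> 1 + 8 * (real n * real a / \<epsilon>)"
proof -
  have "2 ^ length (binary n) * 2 ^ length (binary a) \<le> 2 * n * (2 * a)"
    using assms by (intro mult_mono power_length_binary_le) auto
  then have "real (2 ^ length (binary n) * 2 ^ length (binary a)) \<le> real (2 * n * (2 * a))"
    by (simp only: of_nat_le_iff)
  moreover have "2 ^ kappa \<epsilon> \<le> 2 / \<epsilon>" using kappa_less[OF assms(4)] assms(1) by (simp add: field_simps)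
  ultimately have "real (2 ^ length (binary n) * 2 ^ length (binary a)) * 2 ^ kappa \<epsilon> \<le> real (2 * n * (2 * a)) * (2 / \<epsilon>)"
    by (intro mult_mono) auto
  then show ?thesis by (simp add: len_def power_add)
qed

lemma reduced_correct:
  assumes \<epsilon>: "\<epsilon> > 0" and f: "f \<in> perm_bp_accept n a"
  shows "set (queries (reduced n a \<epsilon>) f) \<subseteq> cube n \<and>
    \<bar>run_sampler (reduced n a \<epsilon>) f - measure_pmf.prob (pmf_of_set (cube n)) {x. f x}\<bar> \<le> \<epsilon> \<and>
    real (card (set (queries (reduced n a \<epsilon>) f))) \<le> (1 + 8 * (real n * real a / \<epsilon>)) ^ (2 * e + 2)"
    (is "_ \<and> _ \<and> _ \<le> ?q ^ _")
proof -
  have q: "1 \<le> ?q" using \<epsilon> by simp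
  consider "a = 0 \<or> kappa \<epsilon> = 0" | "a > 0" "kappa \<epsilon> > 0" "n < len n a \<epsilon>"
    | "a > 0" "kappa \<epsilon> > 0" "len n a \<epsilon> \<le> n" by linarith
  then show ?thesis
  proof cases
    case 1
    have "measure_pmf.prob (pmf_of_set (cube n)) {x. f x} \<le> \<epsilon>"
    proof (cases "a = 0")
      case True
      then have "{x \<in> cube n. f x} = {}" using perm_bp_accept_0 f by blast
      then show ?thesis using \<epsilon> by (simp add: prob_cube del: Collect_empty_eq)
    next
      case False
      then have "1 \<le> \<epsilon>" using 1 kappa_ge[OF \<epsilon>] by simp
      then show ?thesis using measure_pmf.prob_le_1[of "pmf_of_set (cube n)" "{x. f x}"] by linarith
    qed
    then show ?thesis using reduced_trivial[OF 1, of n] q by simp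
  next
    case 2
    have "(2::real) ^ n \<le> ?q ^ (2 * e + 2)"
    proof (cases "n = 0")
      case False
      have "(2::real) ^ n \<le> 2 ^ len n a \<epsilon>" using 2(3) by (intro power_increasing) auto
      also have "\<dots> \<le> ?q ^ 1" using power_len_le[OF \<epsilon> _ 2(1,2), of n] False by simp
      also have "\<dots> \<le> ?q ^ (2 * e + 2)" using q by (intro power_increasing) auto
      finally show ?thesis .
    qed simp
    then show ?thesis using brute[OF 2, of f] \<epsilon> by (simp add: prob_cube card_cube del: power_add_numeral)
  next
    case 3
    note m = main_correct[OF \<epsilon> 3 refl f]
    have n: "n > 0" using sizes(6)[OF \<epsilon> 3 refl] .
    have "real (card (set (queries (reduced n a \<epsilon>) f))) \<le> real (2 ^ ((2 * e + 2) * len n a \<epsilon>))"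
      using m(3) by (simp only: of_nat_le_iff)
    also have "\<dots> = (2 ^ len n a \<epsilon>) ^ (2 * e + 2)" by (simp only: of_nat_power of_nat_numeral power_mult mult.commute[of "2 * e + 2"])
    also have "\<dots> \<le> ?q ^ (2 * e + 2)" using power_len_le[OF \<epsilon> n 3(1,2)] by (intro power_mono) auto
    finally show ?thesis using m(1,2) by blast
  qed
qed

lemma reduced_nonadaptive:
  assumes na: "\<And>n w \<epsilon>. \<epsilon> > 0 \<Longrightarrow> nonadaptive (perm_bp_width n w) (Samp n w \<epsilon>)" and \<epsilon>: "\<epsilon> > 0"
  shows "nonadaptive (perm_bp_accept n a) (reduced n a \<epsilon>)"
proof -
  consider "a = 0 \<or> kappa \<epsilon> = 0" | "a > 0" "kappa \<epsilon> > 0" "n < len n a \<epsilon>"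
    | "a > 0" "kappa \<epsilon> > 0" "len n a \<epsilon> \<le> n" by linarith
  then show ?thesis
  proof cases
    case 1
    then show ?thesis by (simp add: reduced_trivial nonadaptive_def)
  next
    case 2
    then show ?thesis by (simp add: brute nonadaptive_def)
  next
    case 3
    let ?l = "len n a \<epsilon>"
    have "nonadaptive (perm_bp_width n (2 ^ E1 n ?l)) (precise n ?l)"
      unfolding precise_def by (rule na) simp
    then obtain qs where "\<And>g. g \<in> perm_bp_width n (2 ^ E1 n ?l) \<Longrightarrow> queries (precise n ?l) g = qs"
      unfolding nonadaptive_def by blast
    then have "queries (reduced n a \<epsilon>) f = padding n ?l @ concat (map (cross n (hits n ?l)) qs)"
      if "f \<in> perm_bp_accept n a" for f
      using hybrid_hits[OF \<epsilon> 3 refl that]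
      by (simp add: reduced_main[OF \<epsilon> 3 refl] queries_ask_list queries_sim_tree)
    then show ?thesis unfolding nonadaptive_def by blast
  qed
qed

text \<open>Both simulated runs have query complexity at most \<open>2 ^ (e * l)\<close>, so
  \<open>M\<close> works in \<open>d * l\<close> cells, and the entire layout has a number of cells
  linear in \<open>l\<close>. The padding makes \<open>l\<close> at most
  \<open>log 2 (real S + 2)\<close>.\<close>

lemma reduced_explicit:
  assumes "explicit perm_bp_width Samp"
  shows "explicit perm_bp_accept reduced"
proof -
  obtain M and C :: real where valid: "valid_machine 4 M"
    and M: "\<And>n k u v f. u > 0 \<Longrightarrow> v > 0 \<Longrightarrow> f \<in> perm_bp_width n k \<Longrightarrow>
      uses_space M [binary n, binary k, binary u, binary v] f
        (C * log 2 (real (query_complexity (perm_bp_width n k) (Samp n k (real u / real v))) + 2)) \<and>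
      (\<exists>t. halts_at M [binary n, binary k, binary u, binary v] f t \<and>
        denotes (out (config_at M [binary n, binary k, binary u, binary v] f t)) (run_sampler (Samp n k (real u / real v)) f) \<and>
        set (asked (config_at M [binary n, binary k, binary u, binary v] f t)) = set (queries (Samp n k (real u / real v)) f))"
    using assms unfolding explicit_def Let_def by metis
  interpret simulation M by unfold_locales (rule valid)
  \<comment> \<open>Simulated work cells per unit of \<open>l\<close>, as the logarithm for a
    complexity of \<open>2 ^ (e * l)\<close> is at most \<open>(e + 2) * l\<close>.
    \<open>Suc\<close> keeps \<open>d\<close> positive, which provides a cell for the right end
    marker of the longest simulated input.\<close>
  define d where "d = Suc (nat \<lceil>\<bar>C\<bar> * real (e + 2)\<rceil>)"
  define C' where "C' = real (5 * D + d + 8)"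
  let ?x0 = "\<lparr>state = 0, answer = False, input_heads = [], work = [], query_tape = [], asked = [], out = []\<rparr>"
  obtain M' where M': "valid_machine 4 M'" and run: "\<And>inp f v' cs' x'. length inp = 4 \<Longrightarrow>
      exec inp f (whole (5 * D) d) (v_init, [], set_heads ?x0 [0, 0, 0, 0]) (v', cs', x') \<Longrightarrow>
      uses_space M' inp f (real (length cs' + 2)) \<and>
      (\<exists>t. halts_at M' inp f t \<and> out (config_at M' inp f t) = out x' \<and> asked (config_at M' inp f t) = asked x')"
    using machine_of_whole[of "5 * D" d] by blast
  have dC: "C * log 2 (real S + 2) \<le> real (d * l)" if S: "S \<le> 2 ^ (e * l)" and l: "l \<ge> 1" for S l
  proof -
    have "0 \<le> log 2 (real S + 2)" by simp
    then have "C * log 2 (real S + 2) \<le> \<bar>C\<bar> * log 2 (real S + 2)" by (intro mult_right_mono) auto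
    also have "\<dots> \<le> \<bar>C\<bar> * real (e * l + 2)" using log_le[OF S] by (intro mult_left_mono) auto
    also have "real (e * l + 2) \<le> real ((e + 2) * l)" using l by (simp add: distrib_right)
    then have "\<bar>C\<bar> * real (e * l + 2) \<le> \<bar>C\<bar> * real ((e + 2) * l)" by (intro mult_left_mono) auto
    also have "\<dots> = \<bar>C\<bar> * real (e + 2) * real l" by (simp only: of_nat_mult mult.assoc)
    also have "\<bar>C\<bar> * real (e + 2) \<le> real d" unfolding d_def by linarith
    then have "\<bar>C\<bar> * real (e + 2) * real l \<le> real d * real l" by (intro mult_right_mono) auto
    finally show ?thesis by simp
  qed
  have "uses_space M' [binary n, binary a, binary u, binary v] f (C' * log 2 (real (query_complexity (perm_bp_accept n a) (reduced n a (real u / real v))) + 2)) \<and>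
      (\<exists>t. halts_at M' [binary n, binary a, binary u, binary v] f t \<and>
        denotes (out (config_at M' [binary n, binary a, binary u, binary v] f t)) (run_sampler (reduced n a (real u / real v)) f) \<and>
        set (asked (config_at M' [binary n, binary a, binary u, binary v] f t)) = set (queries (reduced n a (real u / real v)) f))"
    if uv: "u > 0" "v > 0" and f: "f \<in> perm_bp_accept n a" for n a u v f
  proof -
    interpret L: layout M n a u v "5 * D" d f by unfold_locales
    let ?\<epsilon> = "real u / real v"
    let ?T = "reduced n a ?\<epsilon>"
    let ?S = "query_complexity (perm_bp_accept n a) ?T"
    have fin: ?thesis
      if "exec L.inp f (whole (5 * D) d) (v_init, [], set_heads ?x0 [0, 0, 0, 0]) (v', cs', x')"
        "denotes (out x') (run_sampler ?T f)" "set (asked x') = set (queries ?T f)"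
        "real (length cs' + 2) \<le> C' * log 2 (real ?S + 2)" for v' cs' x'
    proof -
      have "length L.inp = 4" by (simp add: L.inp_def)
      note r = run[OF this that(1)]
      obtain t where "halts_at M' L.inp f t" "out (config_at M' L.inp f t) = out x'"
        "asked (config_at M' L.inp f t) = asked x'" using r by blast
      moreover have "uses_space M' L.inp f (C' * log 2 (real ?S + 2))"
        by (rule uses_space_mono[OF conjunct1[OF r] that(4)])
      ultimately show ?thesis unfolding L.inp_def[symmetric]
        by (intro conjI exI[of _ t]) (simp_all only: that(2,3))
    qed
    have S: "card (set (queries ?T f)) \<le> ?S" by (rule card_queries_le[OF f])
    have kap: "kappa ?\<epsilon> = (if L.lv < L.lu \<or> L.lv = L.lu \<and> \<not> L.gt then 0 else L.lv - L.lu + of_bool L.gt)"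
      unfolding L.lu_def L.lv_def L.gt_def by (rule kappa_fraction[OF uv])
    show ?thesis
    proof (cases "a = 0 \<or> L.lv < L.lu \<or> L.lv = L.lu \<and> \<not> L.gt")
      case True
      then have T: "?T = Output 0" using kap by (intro reduced_trivial) auto
      obtain v' x' where x': "exec L.inp f (whole (5 * D) d) (v_init, [], set_heads ?x0 [0, 0, 0, 0]) (v', [], x')"
        "out x' = [Slash, Digit True]" "asked x' = []"
        using L.exec_trivial[OF True, of ?x0] by auto
      have "denotes [Slash, Digit True] 0"
        unfolding denotes_def by (rule exI[of _ False], rule exI[of _ "[]"], rule exI[of _ "[True]"]) (simp add: binary_value_def)
      moreover have "real (length ([] :: cell list) + 2) \<le> C' * log 2 (real ?S + 2)"
      proof -
        have "1 \<le> log 2 (real ?S + 2)" by (subst le_log_iff) auto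
        moreover have "2 \<le> C'" by (simp add: C'_def)
        ultimately have "2 * 1 \<le> C' * log 2 (real ?S + 2)" by (intro mult_mono) auto
        then show ?thesis by simp
      qed
      ultimately show ?thesis by (intro fin[OF x'(1)]) (simp_all add: x' T)
    next
      case False
      then have a: "0 < a" and le: "L.lu \<le> L.lv" and gt: "L.lu < L.lv \<or> L.gt" by auto
      have k: "kappa ?\<epsilon> = L.lv - L.lu + of_bool L.gt" using kap False by auto
      then have k0: "kappa ?\<epsilon> > 0" using gt by auto
      have l: "L.ell = len n a ?\<epsilon>" by (simp add: L.ell_def len_def k)
      show ?thesis
      proof (cases "n < L.ell")
        case True
        obtain v' cs' x' where x': "exec L.inp f (whole (5 * D) d) (v_init, [], set_heads ?x0 [0, 0, 0, 0]) (v', cs', x')"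
          "length cs' = length (binary n) + 2 + n" "set (asked x') = cube n"
          "denotes (out x') (real (card {y \<in> cube n. f y}) / 2 ^ n)"
          using L.exec_brute[OF a le gt True, of ?x0] by auto
        note b = brute[OF a k0 True[unfolded l], of f]
        \<comment> \<open>Querying the whole cube pays for the \<open>n\<close> cells of its
          counter.\<close>
        have "2 ^ n \<le> ?S" using S by (simp add: b card_cube)
        then have "real n \<le> log 2 (real ?S + 2)" by (rule log_ge)
        moreover have "1 \<le> log 2 (real ?S + 2)" by (subst le_log_iff) auto
        moreover have "8 * log 2 (real ?S + 2) \<le> C' * log 2 (real ?S + 2)"
          by (intro mult_right_mono) (auto simp: C'_def)
        moreover have "real (length cs' + 2) \<le> 2 * real n + 4" using length_binary_le[of n] by (simp add: x'(2))
        ultimately have "real (length cs' + 2) \<le> C' * log 2 (real ?S + 2)" by linarith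
        then show ?thesis by (intro fin[OF x'(1)]) (simp_all add: x' b)
      next
        case False
        then have n: "L.ell \<le> n" by simp
        have main: "?\<epsilon> > 0" "0 < a" "kappa ?\<epsilon> > 0" using uv a k0 by auto
        note m = main[simplified, simplified] n l
        let ?l = "L.ell"
        have E: "L.E0 = E0 n ?l" "L.E1 = E1 n ?l"
          using n by (simp_all add: L.E0_def L.E1_def L.z1_def L.z0_def L.zl_def E0_def E1_def)
        note sz = sizes[OF main n l]
        have d: "1 \<le> d" by (simp add: d_def)
        have dl: "d \<le> d * ?l" "1 \<le> d * ?l" using d sz(3) by simp_all
        have len_sz: "Suc (length (binary n)) < L.sz" "Suc (Suc L.E1) < L.sz" "Suc (Suc L.E0) < L.sz" "Suc (length (binary 1)) < L.sz"
          using dl sz(3) by (simp_all add: L.sz_def E E0_def E1_def binary.simps)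
        interpret S: sim_run M L.inA f 1 1 L.sz n L.inA L.inB
        proof
          have "n < 2 ^ length (binary n)" by (rule less_power_length_binary)
          also have "(2::nat) ^ length (binary n) \<le> 2 ^ (L.sz - 1)" using len_sz(1) by (intro power_increasing) auto
          finally show "n < 2 ^ (L.sz - 1)" .
        qed simp
        \<comment> \<open>One statement for both simulated runs, which differ only in the exponent
          of the width and in the oracle.\<close>
        have chain: "\<exists>c. S.chain [binary n, binary (2 ^ E), binary 1, binary (2 ^ E0 n ?l)] g (initial_config 4 M) c \<and>
            denotes (out c) (run_sampler (Samp n (2 ^ E) (real 1 / real (2 ^ E0 n ?l :: nat))) g) \<and>
            set (asked c) = set (queries (Samp n (2 ^ E) (real 1 / real (2 ^ E0 n ?l :: nat))) g)"
          if g: "g \<in> perm_bp_width n (2 ^ E)" and E': "Suc (Suc E) < L.sz"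
            and S: "query_complexity (perm_bp_width n (2 ^ E)) (Samp n (2 ^ E) (real 1 / real (2 ^ E0 n ?l :: nat))) \<le> 2 ^ (e * ?l)"
          for E g
        proof -
          let ?m = "[binary n, binary (2 ^ E), binary 1, binary (2 ^ E0 n ?l)]"
          obtain t where t: "halts_at M ?m g t"
            "denotes (out (config_at M ?m g t)) (run_sampler (Samp n (2 ^ E) (real 1 / real (2 ^ E0 n ?l :: nat))) g)"
            "set (asked (config_at M ?m g t)) = set (queries (Samp n (2 ^ E) (real 1 / real (2 ^ E0 n ?l :: nat))) g)"
            and sp: "uses_space M ?m g (C * log 2 (real (query_complexity (perm_bp_width n (2 ^ E)) (Samp n (2 ^ E) (real 1 / real (2 ^ E0 n ?l :: nat)))) + 2))"
            using M[OF _ _ g, of 1 "2 ^ E0 n ?l"] by auto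
          have "S.chain ?m g (initial_config 4 M) (config_at M ?m g t)"
          proof (rule S.chain_config_at[OF _ _ sp _ t(1)])
            fix i :: nat assume "i < 4"
            then have "i = 0 \<or> i = 1 \<or> i = 2 \<or> i = 3" by auto
            then show "Suc (length (?m ! i)) < L.sz"
              using len_sz E' by (auto simp: length_binary_power E)
          next
            have "real (d * ?l) \<le> real L.sz" by (simp only: of_nat_le_iff) (simp add: L.sz_def)
            moreover have "1 \<le> ?l" using sz(3) by simp
            ultimately show "C * log 2 (real (query_complexity (perm_bp_width n (2 ^ E)) (Samp n (2 ^ E) (real 1 / real (2 ^ E0 n ?l :: nat)))) + 2) \<le> real L.sz"
              using dC[OF S] by (meson order_trans)
          qed simp
          then show ?thesis using t by blast
        qed
        have eq0: "5 * D * ?l \<le> e * ?l" by (intro mult_right_mono) (simp_all add: e_def distrib_left)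
        have "query_complexity (perm_bp_width n (2 ^ E0 n ?l)) (coarse n ?l) \<le> 2 ^ (e * ?l)"
          using coarse_complexity[OF main n l] by (rule order_trans) (intro power_increasing eq0, simp)
        from chain[OF FW len_sz(3)[unfolded E(1)] this[unfolded coarse_def]]
        obtain cB where cB: "S.chain L.inB (\<lambda>_. False) (initial_config 4 M) cB" "set (asked cB) = set (hits n ?l)"
          unfolding hits_def coarse_def L.inB_def E by blast
        have sp: "S.splice H g = hybrid n H g" for H g by (auto simp: S.splice_def hybrid_def fun_eq_iff)
        \<comment> \<open>The machine may ask in another order than the sampler, or repeatedly. The
          hybrid depends only on the set of queries, which is that of \<open>hits\<close>.\<close>
        from chain[OF hybrid_hits[OF main n l f] len_sz(2)[unfolded E(2)] precise_complexity[OF main n l, unfolded precise_def]]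
        obtain cA where cA: "S.chain L.inA (S.splice (set (asked cB)) f) (initial_config 4 M) cA"
          "denotes (out cA) (run_sampler (precise n ?l) (hybrid n (set (hits n ?l)) f))"
          "set (asked cA) = set (queries (precise n ?l) (hybrid n (set (hits n ?l)) f))"
          unfolding L.inA_def E precise_def sp cB(2) by blast
        obtain v' cs' x' where x': "exec L.inp f (whole (5 * D) d) (v_init, [], set_heads ?x0 [0, 0, 0, 0]) (v', cs', x')"
          "length cs' = L.sz" "out x' = out cA" "set (asked x') = (\<lambda>z. z @ replicate (n - ?l) False) ` cube ?l \<union>
            {take r X @ drop r Y | r X Y. r \<le> n \<and> X \<in> set (asked cA) \<and> Y \<in> set (asked cB)}"
          using L.exec_main[OF a le gt n _ _ _ cA(1) refl cB(1) refl, of ?x0] by auto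
        have "2 ^ ?l \<le> ?S" using S main_correct(4)[OF main n l f] by linarith
        then have "real ?l \<le> log 2 (real ?S + 2)" by (rule log_ge)
        then have "C' * real ?l \<le> C' * log 2 (real ?S + 2)" by (intro mult_left_mono) (auto simp: C'_def)
        moreover have "L.sz + 2 = length (binary n) + 1 + ?l + 1 + 5 * D * ?l + 2 + d * ?l + 2"
          by (simp add: L.sz_def E E0_def E1_def)
        then have "L.sz + 2 \<le> (5 * D + d + 8) * ?l"
          using sz(3,4) unfolding distrib_right by linarith
        then have "real (L.sz + 2) \<le> C' * real ?l" unfolding C'_def of_nat_mult[symmetric] of_nat_le_iff .
        ultimately have "real (length cs' + 2) \<le> C' * log 2 (real ?S + 2)" unfolding x'(2) by linarith
        then show ?thesis
          by (intro fin[OF x'(1)]) (simp_all only: x' cA cB run_main[OF main n l] set_queries_main[OF main n l])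
      qed
    qed
  qed
  then show ?thesis using M' unfolding explicit_def Let_def by metis
qed

end

theorem theorem1p7:
  fixes p :: "real poly" and Samp :: "nat \<Rightarrow> nat \<Rightarrow> real \<Rightarrow> sampler"
  assumes "\<And>n w \<epsilon>. \<epsilon> > 0 \<Longrightarrow> is_sampler n (perm_bp_width n w) \<epsilon> (Samp n w \<epsilon>)"
    and "\<And>n w \<epsilon>. \<epsilon> > 0 \<Longrightarrow>
           real (query_complexity (perm_bp_width n w) (Samp n w \<epsilon>)) \<le> poly p (real n * real w / \<epsilon>)"
  shows "\<exists>(q :: real poly) (Samp' :: nat \<Rightarrow> nat \<Rightarrow> real \<Rightarrow> sampler).
    (\<forall>n a \<epsilon>. \<epsilon> > 0 \<longrightarrow>
       is_sampler n (perm_bp_accept n a) \<epsilon> (Samp' n a \<epsilon>) \<and>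
       real (query_complexity (perm_bp_accept n a) (Samp' n a \<epsilon>)) \<le> poly q (real n * real a / \<epsilon>)) \<and>
    (explicit perm_bp_width Samp \<longrightarrow> explicit perm_bp_accept Samp') \<and>
    ((\<forall>n w \<epsilon>. \<epsilon> > 0 \<longrightarrow> nonadaptive (perm_bp_width n w) (Samp n w \<epsilon>)) \<longrightarrow>
     (\<forall>n a \<epsilon>. \<epsilon> > 0 \<longrightarrow> nonadaptive (perm_bp_accept n a) (Samp' n a \<epsilon>)))"
proof -
  obtain D where D: "\<And>x. x \<ge> 1 \<Longrightarrow> poly p x \<le> 2 ^ D * x ^ D" using poly_bound by blast
  interpret sampler_family p Samp D by unfold_locales (fact assms D)+
  have "real (query_complexity (perm_bp_accept n a) (reduced n a \<epsilon>)) \<le> poly ([:1, 8:] ^ (2 * e + 2)) (real n * real a / \<epsilon>)"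
    if "\<epsilon> > 0" for n a \<epsilon>
  proof -
    let ?q = "(1 + 8 * (real n * real a / \<epsilon>)) ^ (2 * e + 2)"
    have q: "0 \<le> ?q" using that by simp
    have "query_complexity (perm_bp_accept n a) (reduced n a \<epsilon>) \<le> nat \<lfloor>?q\<rfloor>"
      using reduced_correct[OF that] by (intro query_complexity_le) (simp add: le_nat_floor)
    also have "real (nat \<lfloor>?q\<rfloor>) \<le> ?q" using q by (rule of_nat_floor)
    finally have "real (query_complexity (perm_bp_accept n a) (reduced n a \<epsilon>)) \<le> ?q" by simp
    moreover have "poly [:1, 8:] x = 1 + 8 * x" for x :: real by simp
    ultimately show ?thesis by (simp only: poly_power)
  qed
  moreover have "is_sampler n (perm_bp_accept n a) \<epsilon> (reduced n a \<epsilon>)" if "\<epsilon> > 0" for n a \<epsilon>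
    using reduced_correct[OF that] unfolding is_sampler_def by blast
  ultimately show ?thesis
    by (intro exI[of _ "[:1, 8:] ^ (2 * e + 2)"] exI[of _ reduced] conjI allI impI)
       (simp_all only: reduced_explicit reduced_nonadaptive)
qed

end
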